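(* Let $F,G\in\mathcal S(L_2(Q))$ with corresponding measures $f,g\in\mathcal M(L_2(Q))$. Let $h\in\mathrm{Supp}_{BV}(Q)$ and let $\mathcal K_1=\{k_{11},k_{12},\dots,k_{1n}\}$ and $\mathcal K_2=\{k_{21},k_{22},\dots,k_{2m}\}$ be finite sequences of functions in $\mathrm{Supp}_{BV}(Q)$. Let $\mathbf s(\mathcal K_1),\mathbf s(\mathcal K_2)\in\mathrm{Supp}_{BV}(Q)$ satisfy $\mathbf s(\mathcal K_1)^2=k_{11}^2+\cdots+k_{1n}^2$ and $\mathbf s(\mathcal K_2)^2=k_{21}^2+\cdots+k_{2m}^2$ $m_L^2$-a.e. on $Q$, and assume that $h^2=\mathbf s(\mathcal K_1)\mathbf s(\mathcal K_2)$ $m_L^2$-a.e. on $Q$. For $j\in\{1,2\}$ let $\mathbf s(h,\mathbf s(\mathcal K_j))\in\mathrm{Supp}_{BV}(Q)$ satisfy $\mathbf s(h,\mathbf s(\mathcal K_j))^2=h^2+\mathbf s(\mathcal K_j)^2$ $m_L^2$-a.e. on $Q$. Then, for all nonzero real $q$, $$\begin{aligned}&\Big(T_{q,h/\sqrt2}^{(1)}\big(T_{q,k_{1n}/\sqrt2}^{(1)}(\cdots(T_{q,k_{12}/\sqrt2}^{(1)}(T_{q,k_{11}/\sqrt2}^{(1)}(F)))\cdots)\big)\\&\qquad*T_{q,h/\sqrt2}^{(1)}\big(T_{q,k_{2m}/\sqrt2}^{(1)}(\cdots(T_{q,k_{22}/\sqrt2}^{(1)}(T_{q,k_{21}/\sqrt2}^{(1)}(G)))\cdots)\big)\Big)_{-q}^{(\mathbf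 s(\mathcal K_1),\mathbf s(\mathcal K_2))}(y)\\&=\Big(T_{q,h/\sqrt2}^{(1)}\big(T_{q,\mathbf s(\mathcal K_1)/\sqrt2}^{(1)}(F)\big)*T_{q,h/\sqrt2}^{(1)}\big(T_{q,\mathbf s(\mathcal K_2)/\sqrt2}^{(1)}(G)\big)\Big)_{-q}^{(\mathbf s(\mathcal K_1),\mathbf s(\mathcal K_2))}(y)\\&=\Big(T_{q,\mathbf s(h,\mathbf s(\mathcal K_1))/\sqrt2}^{(1)}(F)*T_{q,\mathbf s(h,\mathbf s(\mathcal K_2))/\sqrt2}^{(1)}(G)\Big)_{-q}^{(\mathbf s(\mathcal K_1),\mathbf s(\mathcal K_2))}(y)\\&=T_{q,h}^{(1)}\Big(F\Big(\frac{\cdot}{\sqrt2}\Big)G\Big(\frac{\cdot}{\sqrt2}\Big)\Big)(y)\end{aligned}$$ for s-a.e. $y\in C_0(Q)$.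
   Context: Fix $S,T>0$, let $Q=[0,S]\times[0,T]$, $m_L^2$ = Lebesgue measure on $Q$, and $L_2(Q)$ the real Hilbert space with inner product $(\cdot,\cdot)_2$ and norm $\|\cdot\|_2$. $C_0(Q)$ is the space of real continuous $x$ on $Q$ with $x(s,0)=x(0,t)=0$, with (completed) Yeh--Wiener measure $m_{\mathrm y}$, i.e. the centered Gaussian measure with $\int x(s,t)x(s',t')\,dm_{\mathrm y}(x)=\min(s,s')\min(t,t')$. A set $E$ is scale-invariant measurable if $\rho E$ is measurable for every $\rho>0$, a scale-invariant measurable set $N$ is scale-invariant null if $m_{\mathrm y}(\rho N)=0$ for every $\rho>0$; "s-a.e." means off a scale-invariant null set. A functional $F$ is scale-invariant measurable if it is defined on a scale-invariant measurable set and $F(\rho\,\cdot)$ is measurable for every $\rho>0$. PWZ integral: fix a complete orthonormal set $\{\phi_n\}$ of $L_2(Q)$ consisting of functions of bounded variation (Hardy--Krause sense); for $v\in L_2(Q)$, $\langle v,x\rangle=\lim_{n}\int_Q\sum_{j=1}^n(v,\phi_j)_2\phi_j\,dx$ where the limit exists (it exists for s-a.e. $x$ and is essentially independent of $\{\phi_n\}$). $\mathrm{Supp}_{BV}(Q)$ is the set of real functions $h$ on $Q$ of bounded variation (Hardy--Krause sense) with $h\neq0$ $m_L^2$-a.e. For such $h$, $\mathcal Y_h(x;s,t)=\langle\chi_{[0,s]\times[0,t]}h,x\rangle$; its sample paths $\mathcal Y_h(x;\cdot,\cdot)$ lie in $C_0(Q)$. $\mathcal M(L_2(Q))$ is the space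 of complex countably additive Borel measures on $L_2(Q)$. $\mathcal S(L_2(Q))$ is the set of functionals $F$ on $C_0(Q)$ of the form $F(x)=\int_{L_2(Q)}\exp\{i\langle u,x\rangle\}df(u)$ for s-a.e. $x$, for some $f\in\mathcal M(L_2(Q))$. Evaluation along Gaussian paths uses this formula together with $\langle u,\mathcal Y_h(x;\cdot,\cdot)\rangle=\langle uh,x\rangle$, i.e. for real $b,c$, $F(by+c\mathcal Y_h(x;\cdot,\cdot))=\int\exp\{ib\langle u,y\rangle+ic\langle uh,x\rangle\}df(u)$. $F(\cdot/\sqrt2)G(\cdot/\sqrt2)$ denotes the functional $x\mapsto F(x/\sqrt2)G(x/\sqrt2)$. Transform: let $\mathbb C_+=\{\mathrm{Re}\,\lambda>0\}$ and $h\in\mathrm{Supp}_{BV}(Q)$. $T_{\lambda,h}(F)(y)$, $\lambda\in\mathbb C_+$, is the analytic continuation to $\mathbb C_+$ (if it exists) of $\lambda\mapsto\int_{C_0(Q)}F(y+\lambda^{-1/2}\mathcal Y_h(x;\cdot,\cdot))dm_{\mathrm y}(x)$, $\lambda>0$. For real $q\ne0$, $T_{q,h}^{(1)}(F)(y)=\lim_{\lambda\to-iq,\,\lambda\in\mathbb C_+}T_{\lambda,h}(F)(y)$ for s-a.e. $y$, whenever this limit exists. For $F\in\mathcal S(L_2(Q))$ it exists and belongs to $\mathcal S(L_2(Q))$. Convolution product: for $k_1,k_2\in\mathrm{Supp}_{BV}(Q)$ and real $q\neq0$, $(F*G)_q^{(k_1,k_2)}(y)$ is the limit as $\lambda\to-iq$,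 $\lambda\in\mathbb C_+$, of the analytic continuation to $\mathbb C_+$ of $$\lambda\mapsto\int_{C_0(Q)}F\Big(\tfrac{y+\lambda^{-1/2}\mathcal Y_{k_1}(x;\cdot,\cdot)}{\sqrt2}\Big)G\Big(\tfrac{y-\lambda^{-1/2}\mathcal Y_{k_2}(x;\cdot,\cdot)}{\sqrt2}\Big)dm_{\mathrm y}(x),\quad\lambda>0,$$ if it exists. For $F,G\in\mathcal S(L_2(Q))$ this product exists for s-a.e. $y$ and belongs to $\mathcal S(L_2(Q))$. *)

theory Defs
  imports "HOL-Probability.Probability" "HOL-Complex_Analysis.Complex_Analysis"
begin

type_synonym field2 = "real \<times> real \<Rightarrow> real"

(* A functional need only be defined on part of C_0(Q), hence the partial functions. *)
type_synonym functional = "field2 \<Rightarrow> complex option"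

definition rect :: "real \<Rightarrow> real \<Rightarrow> (real \<times> real) set" where
  "rect S T = {0..S} \<times> {0..T}"

(* Elements of L_2(Q) are represented by functions; two functions whose difference has
   seminorm 0 represent the same element. Seminorm-open sets are unions of classes, so the
   Borel sets (and complex Borel measures) below are exactly those of the Hilbert space. *)

definition L2 :: "real \<Rightarrow> real \<Rightarrow> field2 set" where
  "L2 S T = {u. u \<in> borel_measurable (lebesgue_on (rect S T)) \<and>
                integrable (lebesgue_on (rect S T)) (\<lambda>p. (u p)\<^sup>2)}"

definition inner2 :: "real \<Rightarrow> real \<Rightarrow> field2 \<Rightarrow> field2 \<Rightarrow> real" where
  "inner2 S T u v = (LINT p|lebesgue_on (rect S T). u p * v p)"

definition norm2 :: "real \<Rightarrow> real \<Rightarrow> field2 \<Rightarrow> real" where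
  "norm2 S T u = sqrt (inner2 S T u u)"

definition open_L2 :: "real \<Rightarrow> real \<Rightarrow> field2 set \<Rightarrow> bool" where
  "open_L2 S T U \<longleftrightarrow> U \<subseteq> L2 S T \<and>
     (\<forall>u\<in>U. \<exists>e>0. \<forall>v\<in>L2 S T. norm2 S T (\<lambda>p. v p - u p) < e \<longrightarrow> v \<in> U)"

definition borel_L2 :: "real \<Rightarrow> real \<Rightarrow> field2 measure" where
  "borel_L2 S T = sigma (L2 S T) {U. open_L2 S T U}"

definition complex_measure_on :: "'a measure \<Rightarrow> ('a set \<Rightarrow> complex) \<Rightarrow> bool" where
  "complex_measure_on M f \<longleftrightarrow> f {} = 0 \<and>
     (\<forall>A :: nat \<Rightarrow> 'a set. range A \<subseteq> sets M \<longrightarrow> disjoint_family A \<longrightarrow>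
        (\<lambda>i. f (A i)) sums f (\<Union>i. A i))"

(* Positive part in the Jordan decomposition of a finite signed measure r. Since r {} = 0,
   cutting off negative values in the conversion to ennreal does not affect the supremum. *)
definition upper_variation :: "'a measure \<Rightarrow> ('a set \<Rightarrow> real) \<Rightarrow> 'a measure" where
  "upper_variation M r = measure_of (space M) (sets M)
     (\<lambda>A. SUP B\<in>{B \<in> sets M. B \<subseteq> A}. ennreal (r B))"

definition signed_integral ::
    "'a measure \<Rightarrow> ('a set \<Rightarrow> real) \<Rightarrow> ('a \<Rightarrow> complex) \<Rightarrow> complex" where
  "signed_integral M r w =
     (LINT u|upper_variation M r. w u) - (LINT u|upper_variation M (\<lambda>A. - r A). w u)"

definition complex_integral ::
    "'a measure \<Rightarrow> ('a set \<Rightarrow> complex) \<Rightarrow> ('a \<Rightarrow> complex) \<Rightarrow> complex" where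
  "complex_integral M f w =
     signed_integral M (\<lambda>A. Re (f A)) w + \<i> * signed_integral M (\<lambda>A. Im (f A)) w"

definition is_partition :: "real \<Rightarrow> nat \<Rightarrow> (nat \<Rightarrow> real) \<Rightarrow> bool" where
  "is_partition L m a \<longleftrightarrow> a 0 = 0 \<and> a m = L \<and> (\<forall>i<m. a i < a (Suc i))"

definition rect_increment :: "field2 \<Rightarrow> real \<Rightarrow> real \<Rightarrow> real \<Rightarrow> real \<Rightarrow> real" where
  "rect_increment x s s' t t' = x (s', t') - x (s, t') - x (s', t) + x (s, t)"

definition bv_interval :: "real \<Rightarrow> (real \<Rightarrow> real) \<Rightarrow> bool" where
  "bv_interval L g \<longleftrightarrow> (\<exists>B. \<forall>m a. is_partition L m a \<longrightarrow>
     (\<Sum>i<m. \<bar>g (a (Suc i)) - g (a i)\<bar>) \<le> B)"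

definition bv_vitali :: "real \<Rightarrow> real \<Rightarrow> field2 \<Rightarrow> bool" where
  "bv_vitali S T g \<longleftrightarrow> (\<exists>B. \<forall>m n a b. is_partition S m a \<longrightarrow> is_partition T n b \<longrightarrow>
     (\<Sum>i<m. \<Sum>j<n. \<bar>rect_increment g (a i) (a (Suc i)) (b j) (b (Suc j))\<bar>) \<le> B)"

definition bv_hardy_krause :: "real \<Rightarrow> real \<Rightarrow> field2 \<Rightarrow> bool" where
  "bv_hardy_krause S T g \<longleftrightarrow> bv_vitali S T g \<and>
     (\<exists>t\<in>{0..T}. bv_interval S (\<lambda>s. g (s, t))) \<and>
     (\<exists>s\<in>{0..S}. bv_interval T (\<lambda>t. g (s, t)))"

definition Supp_BV :: "real \<Rightarrow> real \<Rightarrow> field2 set" where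
  "Supp_BV S T = {h. bv_hardy_krause S T h \<and> (AE p in lebesgue_on (rect S T). h p \<noteq> 0)}"

(* The integral of g dx for continuous x and g of bounded variation. The evaluation points
   form a product grid: with unrelated points in each cell the sums need not converge for
   integrands of bounded variation. *)
definition has_rs_integral ::
    "real \<Rightarrow> real \<Rightarrow> field2 \<Rightarrow> field2 \<Rightarrow> real \<Rightarrow> bool" where
  "has_rs_integral S T g x I \<longleftrightarrow> (\<forall>e>0. \<exists>d>0. \<forall>m n a b \<sigma> \<tau>.
     is_partition S m a \<longrightarrow> is_partition T n b \<longrightarrow>
     (\<forall>i<m. a (Suc i) - a i < d \<and> a i \<le> \<sigma> i \<and> \<sigma> i \<le> a (Suc i)) \<longrightarrow>
     (\<forall>j<n. b (Suc j) - b j < d \<and> b j \<le> \<tau> j \<and> \<tau> j \<le> b (Suc j)) \<longrightarrow>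
     \<bar>(\<Sum>i<m. \<Sum>j<n. g (\<sigma> i, \<tau> j) *
         rect_increment x (a i) (a (Suc i)) (b j) (b (Suc j))) - I\<bar> < e)"

definition rs_integral :: "real \<Rightarrow> real \<Rightarrow> field2 \<Rightarrow> field2 \<Rightarrow> real" where
  "rs_integral S T g x = (THE I. has_rs_integral S T g x I)"

(* Functions on Q are extended by 0 to the plane, so that each path has one representative. *)
definition C0 :: "real \<Rightarrow> real \<Rightarrow> field2 set" where
  "C0 S T = {x. continuous_on (rect S T) x \<and>
     (\<forall>s\<in>{0..S}. x (s, 0) = 0) \<and> (\<forall>t\<in>{0..T}. x (0, t) = 0) \<and>
     (\<forall>p. p \<notin> rect S T \<longrightarrow> x p = 0)}"

(* This sigma-algebra is the Borel sigma-algebra of the supremum norm on C_0(Q). *)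
definition cylinder_C0 :: "real \<Rightarrow> real \<Rightarrow> field2 measure" where
  "cylinder_C0 S T =
     sigma (C0 S T) {{x \<in> C0 S T. x p \<in> B} | p B. p \<in> rect S T \<and> B \<in> sets borel}"

definition centered_normal :: "'a measure \<Rightarrow> ('a \<Rightarrow> real) \<Rightarrow> bool" where
  "centered_normal M X \<longleftrightarrow> (AE x in M. X x = 0) \<or>
     (\<exists>\<sigma>>0. distributed M lborel X (\<lambda>r. ennreal (normal_density 0 \<sigma> r)))"

(* The two conditions on finite-dimensional marginals determine W uniquely. *)
definition yeh_wiener_measure :: "real \<Rightarrow> real \<Rightarrow> field2 measure \<Rightarrow> bool" where
  "yeh_wiener_measure S T W \<longleftrightarrow> (\<exists>W0. W = completion W0 \<and> prob_space W0 \<and>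
     space W0 = C0 S T \<and> sets W0 = sets (cylinder_C0 S T) \<and>
     (\<forall>P c. finite P \<longrightarrow> P \<subseteq> rect S T \<longrightarrow> centered_normal W0 (\<lambda>x. \<Sum>p\<in>P. c p * x p)) \<and>
     (\<forall>s\<in>{0..S}. \<forall>t\<in>{0..T}. \<forall>s'\<in>{0..S}. \<forall>t'\<in>{0..T}.
        (LINT x|W0. x (s, t) * x (s', t')) = min s s' * min t t'))"

definition scale_invariant_null :: "field2 measure \<Rightarrow> field2 set \<Rightarrow> bool" where
  "scale_invariant_null W N \<longleftrightarrow> (\<forall>\<rho>>0. (\<lambda>x p. \<rho> * x p) ` N \<in> null_sets W)"

definition s_ae :: "field2 measure \<Rightarrow> (field2 \<Rightarrow> bool) \<Rightarrow> bool" where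
  "s_ae W P \<longleftrightarrow> (\<exists>N. scale_invariant_null W N \<and> (\<forall>x\<in>space W - N. P x))"

definition bv_complete_orthonormal :: "real \<Rightarrow> real \<Rightarrow> (nat \<Rightarrow> field2) \<Rightarrow> bool" where
  "bv_complete_orthonormal S T \<phi> \<longleftrightarrow>
     (\<forall>n. \<phi> n \<in> L2 S T \<and> bv_hardy_krause S T (\<phi> n)) \<and>
     (\<forall>i j. inner2 S T (\<phi> i) (\<phi> j) = (if i = j then 1 else 0)) \<and>
     (\<forall>v\<in>L2 S T. (\<forall>n. inner2 S T v (\<phi> n) = 0) \<longrightarrow> norm2 S T v = 0)"

definition pwz :: "real \<Rightarrow> real \<Rightarrow> (nat \<Rightarrow> field2) \<Rightarrow> field2 \<Rightarrow> field2 \<Rightarrow> real" where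
  "pwz S T \<phi> v x =
     lim (\<lambda>n. rs_integral S T (\<lambda>p. \<Sum>j<n. inner2 S T v (\<phi> j) * \<phi> j p) x)"

definition gaussian_path ::
    "real \<Rightarrow> real \<Rightarrow> (nat \<Rightarrow> field2) \<Rightarrow> field2 \<Rightarrow> field2 \<Rightarrow> field2" where
  "gaussian_path S T \<phi> h x = (\<lambda>(s, t). if (s, t) \<in> rect S T
     then pwz S T \<phi> (\<lambda>p. indicator ({0..s} \<times> {0..t}) p * h p) x else 0)"

definition has_measure ::
    "real \<Rightarrow> real \<Rightarrow> (nat \<Rightarrow> field2) \<Rightarrow> field2 measure \<Rightarrow> functional \<Rightarrow>
     (field2 set \<Rightarrow> complex) \<Rightarrow> bool" where
  "has_measure S T \<phi> W F f \<longleftrightarrow> complex_measure_on (borel_L2 S T) f \<and>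
     s_ae W (\<lambda>x. F x =
       Some (complex_integral (borel_L2 S T) f (\<lambda>u. exp (\<i> * of_real (pwz S T \<phi> u x)))))"

definition S_class ::
    "real \<Rightarrow> real \<Rightarrow> (nat \<Rightarrow> field2) \<Rightarrow> field2 measure \<Rightarrow> functional set" where
  "S_class S T \<phi> W = {F. \<exists>f. has_measure S T \<phi> W F f}"

(* F (b y + c Y_h(x)). The law of a Gaussian path may be carried by a scale-invariant null
   set, where an element of S_class is not determined; for such functionals the value is
   therefore the one given by the corresponding measure, which is unique (on Borel sets). *)
definition eval_gaussian ::
    "real \<Rightarrow> real \<Rightarrow> (nat \<Rightarrow> field2) \<Rightarrow> field2 measure \<Rightarrow> functional \<Rightarrow>
     real \<Rightarrow> field2 \<Rightarrow> real \<Rightarrow> field2 \<Rightarrow> field2 \<Rightarrow> complex option" where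
  "eval_gaussian S T \<phi> W F b y c h x =
     (if F \<in> S_class S T \<phi> W then
        Some (complex_integral (borel_L2 S T) (SOME f. has_measure S T \<phi> W F f)
          (\<lambda>u. exp (\<i> * of_real b * of_real (pwz S T \<phi> u y)
                   + \<i> * of_real c * of_real (pwz S T \<phi> (\<lambda>p. u p * h p) x))))
      else F (\<lambda>p. b * y p + c * gaussian_path S T \<phi> h x p))"

definition mult_functional :: "functional \<Rightarrow> functional \<Rightarrow> functional" where
  "mult_functional F G = (\<lambda>x. Option.bind (F x) (\<lambda>a. Option.bind (G x) (\<lambda>b. Some (a * b))))"

definition scale_functional :: "real \<Rightarrow> functional \<Rightarrow> functional" where
  "scale_functional \<rho> F = (\<lambda>x. F (\<lambda>p. \<rho> * x p))"

definition partial_integral ::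
    "'a measure \<Rightarrow> ('a \<Rightarrow> complex option) \<Rightarrow> complex option" where
  "partial_integral M w =
     (if (AE x in M. w x \<noteq> None) \<and> integrable M (\<lambda>x. the (w x))
      then Some (LINT x|M. the (w x)) else None)"

definition right_half_plane :: "complex set" where
  "right_half_plane = {z. 0 < Re z}"

definition has_feynman_limit :: "real \<Rightarrow> (real \<Rightarrow> complex option) \<Rightarrow> complex \<Rightarrow> bool" where
  "has_feynman_limit q J c \<longleftrightarrow> (\<exists>\<Phi>. \<Phi> holomorphic_on right_half_plane \<and>
     (\<forall>r>0. J r = Some (\<Phi> (of_real r))) \<and>
     (\<Phi> \<longlongrightarrow> c) (at (- \<i> * of_real q) within right_half_plane))"

definition feynman_limit :: "real \<Rightarrow> (real \<Rightarrow> complex option) \<Rightarrow> complex option" where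
  "feynman_limit q J =
     (if \<exists>c. has_feynman_limit q J c then Some (THE c. has_feynman_limit q J c) else None)"

definition gfft ::
    "real \<Rightarrow> real \<Rightarrow> (nat \<Rightarrow> field2) \<Rightarrow> field2 measure \<Rightarrow> real \<Rightarrow> field2 \<Rightarrow>
     functional \<Rightarrow> functional" where
  "gfft S T \<phi> W q h F = (\<lambda>y. feynman_limit q (\<lambda>r.
     partial_integral W (\<lambda>x. eval_gaussian S T \<phi> W F 1 y (1 / sqrt r) h x)))"

definition conv_product ::
    "real \<Rightarrow> real \<Rightarrow> (nat \<Rightarrow> field2) \<Rightarrow> field2 measure \<Rightarrow> real \<Rightarrow> field2 \<Rightarrow> field2 \<Rightarrow>
     functional \<Rightarrow> functional \<Rightarrow> functional" where
  "conv_product S T \<phi> W q k1 k2 F G = (\<lambda>y. feynman_limit q (\<lambda>r.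
     partial_integral W (\<lambda>x.
       Option.bind (eval_gaussian S T \<phi> W F (1 / sqrt 2) y (1 / sqrt r / sqrt 2) k1 x) (\<lambda>a.
       Option.bind (eval_gaussian S T \<phi> W G (1 / sqrt 2) y (- (1 / sqrt r) / sqrt 2) k2 x) (\<lambda>b.
       Some (a * b))))))"

(* For ks = [k_1, ..., k_n], the transform along k_1 / sqrt 2 is applied first (innermost). *)
definition iterated_gfft ::
    "real \<Rightarrow> real \<Rightarrow> (nat \<Rightarrow> field2) \<Rightarrow> field2 measure \<Rightarrow> real \<Rightarrow> field2 list \<Rightarrow>
     functional \<Rightarrow> functional" where
  "iterated_gfft S T \<phi> W q ks F = fold (\<lambda>k. gfft S T \<phi> W q (\<lambda>p. k p / sqrt 2)) ks F"

end

theory Submission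
  imports Defs
begin

text \<open>
  A functional in the class \<open>S(L2(Q))\<close> has the form \<open>F(x) = \<integral> d(u) exp(i<u,x>) dN(u)\<close> with a finite measure
  \<open>N\<close> on \<open>L2(Q)\<close> and an integrable density \<open>d\<close>. Since \<open><v,x>\<close> is centered normal with variance
  \<open>\<parallel>v\<parallel>\<^sup>2\<close>, Fubini's theorem and analytic continuation show that the transform along \<open>h\<close> multiplies
  \<open>d(u)\<close> by \<open>exp(-i \<parallel>uh\<parallel>\<^sup>2 / 2q)\<close>, and that the convolution product with parameter \<open>-q\<close> of the functionals
  with densities \<open>d\<close>, \<open>e\<close> is the integral of \<open>d(u) e(v) exp(i \<parallel>u k1 - v k2\<parallel>\<^sup>2 / 4q) exp(i<u+v,y>/sqrt 2)\<close>.
  The hypotheses replace sums of \<open>\<parallel>u k\<parallel>\<^sup>2\<close> over a sequence by one square \<open>\<parallel>u s\<parallel>\<^sup>2\<close> and give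
  \<open>(u s1, v s2) = (u h, v h)\<close>, so that the phases of all four functionals add up to
  \<open>-\<parallel>(u + v) h\<parallel>\<^sup>2 / 4q\<close>.

  The transform of \<open>F\<close> is well defined because \<open>F\<close> determines its measure: the averages of
  \<open>F(a x) exp(-i a <w,x>)\<close> over \<open>x\<close> are the integrals of the Gaussian kernels with center \<open>w\<close> and
  width \<open>1/a\<close>.
\<close>

section \<open>Integrals with respect to complex measures\<close>

text \<open>The normality of <v,x> has to be earned: the Yeh-Wiener measure controls only finite
  combinations of point values. A Riemann-Stieltjes sum over a uniform grid is such a combination,
  and its variance is the squared norm of the step function of corner values. Bounded variation
  makes these step functions converge in mean square, so the integrals of the basis functions have
  the joint characteristic function of independent standard normals. Independence is read off from
  it, and Kolmogorov's theorem gives almost sure convergence of the series for <v,x>. The second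
  obstacle is that <v,x> is a \<open>lim\<close>, meaningful only where its series converges, on a
  set depending on v. Joint measurability in (v,x) and Fubini's theorem provide one set of x, stable
  under scaling, on which the series converges for almost every v; the final identity discards
  nothing else. Scale invariance enters the uniqueness of the measure: F is known along a x for
  every a > 0, so Gaussian kernels of all widths are available, and these are closed under products
  up to constants.\<close>

definition bounded_measurable :: "'a measure \<Rightarrow> ('a \<Rightarrow> complex) \<Rightarrow> bool" where
  "bounded_measurable M w \<longleftrightarrow> w \<in> borel_measurable M \<and> (\<exists>B. \<forall>x\<in>space M. norm (w x) \<le> B)"

text \<open>Integration against a complex measure enters through these two properties, linearity on
  bounded functions and continuity under bounded pointwise convergence. Two such functionals agree
  as soon as they agree on indicators, so formulas for complex integrals need checking on sets
  only.\<close>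

definition sigma_functional :: "'a measure \<Rightarrow> (('a \<Rightarrow> complex) \<Rightarrow> complex) \<Rightarrow> bool" where
  "sigma_functional M \<Lambda> \<longleftrightarrow>
     (\<forall>a b v w. bounded_measurable M v \<longrightarrow> bounded_measurable M w \<longrightarrow>
        \<Lambda> (\<lambda>x. a * v x + b * w x) = a * \<Lambda> v + b * \<Lambda> w) \<and>
     (\<forall>w w' B. (\<forall>n. w n \<in> borel_measurable M) \<longrightarrow> (\<forall>n. \<forall>x\<in>space M. norm (w n x) \<le> B) \<longrightarrow>
        w' \<in> borel_measurable M \<longrightarrow> (\<forall>x\<in>space M. (\<lambda>n. w n x) \<longlonglongrightarrow> w' x) \<longrightarrow>
        (\<lambda>n::nat. \<Lambda> (w n)) \<longlonglongrightarrow> \<Lambda> w')"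

lemma bounded_measurableI:
  "w \<in> borel_measurable M \<Longrightarrow> (\<And>x. x \<in> space M \<Longrightarrow> norm (w x) \<le> B) \<Longrightarrow> bounded_measurable M w"
  by (auto simp: bounded_measurable_def)

lemma bounded_measurable_lin:
  assumes "bounded_measurable M v" "bounded_measurable M w"
  shows "bounded_measurable M (\<lambda>x. a * v x + b * w x)"
proof -
  obtain B C where "\<forall>x\<in>space M. norm (v x) \<le> B" "\<forall>x\<in>space M. norm (w x) \<le> C"
    using assms by (auto simp: bounded_measurable_def)
  then have "norm (a * v x + b * w x) \<le> norm a * B + norm b * C" if "x \<in> space M" for x
    using that by (intro norm_triangle_le add_mono) (auto simp: norm_mult intro!: mult_left_mono)
  then show ?thesis
    using assms by (intro bounded_measurableI) (auto simp: bounded_measurable_def)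
qed

lemma bounded_measurable_mult:
  assumes "bounded_measurable M v" "bounded_measurable M w"
  shows "bounded_measurable M (\<lambda>x. v x * w x)"
proof -
  obtain B C where B: "\<forall>x\<in>space M. norm (v x) \<le> B" and C: "\<forall>x\<in>space M. norm (w x) \<le> C"
    using assms by (auto simp: bounded_measurable_def)
  have "norm (v x * w x) \<le> \<bar>B\<bar> * \<bar>C\<bar>" if "x \<in> space M" for x
    unfolding norm_mult using B C that by (intro mult_mono) (auto intro: order_trans[OF _ abs_ge_self])
  then show ?thesis
    using assms by (intro bounded_measurableI) (auto simp: bounded_measurable_def)
qed

lemma bounded_measurable_indicator: "A \<in> sets M \<Longrightarrow> bounded_measurable M (indicator A)"
  by (intro bounded_measurableI[where B=1]) (auto simp: indicator_def)

lemma bounded_measurable_const: "bounded_measurable M (\<lambda>_. c)"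
  by (intro bounded_measurableI[where B="norm c"]) auto

lemma sigma_functional_lin:
  "sigma_functional M \<Lambda> \<Longrightarrow> bounded_measurable M v \<Longrightarrow> bounded_measurable M w \<Longrightarrow>
   \<Lambda> (\<lambda>x. a * v x + b * w x) = a * \<Lambda> v + b * \<Lambda> w"
  by (simp add: sigma_functional_def)

lemma sigma_functional_lim:
  assumes "sigma_functional M \<Lambda>" "\<And>n. w n \<in> borel_measurable M"
    "\<And>n x. x \<in> space M \<Longrightarrow> norm (w n x) \<le> B" "w' \<in> borel_measurable M"
    "\<And>x. x \<in> space M \<Longrightarrow> (\<lambda>n. w n x) \<longlonglongrightarrow> w' x"
  shows "(\<lambda>n::nat. \<Lambda> (w n)) \<longlonglongrightarrow> \<Lambda> w'"
  using assms unfolding sigma_functional_def by blast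

lemma sigma_functional_cong:
  assumes "sigma_functional M \<Lambda>" "bounded_measurable M w" "\<And>x. x \<in> space M \<Longrightarrow> w x = w' x"
  shows "\<Lambda> w = \<Lambda> w'"
proof -
  have w: "w \<in> borel_measurable M" "w' \<in> borel_measurable M"
    using assms(2) measurable_cong[of M w w' borel] assms(3) by (auto simp: bounded_measurable_def)
  obtain B where "\<forall>x\<in>space M. norm (w x) \<le> B"
    using assms(2) by (auto simp: bounded_measurable_def)
  then have "(\<lambda>n::nat. \<Lambda> w) \<longlonglongrightarrow> \<Lambda> w'"
    using w assms(3) by (intro sigma_functional_lim[OF assms(1), where B=B]) auto
  then show ?thesis by (simp add: LIMSEQ_const_iff)
qed

lemma sigma_functional_sum:
  assumes \<Lambda>: "sigma_functional M \<Lambda>" and "finite I" and "\<And>i. i \<in> I \<Longrightarrow> bounded_measurable M (w i)"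
  shows "bounded_measurable M (\<lambda>x. \<Sum>i\<in>I. c i * w i x) \<and>
    \<Lambda> (\<lambda>x. \<Sum>i\<in>I. c i * w i x) = (\<Sum>i\<in>I. c i * \<Lambda> (w i))"
  using assms(2,3)
proof (induction I rule: finite_induct)
  case empty
  have "\<Lambda> (\<lambda>x. 0) = 0"
    using sigma_functional_lin[OF \<Lambda> bounded_measurable_const bounded_measurable_const, of 0 0 0 0]
    by simp
  then show ?case by (simp add: bounded_measurable_const)
next
  case (insert i I)
  then have *: "bounded_measurable M (w i)" "bounded_measurable M (\<lambda>x. \<Sum>i\<in>I. c i * w i x)" by auto
  show ?case
    using insert sigma_functional_lin[OF \<Lambda> *, of "c i" 1] bounded_measurable_lin[OF *, of "c i" 1]
    by simp
qed

lemma sigma_functional_combine: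
  assumes "sigma_functional M \<Lambda>" "sigma_functional M \<Lambda>'"
  shows "sigma_functional M (\<lambda>w. a * \<Lambda> w + b * \<Lambda>' w)"
  unfolding sigma_functional_def
proof (intro conjI allI impI)
  fix c d v w assume "bounded_measurable M v" "bounded_measurable M w"
  then show "a * \<Lambda> (\<lambda>x. c * v x + d * w x) + b * \<Lambda>' (\<lambda>x. c * v x + d * w x) =
      c * (a * \<Lambda> v + b * \<Lambda>' v) + d * (a * \<Lambda> w + b * \<Lambda>' w)"
    using sigma_functional_lin[OF assms(1), of v w c d] sigma_functional_lin[OF assms(2), of v w c d]
    by (simp add: algebra_simps)
next
  fix w :: "nat \<Rightarrow> 'a \<Rightarrow> complex" and w' B
  assume "\<forall>n. w n \<in> borel_measurable M" "\<forall>n. \<forall>x\<in>space M. norm (w n x) \<le> B"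
    "w' \<in> borel_measurable M" "\<forall>x\<in>space M. (\<lambda>n. w n x) \<longlonglongrightarrow> w' x"
  then have "(\<lambda>n::nat. \<Lambda> (w n)) \<longlonglongrightarrow> \<Lambda> w'" "(\<lambda>n::nat. \<Lambda>' (w n)) \<longlonglongrightarrow> \<Lambda>' w'"
    using sigma_functional_lim[OF assms(1), of w B w'] sigma_functional_lim[OF assms(2), of w B w']
    by blast+
  then show "(\<lambda>n::nat. a * \<Lambda> (w n) + b * \<Lambda>' (w n)) \<longlonglongrightarrow> a * \<Lambda> w' + b * \<Lambda>' w'"
    by (intro tendsto_intros)
qed

text \<open>A bounded measurable function is a pointwise limit of simple functions with a common
  bound, and on a simple function the functional is a finite combination of its values on
  indicators.\<close>

lemma sigma_functional_eq_0:
  assumes \<Lambda>: "sigma_functional M \<Lambda>" and 0: "\<And>A. A \<in> sets M \<Longrightarrow> \<Lambda> (indicator A) = 0"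
    and w: "bounded_measurable M w"
  shows "\<Lambda> w = 0"
proof -
  have wm: "w \<in> borel_measurable M" using w by (simp add: bounded_measurable_def)
  obtain B where B: "\<forall>x\<in>space M. norm (w x) \<le> B"
    using w by (auto simp: bounded_measurable_def)
  obtain s where s: "\<And>i. simple_function M (s i)"
    "\<And>x. x \<in> space M \<Longrightarrow> (\<lambda>i. s i x) \<longlonglongrightarrow> w x"
    "\<And>i x. x \<in> space M \<Longrightarrow> dist (s i x) 0 \<le> 2 * dist (w x) 0"
    using borel_measurable_implies_sequence_metric[OF wm, of 0] by metis
  have "\<Lambda> (s i) = 0" for i
  proof -
    let ?A = "\<lambda>y. s i -` {y} \<inter> space M"
    have A: "?A y \<in> sets M" for y
      using simple_functionD(2)[OF s(1)] by auto
    have fin: "finite (s i ` space M)" using simple_functionD(1)[OF s(1)] .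
    have *: "bounded_measurable M (\<lambda>x. \<Sum>y\<in>s i ` space M. y * indicator (?A y) x)"
      "\<Lambda> (\<lambda>x. \<Sum>y\<in>s i ` space M. y * indicator (?A y) x) =
        (\<Sum>y\<in>s i ` space M. y * \<Lambda> (indicator (?A y)))"
      using sigma_functional_sum[OF \<Lambda> fin, of "\<lambda>y. indicator (?A y)" "\<lambda>y. y"]
        bounded_measurable_indicator[OF A] by auto
    have "(\<Sum>y\<in>s i ` space M. y * indicator (?A y) x) = s i x" if "x \<in> space M" for x
    proof -
      have "(\<Sum>y\<in>s i ` space M. y * indicator (?A y) x) =
          (\<Sum>y\<in>s i ` space M. if y = s i x then y else 0)"
        using that by (intro sum.cong) (auto simp: indicator_def)
      then show ?thesis using that fin by simp
    qed
    then have "\<Lambda> (s i) = (\<Sum>y\<in>s i ` space M. y * \<Lambda> (indicator (?A y)))"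
      using sigma_functional_cong[OF \<Lambda> *(1)] *(2) by simp
    then show ?thesis using 0[OF A] by simp
  qed
  \<comment> \<open>The approximating simple functions are at most twice as large as w, which
    explains the bound \<open>2*B\<close>.\<close>
  moreover have "(\<lambda>i. \<Lambda> (s i)) \<longlonglongrightarrow> \<Lambda> w"
  proof (rule sigma_functional_lim[OF \<Lambda>, where B="2*B"])
    show "norm (s n x) \<le> 2 * B" if "x \<in> space M" for n x
      using s(3)[OF that, of n] B that by fastforce
  qed (use s wm in \<open>auto intro: borel_measurable_simple_function\<close>)
  ultimately show ?thesis by (simp add: LIMSEQ_const_iff)
qed

lemma sigma_functional_ext:
  assumes "sigma_functional M \<Lambda>" "sigma_functional M \<Lambda>'"
    and "\<And>A. A \<in> sets M \<Longrightarrow> \<Lambda> (indicator A) = \<Lambda>' (indicator A)" and "bounded_measurable M w"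
  shows "\<Lambda> w = \<Lambda>' w"
  using sigma_functional_eq_0[OF sigma_functional_combine[OF assms(1,2), of 1 "-1"] _ assms(4)] assms(3)
  by simp

text \<open>Weighting by a fixed function allows vanishing on products of kernels and indicators to
  be proved one factor at a time.\<close>

lemma sigma_functional_times:
  assumes \<Lambda>: "sigma_functional M \<Lambda>" and v: "bounded_measurable M v"
  shows "sigma_functional M (\<lambda>w. \<Lambda> (\<lambda>x. v x * w x))"
  unfolding sigma_functional_def
proof (intro conjI allI impI)
  fix c d u w assume "bounded_measurable M u" "bounded_measurable M w"
  then show "\<Lambda> (\<lambda>x. v x * (c * u x + d * w x)) = c * \<Lambda> (\<lambda>x. v x * u x) + d * \<Lambda> (\<lambda>x. v x * w x)"
    using sigma_functional_lin[OF \<Lambda> bounded_measurable_mult[OF v] bounded_measurable_mult[OF v], of u w c d]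
    by (simp add: algebra_simps)
next
  fix w :: "nat \<Rightarrow> 'a \<Rightarrow> complex" and w' B
  assume *: "\<forall>n. w n \<in> borel_measurable M" "\<forall>n. \<forall>x\<in>space M. norm (w n x) \<le> B"
    "w' \<in> borel_measurable M" "\<forall>x\<in>space M. (\<lambda>n. w n x) \<longlonglongrightarrow> w' x"
  obtain C where C: "\<forall>x\<in>space M. norm (v x) \<le> C" "v \<in> borel_measurable M"
    using v by (auto simp: bounded_measurable_def)
  show "(\<lambda>n::nat. \<Lambda> (\<lambda>x. v x * w n x)) \<longlonglongrightarrow> \<Lambda> (\<lambda>x. v x * w' x)"
  proof (rule sigma_functional_lim[OF \<Lambda>, where B="\<bar>C\<bar> * \<bar>B\<bar>"])
    show "norm (v x * w n x) \<le> \<bar>C\<bar> * \<bar>B\<bar>" if "x \<in> space M" for n x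
      unfolding norm_mult using * C that by (intro mult_mono) (auto intro: order_trans[OF _ abs_ge_self])
  qed (use * C in \<open>auto intro!: tendsto_mult borel_measurable_times\<close>)
qed

text \<open>The map \<theta> lets the integrating measure live on a space other than that of the
  functions. The case that matters later is a product of two measure spaces, carried to L_2(Q) by a
  combination of two vectors.\<close>

lemma sigma_functional_integral:
  fixes g :: "'b \<Rightarrow> complex"
  assumes g: "integrable N g" and \<theta>[measurable]: "\<theta> \<in> measurable N M"
  shows "sigma_functional M (\<lambda>w. LINT x|N. g x * w (\<theta> x))"
proof -
  have [measurable]: "g \<in> borel_measurable N" using g by auto
  have int: "integrable N (\<lambda>x. g x * w (\<theta> x))" if w: "bounded_measurable M w" for w
  proof -
    have [measurable]: "w \<in> borel_measurable M" using w by (simp add: bounded_measurable_def)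
    obtain B where B: "\<forall>x\<in>space M. norm (w x) \<le> B"
      using w by (auto simp: bounded_measurable_def)
    show ?thesis
    proof (rule Bochner_Integration.integrable_bound[of _ "\<lambda>x. B * norm (g x)"])
      show "AE x in N. norm (g x * w (\<theta> x)) \<le> norm (B * norm (g x))"
      proof (intro AE_I2)
        fix x assume "x \<in> space N"
        then have "norm (w (\<theta> x)) \<le> \<bar>B\<bar>"
          using B measurable_space[OF \<theta>] by (meson abs_ge_self order_trans)
        then show "norm (g x * w (\<theta> x)) \<le> norm (B * norm (g x))"
          using mult_right_mono[of "norm (w (\<theta> x))" "\<bar>B\<bar>" "norm (g x)"]
          by (simp add: norm_mult abs_mult mult.commute)
      qed
    qed (use g in auto)
  qed
  show ?thesis
    unfolding sigma_functional_def
  proof (intro conjI allI impI)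
    fix a b v w assume *: "bounded_measurable M v" "bounded_measurable M w"
    have "(LINT x|N. g x * (a * v (\<theta> x) + b * w (\<theta> x))) =
       (LINT x|N. a * (g x * v (\<theta> x)) + b * (g x * w (\<theta> x)))"
      by (intro Bochner_Integration.integral_cong) (auto simp: algebra_simps)
    then show "(LINT x|N. g x * (a * v (\<theta> x) + b * w (\<theta> x))) =
       a * (LINT x|N. g x * v (\<theta> x)) + b * (LINT x|N. g x * w (\<theta> x))"
      using int[OF *(1)] int[OF *(2)] by simp
  next
    fix w :: "nat \<Rightarrow> 'a \<Rightarrow> complex" and w' B
    assume *: "\<forall>n. w n \<in> borel_measurable M" "\<forall>n. \<forall>x\<in>space M. norm (w n x) \<le> B"
      "w' \<in> borel_measurable M" "\<forall>x\<in>space M. (\<lambda>n. w n x) \<longlonglongrightarrow> w' x"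
    have [measurable]: "\<And>n. w n \<in> borel_measurable M" "w' \<in> borel_measurable M" using * by auto
    show "(\<lambda>n::nat. LINT x|N. g x * w n (\<theta> x)) \<longlonglongrightarrow> (LINT x|N. g x * w' (\<theta> x))"
    proof (rule integral_dominated_convergence[where w="\<lambda>x. B * norm (g x)"])
      show "AE x in N. (\<lambda>n. g x * w n (\<theta> x)) \<longlonglongrightarrow> g x * w' (\<theta> x)"
        using * measurable_space[OF \<theta>] by (auto intro!: tendsto_intros)
      show "AE x in N. norm (g x * w n (\<theta> x)) \<le> B * norm (g x)" for n
        using * measurable_space[OF \<theta>]
        by (intro AE_I2) (auto simp: norm_mult mult.commute[of "norm (g _)"] intro!: mult_right_mono)
    qed (use g in auto)
  qed
qed

section \<open>Jordan decomposition of a signed measure\<close>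

definition signed_measure_on :: "'a measure \<Rightarrow> ('a set \<Rightarrow> real) \<Rightarrow> bool" where
  "signed_measure_on M r \<longleftrightarrow> r {} = 0 \<and>
     (\<forall>A :: nat \<Rightarrow> 'a set. range A \<subseteq> sets M \<longrightarrow> disjoint_family A \<longrightarrow>
        (\<lambda>i. r (A i)) sums r (\<Union>i. A i))"

lemma signed_measure_sums:
  fixes A :: "nat \<Rightarrow> 'a set"
  shows "signed_measure_on M r \<Longrightarrow> range A \<subseteq> sets M \<Longrightarrow> disjoint_family A \<Longrightarrow>
    (\<lambda>i. r (A i)) sums r (\<Union>i. A i)"
  by (simp add: signed_measure_on_def)

lemma signed_measure_on_uminus: "signed_measure_on M r \<Longrightarrow> signed_measure_on M (\<lambda>A. - r A)"
  by (auto simp: signed_measure_on_def intro: sums_minus)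

lemma complex_measure_on_Re: "complex_measure_on M f \<Longrightarrow> signed_measure_on M (\<lambda>A. Re (f A))"
  by (auto simp: signed_measure_on_def complex_measure_on_def intro: sums_Re)

lemma complex_measure_on_Im: "complex_measure_on M f \<Longrightarrow> signed_measure_on M (\<lambda>A. Im (f A))"
  by (auto simp: signed_measure_on_def complex_measure_on_def intro: sums_Im)

context
  fixes M :: "'a measure" and r :: "'a set \<Rightarrow> real"
  assumes r: "signed_measure_on M r"
begin

lemma signed_measure_Un:
  assumes "A \<in> sets M" "B \<in> sets M" "A \<inter> B = {}"
  shows "r (A \<union> B) = r A + r B"
proof -
  have "(\<lambda>i. r (binaryset A B i)) sums r (\<Union>i. binaryset A B i)"
    using r
  proof (rule signed_measure_sums)
    show "range (binaryset A B) \<subseteq> sets M"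
      using assms by (simp add: range_binaryset_eq)
    show "disjoint_family (binaryset A B)"
      using assms(3) by (simp add: disjoint_family_on_def binaryset_def Int_commute)
  qed
  moreover have "(\<lambda>i. r (binaryset A B i)) sums (r A + r B)"
    using binaryset_sums[of r A B] r by (simp add: signed_measure_on_def)
  ultimately show ?thesis
    by (metis UN_binaryset_eq sums_unique2)
qed

lemma signed_measure_Diff:
  assumes "A \<in> sets M" "B \<in> sets M" "B \<subseteq> A"
  shows "r (A - B) = r A - r B"
  using signed_measure_Un[of B "A - B"] assms by (simp add: Un_absorb1 sup_absorb2)

private definition p :: "'a set \<Rightarrow> ennreal" where
  "p A = (SUP B\<in>{B \<in> sets M. B \<subseteq> A}. ennreal (r B))"

private lemma p_upper: "B \<in> sets M \<Longrightarrow> B \<subseteq> A \<Longrightarrow> ennreal (r B) \<le> p A"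
  unfolding p_def by (intro SUP_upper) auto

text \<open>Subsets of two disjoint sets unite to a subset of the union, so the suprema add. If one
  of the two values is negative, \<open>ennreal\<close> sends it to 0 and the other subset alone
  suffices.\<close>

private lemma p_superadditive:
  assumes "A \<in> sets M" "A' \<in> sets M" "A \<inter> A' = {}"
  shows "p A + p A' \<le> p (A \<union> A')"
proof -
  have *: "ennreal (r B) + ennreal (r B') \<le> p (A \<union> A')"
    if "B \<in> sets M" "B \<subseteq> A" "B' \<in> sets M" "B' \<subseteq> A'" for B B'
  proof -
    have eq: "r (B \<union> B') = r B + r B'"
      using that assms by (intro signed_measure_Un) auto
    consider "r B \<ge> 0" "r B' \<ge> 0" | "r B < 0" | "r B' < 0" by linarith
    then show ?thesis
    proof cases
      case 1
      then show ?thesis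
        using that p_upper[of "B \<union> B'" "A \<union> A'"] by (auto simp: eq ennreal_plus)
    qed (use that p_upper[of B "A \<union> A'"] p_upper[of B' "A \<union> A'"] in \<open>auto simp: ennreal_neg\<close>)
  qed
  have NE: "{B \<in> sets M. B \<subseteq> C} \<noteq> {}" for C by auto
  have "(SUP B\<in>{B \<in> sets M. B \<subseteq> A}. SUP B'\<in>{B \<in> sets M. B \<subseteq> A'}. ennreal (r B) + ennreal (r B')) \<le> p (A \<union> A')"
    using * by (intro SUP_least) auto
  moreover have "(SUP B\<in>{B \<in> sets M. B \<subseteq> A}. SUP B'\<in>{B \<in> sets M. B \<subseteq> A'}. ennreal (r B) + ennreal (r B'))
      = p A + p A'"
    unfolding p_def by (simp add: ennreal_SUP_add_left[OF NE] ennreal_SUP_add_right[OF NE, symmetric])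
  ultimately show ?thesis by simp
qed

private lemma p_positive: "positive (sets M) p"
proof -
  have "r {} = 0" using r by (simp add: signed_measure_on_def)
  moreover have "{B \<in> sets M. B \<subseteq> {}} = {{}}" by auto
  ultimately show ?thesis by (simp add: positive_def p_def)
qed

private lemma p_mono: "A \<subseteq> B \<Longrightarrow> p A \<le> p B"
  unfolding p_def by (intro SUP_subset_mono) auto

text \<open>One inequality is superadditivity on finite unions. For the other, a subset B of the
  union is cut along the sets \<open>A i\<close>; replacing the negative values among the
  \<open>r (B \<inter> A i)\<close> by 0 only increases the partial sums.\<close>

private lemma p_countably_additive: "countably_additive (sets M) p"
  unfolding countably_additive_def
proof (intro allI impI antisym)
  fix A :: "nat \<Rightarrow> 'a set"
  assume A: "range A \<subseteq> sets M" "disjoint_family A" "(\<Union>i. A i) \<in> sets M"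
  have "(\<Sum>i<n. p (A i)) \<le> p (\<Union>i<n. A i)" for n
  proof (induction n)
    case 0
    then show ?case using p_positive by (simp add: positive_def)
  next
    case (Suc n)
    have "p (\<Union>i<n. A i) + p (A n) \<le> p ((\<Union>i<n. A i) \<union> A n)"
      using A by (intro p_superadditive) (auto simp: disjoint_family_on_def, metis IntI empty_iff less_irrefl)
    then show ?case
      using Suc by (simp add: lessThan_Suc Un_commute add.commute) (metis add_left_mono order_trans)
  qed
  then have "(\<Sum>i<n. p (A i)) \<le> p (\<Union>i. A i)" for n
    using p_mono[of "\<Union>i<n. A i" "\<Union>i. A i"] by (meson UN_mono order_trans subset_UNIV subset_refl)
  then show "(\<Sum>i. p (A i)) \<le> p (\<Union>i. A i)"
    by (intro suminf_le_const) (auto simp: summableI)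
  show "p (\<Union>i. A i) \<le> (\<Sum>i. p (A i))"
    unfolding p_def[of "\<Union>i. A i"]
  proof (rule SUP_least, safe)
    fix B assume B: "B \<in> sets M" "B \<subseteq> (\<Union>i. A i)"
    have "(\<lambda>i. r (B \<inter> A i)) sums r (\<Union>i. B \<inter> A i)"
      using r
    proof (rule signed_measure_sums)
      show "range (\<lambda>i. B \<inter> A i) \<subseteq> sets M" using A B by (auto intro: sets.Int)
      show "disjoint_family (\<lambda>i. B \<inter> A i)" using A by (simp add: disjoint_family_on_def) blast
    qed
    also have "(\<Union>i. B \<inter> A i) = B" using B by auto
    finally have "(\<lambda>n. ennreal (\<Sum>i<n. r (B \<inter> A i))) \<longlonglongrightarrow> ennreal (r B)"
      unfolding sums_def by (intro tendsto_ennrealI)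
    moreover have "ennreal (\<Sum>i<n. r (B \<inter> A i)) \<le> (\<Sum>i. p (A i))" for n
    proof -
      have "ennreal (\<Sum>i<n. r (B \<inter> A i)) \<le> ennreal (\<Sum>i<n. max 0 (r (B \<inter> A i)))"
        by (intro ennreal_leI sum_mono) auto
      also have "\<dots> = (\<Sum>i<n. ennreal (r (B \<inter> A i)))"
        by (subst sum_ennreal[symmetric]) (auto simp: ennreal_max_0 intro!: sum.cong)
      also have "\<dots> \<le> (\<Sum>i<n. p (A i))"
        using A B by (intro sum_mono p_upper) auto
      also have "\<dots> \<le> (\<Sum>i. p (A i))"
        by (intro sum_le_suminf) auto
      finally show ?thesis .
    qed
    ultimately show "ennreal (r B) \<le> (\<Sum>i. p (A i))"
      by (intro LIMSEQ_le_const2) auto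
  qed
qed

lemma emeasure_upper_variation:
  assumes "A \<in> sets M"
  shows "emeasure (upper_variation M r) A = (SUP B\<in>{B \<in> sets M. B \<subseteq> A}. ennreal (r B))"
  unfolding upper_variation_def p_def[symmetric]
  using p_positive p_countably_additive assms sets.space_closed sets.sigma_algebra_axioms
  by (intro emeasure_measure_of_sigma) auto

lemma sets_upper_variation[simp]: "sets (upper_variation M r) = sets M"
  by (simp add: upper_variation_def)

lemma space_upper_variation[simp]: "space (upper_variation M r) = space M"
  by (simp add: upper_variation_def)

text \<open>From a set of infinite variation a piece with |r| > 1 can be removed so that infinite
  variation remains. Iteration yields disjoint pieces whose values do not tend to 0, although their
  series converges by countable additivity.\<close>

lemma finite_upper_variation: "finite_measure (upper_variation M r)"
proof (rule ccontr)
  let ?U = "upper_variation M r"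
  assume "\<not> finite_measure ?U"
  then have inf: "emeasure ?U (space M) = \<top>"
    using finite_measureI[of ?U] by auto
  have step: "\<exists>E'\<in>sets M. E' \<subseteq> E \<and> emeasure ?U E' = \<top> \<and> \<bar>r (E - E')\<bar> > 1"
    if E: "E \<in> sets M" "emeasure ?U E = \<top>" for E
  proof -
    \<comment> \<open>The margin 1 + |r E| makes both |r A| and |r (E - A)| exceed 1, so it does not
      matter which of the two halves keeps the infinite variation.\<close>
    have "ennreal (1 + \<bar>r E\<bar>) < (SUP B\<in>{B \<in> sets M. B \<subseteq> E}. ennreal (r B))"
      using E by (simp add: emeasure_upper_variation[symmetric])
    then obtain A where A: "A \<in> sets M" "A \<subseteq> E" "ennreal (1 + \<bar>r E\<bar>) < ennreal (r A)"
      by (auto simp: less_SUP_iff)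
    then have rA: "1 + \<bar>r E\<bar> < r A" using ennreal_less_iff[of "1 + \<bar>r E\<bar>" "r A"] by (simp del: ennreal_plus)
    have rB: "r (E - A) = r E - r A" using A E by (intro signed_measure_Diff) auto
    have "emeasure ?U A + emeasure ?U (E - A) = emeasure ?U (A \<union> (E - A))"
      using A E by (intro plus_emeasure) auto
    also have "A \<union> (E - A) = E" using A by auto
    finally consider "emeasure ?U A = \<top>" | "emeasure ?U (E - A) = \<top>"
      using E by (auto simp: ennreal_add_eq_top)
    then show ?thesis
    proof cases
      case 1
      then show ?thesis using A rA rB by (intro bexI[of _ A]) auto
    next
      case 2
      moreover have "E - (E - A) = A" using A by auto
      ultimately show ?thesis using A E rA by (intro bexI[of _ "E - A"]) auto
    qed
  qed
  have "\<exists>E. \<forall>n. (E n \<in> sets M \<and> emeasure ?U (E n) = \<top>) \<and> (E (Suc n) \<subseteq> E n \<and> \<bar>r (E n - E (Suc n))\<bar> > 1)"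
    using inf step by (intro dependent_nat_choice) auto
  then obtain E where E: "\<And>n. E n \<in> sets M" "\<And>n. E (Suc n) \<subseteq> E n" "\<And>n. \<bar>r (E n - E (Suc n))\<bar> > 1"
    by blast
  have dec: "E n \<subseteq> E m" if "m \<le> n" for m n
    using lift_Suc_antimono_le[of E, OF E(2) that] .
  have "disjoint_family (\<lambda>n. E n - E (Suc n))"
    unfolding disjoint_family_on_def
  proof (intro ballI impI)
    fix m n :: nat assume "m \<noteq> n"
    then show "(E m - E (Suc m)) \<inter> (E n - E (Suc n)) = {}"
      using dec[of "Suc m" n] dec[of "Suc n" m] by (cases "m < n") auto
  qed
  then have "(\<lambda>n. r (E n - E (Suc n))) sums r (\<Union>n. E n - E (Suc n))"
    by (rule signed_measure_sums[OF r, rotated]) (use E(1) in \<open>auto intro!: sets.Diff\<close>)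
  then have "(\<lambda>n. r (E n - E (Suc n))) \<longlonglongrightarrow> 0"
    by (intro summable_LIMSEQ_zero) (auto simp: sums_iff)
  then obtain n where "\<bar>r (E n - E (Suc n))\<bar> < 1"
    by (auto dest!: LIMSEQ_D[where r=1])
  then show False using E(3)[of n] by simp
qed

end

text \<open>With C = A - B one has r B = r A - r C, so the supremum of r B over subsets B of A is r
  A plus the supremum of - r C. Both suprema are finite and may be subtracted.\<close>

lemma signed_measure_eq_variation:
  assumes r: "signed_measure_on M r" and A: "A \<in> sets M"
  shows "r A = measure (upper_variation M r) A - measure (upper_variation M (\<lambda>A. - r A)) A"
proof -
  let ?P = "upper_variation M r" and ?N = "upper_variation M (\<lambda>A. - r A)"
  \<comment> \<open>In \<open>ennreal\<close> the sum with \<open>r' A\<close> is faithful only for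
    a nonnegative value. The other sign is covered by applying the result to - r, which exchanges
    the two variations.\<close>
  have main: "ennreal (r' A) + emeasure (upper_variation M (\<lambda>A. - r' A)) A \<le> emeasure (upper_variation M r') A"
    if r': "signed_measure_on M r'" and pos: "r' A \<ge> 0" for r'
  proof -
    note N = signed_measure_on_uminus[OF r']
    have "ennreal (r' A) + ennreal (- r' B) \<le> emeasure (upper_variation M r') A"
      if "B \<in> sets M" "B \<subseteq> A" for B
    proof (cases "r' B \<le> 0")
      case True
      have "ennreal (r' A) + ennreal (- r' B) = ennreal (r' (A - B))"
        using True pos signed_measure_Diff[OF r' A that] by (simp add: ennreal_plus[symmetric] del: ennreal_plus)
      also have "\<dots> \<le> emeasure (upper_variation M r') A"
        unfolding emeasure_upper_variation[OF r' A] using that A by (intro SUP_upper) auto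
      finally show ?thesis .
    next
      case False
      then have "ennreal (r' A) + ennreal (- r' B) = ennreal (r' A)" by (simp add: ennreal_neg)
      also have "\<dots> \<le> emeasure (upper_variation M r') A"
        unfolding emeasure_upper_variation[OF r' A] using that A by (intro SUP_upper) auto
      finally show ?thesis .
    qed
    moreover have "{B \<in> sets M. B \<subseteq> A} \<noteq> {}" by auto
    ultimately show ?thesis
      unfolding emeasure_upper_variation[OF N A]
      by (subst ennreal_SUP_add_right) (auto intro!: SUP_least)
  qed
  have main2: "emeasure (upper_variation M r') A \<le> ennreal (r' A) + emeasure (upper_variation M (\<lambda>A. - r' A)) A"
    if r': "signed_measure_on M r'" and pos: "r' A \<ge> 0" for r'
    unfolding emeasure_upper_variation[OF r' A]
  proof (rule SUP_least, safe)
    note N = signed_measure_on_uminus[OF r']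
    fix B assume B: "B \<in> sets M" "B \<subseteq> A"
    have "r' B \<le> r' A + max 0 (- r' (A - B))"
      using signed_measure_Diff[OF r' A B] by linarith
    then have "ennreal (r' B) \<le> ennreal (r' A) + ennreal (- r' (A - B))"
      using pos by (metis ennreal_leI ennreal_max_0 ennreal_plus max.cobounded1)
    also have "\<dots> \<le> ennreal (r' A) + emeasure (upper_variation M (\<lambda>A. - r' A)) A"
      unfolding emeasure_upper_variation[OF N A] using B A
      by (intro add_left_mono SUP_upper) auto
    finally show "ennreal (r' B) \<le> ennreal (r' A) + emeasure (upper_variation M (\<lambda>A. - r' A)) A" .
  qed
  have eq: "r' A = measure (upper_variation M r') A - measure (upper_variation M (\<lambda>A. - r' A)) A"
    if r': "signed_measure_on M r'" and pos: "r' A \<ge> 0" for r'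
  proof -
    interpret P: finite_measure "upper_variation M r'" by (rule finite_upper_variation[OF r'])
    interpret N: finite_measure "upper_variation M (\<lambda>A. - r' A)"
      by (rule finite_upper_variation[OF signed_measure_on_uminus[OF r']])
    have "emeasure (upper_variation M r') A = ennreal (r' A) + emeasure (upper_variation M (\<lambda>A. - r' A)) A"
      using main[OF r' pos] main2[OF r' pos] by (rule antisym[rotated])
    then show ?thesis
      using pos by (simp add: P.emeasure_eq_measure N.emeasure_eq_measure ennreal_plus[symmetric] del: ennreal_plus)
  qed
  show ?thesis
  proof (cases "r A \<ge> 0")
    case True
    then show ?thesis using eq[OF r] by simp
  next
    case False
    then show ?thesis using eq[OF signed_measure_on_uminus[OF r]] by simp
  qed
qed

lemma integral_indicator_complex:
  "(LINT x|N. indicator A x :: complex) = of_real (measure N (A \<inter> space N))"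
proof -
  have "(LINT x|N. indicator A x :: complex) = (LINT x|N. of_real (indicator A x))"
    by (intro Bochner_Integration.integral_cong) (auto simp: indicator_def)
  then show ?thesis by simp
qed

lemma sigma_functional_signed_integral:
  assumes r: "signed_measure_on M r"
  shows "sigma_functional M (signed_integral M r)"
    and "A \<in> sets M \<Longrightarrow> signed_integral M r (indicator A) = of_real (r A)"
proof -
  note r' = signed_measure_on_uminus[OF r]
  interpret P: finite_measure "upper_variation M r" by (rule finite_upper_variation[OF r])
  interpret N: finite_measure "upper_variation M (\<lambda>A. - r A)" by (rule finite_upper_variation[OF r'])
  have m: "(\<lambda>x. x) \<in> measurable (upper_variation M r) M"
    "(\<lambda>x. x) \<in> measurable (upper_variation M (\<lambda>A. - r A)) M"
    using r r' by (auto intro!: measurableI)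
  show "sigma_functional M (signed_integral M r)"
    using sigma_functional_combine[OF sigma_functional_integral[OF P.integrable_const[of 1] m(1)]
        sigma_functional_integral[OF N.integrable_const[of 1] m(2)], of 1 "-1"]
    by (simp add: signed_integral_def[abs_def])
  assume A: "A \<in> sets M"
  then show "signed_integral M r (indicator A) = of_real (r A)"
    using signed_measure_eq_variation[OF r A] integral_indicator_complex[of "upper_variation M r" A]
      integral_indicator_complex[of "upper_variation M (\<lambda>A. - r A)" A] r r' sets.sets_into_space[OF A]
    by (simp add: signed_integral_def Int_absorb2)
qed

section \<open>Complex measures as functionals and as densities\<close>

lemma complex_integral_sigma:
  assumes f: "complex_measure_on M f"
  shows sigma_functional_complex_integral: "sigma_functional M (complex_integral M f)"
    and complex_integral_indicator: "A \<in> sets M \<Longrightarrow> complex_integral M f (indicator A) = f A"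
proof -
  note R = sigma_functional_signed_integral[OF complex_measure_on_Re[OF f]]
  note I = sigma_functional_signed_integral[OF complex_measure_on_Im[OF f]]
  show "sigma_functional M (complex_integral M f)"
    using sigma_functional_combine[OF R(1) I(1), of 1 \<i>] by (simp add: complex_integral_def[abs_def])
  show "A \<in> sets M \<Longrightarrow> complex_integral M f (indicator A) = f A"
    using R(2) I(2) by (simp add: complex_integral_def complex_eq_iff)
qed

lemma complex_integral_cong_measure:
  assumes "complex_measure_on M f" "complex_measure_on M f'" "\<And>A. A \<in> sets M \<Longrightarrow> f A = f' A"
    "bounded_measurable M w"
  shows "complex_integral M f w = complex_integral M f' w"
  by (rule sigma_functional_ext[OF sigma_functional_complex_integral[OF assms(1)]
        sigma_functional_complex_integral[OF assms(2)]])
    (auto simp: complex_integral_indicator[OF assms(1)] complex_integral_indicator[OF assms(2)] assms(3,4))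

text \<open>Continuity under bounded convergence, applied to the indicators of partial unions, is
  countable additivity. The integral of the measure obtained here gives the functional back, by the
  next lemma.\<close>

lemma complex_measure_on_functional:
  assumes \<Lambda>: "sigma_functional M \<Lambda>"
  shows "complex_measure_on M (\<lambda>A. \<Lambda> (indicator A))"
  unfolding complex_measure_on_def
proof (intro conjI allI impI)
  show "\<Lambda> (indicator {}) = 0"
    using sigma_functional_sum[OF \<Lambda>, of "{}"] by (simp add: indicator_def[abs_def])
  fix A :: "nat \<Rightarrow> 'a set" assume A: "range A \<subseteq> sets M" "disjoint_family A"
  have [simp]: "A i \<in> sets M" for i using A by auto
  have ind: "(\<Sum>i<n. indicator (A i) x :: complex) = indicator (\<Union>i<n. A i) x" for n x
    using A by (subst indicator_UN_disjoint) (auto simp: disjoint_family_on_def)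
  have "(\<Sum>i<n. \<Lambda> (indicator (A i))) = \<Lambda> (\<lambda>x. \<Sum>i<n. indicator (A i) x)" for n
    using sigma_functional_sum[OF \<Lambda>, of "{..<n}" "\<lambda>i. indicator (A i)" "\<lambda>_. 1"]
    by (simp add: bounded_measurable_indicator)
  moreover have "(\<lambda>n. \<Lambda> (\<lambda>x. \<Sum>i<n. indicator (A i) x)) \<longlonglongrightarrow> \<Lambda> (indicator (\<Union>i. A i))"
    unfolding ind
  proof (rule sigma_functional_lim[OF \<Lambda>, where B=1])
    show "(\<lambda>n. indicator (\<Union>i<n. A i) x) \<longlonglongrightarrow> (indicator (\<Union>i. A i) x :: complex)" for x
      by (rule LIMSEQ_indicator_UN)
    show "indicator (\<Union>i<n. A i) \<in> borel_measurable M" for n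
      by (intro borel_measurable_indicator) auto
    show "indicator (\<Union>i. A i) \<in> borel_measurable M"
      by (intro borel_measurable_indicator) auto
  qed (simp add: indicator_def)
  ultimately show "(\<lambda>i. \<Lambda> (indicator (A i))) sums \<Lambda> (indicator (\<Union>i. A i))"
    by (simp add: sums_def)
qed

lemma complex_integral_functional:
  assumes \<Lambda>: "sigma_functional M \<Lambda>" and "bounded_measurable M w"
  shows "complex_integral M (\<lambda>A. \<Lambda> (indicator A)) w = \<Lambda> w"
  by (rule sigma_functional_ext[OF _ \<Lambda> _ assms(2)])
     (rule complex_integral_sigma[OF complex_measure_on_functional[OF \<Lambda>]], assumption?)+

lemma finite_measure_sum:
  assumes "finite_measure P" "finite_measure N" and [simp]: "sets P = sets M" "sets N = sets M"
  obtains \<mu> where "finite_measure \<mu>" "sets \<mu> = sets M"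
    "\<And>A. A \<in> sets M \<Longrightarrow> emeasure \<mu> A = emeasure P A + emeasure N A"
proof
  let ?\<mu> = "measure_of (space M) (sets M) (\<lambda>A. emeasure P A + emeasure N A)"
  show e: "emeasure ?\<mu> A = emeasure P A + emeasure N A" if "A \<in> sets M" for A
  proof (rule emeasure_measure_of_sigma)
    show "countably_additive (sets M) (\<lambda>A. emeasure P A + emeasure N A)"
      unfolding countably_additive_def
    proof (intro allI impI)
      fix A :: "nat \<Rightarrow> 'a set" assume A: "range A \<subseteq> sets M" "disjoint_family A"
      have "(\<Sum>i. emeasure P (A i) + emeasure N (A i)) = (\<Sum>i. emeasure P (A i)) + (\<Sum>i. emeasure N (A i))"
        by (rule suminf_add[symmetric]) (rule summableI)+
      then show "(\<Sum>i. emeasure P (A i) + emeasure N (A i)) = emeasure P (\<Union>i. A i) + emeasure N (\<Union>i. A i)"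
        using A by (simp add: suminf_emeasure)
    qed
  qed (use that in \<open>auto simp: positive_def sets.sigma_algebra_axioms\<close>)
  show "sets ?\<mu> = sets M" by simp
  have "space P = space M" "space N = space M" using sets_eq_imp_space_eq[OF assms(3)] sets_eq_imp_space_eq[OF assms(4)] by auto
  then show "finite_measure ?\<mu>"
    using e[OF sets.top] finite_measure.emeasure_finite[OF assms(1), of "space M"]
      finite_measure.emeasure_finite[OF assms(2), of "space M"]
    by (intro finite_measureI) auto
qed

text \<open>A measure dominated by \<mu> is absolutely continuous, and since P is finite its
  Radon-Nikodym derivative can be taken real valued.\<close>

lemma finite_measure_density:
  assumes "finite_measure \<mu>" "finite_measure P" and sets: "sets P = sets \<mu>"
    and le: "\<And>A. A \<in> sets \<mu> \<Longrightarrow> emeasure P A \<le> emeasure \<mu> A"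
  obtains D :: "'a \<Rightarrow> real" where "integrable \<mu> D"
    "\<And>A. A \<in> sets \<mu> \<Longrightarrow> measure P A = (LINT x|\<mu>. D x * indicator A x)"
proof -
  interpret \<mu>: finite_measure \<mu> by fact
  interpret P: finite_measure P by fact
  have ac: "absolutely_continuous \<mu> P"
    using le sets by (fastforce simp: absolutely_continuous_def null_sets_def)
  obtain D where D: "D \<in> borel_measurable \<mu>" "AE x in \<mu>. RN_deriv \<mu> P x = ennreal (D x)" "\<And>x. 0 \<le> D x"
    using \<mu>.real_RN_deriv[OF assms(2) ac sets] by metis
  have "P = density \<mu> (RN_deriv \<mu> P)"
    using \<mu>.density_RN_deriv[OF ac sets] by simp
  also have "\<dots> = density \<mu> (\<lambda>x. ennreal (D x))"
    using D by (intro density_cong) auto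
  finally have P: "emeasure P A = (\<integral>\<^sup>+x. ennreal (D x) * indicator A x \<partial>\<mu>)" if "A \<in> sets \<mu>" for A
    using D that by (metis emeasure_density measurable_compose measurable_ennreal)
  show ?thesis
  proof
    have "(\<integral>\<^sup>+x. ennreal (D x) \<partial>\<mu>) = emeasure P (space \<mu>)"
      unfolding P[OF sets.top] by (intro nn_integral_cong) auto
    then show "integrable \<mu> D"
      using D P.emeasure_finite[of "space \<mu>"] by (intro integrableI_nonneg) (auto simp: less_top[symmetric])
    show "measure P A = (LINT x|\<mu>. D x * indicator A x)" if A: "A \<in> sets \<mu>" for A
    proof -
      have "(LINT x|\<mu>. D x * indicator A x) = enn2real (\<integral>\<^sup>+x. ennreal (D x * indicator A x) \<partial>\<mu>)"
        using D A by (intro integral_eq_nn_integral) auto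
      also have "(\<integral>\<^sup>+x. ennreal (D x * indicator A x) \<partial>\<mu>) = emeasure P A"
        unfolding P[OF A] by (intro nn_integral_cong) (auto simp: indicator_def)
      finally show ?thesis by (simp add: measure_def)
    qed
  qed
qed

text \<open>The sum of the four variations (positive and negative, of real and imaginary part)
  dominates each of them, so each has a density with respect to it. A complex integral thus becomes
  one Bochner integral against a finite positive measure, to which Fubini's theorem applies.\<close>

lemma complex_measure_density:
  assumes f: "complex_measure_on M f"
  obtains \<mu> g where "finite_measure \<mu>" "sets \<mu> = sets M" "integrable \<mu> g"
    "\<And>w. bounded_measurable M w \<Longrightarrow> complex_integral M f w = (LINT x|\<mu>. g x * w x)"
proof -
  let ?V = "upper_variation M"
  let ?R = "\<lambda>A. Re (f A)" and ?I = "\<lambda>A. Im (f A)"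
  note R = complex_measure_on_Re[OF f] and I = complex_measure_on_Im[OF f]
  note R' = signed_measure_on_uminus[OF R] and I' = signed_measure_on_uminus[OF I]
  note s = sets_upper_variation
  obtain \<mu>1 where 1: "finite_measure \<mu>1" "sets \<mu>1 = sets M"
    "\<And>A. A \<in> sets M \<Longrightarrow> emeasure \<mu>1 A = emeasure (?V ?R) A + emeasure (?V (\<lambda>A. - ?R A)) A"
    by (rule finite_measure_sum[OF finite_upper_variation[OF R] finite_upper_variation[OF R'] s[OF R] s[OF R']]) blast
  obtain \<mu>2 where 2: "finite_measure \<mu>2" "sets \<mu>2 = sets M"
    "\<And>A. A \<in> sets M \<Longrightarrow> emeasure \<mu>2 A = emeasure (?V ?I) A + emeasure (?V (\<lambda>A. - ?I A)) A"
    by (rule finite_measure_sum[OF finite_upper_variation[OF I] finite_upper_variation[OF I'] s[OF I] s[OF I']]) blast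
  obtain \<mu> where 3: "finite_measure \<mu>" "sets \<mu> = sets M"
    "\<And>A. A \<in> sets M \<Longrightarrow> emeasure \<mu> A = emeasure \<mu>1 A + emeasure \<mu>2 A"
    by (rule finite_measure_sum[OF 1(1) 2(1) 1(2) 2(2)]) blast
  have dens: "\<exists>D. integrable \<mu> D \<and> (\<forall>A\<in>sets M. measure (?V r) A = (LINT x|\<mu>. D x * indicator A x))"
    if r: "signed_measure_on M r" and le: "\<And>A. A \<in> sets M \<Longrightarrow> emeasure (?V r) A \<le> emeasure \<mu>1 A + emeasure \<mu>2 A" for r
  proof -
    have *: "sets (?V r) = sets \<mu>" "\<And>A. A \<in> sets \<mu> \<Longrightarrow> emeasure (?V r) A \<le> emeasure \<mu> A"
      using le 3 s[OF r] by auto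
    show ?thesis
      by (rule finite_measure_density[OF 3(1) finite_upper_variation[OF r] *]) (use 3(2) in auto)
  qed
  obtain D1 where D1: "integrable \<mu> D1" "\<And>A. A \<in> sets M \<Longrightarrow> measure (?V ?R) A = (LINT x|\<mu>. D1 x * indicator A x)"
    using dens[OF R] by (auto simp: 1 2 add_increasing add_increasing2)
  obtain D2 where D2: "integrable \<mu> D2" "\<And>A. A \<in> sets M \<Longrightarrow> measure (?V (\<lambda>A. - ?R A)) A = (LINT x|\<mu>. D2 x * indicator A x)"
    using dens[OF R'] by (auto simp: 1 2 add_increasing add_increasing2)
  obtain D3 where D3: "integrable \<mu> D3" "\<And>A. A \<in> sets M \<Longrightarrow> measure (?V ?I) A = (LINT x|\<mu>. D3 x * indicator A x)"
    using dens[OF I] by (auto simp: 1 2 add_increasing add_increasing2)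
  obtain D4 where D4: "integrable \<mu> D4" "\<And>A. A \<in> sets M \<Longrightarrow> measure (?V (\<lambda>A. - ?I A)) A = (LINT x|\<mu>. D4 x * indicator A x)"
    using dens[OF I'] by (auto simp: 1 2 add_increasing add_increasing2)
  define g where "g x = complex_of_real (D1 x - D2 x) + \<i> * complex_of_real (D3 x - D4 x)" for x
  have g: "integrable \<mu> g"
    unfolding g_def using D1 D2 D3 D4
    by (intro Bochner_Integration.integrable_add integrable_mult_right integrable_of_real Bochner_Integration.integrable_diff)
  show ?thesis
  proof
    show "complex_integral M f w = (LINT x|\<mu>. g x * w x)" if w: "bounded_measurable M w" for w
    proof (rule sigma_functional_ext[OF _ _ _ w])
      show "sigma_functional M (\<lambda>w. LINT x|\<mu>. g x * w x)"
        using sigma_functional_integral[OF g, of "\<lambda>x. x" M] 3(2) by (auto simp: measurable_ident_sets)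
      show "sigma_functional M (complex_integral M f)"
        by (rule complex_integral_sigma[OF f])
      fix A assume A: "A \<in> sets M"
      then have [measurable]: "A \<in> sets \<mu>" using 3 by simp
      have iA: "integrable \<mu> (\<lambda>x. D x * indicator A x)" if "integrable \<mu> D" for D :: "'a \<Rightarrow> real"
        using that by (intro integrable_real_mult_indicator) auto
      note i = iA[OF D1(1)] iA[OF D2(1)] iA[OF D3(1)] iA[OF D4(1)]
      have "(LINT x|\<mu>. g x * indicator A x) = (LINT x|\<mu>. complex_of_real (D1 x * indicator A x - D2 x * indicator A x)
          + \<i> * complex_of_real (D3 x * indicator A x - D4 x * indicator A x))"
        by (intro Bochner_Integration.integral_cong) (auto simp: g_def indicator_def)
      also have "\<dots> = (LINT x|\<mu>. complex_of_real (D1 x * indicator A x - D2 x * indicator A x))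
          + (LINT x|\<mu>. \<i> * complex_of_real (D3 x * indicator A x - D4 x * indicator A x))"
        using i by (intro Bochner_Integration.integral_add integrable_mult_right integrable_of_real Bochner_Integration.integrable_diff)
      also have "\<dots> = of_real (measure (?V ?R) A - measure (?V (\<lambda>A. - ?R A)) A)
          + \<i> * of_real (measure (?V ?I) A - measure (?V (\<lambda>A. - ?I A)) A)"
        using i by (simp add: D1(2)[OF A] D2(2)[OF A] D3(2)[OF A] D4(2)[OF A] del: of_real_diff of_real_mult)
      also have "\<dots> = f A"
        using signed_measure_eq_variation[OF R A] signed_measure_eq_variation[OF I A]
        by (simp add: complex_eq_iff)
      finally show "complex_integral M f (indicator A) = (LINT x|\<mu>. g x * indicator A x)"
        using complex_integral_sigma(2)[OF f A] by simp
    qed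
  qed (use 3 g in auto)
qed

section \<open>The Hilbert space of the rectangle\<close>

lemma rect_eq_cbox: "rect S T = cbox (0, 0) (S, T)"
  by (auto simp: rect_def cbox_Pair_iff)

lemma sets_rect[measurable, simp]: "rect S T \<in> sets lebesgue"
  by (simp add: rect_eq_cbox)

locale l2_basis =
  fixes S T :: real and \<phi> :: "nat \<Rightarrow> field2"
  assumes S_pos: "S > 0" and T_pos: "T > 0" and basis: "bv_complete_orthonormal S T \<phi>"
begin

abbreviation Q :: "(real \<times> real) measure" where "Q \<equiv> lebesgue_on (rect S T)"
abbreviation ip :: "field2 \<Rightarrow> field2 \<Rightarrow> real" where "ip \<equiv> inner2 S T"
abbreviation nrm :: "field2 \<Rightarrow> real" where "nrm \<equiv> norm2 S T"

sublocale Q: finite_measure Q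
proof
  show "emeasure Q (space Q) \<noteq> \<infinity>"
    using fmeasurableD2[OF lmeasurable_cbox[of "(0, 0)" "(S, T)"]]
    by (simp add: space_restrict_space emeasure_restrict_space rect_eq_cbox del: emeasure_completion)
qed

lemma \<phi>_L2[simp]: "\<phi> j \<in> L2 S T"
  using basis by (simp add: bv_complete_orthonormal_def)

lemma \<phi>_orthonormal: "ip (\<phi> i) (\<phi> j) = (if i = j then 1 else 0)"
  using basis by (simp add: bv_complete_orthonormal_def)

lemma \<phi>_complete: "v \<in> L2 S T \<Longrightarrow> (\<And>n. ip v (\<phi> n) = 0) \<Longrightarrow> nrm v = 0"
  using basis by (simp add: bv_complete_orthonormal_def)

lemma L2_measurable[measurable_dest]: "u \<in> L2 S T \<Longrightarrow> u \<in> borel_measurable Q"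
  by (simp add: L2_def)

lemma L2_prod_integrable:
  assumes "u \<in> L2 S T" "v \<in> L2 S T"
  shows "integrable Q (\<lambda>p. u p * v p)"
proof (rule Bochner_Integration.integrable_bound)
  show "integrable Q (\<lambda>p. (u p)\<^sup>2 + (v p)\<^sup>2)" using assms by (simp add: L2_def)
  show "(\<lambda>p. u p * v p) \<in> borel_measurable Q"
    using assms by (auto simp: L2_def)
  have "\<bar>a * b\<bar> \<le> \<bar>a\<^sup>2 + b\<^sup>2\<bar>" for a b :: real
    using sum_squares_bound[of "\<bar>a\<bar>" "\<bar>b\<bar>"] mult_nonneg_nonneg[of "\<bar>a\<bar>" "\<bar>b\<bar>"]
    by (simp only: abs_mult power2_abs abs_ge_zero simp_thms)
  then show "AE p in Q. norm (u p * v p) \<le> norm ((u p)\<^sup>2 + (v p)\<^sup>2)" by simp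
qed

lemma L2_add: assumes "u \<in> L2 S T" "v \<in> L2 S T" shows "(\<lambda>p. u p + v p) \<in> L2 S T"
proof -
  have "integrable Q (\<lambda>p. (u p)\<^sup>2 + 2 * (u p * v p) + (v p)\<^sup>2)"
    using assms L2_prod_integrable[OF assms] by (simp add: L2_def)
  then show ?thesis using assms by (auto simp: L2_def power2_sum algebra_simps)
qed

lemma L2_scale: "u \<in> L2 S T \<Longrightarrow> (\<lambda>p. c * u p) \<in> L2 S T"
  by (auto simp: L2_def power_mult_distrib)

lemma L2_0: "(\<lambda>p. 0) \<in> L2 S T" by (simp add: L2_def)

lemma L2_diff: "u \<in> L2 S T \<Longrightarrow> v \<in> L2 S T \<Longrightarrow> (\<lambda>p. u p - v p) \<in> L2 S T"
  using L2_add[of u "\<lambda>p. (-1) * v p"] L2_scale[of v "-1"] by simp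

lemma L2_sum: "(\<And>i. i \<in> I \<Longrightarrow> u i \<in> L2 S T) \<Longrightarrow> (\<lambda>p. \<Sum>i\<in>I. u i p) \<in> L2 S T"
  by (induction I rule: infinite_finite_induct) (auto intro: L2_add L2_0)

lemma L2_mult_bounded:
  assumes u: "u \<in> L2 S T" and h: "h \<in> borel_measurable Q" and B: "\<And>p. p \<in> rect S T \<Longrightarrow> \<bar>h p\<bar> \<le> B"
  shows "(\<lambda>p. u p * h p) \<in> L2 S T"
proof -
  have [measurable]: "u \<in> borel_measurable Q" "h \<in> borel_measurable Q" using u h by (auto simp: L2_def)
  have "integrable Q (\<lambda>p. (u p * h p)\<^sup>2)"
  proof (rule Bochner_Integration.integrable_bound)
    show "integrable Q (\<lambda>p. B\<^sup>2 * (u p)\<^sup>2)" using u by (simp add: L2_def)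
    show "AE p in Q. norm ((u p * h p)\<^sup>2) \<le> norm (B\<^sup>2 * (u p)\<^sup>2)"
    proof (intro AE_I2)
      fix p assume "p \<in> space Q"
      then have "\<bar>h p\<bar> \<le> B" using B by (simp add: space_restrict_space)
      then have "(h p)\<^sup>2 \<le> B\<^sup>2" by (metis abs_ge_zero order_trans power2_abs power_mono)
      then show "norm ((u p * h p)\<^sup>2) \<le> norm (B\<^sup>2 * (u p)\<^sup>2)"
        unfolding power_mult_distrib by (simp add: abs_mult) (metis mult.commute mult_right_mono zero_le_power2)
    qed
  qed simp
  then show ?thesis by (simp add: L2_def)
qed

lemma L2_const: "(\<lambda>p. c) \<in> L2 S T"
  by (simp add: L2_def)

lemma ip_commute: "ip u v = ip v u"
  by (simp add: inner2_def mult.commute)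

lemma ip_add: "u \<in> L2 S T \<Longrightarrow> v \<in> L2 S T \<Longrightarrow> w \<in> L2 S T \<Longrightarrow> ip (\<lambda>p. u p + v p) w = ip u w + ip v w"
  using L2_prod_integrable by (simp add: inner2_def distrib_right)

lemma ip_scale: "ip (\<lambda>p. c * u p) w = c * ip u w"
  by (simp add: inner2_def mult.assoc)

lemma ip_scale_scale: "ip (\<lambda>p. c * u p) (\<lambda>p. c * u p) = ip u u * c\<^sup>2"
  by (simp only: ip_scale ip_commute[of u "\<lambda>p. c * u p"] power2_eq_square mult_ac)

lemma ip_diff: "u \<in> L2 S T \<Longrightarrow> v \<in> L2 S T \<Longrightarrow> w \<in> L2 S T \<Longrightarrow> ip (\<lambda>p. u p - v p) w = ip u w - ip v w"
  using L2_prod_integrable by (simp add: inner2_def left_diff_distrib)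

lemma ip_add_right: "u \<in> L2 S T \<Longrightarrow> v \<in> L2 S T \<Longrightarrow> w \<in> L2 S T \<Longrightarrow> ip w (\<lambda>p. u p + v p) = ip w u + ip w v"
  by (simp add: ip_commute[of w] ip_add)

lemma ip_diff_right: "u \<in> L2 S T \<Longrightarrow> v \<in> L2 S T \<Longrightarrow> w \<in> L2 S T \<Longrightarrow> ip w (\<lambda>p. u p - v p) = ip w u - ip w v"
  by (simp add: ip_commute[of w] ip_diff)

lemma ip_sum:
  "(\<And>i. i \<in> I \<Longrightarrow> u i \<in> L2 S T) \<Longrightarrow> w \<in> L2 S T \<Longrightarrow> ip (\<lambda>p. \<Sum>i\<in>I. u i p) w = (\<Sum>i\<in>I. ip (u i) w)"
proof (induction I rule: infinite_finite_induct)
  case (insert i I)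
  then show ?case by (simp add: ip_add L2_sum)
qed (simp_all add: inner2_def)

lemma ip_nonneg: "ip u u \<ge> 0"
  by (simp add: inner2_def)

lemma nrm_power2: "(nrm u)\<^sup>2 = ip u u"
  by (simp add: norm2_def ip_nonneg)

lemma nrm_nonneg[simp]: "nrm u \<ge> 0"
  by (simp add: norm2_def ip_nonneg)

lemma ip_diff_diff:
  assumes "u \<in> L2 S T" "v \<in> L2 S T"
  shows "(nrm (\<lambda>p. u p - v p))\<^sup>2 = (nrm u)\<^sup>2 - 2 * ip u v + (nrm v)\<^sup>2"
  using assms by (simp add: nrm_power2 ip_diff ip_diff_right L2_diff ip_commute[of v u])

lemma ip_sum_sum:
  assumes "u \<in> L2 S T" "v \<in> L2 S T"
  shows "(nrm (\<lambda>p. u p + v p))\<^sup>2 = (nrm u)\<^sup>2 + 2 * ip u v + (nrm v)\<^sup>2"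
  using assms by (simp add: nrm_power2 ip_add ip_add_right L2_add ip_commute[of v u])

lemma ip_Cauchy_Schwarz:
  assumes u: "u \<in> L2 S T" and v: "v \<in> L2 S T"
  shows "\<bar>ip u v\<bar> \<le> nrm u * nrm v"
proof -
  have *: "0 \<le> ip u u * t\<^sup>2 - 2 * t * ip u v + ip v v" for t
  proof -
    have "0 \<le> (nrm (\<lambda>p. t * u p - v p))\<^sup>2" by simp
    also have "\<dots> = ip u u * t\<^sup>2 - 2 * t * ip u v + ip v v"
      using ip_diff_diff[OF L2_scale[OF u, of t] v]
      by (simp add: nrm_power2 ip_scale_scale) (simp add: ip_scale)
    finally show ?thesis .
  qed
  have "(ip u v)\<^sup>2 \<le> ip u u * ip v v"
  proof (cases "ip u u = 0")
    case True
    have "ip u v = 0"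
    proof (rule ccontr)
      assume "ip u v \<noteq> 0"
      \<comment> \<open>At this t the right side of \<open>*\<close> takes the value -1.\<close>
      then show False using *[of "(ip v v + 1) / (2 * ip u v)"] True by simp
    qed
    then show ?thesis using True by simp
  next
    case False
    then have "ip u u > 0" using ip_nonneg[of u] by simp
    \<comment> \<open>The minimum of the quadratic polynomial in t.\<close>
    moreover have "0 \<le> ip v v - (ip u v)\<^sup>2 / ip u u"
      using *[of "ip u v / ip u u"] False by (simp add: power2_eq_square)
    ultimately show ?thesis by (simp add: pos_divide_le_eq mult.commute)
  qed
  then have "(ip u v)\<^sup>2 \<le> (nrm u * nrm v)\<^sup>2" by (simp add: power_mult_distrib nrm_power2)
  then show ?thesis by (simp add: abs_le_square_iff[symmetric] abs_mult)
qed

lemma nrm_triangle: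
  assumes u: "u \<in> L2 S T" and v: "v \<in> L2 S T"
  shows "nrm (\<lambda>p. u p + v p) \<le> nrm u + nrm v"
proof -
  have "(nrm (\<lambda>p. u p + v p))\<^sup>2 \<le> (nrm u + nrm v)\<^sup>2"
    using ip_Cauchy_Schwarz[OF assms] by (simp add: ip_sum_sum[OF assms] power2_sum)
  then show ?thesis by (simp add: abs_le_square_iff[symmetric])
qed

lemma nrm_triangle_diff:
  assumes "u \<in> L2 S T" "v \<in> L2 S T" "w \<in> L2 S T"
  shows "nrm (\<lambda>p. u p - w p) \<le> nrm (\<lambda>p. u p - v p) + nrm (\<lambda>p. v p - w p)"
  using nrm_triangle[OF L2_diff[OF assms(1,2)] L2_diff[OF assms(2,3)]] by simp

lemma nrm_minus_commute: "nrm (\<lambda>p. u p - v p) = nrm (\<lambda>p. v p - u p)"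
  by (simp add: norm2_def inner2_def algebra_simps)

definition coef :: "field2 \<Rightarrow> nat \<Rightarrow> real" where "coef u j = ip u (\<phi> j)"

definition comb :: "(nat \<Rightarrow> real) \<Rightarrow> nat set \<Rightarrow> field2" where
  "comb c J = (\<lambda>p. \<Sum>j\<in>J. c j * \<phi> j p)"

lemma comb_L2[simp]: "comb c J \<in> L2 S T"
  unfolding comb_def by (intro L2_sum L2_scale) simp

lemma coef_comb: "finite J \<Longrightarrow> coef (comb c J) i = (if i \<in> J then c i else 0)"
  unfolding coef_def comb_def
  by (subst ip_sum) (auto simp: ip_scale \<phi>_orthonormal L2_scale if_distrib cong: if_cong)

lemma ip_comb: "u \<in> L2 S T \<Longrightarrow> ip u (comb c J) = (\<Sum>j\<in>J. c j * coef u j)"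
  unfolding coef_def comb_def ip_commute[of u]
  by (subst ip_sum) (auto simp: ip_scale L2_scale)

lemma nrm_comb: "finite J \<Longrightarrow> (nrm (comb c J))\<^sup>2 = (\<Sum>j\<in>J. (c j)\<^sup>2)"
  by (simp add: nrm_power2 ip_comb coef_comb flip: power2_eq_square)

lemma coef_diff: "u \<in> L2 S T \<Longrightarrow> v \<in> L2 S T \<Longrightarrow> coef (\<lambda>p. u p - v p) j = coef u j - coef v j"
  by (simp add: coef_def ip_diff)

lemma coef_add: "u \<in> L2 S T \<Longrightarrow> v \<in> L2 S T \<Longrightarrow> coef (\<lambda>p. u p + v p) j = coef u j + coef v j"
  by (simp add: coef_def ip_add)

lemma coef_scale: "coef (\<lambda>p. c * u p) j = c * coef u j"
  by (simp add: coef_def ip_scale)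

lemma nrm_projection:
  assumes "u \<in> L2 S T" "finite J"
  shows "(nrm (\<lambda>p. u p - comb (coef u) J p))\<^sup>2 = (nrm u)\<^sup>2 - (\<Sum>j\<in>J. (coef u j)\<^sup>2)"
  using assms by (simp add: ip_diff_diff nrm_comb ip_comb flip: power2_eq_square)

lemma summable_coef: assumes "u \<in> L2 S T" shows "summable (\<lambda>j. (coef u j)\<^sup>2)"
proof (rule summableI_nonneg_bounded)
  show "(\<Sum>j<n. (coef u j)\<^sup>2) \<le> (nrm u)\<^sup>2" for n
    using nrm_projection[OF assms, of "{..<n}"] zero_le_power2[of "nrm (\<lambda>p. u p - comb (coef u) {..<n} p)"]
    by simp
qed simp

end

section \<open>Parseval's identity\<close>

context l2_basis begin

lemma nrm_abs: "nrm (\<lambda>p. \<bar>g p\<bar>) = nrm g"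
  by (simp add: norm2_def inner2_def)

lemma L2_abs: "g \<in> L2 S T \<Longrightarrow> (\<lambda>p. \<bar>g p\<bar>) \<in> L2 S T"
  by (auto simp: L2_def)

lemma comb_diff: "m \<le> n \<Longrightarrow> comb c {..<n} p - comb c {..<m} p = comb c {m..<n} p"
  unfolding comb_def by (simp add: sum_diff_nat_ivl lessThan_atLeast0)

text \<open>Cauchy-Schwarz against the constant 1, which is square integrable because Q has finite
  measure. It turns mean square estimates into summable L_1 estimates, hence into convergence almost
  everywhere.\<close>

lemma L1_le_nrm:
  assumes g: "g \<in> L2 S T"
  shows "(\<integral>\<^sup>+p. ennreal \<bar>g p\<bar> \<partial>Q) \<le> ennreal (nrm g * nrm (\<lambda>_. 1))"
proof -
  have int: "integrable Q (\<lambda>p. \<bar>g p\<bar>)"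
    using L2_prod_integrable[OF L2_abs[OF g] L2_const[of 1]] by simp
  have "(\<integral>\<^sup>+p. ennreal \<bar>g p\<bar> \<partial>Q) = ennreal (LINT p|Q. \<bar>g p\<bar>)"
    by (rule nn_integral_eq_integral[OF int]) simp
  also have "(LINT p|Q. \<bar>g p\<bar>) = ip (\<lambda>p. \<bar>g p\<bar>) (\<lambda>_. 1)" by (simp add: inner2_def)
  also have "\<dots> \<le> nrm g * nrm (\<lambda>_. 1)"
    using ip_Cauchy_Schwarz[OF L2_abs[OF g] L2_const[of 1]] by (simp add: nrm_abs)
  finally show ?thesis by (simp add: ennreal_leI)
qed

lemma nn_integral_nrm:
  assumes g: "g \<in> L2 S T"
  shows "(\<integral>\<^sup>+p. ennreal ((g p)\<^sup>2) \<partial>Q) = ennreal ((nrm g)\<^sup>2)"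
proof -
  have "integrable Q (\<lambda>p. (g p)\<^sup>2)" using g by (simp add: L2_def)
  then show ?thesis
    by (simp add: nn_integral_eq_integral nrm_power2 inner2_def flip: power2_eq_square)
qed

lemma L2_nn_integral:
  assumes g: "g \<in> borel_measurable Q" and le: "(\<integral>\<^sup>+p. ennreal ((g p)\<^sup>2) \<partial>Q) \<le> ennreal (b\<^sup>2)" and "b \<ge> 0"
  shows "g \<in> L2 S T" "nrm g \<le> b"
proof -
  have "(\<integral>\<^sup>+p. ennreal ((g p)\<^sup>2) \<partial>Q) < \<infinity>" using le by (rule le_less_trans) simp
  then have "integrable Q (\<lambda>p. (g p)\<^sup>2)"
    using g by (intro integrableI_nonneg) auto
  then show L2: "g \<in> L2 S T" using g by (simp add: L2_def)
  have "(nrm g)\<^sup>2 \<le> b\<^sup>2" using le by (simp add: nn_integral_nrm[OF L2])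
  then show "nrm g \<le> b" using \<open>b \<ge> 0\<close> by (rule power2_le_imp_le)
qed

text \<open>Completeness of the basis only says that a vector orthogonal to every
  \<open>\<phi> n\<close> has norm 0, so a limit w of the partial sums must first be produced: a
  fast subsequence converges almost everywhere, and by Fatou's lemma also in mean square. Then u - w
  is orthogonal to the basis, so u is the limit of its own partial sums.\<close>

lemma parseval:
  assumes u: "u \<in> L2 S T"
  shows "(\<lambda>j. (coef u j)\<^sup>2) sums (nrm u)\<^sup>2"
proof -
  define s where "s n = (\<Sum>j<n. (coef u j)\<^sup>2)" for n
  have conv: "s \<longlonglongrightarrow> (\<Sum>j. (coef u j)\<^sup>2)"
    unfolding s_def using summable_coef[OF u] by (rule summable_LIMSEQ)
  \<comment> \<open>Keeping the sums of squared coefficients within (1/4)^k makes the terms of the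
    subsequence differ by at most (1/2)^k in norm, which is summable.\<close>
  have "\<exists>M. \<forall>m\<ge>M. \<forall>n\<ge>M. norm (s m - s n) < (1/4)^k" for k
    using LIMSEQ_imp_Cauchy[OF conv] by (intro CauchyD) auto
  then obtain M where M: "\<And>k m n. m \<ge> M k \<Longrightarrow> n \<ge> M k \<Longrightarrow> norm (s m - s n) < (1/4)^k"
    by metis
  \<comment> \<open>Adding up the thresholds, each raised by 1, makes the index sequence strictly
    increasing while it stays above \<open>M k\<close>.\<close>
  define N where "N k = (\<Sum>i\<le>k. M i + 1)" for k
  have N_M: "M k \<le> N k" for k
    unfolding N_def using member_le_sum[of k "{..k}" "\<lambda>i. M i + 1"] by simp
  have "strict_mono N"
    by (auto simp: strict_mono_Suc_iff N_def)
  then have N_mono: "k \<le> l \<Longrightarrow> N k \<le> N l" and N_ge: "k \<le> N k" for k l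
    by (auto simp: strict_mono_less_eq intro: strict_mono_imp_increasing)
  define f where "f k = comb (coef u) {..<N k}" for k
  have f_L2[simp]: "f k \<in> L2 S T" for k by (simp add: f_def)
  have [measurable]: "f k \<in> borel_measurable Q" for k using f_L2[of k] by (simp only: L2_def mem_Collect_eq)
  have f_diff: "nrm (\<lambda>p. f l p - f k p) \<le> (1/2)^k" if "k \<le> l" for k l
  proof -
    have "(nrm (\<lambda>p. f l p - f k p))\<^sup>2 = (\<Sum>j\<in>{N k..<N l}. (coef u j)\<^sup>2)"
      by (simp add: f_def comb_diff[OF N_mono[OF that]] nrm_comb)
    also have "\<dots> = s (N l) - s (N k)"
      using sum_diff_nat_ivl[of 0 "N k" "N l" "\<lambda>j. (coef u j)\<^sup>2"] N_mono[OF that]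
      by (simp add: s_def lessThan_atLeast0)
    also have "\<dots> \<le> norm (s (N l) - s (N k))" by simp
    also have "\<dots> \<le> (1/4)^k"
      using M[of k "N l" "N k"] N_M[of k] N_mono[OF that] by fastforce
    also have "\<dots> = ((1/2)^k)\<^sup>2" by (simp add: power_mult[symmetric] mult.commute power_mult power2_eq_square flip: power_mult_distrib)
    finally show ?thesis by (rule power2_le_imp_le) simp
  qed
  define C where "C = nrm (\<lambda>_. 1)"
  have "(\<integral>\<^sup>+p. (\<Sum>k. ennreal \<bar>f (Suc k) p - f k p\<bar>) \<partial>Q) = (\<Sum>k. \<integral>\<^sup>+p. ennreal \<bar>f (Suc k) p - f k p\<bar> \<partial>Q)"
    by (intro nn_integral_suminf) measurable
  also have "\<dots> \<le> (\<Sum>k. ennreal ((1/2)^k * C))"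
  proof (intro suminf_le summableI)
    fix k
    have "(\<integral>\<^sup>+p. ennreal \<bar>f (Suc k) p - f k p\<bar> \<partial>Q) \<le> ennreal (nrm (\<lambda>p. f (Suc k) p - f k p) * C)"
      unfolding C_def by (intro L1_le_nrm L2_diff) auto
    also have "\<dots> \<le> ennreal ((1/2)^k * C)"
      using f_diff[of k "Suc k"] by (intro ennreal_leI mult_right_mono) (auto simp: C_def)
    finally show "(\<integral>\<^sup>+p. ennreal \<bar>f (Suc k) p - f k p\<bar> \<partial>Q) \<le> ennreal ((1/2)^k * C)" .
  qed
  also have "\<dots> = ennreal (\<Sum>k. (1/2)^k * C)"
    by (intro suminf_ennreal2 summable_mult2 summable_geometric) (auto simp: C_def)
  also have "\<dots> < \<infinity>" by simp
  finally have fin: "(\<integral>\<^sup>+p. (\<Sum>k. ennreal \<bar>f (Suc k) p - f k p\<bar>) \<partial>Q) \<noteq> \<infinity>" by simp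
  have "AE p in Q. (\<Sum>k. ennreal \<bar>f (Suc k) p - f k p\<bar>) \<noteq> \<infinity>"
    by (rule nn_integral_noteq_infinite[OF _ fin]) measurable
  then have lim: "AE p in Q. convergent (\<lambda>k. f k p)"
  proof eventually_elim
    case (elim p)
    then have "summable (\<lambda>k. \<bar>f (Suc k) p - f k p\<bar>)"
      by (intro summable_suminf_not_top) auto
    then have "summable (\<lambda>k. f (Suc k) p - f k p)" by (rule summable_rabs_cancel)
    then have "convergent (\<lambda>n. \<Sum>k<n. f (Suc k) p - f k p)" by (simp add: summable_iff_convergent)
    then have "convergent (\<lambda>n. f n p - f 0 p)" by (simp only: sum_lessThan_telescope[of "\<lambda>n. f n p"])
    then have "convergent (\<lambda>n. (f n p - f 0 p) + f 0 p)" by (intro convergent_add convergent_const)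
    then show ?case by simp
  qed
  define w where "w p = lim (\<lambda>k. f k p)" for p
  have w[measurable]: "w \<in> borel_measurable Q"
    unfolding w_def[abs_def] by (intro borel_measurable_lim_metric) measurable
  \<comment> \<open>Fatou's lemma in l transfers the bound for \<open>f l - f k\<close> to
    \<open>w - f k\<close>.\<close>
  have fatou: "(\<integral>\<^sup>+p. ennreal ((w p - f k p)\<^sup>2) \<partial>Q) \<le> ennreal (((1/2)^k)\<^sup>2)" for k
  proof -
    have "(\<integral>\<^sup>+p. ennreal ((w p - f k p)\<^sup>2) \<partial>Q) = (\<integral>\<^sup>+p. liminf (\<lambda>l. ennreal ((f l p - f k p)\<^sup>2)) \<partial>Q)"
    proof (intro nn_integral_cong_AE)
      show "AE p in Q. ennreal ((w p - f k p)\<^sup>2) = liminf (\<lambda>l. ennreal ((f l p - f k p)\<^sup>2))"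
        using lim
      proof eventually_elim
        case (elim p)
        then have "(\<lambda>l. f l p) \<longlonglongrightarrow> w p" by (simp add: w_def convergent_LIMSEQ_iff)
        then have "(\<lambda>l. ennreal ((f l p - f k p)\<^sup>2)) \<longlonglongrightarrow> ennreal ((w p - f k p)\<^sup>2)"
          by (intro tendsto_ennrealI tendsto_intros)
        then show ?case by (intro lim_imp_Liminf[symmetric]) auto
      qed
    qed
    also have "\<dots> \<le> liminf (\<lambda>l. \<integral>\<^sup>+p. ennreal ((f l p - f k p)\<^sup>2) \<partial>Q)"
      by (intro nn_integral_liminf) measurable
    also have "\<dots> \<le> liminf (\<lambda>l. ennreal (((1/2)^k)\<^sup>2))"
    proof (intro Liminf_mono)
      show "\<forall>\<^sub>F l in sequentially. (\<integral>\<^sup>+p. ennreal ((f l p - f k p)\<^sup>2) \<partial>Q) \<le> ennreal (((1/2)^k)\<^sup>2)"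
        using eventually_ge_at_top[of k]
      proof eventually_elim
        case (elim l)
        show ?case
          unfolding nn_integral_nrm[OF L2_diff[OF f_L2 f_L2]]
          by (intro ennreal_leI power_mono f_diff elim) simp
      qed
    qed
    also have "\<dots> = ennreal (((1/2)^k)\<^sup>2)" by (simp add: Liminf_const)
    finally show ?thesis .
  qed
  have wf: "(\<lambda>p. w p - f k p) \<in> L2 S T" "nrm (\<lambda>p. w p - f k p) \<le> (1/2)^k" for k
    using L2_nn_integral[OF _ fatou[of k]] by auto
  have w_L2: "w \<in> L2 S T" using L2_add[OF wf(1)[of 0] f_L2[of 0]] by simp
  have half: "(\<lambda>k. (1/2::real)^k) \<longlonglongrightarrow> 0" by (intro LIMSEQ_power_zero) simp
  \<comment> \<open>For k > j the partial sum \<open>f k\<close> already has the j-th coefficient of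
    u, and the remainder \<open>w - f k\<close> contributes at most (1/2)^k.\<close>
  have "coef w j = coef u j" for j
  proof -
    have "\<bar>coef w j - coef u j\<bar> \<le> (1/2)^k" if "k \<ge> Suc j" for k
    proof -
      have "coef (f k) j = coef u j"
        using N_ge[of k] that by (simp add: f_def coef_comb)
      then have "coef w j - coef u j = ip (\<lambda>p. w p - f k p) (\<phi> j)"
        using w_L2 by (simp add: coef_def ip_diff)
      also have "\<bar>\<dots>\<bar> \<le> nrm (\<lambda>p. w p - f k p) * nrm (\<phi> j)"
        by (intro ip_Cauchy_Schwarz wf \<phi>_L2)
      also have "nrm (\<phi> j) = 1" by (simp add: norm2_def \<phi>_orthonormal)
      finally show ?thesis using wf(2)[of k] by simp
    qed
    then have "\<bar>coef w j - coef u j\<bar> \<le> 0"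
      by (intro LIMSEQ_le_const[OF half]) auto
    then show ?thesis by simp
  qed
  then have "nrm (\<lambda>p. u p - w p) = 0"
    using u w_L2 coef_diff[OF u w_L2] by (intro \<phi>_complete L2_diff) (auto simp: coef_def)
  then have uf: "nrm (\<lambda>p. u p - f k p) \<le> (1/2)^k" for k
    using nrm_triangle_diff[OF u w_L2 f_L2[of k]] wf(2)[of k] by simp
  have "(\<lambda>k. nrm (\<lambda>p. u p - f k p)) \<longlonglongrightarrow> 0"
    by (rule tendsto_sandwich[OF _ _ tendsto_const half]) (use uf in auto)
  then have "(\<lambda>k. (nrm (\<lambda>p. u p - f k p))\<^sup>2) \<longlonglongrightarrow> 0\<^sup>2" by (intro tendsto_power)
  then have "(\<lambda>k. (nrm u)\<^sup>2 - s (N k)) \<longlonglongrightarrow> 0"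
    by (simp add: f_def nrm_projection[OF u] s_def)
  moreover have "(\<lambda>k. (nrm u)\<^sup>2 - s (N k)) \<longlonglongrightarrow> (nrm u)\<^sup>2 - (\<Sum>j. (coef u j)\<^sup>2)"
    using LIMSEQ_subseq_LIMSEQ[OF conv \<open>strict_mono N\<close>] by (intro tendsto_intros) (simp add: o_def)
  ultimately have "(nrm u)\<^sup>2 = (\<Sum>j. (coef u j)\<^sup>2)"
    using LIMSEQ_unique by fastforce
  then show ?thesis using summable_sums[OF summable_coef[OF u]] by simp
qed

lemma nrm_diff_sums:
  "u \<in> L2 S T \<Longrightarrow> v \<in> L2 S T \<Longrightarrow> (\<lambda>j. (coef u j - coef v j)\<^sup>2) sums (nrm (\<lambda>p. u p - v p))\<^sup>2"
  using parseval[OF L2_diff, of u v] by (simp add: coef_diff)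

section \<open>Separability and the Borel sets of L_2(Q)\<close>

definition ball2 :: "field2 \<Rightarrow> real \<Rightarrow> field2 set" where
  "ball2 w r = {u \<in> L2 S T. nrm (\<lambda>p. u p - w p) < r}"

text \<open>Indexing by lists of rationals makes countability immediate.\<close>

definition dense_combs :: "field2 set" where
  "dense_combs = range (\<lambda>qs::rat list. comb (\<lambda>j. of_rat (qs ! j)) {..<length qs})"

lemma countable_dense_combs: "countable dense_combs"
  unfolding dense_combs_def by simp

lemma dense_combs_L2: "w \<in> dense_combs \<Longrightarrow> w \<in> L2 S T"
  unfolding dense_combs_def by auto

lemma dense_combs_approx:
  assumes u: "u \<in> L2 S T" and e: "e > 0"
  shows "\<exists>w\<in>dense_combs. nrm (\<lambda>p. u p - w p) < e"
proof -
  have "(\<lambda>n. (nrm u)\<^sup>2 - (\<Sum>j<n. (coef u j)\<^sup>2)) \<longlonglongrightarrow> (nrm u)\<^sup>2 - (nrm u)\<^sup>2"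
    using parseval[OF u] unfolding sums_def by (intro tendsto_intros)
  moreover have "(e/2)\<^sup>2 > 0" using e by simp
  ultimately obtain n where "(nrm u)\<^sup>2 - (\<Sum>j<n. (coef u j)\<^sup>2) < (e/2)\<^sup>2"
    using order_tendstoD(2)[of _ "0::real" sequentially "(e/2)\<^sup>2"]
    by (metis (mono_tags, lifting) diff_self eventually_sequentially order_refl)
  then have "(nrm (\<lambda>p. u p - comb (coef u) {..<n} p))\<^sup>2 < (e/2)\<^sup>2"
    by (simp add: nrm_projection[OF u])
  then have 1: "nrm (\<lambda>p. u p - comb (coef u) {..<n} p) < e/2"
    using e by (intro power2_less_imp_less[of _ "e/2"]) auto
  \<comment> \<open>An error below d in each of n coefficients gives a squared distance of at most n
    d^2, which is at most ((n + 1) d)^2 = (e/2)^2. The + 1 also covers n = 0.\<close>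
  define d where "d = e / 2 / (real n + 1)"
  have d: "d > 0" using e by (simp add: d_def)
  have "\<exists>q. \<bar>coef u j - of_rat q\<bar> < d" for j
    using of_rat_dense[of "coef u j - d" "coef u j + d"] d by (auto simp: abs_less_iff) (metis add.commute less_diff_eq minus_diff_eq diff_less_eq)
  then obtain q where q: "\<And>j. \<bar>coef u j - of_rat (q j)\<bar> < d" by metis
  define w where "w = comb (\<lambda>j. of_rat (map q [0..<n] ! j)) {..<n}"
  have "w \<in> dense_combs"
    unfolding dense_combs_def w_def by (rule range_eqI[of _ _ "map q [0..<n]"]) simp
  have w_eq: "w = comb (\<lambda>j. of_rat (q j)) {..<n}"
    unfolding w_def comb_def by (intro ext sum.cong) auto
  have "(\<lambda>p. comb (coef u) {..<n} p - w p) = comb (\<lambda>j. coef u j - of_rat (q j)) {..<n}"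
    by (simp add: w_eq comb_def sum_subtractf left_diff_distrib)
  then have "(nrm (\<lambda>p. comb (coef u) {..<n} p - w p))\<^sup>2 = (\<Sum>j<n. (coef u j - of_rat (q j))\<^sup>2)"
    by (simp add: nrm_comb)
  also have "\<dots> \<le> (\<Sum>j<n. d\<^sup>2)"
    using q d by (intro sum_mono) (metis abs_ge_zero less_imp_le power2_abs power_mono)
  also have "\<dots> \<le> ((real n + 1) * d)\<^sup>2"
  proof -
    have "real n \<le> (real n + 1)\<^sup>2" by (simp add: power2_eq_square algebra_simps)
    then show ?thesis unfolding power_mult_distrib by (simp add: mult_right_mono)
  qed
  also have "(real n + 1) * d = e/2" by (subst mult.commute, rule iffD1[OF nonzero_eq_divide_eq d_def]) linarith
  finally have 2: "nrm (\<lambda>p. comb (coef u) {..<n} p - w p) \<le> e/2"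
    using e by (auto intro: power2_le_imp_le[of _ "e/2"])
  have "nrm (\<lambda>p. u p - w p) < e"
    using nrm_triangle_diff[OF u comb_L2 dense_combs_L2[OF \<open>w \<in> dense_combs\<close>], of "coef u" "{..<n}"] 1 2 by linarith
  then show ?thesis using \<open>w \<in> dense_combs\<close> by blast
qed

text \<open>This is separability in the form that reduces measurability questions about Borel sets
  to balls.\<close>

lemma open_L2_countable_balls:
  assumes U: "open_L2 S T U"
  shows "\<exists>C. countable C \<and> C \<subseteq> dense_combs \<times> UNIV \<and> U = (\<Union>(w,r)\<in>C. ball2 w r)"
proof -
  define C where "C = {(w, r). w \<in> dense_combs \<and> r \<in> \<rat> \<and> ball2 w r \<subseteq> U}"
  have "C \<subseteq> dense_combs \<times> \<rat>" by (auto simp: C_def)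
  then have "countable C"
    by (rule countable_subset) (intro countable_SIGMA countable_dense_combs countable_rat)
  moreover have "u \<in> (\<Union>(w,r)\<in>C. ball2 w r)" if uU: "u \<in> U" for u
  proof -
    have u: "u \<in> L2 S T" using U uU by (auto simp: open_L2_def)
    obtain e where e: "e > 0" "\<And>v. v \<in> L2 S T \<Longrightarrow> nrm (\<lambda>p. v p - u p) < e \<Longrightarrow> v \<in> U"
      using U[unfolded open_L2_def, THEN conjunct2, THEN bspec, OF uU] by blast
    \<comment> \<open>If r < e/2, a ball of radius r containing u has all its points within 2 r < e
      of u, so it stays inside U.\<close>
    obtain r where r: "r \<in> \<rat>" "0 < r" "r < e/2"
      using Rats_dense_in_real[of 0 "e/2"] e by auto
    obtain w where w: "w \<in> dense_combs" "nrm (\<lambda>p. u p - w p) < r"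
      using dense_combs_approx[OF u r(2)] by auto
    have "v \<in> U" if "v \<in> ball2 w r" for v
    proof -
      have v: "v \<in> L2 S T" "nrm (\<lambda>p. v p - w p) < r" using that by (auto simp: ball2_def)
      have "nrm (\<lambda>p. v p - u p) < e"
        using nrm_triangle_diff[OF v(1) dense_combs_L2[OF w(1)] u] v(2) w(2) r(3)
        by (simp add: nrm_minus_commute[of u w])
      then show ?thesis using e v by blast
    qed
    then have "(w, r) \<in> C" using w r by (auto simp: C_def)
    moreover have "u \<in> ball2 w r" using u w by (simp add: ball2_def)
    ultimately show ?thesis by auto
  qed
  ultimately show ?thesis
    by (intro exI[of _ C]) (auto simp: C_def)
qed

lemma open_L2_space: "open_L2 S T U \<Longrightarrow> U \<subseteq> L2 S T"
  by (simp add: open_L2_def)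

lemma space_borel_L2[simp]: "space (borel_L2 S T) = L2 S T"
  by (simp add: borel_L2_def space_measure_of_conv)

lemma sets_borel_L2: "sets (borel_L2 S T) = sigma_sets (L2 S T) {U. open_L2 S T U}"
  unfolding borel_L2_def by (intro sets_measure_of) (auto dest: open_L2_space)

lemma open_L2_sets: "open_L2 S T U \<Longrightarrow> U \<in> sets (borel_L2 S T)"
  by (auto simp: sets_borel_L2)

lemma measurable_ip[measurable]:
  assumes v: "v \<in> L2 S T"
  shows "(\<lambda>u. ip u v) \<in> borel_measurable (borel_L2 S T)"
proof (rule borel_measurableI)
  fix A :: "real set" assume A: "open A"
  have "open_L2 S T {u \<in> L2 S T. ip u v \<in> A}"
    unfolding open_L2_def
  proof (intro conjI ballI)
    fix u assume "u \<in> {u \<in> L2 S T. ip u v \<in> A}"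
    then have u: "u \<in> L2 S T" "ip u v \<in> A" by auto
    obtain d where d: "d > 0" "\<And>y. dist y (ip u v) < d \<Longrightarrow> y \<in> A"
      using A u(2) unfolding open_dist by metis
    \<comment> \<open>The + 1 avoids a division by 0 when v has norm 0.\<close>
    have pos: "nrm v + 1 > 0" using nrm_nonneg[of v] by linarith
    show "\<exists>e>0. \<forall>x\<in>L2 S T. nrm (\<lambda>p. x p - u p) < e \<longrightarrow> x \<in> {u \<in> L2 S T. ip u v \<in> A}"
    proof (intro exI[of _ "d / (nrm v + 1)"] conjI ballI impI)
      show "d / (nrm v + 1) > 0" using d pos by simp
      fix x assume x: "x \<in> L2 S T" "nrm (\<lambda>p. x p - u p) < d / (nrm v + 1)"
      have "\<bar>ip x v - ip u v\<bar> \<le> nrm (\<lambda>p. x p - u p) * nrm v"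
        using ip_Cauchy_Schwarz[OF L2_diff[OF x(1) u(1)] v] x u v by (simp add: ip_diff)
      also have "\<dots> \<le> nrm (\<lambda>p. x p - u p) * (nrm v + 1)" by (intro mult_left_mono) auto
      also have "\<dots> < d" using x(2) pos by (simp add: less_divide_eq)
      finally have "ip x v \<in> A" by (intro d) (simp add: dist_real_def)
      then show "x \<in> {u \<in> L2 S T. ip u v \<in> A}" using x by simp
    qed
  qed auto
  moreover have "(\<lambda>u. ip u v) -` A \<inter> space (borel_L2 S T) = {u \<in> L2 S T. ip u v \<in> A}" by auto
  ultimately show "(\<lambda>u. ip u v) -` A \<inter> space (borel_L2 S T) \<in> sets (borel_L2 S T)"
    by (simp add: open_L2_sets)
qed

lemma measurable_coef[measurable]: "(\<lambda>u. coef u j) \<in> borel_measurable (borel_L2 S T)"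
  unfolding coef_def by measurable

text \<open>By Parseval's identity the squared distance to a fixed w is a series in the
  coefficients. Hence preimages of balls are measurable, and countable unions of balls give all open
  sets.\<close>

lemma borel_L2_measurableI:
  assumes space: "\<And>x. x \<in> space N \<Longrightarrow> \<theta> x \<in> L2 S T"
    and coef: "\<And>j. (\<lambda>x. coef (\<theta> x) j) \<in> borel_measurable N"
  shows "\<theta> \<in> measurable N (borel_L2 S T)"
  unfolding borel_L2_def
proof (rule measurable_measure_of)
  show "{U. open_L2 S T U} \<subseteq> Pow (L2 S T)" by (auto dest: open_L2_space)
  show "\<theta> \<in> space N \<rightarrow> L2 S T" using space by auto
  fix U assume "U \<in> {U. open_L2 S T U}"
  then obtain C where C: "countable C" "C \<subseteq> dense_combs \<times> UNIV" "U = (\<Union>(w,r)\<in>C. ball2 w r)"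
    using open_L2_countable_balls by auto
  have ball: "\<theta> -` ball2 w r \<inter> space N \<in> sets N" if w: "w \<in> L2 S T" for w r
  proof (cases "r > 0")
    case True
    have "nrm (\<lambda>p. \<theta> x p - w p) < r \<longleftrightarrow> (\<Sum>j. (coef (\<theta> x) j - coef w j)\<^sup>2) < r\<^sup>2" if "x \<in> space N" for x
      using sums_unique[OF nrm_diff_sums[OF space[OF that] w]] True
        power_strict_mono[of "nrm (\<lambda>p. \<theta> x p - w p)" r 2] power2_less_imp_less[of "nrm (\<lambda>p. \<theta> x p - w p)" r]
      by auto
    then have "\<theta> -` ball2 w r \<inter> space N = {x \<in> space N. (\<Sum>j. (coef (\<theta> x) j - coef w j)\<^sup>2) < r\<^sup>2}"
      using space by (auto simp: ball2_def)
    also have "\<dots> \<in> sets N" using coef by measurable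
    finally show ?thesis .
  next
    case False
    then have "\<theta> -` ball2 w r \<inter> space N = {}"
      by (auto simp: ball2_def dest: order.strict_trans1[OF nrm_nonneg])
    then show ?thesis by simp
  qed
  have "\<theta> -` U \<inter> space N = (\<Union>(w,r)\<in>C. \<theta> -` ball2 w r \<inter> space N)" by (auto simp: C(3))
  also have "\<dots> \<in> sets N"
    using C(1,2) ball dense_combs_L2 by (intro sets.countable_UN') auto
  finally show "\<theta> -` U \<inter> space N \<in> sets N" .
qed

lemma measurable_nrm:
  assumes "\<And>x. x \<in> space N \<Longrightarrow> \<theta> x \<in> L2 S T" and [measurable]: "\<And>j. (\<lambda>x. coef (\<theta> x) j) \<in> borel_measurable N"
  shows "(\<lambda>x. (nrm (\<theta> x))\<^sup>2) \<in> borel_measurable N"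
proof -
  have "(\<lambda>x. \<Sum>j. (coef (\<theta> x) j)\<^sup>2) \<in> borel_measurable N" by measurable
  moreover have "(nrm (\<theta> x))\<^sup>2 = (\<Sum>j. (coef (\<theta> x) j)\<^sup>2)" if "x \<in> space N" for x
    using sums_unique[OF parseval[OF assms(1)[OF that]]] .
  ultimately show ?thesis by (subst measurable_cong) auto
qed

lemma ball2_sets: "w \<in> L2 S T \<Longrightarrow> ball2 w r \<in> sets (borel_L2 S T)"
proof (rule open_L2_sets)
  assume w: "w \<in> L2 S T"
  show "open_L2 S T (ball2 w r)"
    unfolding open_L2_def
  proof (intro conjI ballI)
    fix u assume u: "u \<in> ball2 w r"
    then have u': "u \<in> L2 S T" "r - nrm (\<lambda>p. u p - w p) > 0" by (auto simp: ball2_def)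
    have "x \<in> ball2 w r" if "x \<in> L2 S T" "nrm (\<lambda>p. x p - u p) < r - nrm (\<lambda>p. u p - w p)" for x
      using nrm_triangle_diff[OF that(1) u'(1) w] that by (auto simp: ball2_def)
    then show "\<exists>e>0. \<forall>x\<in>L2 S T. nrm (\<lambda>p. x p - u p) < e \<longrightarrow> x \<in> ball2 w r"
      using u' by blast
  qed (auto simp: ball2_def)
qed

end

section \<open>Functions of bounded variation and Riemann--Stieltjes integrals\<close>

definition grid_sum :: "field2 \<Rightarrow> field2 \<Rightarrow> nat \<Rightarrow> nat \<Rightarrow> (nat \<Rightarrow> real) \<Rightarrow> (nat \<Rightarrow> real) \<Rightarrow>
    (nat \<Rightarrow> real) \<Rightarrow> (nat \<Rightarrow> real) \<Rightarrow> real" where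
  "grid_sum g x m n a b \<sigma> \<tau> = (\<Sum>i<m. \<Sum>j<n. g (\<sigma> i, \<tau> j) *
     rect_increment x (a i) (a (Suc i)) (b j) (b (Suc j)))"

definition fine_tagged :: "real \<Rightarrow> real \<Rightarrow> nat \<Rightarrow> (nat \<Rightarrow> real) \<Rightarrow> (nat \<Rightarrow> real) \<Rightarrow> bool" where
  "fine_tagged L \<delta> m a \<sigma> \<longleftrightarrow> is_partition L m a \<and>
     (\<forall>i<m. a (Suc i) - a i < \<delta> \<and> a i \<le> \<sigma> i \<and> \<sigma> i \<le> a (Suc i))"

text \<open>The value 0 beyond the last grid lines turns differences along the two far edges, and
  the value at the far corner, into ordinary box increments. Their absolute sum is then the whole
  Hardy-Krause variation on the grid.\<close>

definition grid_ext :: "field2 \<Rightarrow> nat \<Rightarrow> nat \<Rightarrow> (nat \<Rightarrow> real) \<Rightarrow> (nat \<Rightarrow> real) \<Rightarrow> nat \<Rightarrow> nat \<Rightarrow> real" where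
  "grid_ext g N M c d k l = (if k \<le> N \<and> l \<le> M then g (c k, d l) else 0)"

definition box_incr :: "(nat \<Rightarrow> nat \<Rightarrow> real) \<Rightarrow> nat \<Rightarrow> nat \<Rightarrow> real" where
  "box_incr \<gamma> k l = \<gamma> (Suc k) (Suc l) - \<gamma> k (Suc l) - \<gamma> (Suc k) l + \<gamma> k l"

lemma is_partition_less: "is_partition L m a \<Longrightarrow> i < j \<Longrightarrow> j \<le> m \<Longrightarrow> a i < a j"
proof (induction j)
  case (Suc j)
  then show ?case by (cases "i = j") (auto simp: is_partition_def intro: less_trans)
qed simp

lemma is_partition_le: "is_partition L m a \<Longrightarrow> i \<le> j \<Longrightarrow> j \<le> m \<Longrightarrow> a i \<le> a j"
  using is_partition_less[of L m a i j] by (cases "i = j") auto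

lemma is_partition_range: "is_partition L m a \<Longrightarrow> i \<le> m \<Longrightarrow> a i \<in> {0..L}"
  using is_partition_le[of L m a 0 i] is_partition_le[of L m a i m] by (auto simp: is_partition_def)

lemma is_partition_le_iff: "is_partition L m a \<Longrightarrow> i \<le> m \<Longrightarrow> j \<le> m \<Longrightarrow> a i \<le> a j \<longleftrightarrow> i \<le> j"
  using is_partition_less[of L m a j i] is_partition_le[of L m a i j] by (cases "i \<le> j") auto

text \<open>Used to place two families of tags on one common grid.\<close>

lemma partition_containing:
  assumes "finite A" "A \<subseteq> {0..L}" "L > 0"
  obtains N c where "is_partition L N c" "A \<subseteq> c ` {..N}"
proof -
  define B where "B = insert 0 (insert L A)"
  have B: "finite B" "B \<subseteq> {0..L}" "0 \<in> B" "L \<in> B" "A \<subseteq> B" using assms by (auto simp: B_def)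
  define xs where "xs = sorted_list_of_set B"
  have xs: "set xs = B" "sorted_wrt (<) xs" using B by (auto simp: xs_def)
  have sorted: "sorted xs" using xs by (simp add: strict_sorted_imp_sorted)
  have ne: "xs \<noteq> []" using xs B by auto
  define N where "N = length xs - 1"
  have len: "length xs = Suc N" using ne by (simp add: N_def)
  have "is_partition L N (\<lambda>i. xs ! i)"
    unfolding is_partition_def
  proof (intro conjI allI impI)
    obtain i where i: "i < length xs" "xs ! i = 0" using B xs by (metis in_set_conv_nth)
    have "xs ! 0 \<le> 0" using sorted_nth_mono[OF sorted, of 0 i] i by simp
    moreover have "xs ! 0 \<in> B" using xs ne by (metis length_greater_0_conv nth_mem)
    ultimately show "xs ! 0 = 0" using B by auto
    obtain i where i: "i < length xs" "xs ! i = L" using B xs by (metis in_set_conv_nth)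
    have "xs ! N \<ge> L" using sorted_nth_mono[OF sorted, of i N] i len by simp
    moreover have "xs ! N \<in> B" using xs len by (metis lessI nth_mem)
    ultimately show "xs ! N = L" using B by auto
    fix i assume "i < N"
    then show "xs ! i < xs ! Suc i" using xs(2) len by (simp add: sorted_wrt_iff_nth_less)
  qed
  moreover have "A \<subseteq> (\<lambda>i. xs ! i) ` {..N}"
  proof
    fix y assume "y \<in> A"
    then have "y \<in> set xs" using B xs by auto
    then obtain i where "i < length xs" "y = xs ! i" by (metis in_set_conv_nth)
    then show "y \<in> (\<lambda>i. xs ! i) ` {..N}" using len by auto
  qed
  ultimately show ?thesis using that by blast
qed

lemma box_incr_telescope:
  assumes "k \<le> Suc N" "l \<le> Suc M"
  shows "(\<Sum>i=k..N. \<Sum>j=l..M. box_incr \<gamma> i j) =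
    \<gamma> (Suc N) (Suc M) - \<gamma> k (Suc M) - \<gamma> (Suc N) l + \<gamma> k l"
proof -
  have "(\<Sum>j=l..M. box_incr \<gamma> i j) = (\<gamma> (Suc i) (Suc M) - \<gamma> i (Suc M)) - (\<gamma> (Suc i) l - \<gamma> i l)" for i
  proof -
    have "(\<Sum>j=l..M. box_incr \<gamma> i j) = (\<Sum>j=l..M. (\<gamma> (Suc i) (Suc j) - \<gamma> i (Suc j)) - (\<gamma> (Suc i) j - \<gamma> i j))"
      by (intro sum.cong) (auto simp: box_incr_def)
    also have "\<dots> = (\<gamma> (Suc i) (Suc M) - \<gamma> i (Suc M)) - (\<gamma> (Suc i) l - \<gamma> i l)"
      by (rule sum_Suc_diff[OF assms(2), of "\<lambda>j. \<gamma> (Suc i) j - \<gamma> i j"])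
    finally show ?thesis .
  qed
  then have "(\<Sum>i=k..N. \<Sum>j=l..M. box_incr \<gamma> i j) =
      (\<Sum>i=k..N. (\<gamma> (Suc i) (Suc M) - \<gamma> (Suc i) l) - (\<gamma> i (Suc M) - \<gamma> i l))"
    by (intro sum.cong) auto
  also have "\<dots> = (\<gamma> (Suc N) (Suc M) - \<gamma> (Suc N) l) - (\<gamma> k (Suc M) - \<gamma> k l)"
    by (rule sum_Suc_diff[OF assms(1), of "\<lambda>i. \<gamma> i (Suc M) - \<gamma> i l"])
  finally show ?thesis by simp
qed

text \<open>Summation from the far corner, beyond which the extension vanishes: the box increments
  at all grid points above and to the right of (s, t) telescope to the value at (s, t).\<close>

lemma grid_representation:
  assumes c: "is_partition S N c" and d: "is_partition T M d"
    and s: "s \<in> c ` {..N}" and t: "t \<in> d ` {..M}"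
  shows "g (s, t) = (\<Sum>k\<le>N. \<Sum>l\<le>M. of_bool (s \<le> c k) * of_bool (t \<le> d l) * box_incr (grid_ext g N M c d) k l)"
proof -
  obtain k0 where k0: "k0 \<le> N" "s = c k0" using s by auto
  obtain l0 where l0: "l0 \<le> M" "t = d l0" using t by auto
  have "(\<Sum>k\<le>N. \<Sum>l\<le>M. of_bool (s \<le> c k) * of_bool (t \<le> d l) * box_incr (grid_ext g N M c d) k l) =
     (\<Sum>k\<le>N. \<Sum>l\<le>M. of_bool (k0 \<le> k) * (of_bool (l0 \<le> l) * box_incr (grid_ext g N M c d) k l))"
    using k0 l0 is_partition_le_iff[OF c] is_partition_le_iff[OF d] by (intro sum.cong) auto
  also have "\<dots> = (\<Sum>k\<le>N. of_bool (k0 \<le> k) * (\<Sum>l\<le>M. of_bool (l0 \<le> l) * box_incr (grid_ext g N M c d) k l))"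
    by (simp only: sum_distrib_left)
  also have "\<dots> = (\<Sum>k\<in>{k0..N}. \<Sum>l\<le>M. of_bool (l0 \<le> l) * box_incr (grid_ext g N M c d) k l)"
    by (intro sum.mono_neutral_cong_right) auto
  also have "\<dots> = (\<Sum>k\<in>{k0..N}. \<Sum>l\<in>{l0..M}. box_incr (grid_ext g N M c d) k l)"
    by (intro sum.cong refl sum.mono_neutral_cong_right) auto
  also have "\<dots> = g (s, t)"
    using k0 l0 by (subst box_incr_telescope) (auto simp: grid_ext_def)
  finally show ?thesis by simp
qed

section \<open>Bounds for the Hardy-Krause variation on grids\<close>

lemma bv_vitali_bound:
  assumes "bv_vitali S T g" "S > 0" "T > 0"
  obtains B where "B \<ge> 0" "\<And>m n a b. is_partition S m a \<Longrightarrow> is_partition T n b \<Longrightarrow>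
     (\<Sum>i<m. \<Sum>j<n. \<bar>rect_increment g (a i) (a (Suc i)) (b j) (b (Suc j))\<bar>) \<le> B"
proof -
  obtain B where B: "\<And>m n a b. is_partition S m a \<Longrightarrow> is_partition T n b \<Longrightarrow>
     (\<Sum>i<m. \<Sum>j<n. \<bar>rect_increment g (a i) (a (Suc i)) (b j) (b (Suc j))\<bar>) \<le> B"
    using assms(1) unfolding bv_vitali_def by blast
  have p: "is_partition S 1 (\<lambda>i. if i = 0 then 0 else S)" "is_partition T 1 (\<lambda>i. if i = 0 then 0 else T)"
    using assms by (auto simp: is_partition_def)
  have "B \<ge> 0" by (rule order_trans[OF _ B[OF p]]) (simp add: sum_nonneg)
  then show ?thesis using B that by blast
qed

text \<open>The variation is given as bounded on one section s = s0 only. The difference of the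
  sections at s0 and S has rectangle increments over [s0, S] as its increments, and these are
  controlled by the Vitali variation.\<close>

lemma bv_hardy_krause_edge:
  assumes v: "bv_vitali S T g" and S: "S > 0" "T > 0" and s0: "s0 \<in> {0..S}" "bv_interval T (\<lambda>t. g (s0, t))"
  obtains C where "\<And>n b. is_partition T n b \<Longrightarrow> (\<Sum>j<n. \<bar>g (S, b (Suc j)) - g (S, b j)\<bar>) \<le> C"
proof -
  obtain B where B: "B \<ge> 0" "\<And>m n a b. is_partition S m a \<Longrightarrow> is_partition T n b \<Longrightarrow>
     (\<Sum>i<m. \<Sum>j<n. \<bar>rect_increment g (a i) (a (Suc i)) (b j) (b (Suc j))\<bar>) \<le> B"
    using bv_vitali_bound[OF v S] by blast
  obtain D where D: "\<And>n b. is_partition T n b \<Longrightarrow> (\<Sum>j<n. \<bar>g (s0, b (Suc j)) - g (s0, b j)\<bar>) \<le> D"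
    using s0(2) unfolding bv_interval_def by blast
  have row: "(\<Sum>j<n. \<bar>rect_increment g s0 S (b j) (b (Suc j))\<bar>) \<le> B" if b: "is_partition T n b" for n b
  proof -
    consider "s0 = S" | "s0 = 0" | "0 < s0" "s0 < S" using s0(1) by force
    then show ?thesis
    proof cases
      case 1
      then show ?thesis using B(1) by (simp add: rect_increment_def)
    next
      case 2
      have "is_partition S 1 (\<lambda>i. if i = 0 then 0 else S)" using S by (auto simp: is_partition_def)
      from B(2)[OF this b] 2 show ?thesis by simp
    next
      case 3
      have "is_partition S 2 (\<lambda>i. if i = 0 then 0 else if i = 1 then s0 else S)"
        using 3 by (auto simp: is_partition_def less_2_cases_iff)
      from B(2)[OF this b] have *: "(\<Sum>j<n. \<bar>rect_increment g 0 s0 (b j) (b (Suc j))\<bar>) +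
          (\<Sum>j<n. \<bar>rect_increment g s0 S (b j) (b (Suc j))\<bar>) \<le> B"
        by (simp add: numeral_2_eq_2)
      have "0 \<le> (\<Sum>j<n. \<bar>rect_increment g 0 s0 (b j) (b (Suc j))\<bar>)" by (intro sum_nonneg) simp
      with * show ?thesis by linarith
    qed
  qed
  have "(\<Sum>j<n. \<bar>g (S, b (Suc j)) - g (S, b j)\<bar>) \<le> D + B" if b: "is_partition T n b" for n b
  proof -
    have "(\<Sum>j<n. \<bar>g (S, b (Suc j)) - g (S, b j)\<bar>) \<le>
        (\<Sum>j<n. \<bar>g (s0, b (Suc j)) - g (s0, b j)\<bar> + \<bar>rect_increment g s0 S (b j) (b (Suc j))\<bar>)"
      by (intro sum_mono) (auto simp: rect_increment_def)
    also have "\<dots> \<le> D + B" unfolding sum.distrib by (intro add_mono D row b)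
    finally show ?thesis .
  qed
  then show ?thesis using that by blast
qed

lemma bv_vitali_swap: "bv_vitali S T g \<Longrightarrow> bv_vitali T S (\<lambda>(t, s). g (s, t))"
proof -
  assume "bv_vitali S T g"
  then obtain B where B: "\<And>m n a b. is_partition S m a \<Longrightarrow> is_partition T n b \<Longrightarrow>
     (\<Sum>i<m. \<Sum>j<n. \<bar>rect_increment g (a i) (a (Suc i)) (b j) (b (Suc j))\<bar>) \<le> B"
    unfolding bv_vitali_def by blast
  have "(\<Sum>i<m. \<Sum>j<n. \<bar>rect_increment (\<lambda>(t, s). g (s, t)) (a i) (a (Suc i)) (b j) (b (Suc j))\<bar>) \<le> B"
    if "is_partition T m a" "is_partition S n b" for m n a b
    using B[OF that(2,1)] by (subst sum.swap) (simp add: rect_increment_def algebra_simps)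
  then show ?thesis unfolding bv_vitali_def by blast
qed

text \<open>The box increments of the extension split into rectangle increments in the interior,
  differences along the two far edges, and the value at the far corner, each of which is bounded
  separately.\<close>

lemma bv_hardy_krause_bound:
  assumes g: "bv_hardy_krause S T g" and S: "S > 0" "T > 0"
  obtains V where "V > 0" "\<And>N M c d. is_partition S N c \<Longrightarrow> is_partition T M d \<Longrightarrow>
     (\<Sum>k\<le>N. \<Sum>l\<le>M. \<bar>box_incr (grid_ext g N M c d) k l\<bar>) \<le> V"
proof -
  have v: "bv_vitali S T g" using g by (simp add: bv_hardy_krause_def)
  obtain B where B: "B \<ge> 0" "\<And>m n a b. is_partition S m a \<Longrightarrow> is_partition T n b \<Longrightarrow>
     (\<Sum>i<m. \<Sum>j<n. \<bar>rect_increment g (a i) (a (Suc i)) (b j) (b (Suc j))\<bar>) \<le> B"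
    using bv_vitali_bound[OF v S] by blast
  obtain s0 where s0: "s0 \<in> {0..S}" "bv_interval T (\<lambda>t. g (s0, t))"
    using g by (auto simp: bv_hardy_krause_def)
  obtain t0 where t0: "t0 \<in> {0..T}" "bv_interval S (\<lambda>s. g (s, t0))"
    using g by (auto simp: bv_hardy_krause_def)
  obtain C where C: "\<And>n b. is_partition T n b \<Longrightarrow> (\<Sum>j<n. \<bar>g (S, b (Suc j)) - g (S, b j)\<bar>) \<le> C"
    using bv_hardy_krause_edge[OF v S s0] by blast
  obtain D where D: "\<And>n b. is_partition S n b \<Longrightarrow> (\<Sum>j<n. \<bar>g (b (Suc j), T) - g (b j, T)\<bar>) \<le> D"
    using bv_hardy_krause_edge[OF bv_vitali_swap[OF v] S(2,1) t0(1)] t0(2) by auto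
  \<comment> \<open>The + 1 makes the bound positive, so that it can serve as a divisor.\<close>
  have "(\<Sum>k\<le>N. \<Sum>l\<le>M. \<bar>box_incr (grid_ext g N M c d) k l\<bar>) \<le> \<bar>B + D + C + \<bar>g (S, T)\<bar>\<bar> + 1"
    if c: "is_partition S N c" and d: "is_partition T M d" for N M c d
  proof -
    let ?b = "\<lambda>k l. \<bar>box_incr (grid_ext g N M c d) k l\<bar>"
    have ST: "c N = S" "d M = T" using c d by (auto simp: is_partition_def)
    have "(\<Sum>k\<le>N. \<Sum>l\<le>M. ?b k l) = (\<Sum>k<N. \<Sum>l<M. ?b k l) + (\<Sum>k<N. ?b k M) + (\<Sum>l<M. ?b N l) + ?b N M"
      by (simp add: lessThan_Suc_atMost[symmetric] sum.distrib)
    also have "(\<Sum>k<N. \<Sum>l<M. ?b k l) = (\<Sum>i<N. \<Sum>j<M. \<bar>rect_increment g (c i) (c (Suc i)) (d j) (d (Suc j))\<bar>)"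
      by (intro sum.cong) (auto simp: box_incr_def grid_ext_def rect_increment_def)
    also have "(\<Sum>k<N. ?b k M) = (\<Sum>k<N. \<bar>g (c (Suc k), T) - g (c k, T)\<bar>)"
      by (intro sum.cong) (auto simp: box_incr_def grid_ext_def ST)
    also have "(\<Sum>l<M. ?b N l) = (\<Sum>l<M. \<bar>g (S, d (Suc l)) - g (S, d l)\<bar>)"
      by (intro sum.cong) (auto simp: box_incr_def grid_ext_def ST)
    also have "?b N M = \<bar>g (S, T)\<bar>" by (simp add: box_incr_def grid_ext_def ST)
    also have "(\<Sum>i<N. \<Sum>j<M. \<bar>rect_increment g (c i) (c (Suc i)) (d j) (d (Suc j))\<bar>) +
        (\<Sum>k<N. \<bar>g (c (Suc k), T) - g (c k, T)\<bar>) + (\<Sum>l<M. \<bar>g (S, d (Suc l)) - g (S, d l)\<bar>) + \<bar>g (S, T)\<bar>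
        \<le> B + D + C + \<bar>g (S, T)\<bar>"
      by (intro add_mono B(2) C D c d order_refl)
    finally show ?thesis by linarith
  qed
  then show ?thesis using that[of "\<bar>B + D + C + \<bar>g (S, T)\<bar>\<bar> + 1"] by (auto simp: add_nonneg_pos)
qed

section \<open>Summation by parts for Riemann-Stieltjes sums\<close>

lemma fine_tagged_index:
  assumes a: "fine_tagged L \<delta> m a \<sigma>" and s: "s \<in> {0..L}" and L: "L > 0"
  shows "\<exists>k\<le>m. (\<forall>i<m. \<sigma> i \<le> s \<longleftrightarrow> i < k) \<and> \<bar>a k - s\<bar> < \<delta>"
proof -
  have p: "is_partition L m a" and tag: "\<And>i. i < m \<Longrightarrow> a (Suc i) - a i < \<delta> \<and> a i \<le> \<sigma> i \<and> \<sigma> i \<le> a (Suc i)"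
    using a by (auto simp: fine_tagged_def)
  have a0: "a 0 = 0" "a m = L" using p by (auto simp: is_partition_def)
  have m: "m > 0" using a0 L by (cases m) auto
  have mono: "\<sigma> i \<le> \<sigma> j" if "i \<le> j" "j < m" for i j
  proof (cases "i = j")
    case False
    then have "a (Suc i) \<le> a j" using is_partition_le[OF p] that by auto
    then show ?thesis using tag[of i] tag[of j] that by auto
  qed simp
  \<comment> \<open>The tags increase, so those not exceeding s are the first k, with k = m if no
    tag exceeds s. The partition point \<open>a k\<close> following them lies within one mesh width
    of s; it is where increments summed over these tags telescope.\<close>
  define k where "k = (LEAST k. k = m \<or> s < \<sigma> k)"
  have k: "k = m \<or> s < \<sigma> k" unfolding k_def by (rule LeastI[of _ m]) simp
  have "k \<le> m" unfolding k_def by (rule Least_le) simp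
  have lt: "\<sigma> i \<le> s" if "i < k" for i using not_less_Least[of i "\<lambda>k. k = m \<or> s < \<sigma> k"] that unfolding k_def by auto
  have "\<forall>i<m. \<sigma> i \<le> s \<longleftrightarrow> i < k"
    using lt k mono by (metis leI le_less_trans linorder_not_less)
  moreover have "\<bar>a k - s\<bar> < \<delta>"
  proof -
    have up: "a k - s < \<delta>"
    proof (cases k)
      case 0
      then show ?thesis using s a0 tag[of 0] m p by (auto simp: is_partition_def)
    next
      case (Suc k')
      then show ?thesis using lt[of k'] tag[of k'] \<open>k \<le> m\<close> by auto
    qed
    have "s - a k < \<delta>"
    proof (cases "k = m")
      case True
      then show ?thesis using s a0 tag[of 0] m p by (auto simp: is_partition_def)
    next
      case False
      then show ?thesis using k tag[of k] \<open>k \<le> m\<close> by auto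
    qed
    then show ?thesis using up by auto
  qed
  ultimately show ?thesis using \<open>k \<le> m\<close> by blast
qed

lemma rect_increment_telescope:
  assumes "\<And>t. t \<in> {0..T} \<Longrightarrow> x (0, t) = 0" "\<And>s. s \<in> {0..S} \<Longrightarrow> x (s, 0) = 0"
    and a: "is_partition S m a" and b: "is_partition T n b" and k: "k \<le> m" "l \<le> n"
  shows "(\<Sum>i<k. \<Sum>j<l. rect_increment x (a i) (a (Suc i)) (b j) (b (Suc j))) = x (a k, b l)"
proof -
  have 0: "a 0 = 0" "b 0 = 0" using a b by (auto simp: is_partition_def)
  have "(\<Sum>j<l. rect_increment x s s' (b j) (b (Suc j))) = (x (s', b l) - x (s, b l)) - (x (s', b 0) - x (s, b 0))" for s s'
  proof -
    have "(\<Sum>j<l. rect_increment x s s' (b j) (b (Suc j))) =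
       (\<Sum>j<l. (x (s', b (Suc j)) - x (s, b (Suc j))) - (x (s', b j) - x (s, b j)))"
      by (intro sum.cong) (auto simp: rect_increment_def)
    also have "\<dots> = (x (s', b l) - x (s, b l)) - (x (s', b 0) - x (s, b 0))"
      by (rule sum_lessThan_telescope[of "\<lambda>j. x (s', b j) - x (s, b j)"])
    finally show ?thesis .
  qed
  then have "(\<Sum>i<k. \<Sum>j<l. rect_increment x (a i) (a (Suc i)) (b j) (b (Suc j))) =
     (\<Sum>i<k. (x (a (Suc i), b l) - x (a (Suc i), b 0)) - (x (a i, b l) - x (a i, b 0)))"
    by (intro sum.cong) auto
  also have "\<dots> = (x (a k, b l) - x (a k, b 0)) - (x (a 0, b l) - x (a 0, b 0))"
    by (rule sum_lessThan_telescope[of "\<lambda>i. x (a i, b l) - x (a i, b 0)"])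
  also have "\<dots> = x (a k, b l)"
    using assms(1,2) is_partition_range[OF a k(1)] is_partition_range[OF b k(2)] is_partition_range[OF b, of 0] 0
    by simp
  finally show ?thesis .
qed

text \<open>Each value of g at a tag is a sum of box increments over a grid containing the tags.
  After exchanging the sums, the increments of x belonging to tags below (c k, d l) telescope to x
  at a partition point near (c k, d l). The variation of g thus becomes the weight, and x is merely
  evaluated.\<close>

lemma grid_sum_by_parts:
  assumes x: "x \<in> C0 S T" and S: "S > 0" "T > 0"
    and a: "fine_tagged S \<delta> m a \<sigma>" and b: "fine_tagged T \<delta> n b \<tau>"
    and c: "is_partition S N c" "\<sigma> ` {..<m} \<subseteq> c ` {..N}"
    and d: "is_partition T M d" "\<tau> ` {..<n} \<subseteq> d ` {..M}"
  obtains \<alpha> \<beta> where "\<And>k l. k \<le> N \<Longrightarrow> l \<le> M \<Longrightarrow>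
      (\<alpha> k, \<beta> l) \<in> rect S T \<and> \<bar>\<alpha> k - c k\<bar> < \<delta> \<and> \<bar>\<beta> l - d l\<bar> < \<delta>"
    "\<And>g. grid_sum g x m n a b \<sigma> \<tau> = (\<Sum>k\<le>N. \<Sum>l\<le>M. x (\<alpha> k, \<beta> l) * box_incr (grid_ext g N M c d) k l)"
proof -
  have pa: "is_partition S m a" and pb: "is_partition T n b" using a b by (auto simp: fine_tagged_def)
  have "\<forall>k\<in>{..N}. \<exists>i\<le>m. (\<forall>i'<m. \<sigma> i' \<le> c k \<longleftrightarrow> i' < i) \<and> \<bar>a i - c k\<bar> < \<delta>"
    using fine_tagged_index[OF a is_partition_range[OF c(1)] S(1)] by auto
  then obtain \<kappa> where \<kappa>: "\<And>k. k \<le> N \<Longrightarrow> \<kappa> k \<le> m \<and> (\<forall>i<m. \<sigma> i \<le> c k \<longleftrightarrow> i < \<kappa> k) \<and> \<bar>a (\<kappa> k) - c k\<bar> < \<delta>"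
    by (metis atMost_iff)
  have "\<forall>k\<in>{..M}. \<exists>i\<le>n. (\<forall>i'<n. \<tau> i' \<le> d k \<longleftrightarrow> i' < i) \<and> \<bar>b i - d k\<bar> < \<delta>"
    using fine_tagged_index[OF b is_partition_range[OF d(1)] S(2)] by auto
  then obtain \<mu> where \<mu>: "\<And>k. k \<le> M \<Longrightarrow> \<mu> k \<le> n \<and> (\<forall>i<n. \<tau> i \<le> d k \<longleftrightarrow> i < \<mu> k) \<and> \<bar>b (\<mu> k) - d k\<bar> < \<delta>"
    by (metis atMost_iff)
  let ?D = "\<lambda>i j. rect_increment x (a i) (a (Suc i)) (b j) (b (Suc j))"
  have x_eq: "x (a (\<kappa> k), b (\<mu> l)) = (\<Sum>i<m. \<Sum>j<n. of_bool (\<sigma> i \<le> c k) * of_bool (\<tau> j \<le> d l) * ?D i j)"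
    if kl: "k \<le> N" "l \<le> M" for k l
  proof -
    have "(\<Sum>i<m. \<Sum>j<n. of_bool (\<sigma> i \<le> c k) * of_bool (\<tau> j \<le> d l) * ?D i j) =
      (\<Sum>i<m. of_bool (i < \<kappa> k) * (\<Sum>j<n. of_bool (j < \<mu> l) * ?D i j))"
      unfolding sum_distrib_left using \<kappa>[OF kl(1)] \<mu>[OF kl(2)] by (intro sum.cong) auto
    also have "\<dots> = (\<Sum>i<\<kappa> k. (\<Sum>j<n. of_bool (j < \<mu> l) * ?D i j))"
      using \<kappa>[OF kl(1)] by (intro sum.mono_neutral_cong_right) auto
    also have "\<dots> = (\<Sum>i<\<kappa> k. \<Sum>j<\<mu> l. ?D i j)"
      using \<mu>[OF kl(2)] by (intro sum.cong refl sum.mono_neutral_cong_right) auto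
    also have "\<dots> = x (a (\<kappa> k), b (\<mu> l))"
      using x \<kappa>[OF kl(1)] \<mu>[OF kl(2)] by (intro rect_increment_telescope[OF _ _ pa pb]) (auto simp: C0_def)
    finally show ?thesis by simp
  qed
  show ?thesis
  proof (rule that[of "\<lambda>k. a (\<kappa> k)" "\<lambda>l. b (\<mu> l)"])
    show "(a (\<kappa> k), b (\<mu> l)) \<in> rect S T \<and> \<bar>a (\<kappa> k) - c k\<bar> < \<delta> \<and> \<bar>b (\<mu> l) - d l\<bar> < \<delta>"
      if "k \<le> N" "l \<le> M" for k l
      using \<kappa>[OF that(1)] \<mu>[OF that(2)] is_partition_range[OF pa, of "\<kappa> k"] is_partition_range[OF pb, of "\<mu> l"]
      by (auto simp: rect_def)
    fix g
    let ?B = "\<lambda>k l. box_incr (grid_ext g N M c d) k l"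
    \<comment> \<open>The four sums are interchanged until those over the grid (c, d) are innermost,
      where they form the representation of g at a tag.\<close>
    have "(\<Sum>k\<le>N. \<Sum>l\<le>M. x (a (\<kappa> k), b (\<mu> l)) * ?B k l) =
      (\<Sum>k\<le>N. \<Sum>l\<le>M. \<Sum>i<m. \<Sum>j<n. ?D i j * (of_bool (\<sigma> i \<le> c k) * of_bool (\<tau> j \<le> d l) * ?B k l))"
    proof (intro sum.cong refl)
      fix k l assume "k \<in> {..N}" "l \<in> {..M}"
      then have "k \<le> N" "l \<le> M" by auto
      note eq = x_eq[OF this]
      show "x (a (\<kappa> k), b (\<mu> l)) * ?B k l =
          (\<Sum>i<m. \<Sum>j<n. ?D i j * (of_bool (\<sigma> i \<le> c k) * of_bool (\<tau> j \<le> d l) * ?B k l))"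
        unfolding eq sum_distrib_right by (simp only: mult_ac)
    qed
    also have "\<dots> = (\<Sum>k\<le>N. \<Sum>i<m. \<Sum>l\<le>M. \<Sum>j<n. ?D i j * (of_bool (\<sigma> i \<le> c k) * of_bool (\<tau> j \<le> d l) * ?B k l))"
      by (intro sum.cong refl sum.swap)
    also have "\<dots> = (\<Sum>k\<le>N. \<Sum>i<m. \<Sum>j<n. \<Sum>l\<le>M. ?D i j * (of_bool (\<sigma> i \<le> c k) * of_bool (\<tau> j \<le> d l) * ?B k l))"
      by (intro sum.cong refl sum.swap)
    also have "\<dots> = (\<Sum>i<m. \<Sum>k\<le>N. \<Sum>j<n. \<Sum>l\<le>M. ?D i j * (of_bool (\<sigma> i \<le> c k) * of_bool (\<tau> j \<le> d l) * ?B k l))"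
      by (rule sum.swap)
    also have "\<dots> = (\<Sum>i<m. \<Sum>j<n. \<Sum>k\<le>N. \<Sum>l\<le>M. ?D i j * (of_bool (\<sigma> i \<le> c k) * of_bool (\<tau> j \<le> d l) * ?B k l))"
      by (intro sum.cong refl sum.swap)
    also have "\<dots> = (\<Sum>i<m. \<Sum>j<n. ?D i j * g (\<sigma> i, \<tau> j))"
    proof (intro sum.cong refl)
      fix i j assume "i \<in> {..<m}" "j \<in> {..<n}"
      then have "\<sigma> i \<in> c ` {..N}" "\<tau> j \<in> d ` {..M}" using c d by auto
      from grid_representation[OF c(1) d(1) this, of g]
      show "(\<Sum>k\<le>N. \<Sum>l\<le>M. ?D i j * (of_bool (\<sigma> i \<le> c k) * of_bool (\<tau> j \<le> d l) * ?B k l)) = ?D i j * g (\<sigma> i, \<tau> j)"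
        by (simp add: sum_distrib_left)
    qed
    finally show "grid_sum g x m n a b \<sigma> \<tau> = (\<Sum>k\<le>N. \<Sum>l\<le>M. x (a (\<kappa> k), b (\<mu> l)) * ?B k l)"
      by (simp add: grid_sum_def mult.commute)
  qed
qed

text \<open>After summation by parts on a grid containing both families of tags, the two sums have
  the same weights, of total size at most V, and differ only in the points at which x is
  evaluated.\<close>

lemma grid_sum_close:
  assumes x: "x \<in> C0 S T" and S: "S > 0" "T > 0"
    and a: "fine_tagged S \<delta> m a \<sigma>" and b: "fine_tagged T \<delta> n b \<tau>"
    and a': "fine_tagged S \<delta> m' a' \<sigma>'" and b': "fine_tagged T \<delta> n' b' \<tau>'"
    and V: "\<And>N M c d. is_partition S N c \<Longrightarrow> is_partition T M d \<Longrightarrow>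
     (\<Sum>k\<le>N. \<Sum>l\<le>M. \<bar>box_incr (grid_ext g N M c d) k l\<bar>) \<le> V"
    and uc: "\<And>p p'. p \<in> rect S T \<Longrightarrow> p' \<in> rect S T \<Longrightarrow> dist p p' < 4 * \<delta> \<Longrightarrow> \<bar>x p - x p'\<bar> \<le> e" and "e \<ge> 0"
  shows "\<bar>grid_sum g x m n a b \<sigma> \<tau> - grid_sum g x m' n' a' b' \<sigma>' \<tau>'\<bar> \<le> e * V"
proof -
  have tag_range: "\<sigma> ` {..<m} \<subseteq> {0..L}" if "fine_tagged L \<delta> m a \<sigma>" for L m a \<sigma>
  proof safe
    fix i assume "i < m"
    then show "\<sigma> i \<in> {0..L}"
      using that is_partition_range[of L m a i] is_partition_range[of L m a "Suc i"]
      by (force simp: fine_tagged_def)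
  qed
  obtain N c where c: "is_partition S N c" "\<sigma> ` {..<m} \<union> \<sigma>' ` {..<m'} \<subseteq> c ` {..N}"
    using partition_containing[of "\<sigma> ` {..<m} \<union> \<sigma>' ` {..<m'}" S] tag_range[OF a] tag_range[OF a'] S by auto
  obtain M d where d: "is_partition T M d" "\<tau> ` {..<n} \<union> \<tau>' ` {..<n'} \<subseteq> d ` {..M}"
    using partition_containing[of "\<tau> ` {..<n} \<union> \<tau>' ` {..<n'}" T] tag_range[OF b] tag_range[OF b'] S by auto
  obtain \<alpha> \<beta> where 1: "\<And>k l. k \<le> N \<Longrightarrow> l \<le> M \<Longrightarrow>
      (\<alpha> k, \<beta> l) \<in> rect S T \<and> \<bar>\<alpha> k - c k\<bar> < \<delta> \<and> \<bar>\<beta> l - d l\<bar> < \<delta>"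
    "\<And>g. grid_sum g x m n a b \<sigma> \<tau> = (\<Sum>k\<le>N. \<Sum>l\<le>M. x (\<alpha> k, \<beta> l) * box_incr (grid_ext g N M c d) k l)"
    by (rule grid_sum_by_parts[OF x S a b c(1) _ d(1)]) (use c(2) d(2) in auto)
  obtain \<alpha>' \<beta>' where 2: "\<And>k l. k \<le> N \<Longrightarrow> l \<le> M \<Longrightarrow>
      (\<alpha>' k, \<beta>' l) \<in> rect S T \<and> \<bar>\<alpha>' k - c k\<bar> < \<delta> \<and> \<bar>\<beta>' l - d l\<bar> < \<delta>"
    "\<And>g. grid_sum g x m' n' a' b' \<sigma>' \<tau>' = (\<Sum>k\<le>N. \<Sum>l\<le>M. x (\<alpha>' k, \<beta>' l) * box_incr (grid_ext g N M c d) k l)"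
    by (rule grid_sum_by_parts[OF x S a' b' c(1) _ d(1)]) (use c(2) d(2) in auto)
  let ?B = "\<lambda>k l. box_incr (grid_ext g N M c d) k l"
  have "\<bar>grid_sum g x m n a b \<sigma> \<tau> - grid_sum g x m' n' a' b' \<sigma>' \<tau>'\<bar> =
     \<bar>\<Sum>k\<le>N. \<Sum>l\<le>M. (x (\<alpha> k, \<beta> l) - x (\<alpha>' k, \<beta>' l)) * ?B k l\<bar>"
    unfolding 1(2) 2(2) by (simp add: sum_subtractf left_diff_distrib)
  also have "\<dots> \<le> (\<Sum>k\<le>N. \<bar>\<Sum>l\<le>M. (x (\<alpha> k, \<beta> l) - x (\<alpha>' k, \<beta>' l)) * ?B k l\<bar>)"
    by (rule sum_abs)
  also have "\<dots> \<le> (\<Sum>k\<le>N. \<Sum>l\<le>M. \<bar>(x (\<alpha> k, \<beta> l) - x (\<alpha>' k, \<beta>' l)) * ?B k l\<bar>)"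
    by (intro sum_mono sum_abs)
  also have "\<dots> \<le> (\<Sum>k\<le>N. \<Sum>l\<le>M. e * \<bar>?B k l\<bar>)"
  proof (intro sum_mono)
    fix k l assume "k \<in> {..N}" "l \<in> {..M}"
    then have *: "(\<alpha> k, \<beta> l) \<in> rect S T" "(\<alpha>' k, \<beta>' l) \<in> rect S T" "\<bar>\<alpha> k - \<alpha>' k\<bar> < 2 * \<delta>" "\<bar>\<beta> l - \<beta>' l\<bar> < 2 * \<delta>"
      using 1(1)[of k l] 2(1)[of k l] by auto
    \<comment> \<open>Both points are within \<delta> of the same grid lines, so each coordinate
      differs by less than 2 * \<delta>; this is the source of the 4 in the assumption on x.\<close>
    have "dist (\<alpha> k, \<beta> l) (\<alpha>' k, \<beta>' l) \<le> \<bar>\<alpha> k - \<alpha>' k\<bar> + \<bar>\<beta> l - \<beta>' l\<bar>"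
      unfolding dist_Pair_Pair dist_real_def using sqrt_sum_squares_le_sum_abs[of "\<alpha> k - \<alpha>' k" "\<beta> l - \<beta>' l"] by simp
    then have "\<bar>x (\<alpha> k, \<beta> l) - x (\<alpha>' k, \<beta>' l)\<bar> \<le> e" using * by (intro uc) auto
    then show "\<bar>(x (\<alpha> k, \<beta> l) - x (\<alpha>' k, \<beta>' l)) * ?B k l\<bar> \<le> e * \<bar>?B k l\<bar>"
      unfolding abs_mult by (intro mult_right_mono) auto
  qed
  also have "\<dots> = e * (\<Sum>k\<le>N. \<Sum>l\<le>M. \<bar>?B k l\<bar>)" by (simp add: sum_distrib_left)
  also have "\<dots> \<le> e * V" using V[OF c(1) d(1)] \<open>e \<ge> 0\<close> by (intro mult_left_mono)
  finally show ?thesis .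
qed

section \<open>Uniform partitions and existence of the integral\<close>

definition unode :: "real \<Rightarrow> nat \<Rightarrow> nat \<Rightarrow> real" where
  "unode L n i = L * real i / real n"

text \<open>These sums converge to the integral whenever it exists. A single sequence of sums then
  serves for uniqueness, measurability and scaling.\<close>

definition usum :: "real \<Rightarrow> real \<Rightarrow> nat \<Rightarrow> field2 \<Rightarrow> field2 \<Rightarrow> real" where
  "usum S T n g x = grid_sum g x n n (unode S n) (unode T n) (unode S n) (unode T n)"

lemma unode_diff: "n > 0 \<Longrightarrow> unode L n (Suc i) - unode L n i = L / real n"
  by (simp add: unode_def diff_divide_distrib[symmetric] right_diff_distrib[symmetric])

lemma is_partition_unode: "n > 0 \<Longrightarrow> L > 0 \<Longrightarrow> is_partition L n (unode L n)"
  using unode_diff[of n L] by (auto simp: is_partition_def unode_def) (simp add: divide_strict_right_mono)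

lemma fine_tagged_unode:
  assumes "n > 0" "L > 0" "L / real n < \<delta>"
  shows "fine_tagged L \<delta> n (unode L n) (unode L n)"
  unfolding fine_tagged_def
proof (intro conjI allI impI is_partition_unode assms)
  fix i show "unode L n (Suc i) - unode L n i < \<delta>" using assms by (simp add: unode_diff)
  have "0 < L / real n" using assms by simp
  then show "unode L n i \<le> unode L n (Suc i)" using unode_diff[OF assms(1), of L i] by linarith
qed simp

lemma has_rs_integral_fine:
  "has_rs_integral S T g x I \<longleftrightarrow> (\<forall>e>0. \<exists>\<delta>>0. \<forall>m n a b \<sigma> \<tau>.
     fine_tagged S \<delta> m a \<sigma> \<longrightarrow> fine_tagged T \<delta> n b \<tau> \<longrightarrow> \<bar>grid_sum g x m n a b \<sigma> \<tau> - I\<bar> < e)"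
proof -
  have *: "(\<forall>m n a b \<sigma> \<tau>. A m a \<longrightarrow> B n b \<longrightarrow> C m a \<sigma> \<longrightarrow> D n b \<tau> \<longrightarrow> X m n a b \<sigma> \<tau>) \<longleftrightarrow>
      (\<forall>m n a b \<sigma> \<tau>. A m a \<and> C m a \<sigma> \<longrightarrow> B n b \<and> D n b \<tau> \<longrightarrow> X m n a b \<sigma> \<tau>)"
    for A B C D and X :: "nat \<Rightarrow> nat \<Rightarrow> (nat \<Rightarrow> real) \<Rightarrow> (nat \<Rightarrow> real) \<Rightarrow> (nat \<Rightarrow> real) \<Rightarrow> (nat \<Rightarrow> real) \<Rightarrow> bool"
    by blast
  show ?thesis
    unfolding has_rs_integral_def fine_tagged_def grid_sum_def by (simp only: *)
qed

lemma eventually_fine_unode: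
  assumes "L > 0" "\<delta> > 0"
  shows "\<forall>\<^sub>F n in sequentially. n > 0 \<and> fine_tagged L \<delta> n (unode L n) (unode L n)"
proof -
  have "(\<lambda>n. L / real n) \<longlonglongrightarrow> 0" by (rule lim_const_over_n)
  then have "\<forall>\<^sub>F n in sequentially. L / real n < \<delta>" using assms by (auto dest: order_tendstoD)
  then show ?thesis using eventually_gt_at_top[of 0]
    by eventually_elim (auto intro: fine_tagged_unode assms)
qed

lemma has_rs_integral_usum:
  assumes I: "has_rs_integral S T g x I" and S: "S > 0" "T > 0"
  shows "(\<lambda>n. usum S T n g x) \<longlonglongrightarrow> I"
proof (rule tendstoI)
  fix e :: real assume "e > 0"
  then obtain \<delta> where \<delta>: "\<delta> > 0" "\<And>m n a b \<sigma> \<tau>. fine_tagged S \<delta> m a \<sigma> \<Longrightarrow> fine_tagged T \<delta> n b \<tau> \<Longrightarrow>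
      \<bar>grid_sum g x m n a b \<sigma> \<tau> - I\<bar> < e"
    using I unfolding has_rs_integral_fine by blast
  show "\<forall>\<^sub>F n in sequentially. dist (usum S T n g x) I < e"
    using eventually_fine_unode[OF S(1) \<delta>(1)] eventually_fine_unode[OF S(2) \<delta>(1)]
    by eventually_elim (auto simp: usum_def dist_real_def intro: \<delta>(2))
qed

lemma rs_integral_eq:
  assumes I: "has_rs_integral S T g x I" and S: "S > 0" "T > 0"
  shows "rs_integral S T g x = I"
  unfolding rs_integral_def
proof (rule the_equality[where P="has_rs_integral S T g x", OF I])
  fix J assume "has_rs_integral S T g x J"
  from has_rs_integral_usum[OF this S] has_rs_integral_usum[OF I S] show "J = I" by (rule LIMSEQ_unique)
qed

text \<open>All sufficiently fine sums are close to each other, since x is uniformly continuous and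
  g has bounded variation. The uniform sums are therefore Cauchy, and every other fine sum is close
  to their limit.\<close>

lemma has_rs_integral_rs_integral:
  assumes g: "bv_hardy_krause S T g" and x: "x \<in> C0 S T" and S: "S > 0" "T > 0"
  shows "has_rs_integral S T g x (rs_integral S T g x)"
proof -
  obtain V where V: "V > 0" "\<And>N M c d. is_partition S N c \<Longrightarrow> is_partition T M d \<Longrightarrow>
     (\<Sum>k\<le>N. \<Sum>l\<le>M. \<bar>box_incr (grid_ext g N M c d) k l\<bar>) \<le> V"
    using bv_hardy_krause_bound[OF g S] by blast
  have "compact (rect S T)" unfolding rect_def by (intro compact_Times compact_Icc)
  then have "uniformly_continuous_on (rect S T) x"
    using x by (intro compact_uniformly_continuous) (auto simp: C0_def)
  then have key: "\<exists>\<delta>>0. \<forall>m n a b \<sigma> \<tau> m' n' a' b' \<sigma>' \<tau>'.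
      fine_tagged S \<delta> m a \<sigma> \<longrightarrow> fine_tagged T \<delta> n b \<tau> \<longrightarrow> fine_tagged S \<delta> m' a' \<sigma>' \<longrightarrow> fine_tagged T \<delta> n' b' \<tau>' \<longrightarrow>
      \<bar>grid_sum g x m n a b \<sigma> \<tau> - grid_sum g x m' n' a' b' \<sigma>' \<tau>'\<bar> \<le> e" if "e > 0" for e
  proof -
    have e: "e / V > 0" using that V by simp
    then obtain d where d: "d > 0" "\<And>p p'. p \<in> rect S T \<Longrightarrow> p' \<in> rect S T \<Longrightarrow> dist p' p < d \<Longrightarrow> dist (x p') (x p) < e / V"
      using \<open>uniformly_continuous_on (rect S T) x\<close> unfolding uniformly_continuous_on_def by blast
    have uc: "\<bar>x p - x p'\<bar> \<le> e / V" if "p \<in> rect S T" "p' \<in> rect S T" "dist p p' < 4 * (d / 4)" for p p'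
      using d(2)[OF that(2,1)] that(3) by (simp add: dist_real_def)
    have "\<bar>grid_sum g x m n a b \<sigma> \<tau> - grid_sum g x m' n' a' b' \<sigma>' \<tau>'\<bar> \<le> e"
      if "fine_tagged S (d/4) m a \<sigma>" "fine_tagged T (d/4) n b \<tau>" "fine_tagged S (d/4) m' a' \<sigma>'" "fine_tagged T (d/4) n' b' \<tau>'"
      for m n a b \<sigma> \<tau> m' n' a' b' \<sigma>' \<tau>'
      using grid_sum_close[OF x S that V(2) uc less_imp_le[OF e]] V(1) by simp
    then show ?thesis using d(1) by (intro exI[of _ "d/4"]) auto
  qed
  have "Cauchy (\<lambda>n. usum S T n g x)"
  proof (rule metric_CauchyI)
    fix e :: real assume "e > 0"
    then obtain \<delta> where \<delta>: "\<delta> > 0" "\<And>m n a b \<sigma> \<tau> m' n' a' b' \<sigma>' \<tau>'.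
      fine_tagged S \<delta> m a \<sigma> \<Longrightarrow> fine_tagged T \<delta> n b \<tau> \<Longrightarrow> fine_tagged S \<delta> m' a' \<sigma>' \<Longrightarrow> fine_tagged T \<delta> n' b' \<tau>' \<Longrightarrow>
      \<bar>grid_sum g x m n a b \<sigma> \<tau> - grid_sum g x m' n' a' b' \<sigma>' \<tau>'\<bar> \<le> e/2"
      using key[of "e/2"] by (meson half_gt_zero)
    obtain N where N: "\<And>n. n \<ge> N \<Longrightarrow> fine_tagged S \<delta> n (unode S n) (unode S n) \<and> fine_tagged T \<delta> n (unode T n) (unode T n)"
      using eventually_conj[OF eventually_fine_unode[OF S(1) \<delta>(1)] eventually_fine_unode[OF S(2) \<delta>(1)]]
      unfolding eventually_sequentially by blast
    have "dist (usum S T m g x) (usum S T n g x) < e" if "m \<ge> N" "n \<ge> N" for m n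
      using \<delta>(2)[of m "unode S m" "unode S m" m "unode T m" "unode T m" n "unode S n" "unode S n" n "unode T n" "unode T n"]
        N[OF that(1)] N[OF that(2)] \<open>e > 0\<close> by (simp add: usum_def dist_real_def)
    then show "\<exists>M. \<forall>m\<ge>M. \<forall>n\<ge>M. dist (usum S T m g x) (usum S T n g x) < e" by blast
  qed
  then obtain I where I: "(\<lambda>n. usum S T n g x) \<longlonglongrightarrow> I" by (auto simp: Cauchy_convergent_iff convergent_def)
  have "has_rs_integral S T g x I"
    unfolding has_rs_integral_fine
  proof (intro allI impI)
    fix e :: real assume "e > 0"
    then obtain \<delta> where \<delta>: "\<delta> > 0" "\<And>m n a b \<sigma> \<tau> m' n' a' b' \<sigma>' \<tau>'.
      fine_tagged S \<delta> m a \<sigma> \<Longrightarrow> fine_tagged T \<delta> n b \<tau> \<Longrightarrow> fine_tagged S \<delta> m' a' \<sigma>' \<Longrightarrow> fine_tagged T \<delta> n' b' \<tau>' \<Longrightarrow>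
      \<bar>grid_sum g x m n a b \<sigma> \<tau> - grid_sum g x m' n' a' b' \<sigma>' \<tau>'\<bar> \<le> e/2"
      using key[of "e/2"] by (meson half_gt_zero)
    have "\<bar>grid_sum g x m n a b \<sigma> \<tau> - I\<bar> \<le> e/2"
      if t: "fine_tagged S \<delta> m a \<sigma>" "fine_tagged T \<delta> n b \<tau>" for m n a b \<sigma> \<tau>
    proof (rule tendsto_upperbound)
      show "(\<lambda>k. \<bar>grid_sum g x m n a b \<sigma> \<tau> - usum S T k g x\<bar>) \<longlonglongrightarrow> \<bar>grid_sum g x m n a b \<sigma> \<tau> - I\<bar>"
        by (intro tendsto_intros I)
      show "\<forall>\<^sub>F k in sequentially. \<bar>grid_sum g x m n a b \<sigma> \<tau> - usum S T k g x\<bar> \<le> e/2"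
        using eventually_fine_unode[OF S(1) \<delta>(1)] eventually_fine_unode[OF S(2) \<delta>(1)]
      proof eventually_elim
        case (elim k)
        then show ?case unfolding usum_def using \<delta>(2)[OF t] by blast
      qed
    qed simp
    then show "\<exists>\<delta>>0. \<forall>m n a b \<sigma> \<tau>. fine_tagged S \<delta> m a \<sigma> \<longrightarrow> fine_tagged T \<delta> n b \<tau> \<longrightarrow>
        \<bar>grid_sum g x m n a b \<sigma> \<tau> - I\<bar> < e"
      using \<delta>(1) \<open>e > 0\<close> by (intro exI[of _ \<delta>]) (fastforce intro: le_less_trans)
  qed
  then show ?thesis using rs_integral_eq[OF _ S] by simp
qed

lemma has_rs_integral_add:
  assumes "has_rs_integral S T g x I" "has_rs_integral S T g' x I'"
  shows "has_rs_integral S T (\<lambda>p. g p + g' p) x (I + I')"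
  unfolding has_rs_integral_fine
proof (intro allI impI)
  fix e :: real assume "e > 0"
  then have e2: "e/2 > 0" by simp
  obtain d where d: "d > 0" "\<And>m n a b \<sigma> \<tau>. fine_tagged S d m a \<sigma> \<Longrightarrow> fine_tagged T d n b \<tau> \<Longrightarrow>
      \<bar>grid_sum g x m n a b \<sigma> \<tau> - I\<bar> < e/2"
    using assms(1) e2 unfolding has_rs_integral_fine by blast
  obtain d' where d': "d' > 0" "\<And>m n a b \<sigma> \<tau>. fine_tagged S d' m a \<sigma> \<Longrightarrow> fine_tagged T d' n b \<tau> \<Longrightarrow>
      \<bar>grid_sum g' x m n a b \<sigma> \<tau> - I'\<bar> < e/2"
    using assms(2) e2 unfolding has_rs_integral_fine by blast
  have "\<bar>grid_sum (\<lambda>p. g p + g' p) x m n a b \<sigma> \<tau> - (I + I')\<bar> < e"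
    if "fine_tagged S (min d d') m a \<sigma>" "fine_tagged T (min d d') n b \<tau>" for m n a b \<sigma> \<tau>
  proof -
    have "fine_tagged S d m a \<sigma>" "fine_tagged T d n b \<tau>" "fine_tagged S d' m a \<sigma>" "fine_tagged T d' n b \<tau>"
      using that by (auto simp: fine_tagged_def)
    then have "\<bar>grid_sum g x m n a b \<sigma> \<tau> - I\<bar> < e/2" "\<bar>grid_sum g' x m n a b \<sigma> \<tau> - I'\<bar> < e/2"
      using d(2) d'(2) by blast+
    moreover have "grid_sum (\<lambda>p. g p + g' p) x m n a b \<sigma> \<tau> = grid_sum g x m n a b \<sigma> \<tau> + grid_sum g' x m n a b \<sigma> \<tau>"
      by (simp add: grid_sum_def distrib_right sum.distrib)
    ultimately show ?thesis unfolding abs_less_iff by linarith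
  qed
  then show "\<exists>\<delta>>0. \<forall>m n a b \<sigma> \<tau>. fine_tagged S \<delta> m a \<sigma> \<longrightarrow> fine_tagged T \<delta> n b \<tau> \<longrightarrow>
      \<bar>grid_sum (\<lambda>p. g p + g' p) x m n a b \<sigma> \<tau> - (I + I')\<bar> < e"
    using d(1) d'(1) by (intro exI[of _ "min d d'"]) auto
qed

lemma has_rs_integral_scale:
  assumes "has_rs_integral S T g x I"
  shows "has_rs_integral S T (\<lambda>p. c * g p) x (c * I)"
  unfolding has_rs_integral_fine
proof (intro allI impI)
  fix e :: real assume "e > 0"
  then have e2: "e / (\<bar>c\<bar> + 1) > 0" by (simp add: add_nonneg_pos)
  obtain d where d: "d > 0" "\<And>m n a b \<sigma> \<tau>. fine_tagged S d m a \<sigma> \<Longrightarrow> fine_tagged T d n b \<tau> \<Longrightarrow>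
      \<bar>grid_sum g x m n a b \<sigma> \<tau> - I\<bar> < e / (\<bar>c\<bar> + 1)"
    using assms(1) e2 unfolding has_rs_integral_fine by blast
  have "\<bar>grid_sum (\<lambda>p. c * g p) x m n a b \<sigma> \<tau> - c * I\<bar> < e"
    if "fine_tagged S d m a \<sigma>" "fine_tagged T d n b \<tau>" for m n a b \<sigma> \<tau>
  proof -
    have "grid_sum (\<lambda>p. c * g p) x m n a b \<sigma> \<tau> - c * I = c * (grid_sum g x m n a b \<sigma> \<tau> - I)"
      by (simp add: grid_sum_def sum_distrib_left right_diff_distrib mult.assoc)
    also have "\<bar>\<dots>\<bar> \<le> (\<bar>c\<bar> + 1) * \<bar>grid_sum g x m n a b \<sigma> \<tau> - I\<bar>"
      unfolding abs_mult by (intro mult_right_mono) auto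
    also have "\<dots> < e" using d(2)[OF that] by (simp add: pos_less_divide_eq mult.commute)
    finally show ?thesis .
  qed
  then show "\<exists>\<delta>>0. \<forall>m n a b \<sigma> \<tau>. fine_tagged S \<delta> m a \<sigma> \<longrightarrow> fine_tagged T \<delta> n b \<tau> \<longrightarrow>
      \<bar>grid_sum (\<lambda>p. c * g p) x m n a b \<sigma> \<tau> - c * I\<bar> < e"
    using d(1) by (intro exI[of _ d]) auto
qed

lemma rs_integral_sum:
  fixes g :: "nat \<Rightarrow> field2"
  assumes g: "\<And>j. bv_hardy_krause S T (g j)" and x: "x \<in> C0 S T" and S: "S > 0" "T > 0"
  shows "rs_integral S T (\<lambda>p. \<Sum>j<n. c j * g j p) x = (\<Sum>j<n. c j * rs_integral S T (g j) x)"
proof (rule rs_integral_eq[OF _ S])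
  show "has_rs_integral S T (\<lambda>p. \<Sum>j<n. c j * g j p) x (\<Sum>j<n. c j * rs_integral S T (g j) x)"
  proof (induction n)
    case 0
    have "grid_sum (\<lambda>p. 0) x m n a b \<sigma> \<tau> = 0" for m n a b \<sigma> \<tau> by (simp add: grid_sum_def)
    then show ?case unfolding has_rs_integral_fine by (auto intro: exI[of _ 1])
  next
    case (Suc n)
    then show ?case
      using has_rs_integral_add[OF Suc has_rs_integral_scale[OF has_rs_integral_rs_integral[OF g x S]]] by simp
  qed
qed

text \<open>Both integrals are limits of uniform sums, and these scale exactly.\<close>

lemma rs_integral_scale_path:
  assumes g: "bv_hardy_krause S T g" and x: "x \<in> C0 S T" "(\<lambda>p. \<rho> * x p) \<in> C0 S T" and S: "S > 0" "T > 0"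
  shows "rs_integral S T g (\<lambda>p. \<rho> * x p) = \<rho> * rs_integral S T g x"
proof (rule LIMSEQ_unique)
  show "(\<lambda>n. usum S T n g (\<lambda>p. \<rho> * x p)) \<longlonglongrightarrow> rs_integral S T g (\<lambda>p. \<rho> * x p)"
    by (intro has_rs_integral_usum has_rs_integral_rs_integral assms)
  have "usum S T n g (\<lambda>p. \<rho> * x p) = \<rho> * usum S T n g x" for n
    by (simp add: usum_def grid_sum_def rect_increment_def sum_distrib_left algebra_simps)
  then show "(\<lambda>n. usum S T n g (\<lambda>p. \<rho> * x p)) \<longlonglongrightarrow> \<rho> * rs_integral S T g x"
    using has_rs_integral_usum[OF has_rs_integral_rs_integral[OF g x(1) S] S] by (auto intro: tendsto_intros)
qed

lemma sum_of_bool_le_1: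
  assumes "finite A" "\<And>i j. i \<in> A \<Longrightarrow> j \<in> A \<Longrightarrow> P i \<Longrightarrow> P j \<Longrightarrow> i = j"
  shows "(\<Sum>i\<in>A. of_bool (P i) :: real) \<le> 1"
proof -
  have "(\<Sum>i\<in>A. of_bool (P i) :: real) = real (card {i\<in>A. P i})"
    using assms(1) by (simp add: of_bool_def sum.If_cases Int_def)
  moreover have "card {i\<in>A. P i} \<le> 1"
    using assms card_le_Suc0_iff_eq[of "{i\<in>A. P i}"] by auto
  ultimately show ?thesis by simp
qed

section \<open>Approximation by step functions\<close>

context l2_basis begin

lemma complete_Q: "complete_measure Q"
proof
  fix A B assume "B \<subseteq> A" "A \<in> null_sets Q"
  then have "A \<in> null_sets lebesgue" "A \<subseteq> rect S T" by (auto simp: null_sets_restrict_space)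
  then have "B \<in> null_sets lebesgue" using \<open>B \<subseteq> A\<close> by (blast intro: completion.complete2)
  then show "B \<in> sets Q" using \<open>B \<subseteq> A\<close> \<open>A \<subseteq> rect S T\<close>
    by (auto simp: sets_restrict_space_iff)
qed

text \<open>Half-open cells are disjoint; they cover Q up to the edges s = S and t = T, which are
  null.\<close>

definition cell :: "nat \<Rightarrow> nat \<Rightarrow> nat \<Rightarrow> (real \<times> real) set" where
  "cell n i j = {unode S n i ..< unode S n (Suc i)} \<times> {unode T n j ..< unode T n (Suc j)}"

definition corner :: "nat \<Rightarrow> nat \<Rightarrow> nat \<Rightarrow> real \<times> real" where
  "corner n i j = (unode S n i, unode T n j)"

text \<open>The lower left corners are also the tags of \<open>usum\<close>, so that the squared
  norm of this function is the variance of that sum under the Yeh-Wiener measure.\<close>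

definition ustep :: "nat \<Rightarrow> field2 \<Rightarrow> field2" where
  "ustep n g p = (\<Sum>i<n. \<Sum>j<n. g (corner n i j) * indicator (cell n i j) p)"

text \<open>Multiplied by n / L, the coordinate lies in [i, i + 1), which determines i.\<close>

lemma unode_interval_unique:
  assumes "0 < L" "0 < n" "s \<in> {unode L n i ..< unode L n (Suc i)}" "s \<in> {unode L n j ..< unode L n (Suc j)}"
  shows "i = j"
proof -
  have "real i \<le> s * n / L" "s * n / L < real (Suc i)" "real j \<le> s * n / L" "s * n / L < real (Suc j)"
    using assms by (auto simp: unode_def field_simps)
  then show ?thesis by linarith
qed

lemma unode_interval_ex:
  assumes "0 < L" "0 < n" "s \<in> {0..<L}"
  shows "\<exists>i<n. s \<in> {unode L n i ..< unode L n (Suc i)}"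
proof -
  define i where "i = nat \<lfloor>s * n / L\<rfloor>"
  have 0: "0 \<le> s * n / L" using assms by simp
  have *: "real i \<le> s * n / L" "s * n / L < real i + 1"
    using 0 by (auto simp: i_def)
  have "s * n / L < n" using assms by (simp add: field_simps)
  then have "i < n" using *(1) by linarith
  moreover have "s \<in> {unode L n i ..< unode L n (Suc i)}"
    using * assms by (auto simp: unode_def field_simps)
  ultimately show ?thesis by blast
qed

lemma cell_unique: "0 < n \<Longrightarrow> p \<in> cell n i j \<Longrightarrow> p \<in> cell n i' j' \<Longrightarrow> i = i' \<and> j = j'"
  using unode_interval_unique[OF S_pos, of n "fst p" i i'] unode_interval_unique[OF T_pos, of n "snd p" j j']
  by (auto simp: cell_def mem_Times_iff)

lemma cell_ex:
  assumes "0 < n" "p \<in> {0..<S} \<times> {0..<T}"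
  obtains i j where "i < n" "j < n" "p \<in> cell n i j"
  using unode_interval_ex[OF S_pos assms(1), of "fst p"] unode_interval_ex[OF T_pos assms(1), of "snd p"] assms(2)
  by (auto simp: cell_def mem_Times_iff)

lemma unode_range: "0 < n \<Longrightarrow> 0 < L \<Longrightarrow> i \<le> n \<Longrightarrow> unode L n i \<in> {0..L}"
  using is_partition_range[OF is_partition_unode] by blast

lemma cell_subset: "i < n \<Longrightarrow> j < n \<Longrightarrow> cell n i j \<subseteq> rect S T"
  using unode_range[of n S i] unode_range[of n S "Suc i"] unode_range[of n T j] unode_range[of n T "Suc j"] S_pos T_pos
  by (auto simp: cell_def rect_def)

lemma cell_borel: "cell n i j \<in> sets borel"
  unfolding cell_def borel_prod[symmetric] by (intro pair_measureI) auto

lemma cell_sets[measurable, simp]: "i < n \<Longrightarrow> j < n \<Longrightarrow> cell n i j \<in> sets Q"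
  using cell_subset[of i n j] cell_borel[of n i j]
  by (subst sets_restrict_space_iff) auto

lemma emeasure_cell:
  assumes "i < n" "j < n" shows "emeasure Q (cell n i j) = ennreal (S / n * (T / n))"
proof -
  have "emeasure Q (cell n i j) = emeasure lborel (cell n i j)"
    using cell_subset[OF assms] cell_borel[of n i j] by (simp add: emeasure_restrict_space)
  also have "\<dots> = emeasure (lborel \<Otimes>\<^sub>M lborel) (cell n i j)" by (simp add: lborel_prod)
  also have "\<dots> = ennreal (S / n) * ennreal (T / n)"
  proof -
    have "unode S n i \<le> unode S n (Suc i)" "unode T n j \<le> unode T n (Suc j)"
      using assms(1) S_pos T_pos unode_diff[of n S i] unode_diff[of n T j] divide_pos_pos[of S "real n"] divide_pos_pos[of T "real n"] by linarith+
    then show ?thesis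
      unfolding cell_def using assms
      by (subst lborel.emeasure_pair_measure_Times) (auto simp: unode_diff)
  qed
  finally show ?thesis using S_pos T_pos by (simp add: ennreal_mult[symmetric])
qed

lemma AE_interior: "AE p in Q. p \<in> {0..<S} \<times> {0..<T}"
proof -
  have "AE p in lborel. (p::real\<times>real) \<bullet> (1, 0) \<noteq> S" "AE p in lborel. (p::real\<times>real) \<bullet> (0, 1) \<noteq> T"
    by (rule AE_lborel_inner_neq; simp add: Basis_prod_def)+
  then have "AE p in lebesgue. (p::real\<times>real) \<bullet> (1, 0) \<noteq> S \<and> p \<bullet> (0, 1) \<noteq> T"
    by (auto intro: AE_completion)
  then have "AE p in lebesgue. p \<in> rect S T \<longrightarrow> p \<in> {0..<S} \<times> {0..<T}"
    by eventually_elim (auto simp: rect_def)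
  then show ?thesis by (subst AE_restrict_space_iff) auto
qed

lemma ustep_on_cell:
  assumes "0 < n" "i < n" "j < n" "p \<in> cell n i j"
  shows "(\<Sum>i<n. \<Sum>j<n. f i j * indicator (cell n i j) p) = (f i j :: real)"
proof -
  have ind: "indicator (cell n i' j') p = (if i' = i \<and> j' = j then 1 else 0 :: real)" for i' j'
  proof (cases "p \<in> cell n i' j'")
    case True
    then show ?thesis using cell_unique[OF assms(1,4) True] by simp
  next
    case False
    then have "\<not> (i' = i \<and> j' = j)" using assms(4) by blast
    with False show ?thesis by (simp add: indicator_def)
  qed
  have row: "(\<Sum>j'<n. f i' j' * indicator (cell n i' j') p) = (if i' = i then f i j else 0)" for i'
  proof -
    have "(\<Sum>j'<n. f i' j' * indicator (cell n i' j') p) = (\<Sum>j'<n. if j' = j then (if i' = i then f i j else 0) else 0)"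
      by (intro sum.cong refl) (simp add: ind)
    then show ?thesis using assms(3) by simp
  qed
  show ?thesis using assms(2) by (simp add: row)
qed

lemma ustep_measurable[measurable]: "ustep n g \<in> borel_measurable Q"
  unfolding ustep_def[abs_def]
  by (intro borel_measurable_sum borel_measurable_times borel_measurable_indicator) auto

lemma nn_integral_cells:
  assumes "\<And>i j. f i j \<ge> 0"
  shows "(\<integral>\<^sup>+p. ennreal (\<Sum>i<n. \<Sum>j<n. f i j * indicator (cell n i j) p) \<partial>Q) =
    ennreal (\<Sum>i<n. \<Sum>j<n. f i j * (S / n * (T / n)))"
proof -
  have "ennreal (\<Sum>i<n. \<Sum>j<n. f i j * indicator (cell n i j) p) =
      (\<Sum>i<n. \<Sum>j<n. ennreal (f i j) * indicator (cell n i j) p)" for p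
  proof -
    have "ennreal (\<Sum>i<n. \<Sum>j<n. f i j * indicator (cell n i j) p) =
        (\<Sum>i<n. ennreal (\<Sum>j<n. f i j * indicator (cell n i j) p))"
      by (rule sum_ennreal[symmetric]) (intro sum_nonneg mult_nonneg_nonneg assms indicator_pos_le)
    also have "\<dots> = (\<Sum>i<n. \<Sum>j<n. ennreal (f i j * indicator (cell n i j) p))"
      by (intro sum.cong refl sum_ennreal[symmetric]) (intro mult_nonneg_nonneg assms indicator_pos_le)
    finally show ?thesis by (simp only: ennreal_mult[OF assms indicator_pos_le] ennreal_indicator)
  qed
  then have "(\<integral>\<^sup>+p. ennreal (\<Sum>i<n. \<Sum>j<n. f i j * indicator (cell n i j) p) \<partial>Q) =
      (\<integral>\<^sup>+p. (\<Sum>i<n. \<Sum>j<n. ennreal (f i j) * indicator (cell n i j) p) \<partial>Q)" by simp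
  also have "\<dots> = (\<Sum>i<n. \<integral>\<^sup>+p. (\<Sum>j<n. ennreal (f i j) * indicator (cell n i j) p) \<partial>Q)"
    by (intro nn_integral_sum borel_measurable_sum borel_measurable_times_ennreal borel_measurable_indicator) auto
  also have "\<dots> = (\<Sum>i<n. \<Sum>j<n. \<integral>\<^sup>+p. ennreal (f i j) * indicator (cell n i j) p \<partial>Q)"
    by (intro sum.cong refl nn_integral_sum borel_measurable_times_ennreal borel_measurable_indicator) auto
  also have "\<dots> = (\<Sum>i<n. \<Sum>j<n. ennreal (f i j * (S / n * (T / n))))"
  proof (intro sum.cong refl)
    fix i j assume "i \<in> {..<n}" "j \<in> {..<n}"
    then show "(\<integral>\<^sup>+p. ennreal (f i j) * indicator (cell n i j) p \<partial>Q) = ennreal (f i j * (S / n * (T / n)))"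
      using S_pos T_pos ennreal_mult[OF assms[of i j], of "S / n * (T / n)"]
      by (simp only: nn_integral_cmult_indicator cell_sets lessThan_iff emeasure_cell) simp
  qed
  also have "\<dots> = ennreal (\<Sum>i<n. \<Sum>j<n. f i j * (S / n * (T / n)))"
  proof -
    have 0: "f i j * (S / n * (T / n)) \<ge> 0" for i j using assms S_pos T_pos by simp
    then show ?thesis by (simp only: sum_ennreal sum_nonneg)
  qed
  finally show ?thesis .
qed

lemma ustep_power2: "0 < n \<Longrightarrow> (ustep n g p)\<^sup>2 = (\<Sum>i<n. \<Sum>j<n. (g (corner n i j))\<^sup>2 * indicator (cell n i j) p)"
proof (cases "\<exists>i<n. \<exists>j<n. p \<in> cell n i j")
  case True
  assume "0 < n"
  moreover obtain i j where ij: "i < n" "j < n" "p \<in> cell n i j" using True by blast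
  ultimately show ?thesis by (simp only: ustep_def ustep_on_cell[OF _ ij])
next
  case False
  have "(\<Sum>i<n. \<Sum>j<n. f i j * indicator (cell n i j) p) = (0::real)" for f :: "nat \<Rightarrow> nat \<Rightarrow> real"
    using False by (intro sum.neutral ballI) auto
  then show ?thesis by (simp add: ustep_def)
qed

lemma ustep_L2[simp]: "0 < n \<Longrightarrow> ustep n g \<in> L2 S T"
  and nrm_ustep: "0 < n \<Longrightarrow> (nrm (ustep n g))\<^sup>2 = (\<Sum>i<n. \<Sum>j<n. (g (corner n i j))\<^sup>2 * (S / n * (T / n)))"
proof -
  assume n: "0 < n"
  let ?s = "\<Sum>i<n. \<Sum>j<n. (g (corner n i j))\<^sup>2 * (S / n * (T / n))"
  have s: "?s \<ge> 0" using S_pos T_pos by (intro sum_nonneg) auto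
  have nn: "(\<integral>\<^sup>+p. ennreal ((ustep n g p)\<^sup>2) \<partial>Q) = ennreal ?s"
    unfolding ustep_power2[OF n] by (rule nn_integral_cells) simp
  show L2: "ustep n g \<in> L2 S T"
    using nn s by (intro L2_nn_integral(1)[of _ "sqrt ?s"]) auto
  show "(nrm (ustep n g))\<^sup>2 = ?s"
    using nn_integral_nrm[OF L2] nn s by simp
qed

text \<open>A box increment at (c k, d l) affects the difference in cell (i, j) only if c k lies in
  column i or d l in row j, which happens for at most 2 n of the n^2 cells. So the sum of
  oscillations is of order n, and after multiplication by the cell area of order 1/n.\<close>

lemma hk_osc_bound:
  assumes V: "\<And>N M c d. is_partition S N c \<Longrightarrow> is_partition T M d \<Longrightarrow>
     (\<Sum>k\<le>N. \<Sum>l\<le>M. \<bar>box_incr (grid_ext g N M c d) k l\<bar>) \<le> V"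
    and n: "0 < n" and P: "\<And>i j. i < n \<Longrightarrow> j < n \<Longrightarrow> P i j \<in> cell n i j"
  shows "(\<Sum>i<n. \<Sum>j<n. \<bar>g (P i j) - g (corner n i j)\<bar>) \<le> 2 * n * V"
proof -
  define A where "A = (\<lambda>(i,j). fst (P i j)) ` ({..<n} \<times> {..<n}) \<union> unode S n ` {..<n}"
  define B where "B = (\<lambda>(i,j). snd (P i j)) ` ({..<n} \<times> {..<n}) \<union> unode T n ` {..<n}"
  have P': "P i j \<in> rect S T" if "i < n" "j < n" for i j using P[OF that] cell_subset[OF that] by blast
  have "A \<subseteq> {0..S}" "B \<subseteq> {0..T}"
    using P' unode_range[OF n S_pos] unode_range[OF n T_pos] by (fastforce simp: A_def B_def rect_def mem_Times_iff)+
  moreover have "finite A" "finite B" by (auto simp: A_def B_def)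
  ultimately obtain N c M d where c: "is_partition S N c" "A \<subseteq> c ` {..N}" and d: "is_partition T M d" "B \<subseteq> d ` {..M}"
    using partition_containing[of A S] partition_containing[of B T] S_pos T_pos by metis
  let ?B = "\<lambda>k l. box_incr (grid_ext g N M c d) k l"
  define I where "I i k \<longleftrightarrow> c k \<in> {unode S n i ..< unode S n (Suc i)}" for i k
  define J where "J j l \<longleftrightarrow> d l \<in> {unode T n j ..< unode T n (Suc j)}" for j l
  have "\<bar>g (P i j) - g (corner n i j)\<bar> \<le> (\<Sum>k\<le>N. \<Sum>l\<le>M. (of_bool (I i k) + of_bool (J j l)) * \<bar>?B k l\<bar>)"
    if ij: "i < n" "j < n" for i j
  proof -
    obtain s t where st: "P i j = (s, t)" by fastforce
    have s: "unode S n i \<le> s" "s < unode S n (Suc i)" "unode T n j \<le> t" "t < unode T n (Suc j)"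
      using P[OF ij] st by (auto simp: cell_def)
    have mem: "s \<in> c ` {..N}" "t \<in> d ` {..M}" "unode S n i \<in> c ` {..N}" "unode T n j \<in> d ` {..M}"
    proof -
      have "s \<in> A" "t \<in> B"
        using ij st by (force simp: A_def B_def)+
      moreover have "unode S n i \<in> A" "unode T n j \<in> B" using ij by (auto simp: A_def B_def)
      ultimately show "s \<in> c ` {..N}" "t \<in> d ` {..M}" "unode S n i \<in> c ` {..N}" "unode T n j \<in> d ` {..M}"
        using c d by auto
    qed
    have eq: "g (P i j) - g (corner n i j) = (\<Sum>k\<le>N. \<Sum>l\<le>M. (of_bool (s \<le> c k) * of_bool (t \<le> d l)
        - of_bool (unode S n i \<le> c k) * of_bool (unode T n j \<le> d l)) * ?B k l)"
      unfolding st corner_def grid_representation[OF c(1) d(1) mem(1,2)] grid_representation[OF c(1) d(1) mem(3,4)]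
      by (simp only: sum_subtractf left_diff_distrib)
    have "\<bar>g (P i j) - g (corner n i j)\<bar> \<le> (\<Sum>k\<le>N. \<bar>\<Sum>l\<le>M. (of_bool (s \<le> c k) * of_bool (t \<le> d l)
        - of_bool (unode S n i \<le> c k) * of_bool (unode T n j \<le> d l)) * ?B k l\<bar>)"
      unfolding eq by (rule sum_abs)
    also have "\<dots> \<le> (\<Sum>k\<le>N. \<Sum>l\<le>M. \<bar>(of_bool (s \<le> c k) * of_bool (t \<le> d l)
        - of_bool (unode S n i \<le> c k) * of_bool (unode T n j \<le> d l)) * ?B k l\<bar>)"
      by (intro sum_mono sum_abs)
    also have "\<dots> \<le> (\<Sum>k\<le>N. \<Sum>l\<le>M. (of_bool (I i k) + of_bool (J j l)) * \<bar>?B k l\<bar>)"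
    proof (intro sum_mono)
      fix k l
      \<comment> \<open>The two products can differ only if c k separates s from its node or d l
        separates t from its node.\<close>
      have "\<bar>of_bool (s \<le> c k) * of_bool (t \<le> d l) - of_bool (unode S n i \<le> c k) * of_bool (unode T n j \<le> d l)\<bar>
          \<le> (of_bool (I i k) + of_bool (J j l) :: real)"
        unfolding I_def J_def of_bool_def using s by simp
      then show "\<bar>(of_bool (s \<le> c k) * of_bool (t \<le> d l) - of_bool (unode S n i \<le> c k) * of_bool (unode T n j \<le> d l)) * ?B k l\<bar>
          \<le> (of_bool (I i k) + of_bool (J j l)) * \<bar>?B k l\<bar>"
        unfolding abs_mult by (intro mult_right_mono) auto
    qed
    finally show ?thesis .
  qed
  then have "(\<Sum>i<n. \<Sum>j<n. \<bar>g (P i j) - g (corner n i j)\<bar>) \<le>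
      (\<Sum>i<n. \<Sum>j<n. \<Sum>k\<le>N. \<Sum>l\<le>M. (of_bool (I i k) + of_bool (J j l)) * \<bar>?B k l\<bar>)"
    by (intro sum_mono) auto
  also have "\<dots> = (\<Sum>i<n. \<Sum>k\<le>N. \<Sum>j<n. \<Sum>l\<le>M. (of_bool (I i k) + of_bool (J j l)) * \<bar>?B k l\<bar>)"
    by (intro sum.cong refl sum.swap)
  also have "\<dots> = (\<Sum>k\<le>N. \<Sum>i<n. \<Sum>j<n. \<Sum>l\<le>M. (of_bool (I i k) + of_bool (J j l)) * \<bar>?B k l\<bar>)"
    by (rule sum.swap)
  also have "\<dots> = (\<Sum>k\<le>N. \<Sum>i<n. \<Sum>l\<le>M. \<Sum>j<n. (of_bool (I i k) + of_bool (J j l)) * \<bar>?B k l\<bar>)"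
    by (intro sum.cong refl sum.swap)
  also have "\<dots> = (\<Sum>k\<le>N. \<Sum>l\<le>M. \<Sum>i<n. \<Sum>j<n. (of_bool (I i k) + of_bool (J j l)) * \<bar>?B k l\<bar>)"
    by (intro sum.cong refl sum.swap)
  also have "\<dots> \<le> (\<Sum>k\<le>N. \<Sum>l\<le>M. (2 * n) * \<bar>?B k l\<bar>)"
  proof (intro sum_mono)
    fix k l
    have "(\<Sum>i<n. of_bool (I i k) :: real) \<le> 1" "(\<Sum>j<n. of_bool (J j l) :: real) \<le> 1"
      using unode_interval_unique[OF S_pos n] unode_interval_unique[OF T_pos n]
      by (auto intro!: sum_of_bool_le_1 simp: I_def J_def simp del: sum_of_bool_eq)
    then have "real n * (\<Sum>i<n. of_bool (I i k)) + real n * (\<Sum>j<n. of_bool (J j l)) \<le> real n * 1 + real n * 1"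
      by (intro add_mono mult_left_mono) auto
    then have "(\<Sum>i<n. \<Sum>j<n. of_bool (I i k) + of_bool (J j l)) \<le> real (2 * n)"
      by (simp add: sum.distrib sum_distrib_left[symmetric] del: sum_of_bool_eq)
    then have "(\<Sum>i<n. \<Sum>j<n. of_bool (I i k) + of_bool (J j l)) * \<bar>?B k l\<bar> \<le> real (2 * n) * \<bar>?B k l\<bar>"
      by (intro mult_right_mono) auto
    then show "(\<Sum>i<n. \<Sum>j<n. (of_bool (I i k) + of_bool (J j l)) * \<bar>?B k l\<bar>) \<le> (2 * n) * \<bar>?B k l\<bar>"
      by (simp only: sum_distrib_right of_nat_mult of_nat_numeral)
  qed
  also have "\<dots> = 2 * n * (\<Sum>k\<le>N. \<Sum>l\<le>M. \<bar>?B k l\<bar>)" by (simp add: sum_distrib_left)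
  also have "\<dots> \<le> 2 * n * V" using V[OF c(1) d(1)] by (intro mult_left_mono) auto
  finally show ?thesis .
qed

lemma hk_bounded:
  assumes V: "\<And>N M c d. is_partition S N c \<Longrightarrow> is_partition T M d \<Longrightarrow>
     (\<Sum>k\<le>N. \<Sum>l\<le>M. \<bar>box_incr (grid_ext g N M c d) k l\<bar>) \<le> V"
    and p: "p \<in> rect S T"
  shows "\<bar>g p\<bar> \<le> V"
proof -
  obtain s t where st: "p = (s, t)" by fastforce
  obtain N c where c: "is_partition S N c" "{s} \<subseteq> c ` {..N}"
    using partition_containing[of "{s}" S] p st S_pos by (auto simp: rect_def)
  obtain M d where d: "is_partition T M d" "{t} \<subseteq> d ` {..M}"
    using partition_containing[of "{t}" T] p st T_pos by (auto simp: rect_def)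
  let ?B = "\<lambda>k l. box_incr (grid_ext g N M c d) k l"
  have mem: "s \<in> c ` {..N}" "t \<in> d ` {..M}" using c d by auto
  have "\<bar>g p\<bar> \<le> (\<Sum>k\<le>N. \<bar>\<Sum>l\<le>M. of_bool (s \<le> c k) * of_bool (t \<le> d l) * ?B k l\<bar>)"
    unfolding st grid_representation[OF c(1) d(1) mem] by (rule sum_abs)
  also have "\<dots> \<le> (\<Sum>k\<le>N. \<Sum>l\<le>M. \<bar>of_bool (s \<le> c k) * of_bool (t \<le> d l) * ?B k l\<bar>)"
    by (intro sum_mono sum_abs)
  also have "\<dots> \<le> (\<Sum>k\<le>N. \<Sum>l\<le>M. \<bar>?B k l\<bar>)" by (intro sum_mono) (auto simp: of_bool_def)
  also have "\<dots> \<le> V" by (rule V[OF c(1) d(1)])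
  finally show ?thesis .
qed

end

context l2_basis begin

text \<open>Measurability of g is still open at this point. The error is therefore majorised by the
  step function E of cell oscillations, which is measurable by construction and whose integral can
  be estimated.\<close>

lemma hk_step_error:
  assumes g: "bv_hardy_krause S T g"
  obtains V E where "V > 0" "\<And>p. p \<in> rect S T \<Longrightarrow> \<bar>g p\<bar> \<le> V"
    "\<And>n. E n \<in> borel_measurable Q" "\<And>n p. 0 \<le> (E n p :: real)"
    "\<And>n p. 0 < n \<Longrightarrow> p \<in> {0..<S} \<times> {0..<T} \<Longrightarrow> \<bar>g p - ustep n g p\<bar> \<le> E n p"
    "\<And>n. 0 < n \<Longrightarrow> (\<integral>\<^sup>+p. ennreal (E n p) \<partial>Q) \<le> ennreal (3 * V * S * T / real n)"
proof -
  obtain V where V: "V > 0" "\<And>N M c d. is_partition S N c \<Longrightarrow> is_partition T M d \<Longrightarrow>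
     (\<Sum>k\<le>N. \<Sum>l\<le>M. \<bar>box_incr (grid_ext g N M c d) k l\<bar>) \<le> V"
    using bv_hardy_krause_bound[OF g S_pos T_pos] by blast
  have bound: "\<bar>g p\<bar> \<le> V" if "p \<in> rect S T" for p
    by (rule hk_bounded[OF V(2) that])
  define D where "D n i j = (\<lambda>p. \<bar>g p - g (corner n i j)\<bar>) ` cell n i j" for n i j
  define e where "e n i j = (if i < n \<and> j < n then Sup (D n i j) else 0)" for n i j
  have corner: "corner n i j \<in> cell n i j" if "i < n" "j < n" for n i j
  proof -
    have "0 < n" using that by simp
    moreover have "0 < S / n" "0 < T / n" using S_pos T_pos that by auto
    ultimately show ?thesis
      using unode_diff[of n S i] unode_diff[of n T j] by (auto simp: corner_def cell_def)
  qed
  have bdd: "bdd_above (D n i j)" if "i < n" "j < n" for n i j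
  proof (rule bdd_aboveI)
    fix y assume "y \<in> D n i j"
    then obtain p where p: "p \<in> cell n i j" "y = \<bar>g p - g (corner n i j)\<bar>" by (auto simp: D_def)
    have "\<bar>g p\<bar> \<le> V" "\<bar>g (corner n i j)\<bar> \<le> V"
      using p corner[OF that] cell_subset[OF that] by (auto intro!: bound)
    then show "y \<le> V + V" using p(2) by linarith
  qed
  have ne: "D n i j \<noteq> {}" if "i < n" "j < n" for n i j using corner[OF that] by (auto simp: D_def)
  have e_upper: "\<bar>g p - g (corner n i j)\<bar> \<le> e n i j" if "i < n" "j < n" "p \<in> cell n i j" for n i j p
  proof -
    have "\<bar>g p - g (corner n i j)\<bar> \<in> D n i j" using that by (auto simp: D_def)
    then show ?thesis using cSup_upper[OF _ bdd[OF that(1,2)]] that by (simp add: e_def)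
  qed
  have e_nonneg: "0 \<le> e n i j" for n i j
  proof (cases "i < n \<and> j < n")
    case True
    then show ?thesis using e_upper[of i n j "corner n i j"] corner[of i n j] by simp
  qed (auto simp: e_def)
  define E where "E n p = (\<Sum>i<n. \<Sum>j<n. e n i j * indicator (cell n i j) p)" for n p
  show ?thesis
  proof (rule that[of V E])
    show "V > 0" by (rule V(1))
    show "\<bar>g p\<bar> \<le> V" if "p \<in> rect S T" for p by (rule bound[OF that])
    show "E n \<in> borel_measurable Q" for n
      unfolding E_def[abs_def]
      by (intro borel_measurable_sum borel_measurable_times borel_measurable_const borel_measurable_indicator cell_sets) auto
    show "0 \<le> E n p" for n p
      unfolding E_def by (intro sum_nonneg mult_nonneg_nonneg e_nonneg indicator_pos_le)
    show "\<bar>g p - ustep n g p\<bar> \<le> E n p" if n: "0 < n" and p: "p \<in> {0..<S} \<times> {0..<T}" for n p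
    proof -
      obtain i j where ij: "i < n" "j < n" "p \<in> cell n i j" by (rule cell_ex[OF n p])
      show ?thesis
        unfolding ustep_def E_def ustep_on_cell[OF n ij] by (rule e_upper[OF ij])
    qed
    show "(\<integral>\<^sup>+p. ennreal (E n p) \<partial>Q) \<le> ennreal (3 * V * S * T / real n)" if n: "0 < n" for n
    proof -
      \<comment> \<open>In each cell a point nearly attains the supremum. A loss of V / n in each of
        n^2 cells adds n * V to the bound 2 * n * V, whence the factor 3.\<close>
      have "\<exists>p\<in>cell n i j. e n i j - V / n \<le> \<bar>g p - g (corner n i j)\<bar>" if i: "i < n" and j: "j < n" for i j
      proof -
        have "e n i j - V / n < Sup (D n i j)" using i j V(1) n by (simp add: e_def)
        then obtain y where "y \<in> D n i j" "e n i j - V / n < y"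
          using less_cSup_iff[OF ne[OF i j] bdd[OF i j]] by blast
        then show ?thesis by (force simp: D_def)
      qed
      then obtain P where P: "\<And>i j. i < n \<Longrightarrow> j < n \<Longrightarrow> P i j \<in> cell n i j"
        "\<And>i j. i < n \<Longrightarrow> j < n \<Longrightarrow> e n i j - V / n \<le> \<bar>g (P i j) - g (corner n i j)\<bar>"
        by metis
      have "(\<Sum>i<n. \<Sum>j<n. e n i j) \<le> (\<Sum>i<n. \<Sum>j<n. \<bar>g (P i j) - g (corner n i j)\<bar> + V / n)"
        using P(2) by (intro sum_mono) (simp add: algebra_simps)
      also have "\<dots> = (\<Sum>i<n. \<Sum>j<n. \<bar>g (P i j) - g (corner n i j)\<bar>) + n * V"
        using n by (simp add: sum.distrib)
      also have "\<dots> \<le> 2 * n * V + n * V"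
        by (intro add_right_mono hk_osc_bound[OF V(2) n P(1)])
      finally have "(\<Sum>i<n. \<Sum>j<n. e n i j) \<le> 3 * n * V" by (simp add: algebra_simps)
      then have "(\<Sum>i<n. \<Sum>j<n. e n i j) * (S / n * (T / n)) \<le> 3 * n * V * (S / n * (T / n))"
        using S_pos T_pos by (intro mult_right_mono) auto
      also have "\<dots> = 3 * V * S * T / n" using n by (simp add: field_simps)
      finally have "(\<Sum>i<n. \<Sum>j<n. e n i j * (S / n * (T / n))) \<le> 3 * V * S * T / n"
        by (simp only: sum_distrib_right)
      then show ?thesis
        unfolding E_def by (subst nn_integral_cells[OF e_nonneg]) (rule ennreal_leI)
    qed
  qed
qed

text \<open>Along n = 2^k the integrals of the error bounds are summable, so the step functions
  converge to g almost everywhere. Completeness of Lebesgue measure then makes g itself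
  measurable.\<close>

lemma hk_measurable:
  assumes g: "bv_hardy_krause S T g"
  shows "g \<in> borel_measurable Q"
proof -
  obtain V E where VE: "V > 0" "\<And>p. p \<in> rect S T \<Longrightarrow> \<bar>g p\<bar> \<le> V"
    "\<And>n. E n \<in> borel_measurable Q" "\<And>n p. 0 \<le> (E n p :: real)"
    "\<And>n p. 0 < n \<Longrightarrow> p \<in> {0..<S} \<times> {0..<T} \<Longrightarrow> \<bar>g p - ustep n g p\<bar> \<le> E n p"
    "\<And>n. 0 < n \<Longrightarrow> (\<integral>\<^sup>+p. ennreal (E n p) \<partial>Q) \<le> ennreal (3 * V * S * T / real n)"
    by (rule hk_step_error[OF g]) blast
  have [measurable]: "\<And>n. E n \<in> borel_measurable Q" by (rule VE(3))
  define C where "C = 3 * V * S * T"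
  have C: "C \<ge> 0" using VE(1) S_pos T_pos by (simp add: C_def)
  have "(\<integral>\<^sup>+p. (\<Sum>k. ennreal (E (2^k) p)) \<partial>Q) = (\<Sum>k. \<integral>\<^sup>+p. ennreal (E (2^k) p) \<partial>Q)"
    by (intro nn_integral_suminf) measurable
  also have "\<dots> \<le> (\<Sum>k. ennreal (C * (1/2)^k))"
  proof (intro suminf_le summableI)
    fix k
    have "C / real (2^k) = C * (1/2)^k" by (simp add: power_one_over)
    then show "(\<integral>\<^sup>+p. ennreal (E (2^k) p) \<partial>Q) \<le> ennreal (C * (1/2)^k)"
      using VE(6)[of "2^k"] unfolding C_def by simp
  qed
  also have "\<dots> = ennreal (\<Sum>k. C * (1/2)^k)"
    using C by (intro suminf_ennreal2 summable_mult summable_geometric) auto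
  also have "\<dots> < \<infinity>" by simp
  finally have fin: "(\<integral>\<^sup>+p. (\<Sum>k. ennreal (E (2^k) p)) \<partial>Q) \<noteq> \<infinity>" by simp
  have "AE p in Q. (\<Sum>k. ennreal (E (2^k) p)) \<noteq> \<infinity>"
    by (rule nn_integral_noteq_infinite[OF _ fin]) measurable
  then have lim: "AE p in Q. (\<lambda>k. ustep (2^k) g p) \<longlonglongrightarrow> g p"
    using AE_interior
  proof eventually_elim
    case (elim p)
    have "summable (\<lambda>k. E (2^k) p)"
      using VE(4) elim(1) by (intro summable_suminf_not_top) auto
    then have "(\<lambda>k. E (2^k) p) \<longlonglongrightarrow> 0" by (rule summable_LIMSEQ_zero)
    moreover have "norm (ustep (2^k) g p - g p) \<le> E (2^k) p" for k
      using VE(5)[OF _ elim(2), of "2^k"] by (simp add: abs_minus_commute)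
    then have "\<forall>\<^sub>F k in sequentially. norm (ustep (2^k) g p - g p) \<le> E (2^k) p"
      by (rule always_eventually[OF allI])
    ultimately have "(\<lambda>k. ustep (2^k) g p - g p) \<longlonglongrightarrow> 0"
      by (rule Lim_null_comparison[rotated])
    then show ?case by (simp add: LIM_zero_iff)
  qed
  define g' where "g' p = lim (\<lambda>k. ustep (2^k) g p)" for p
  have g': "g' \<in> borel_measurable Q"
    unfolding g'_def[abs_def] by (intro borel_measurable_lim_metric) measurable
  have eq: "AE p in Q. g' p = g p" using lim by eventually_elim (simp add: g'_def limI)
  show ?thesis
  proof (rule measurableI)
    fix A :: "real set" assume A: "A \<in> sets borel"
    show "g -` A \<inter> space Q \<in> sets Q"
    proof (rule complete_measure.in_sets_AE[OF complete_Q])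
      show "g' -` A \<inter> space Q \<in> sets Q" using measurable_sets[OF g' A] .
      show "AE p in Q. (p \<in> g' -` A \<inter> space Q) = (p \<in> g -` A \<inter> space Q)"
        using eq by eventually_elim auto
    qed auto
  qed simp
qed

lemma hk_L2_mult:
  assumes g: "bv_hardy_krause S T g" and u: "u \<in> L2 S T"
  shows "(\<lambda>p. u p * g p) \<in> L2 S T"
proof -
  obtain V E where VE: "V > 0" "\<And>p. p \<in> rect S T \<Longrightarrow> \<bar>g p\<bar> \<le> V"
    by (rule hk_step_error[OF g]) blast
  show ?thesis by (rule L2_mult_bounded[OF u hk_measurable[OF g] VE(2)])
qed

lemma hk_L2: "bv_hardy_krause S T g \<Longrightarrow> g \<in> L2 S T"
  using hk_L2_mult[OF _ L2_const[of 1], of g] by simp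

lemma ustep_tendsto:
  assumes g: "bv_hardy_krause S T g"
  shows "(\<lambda>n. nrm (\<lambda>p. g p - ustep n g p)) \<longlonglongrightarrow> 0"
proof -
  obtain V E where VE: "V > 0" "\<And>p. p \<in> rect S T \<Longrightarrow> \<bar>g p\<bar> \<le> V"
    "\<And>n. E n \<in> borel_measurable Q" "\<And>n p. 0 \<le> (E n p :: real)"
    "\<And>n p. 0 < n \<Longrightarrow> p \<in> {0..<S} \<times> {0..<T} \<Longrightarrow> \<bar>g p - ustep n g p\<bar> \<le> E n p"
    "\<And>n. 0 < n \<Longrightarrow> (\<integral>\<^sup>+p. ennreal (E n p) \<partial>Q) \<le> ennreal (3 * V * S * T / real n)"
    by (rule hk_step_error[OF g]) blast
  have [measurable]: "g \<in> borel_measurable Q" by (rule hk_measurable[OF g])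
  have [measurable]: "\<And>n. E n \<in> borel_measurable Q" by (rule VE(3))
  \<comment> \<open>Both g and the step function are bounded by V, so the squared error is at most 2
    * V times \<open>E n\<close>, whose integral is at most 3 * V * S * T / n.\<close>
  define C where "C = 6 * V\<^sup>2 * S * T"
  have C: "C \<ge> 0" using VE(1) S_pos T_pos by (simp add: C_def)
  have le: "nrm (\<lambda>p. g p - ustep n g p) \<le> sqrt (C / n)" if n: "0 < n" for n
  proof (rule L2_nn_integral(2))
    have "(\<integral>\<^sup>+p. ennreal ((g p - ustep n g p)\<^sup>2) \<partial>Q) \<le> (\<integral>\<^sup>+p. ennreal (2 * V) * ennreal (E n p) \<partial>Q)"
    proof (rule nn_integral_mono_AE, use AE_interior in eventually_elim)
      fix p assume p: "p \<in> {0..<S} \<times> {0..<T}"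
      obtain i j where ij: "i < n" "j < n" "p \<in> cell n i j" by (rule cell_ex[OF n p])
      have "\<bar>ustep n g p\<bar> \<le> V"
        unfolding ustep_def ustep_on_cell[OF n ij] corner_def
        using unode_range[OF n S_pos, of i] unode_range[OF n T_pos, of j] ij by (intro VE(2)) (auto simp: rect_def)
      moreover have "\<bar>g p\<bar> \<le> V" using p by (intro VE(2)) (auto simp: rect_def)
      ultimately have "\<bar>g p - ustep n g p\<bar> \<le> 2 * V" by linarith
      then have "\<bar>g p - ustep n g p\<bar> * \<bar>g p - ustep n g p\<bar> \<le> 2 * V * E n p"
        using VE(1) VE(5)[OF n p] by (intro mult_mono) auto
      then have "(g p - ustep n g p)\<^sup>2 \<le> 2 * V * E n p" by (simp add: power2_eq_square)
      then show "ennreal ((g p - ustep n g p)\<^sup>2) \<le> ennreal (2 * V) * ennreal (E n p)"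
        using VE(1) VE(4)[of n p] by (subst ennreal_mult[symmetric]) (auto intro: ennreal_leI)
    qed
    also have "\<dots> = ennreal (2 * V) * (\<integral>\<^sup>+p. ennreal (E n p) \<partial>Q)"
      by (intro nn_integral_cmult) measurable
    also have "\<dots> \<le> ennreal (2 * V) * ennreal (3 * V * S * T / real n)"
      by (intro mult_left_mono VE(6) n) auto
    also have "\<dots> = ennreal (2 * V * (3 * V * S * T / real n))"
      using VE(1) S_pos T_pos by (intro ennreal_mult[symmetric]) auto
    also have "2 * V * (3 * V * S * T / real n) = (sqrt (C / n))\<^sup>2"
      using C by (simp add: C_def power2_eq_square)
    finally show "(\<integral>\<^sup>+p. ennreal ((g p - ustep n g p)\<^sup>2) \<partial>Q) \<le> ennreal ((sqrt (C / n))\<^sup>2)" .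
  qed (use C in auto)
  have "(\<lambda>n. sqrt (C / real n)) \<longlonglongrightarrow> sqrt 0"
    by (intro tendsto_real_sqrt lim_const_over_n)
  then have lim0: "(\<lambda>n. sqrt (C / real n)) \<longlonglongrightarrow> 0" by simp
  show ?thesis
  proof (rule tendsto_sandwich[OF _ _ tendsto_const lim0])
    show "\<forall>\<^sub>F n in sequentially. nrm (\<lambda>p. g p - ustep n g p) \<le> sqrt (C / real n)"
      using eventually_gt_at_top[of 0] by eventually_elim (rule le)
  qed simp
qed

lemma nrm_scale: "nrm (\<lambda>p. c * u p) = \<bar>c\<bar> * nrm u"
  by (simp add: norm2_def ip_scale_scale real_sqrt_mult)

lemma nrm_sum_le:
  assumes "finite J" "\<And>j. j \<in> J \<Longrightarrow> u j \<in> L2 S T"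
  shows "nrm (\<lambda>p. \<Sum>j\<in>J. u j p) \<le> (\<Sum>j\<in>J. nrm (u j))"
  using assms
proof (induction J)
  case empty
  then show ?case by (simp add: norm2_def inner2_def)
next
  case (insert j J)
  have "nrm (\<lambda>p. u j p + (\<Sum>j\<in>J. u j p)) \<le> nrm (u j) + nrm (\<lambda>p. \<Sum>j\<in>J. u j p)"
    using insert by (intro nrm_triangle L2_sum) auto
  then show ?case using insert by auto
qed

lemma ustep_comb: "ustep n (comb c J) p = (\<Sum>j\<in>J. c j * ustep n (\<phi> j) p)"
proof -
  have "ustep n (comb c J) p = (\<Sum>i<n. \<Sum>k<n. \<Sum>j\<in>J. c j * (\<phi> j (corner n i k) * indicator (cell n i k) p))"
    by (simp only: ustep_def comb_def sum_distrib_right mult.assoc)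
  also have "\<dots> = (\<Sum>i<n. \<Sum>j\<in>J. \<Sum>k<n. c j * (\<phi> j (corner n i k) * indicator (cell n i k) p))"
    by (intro sum.cong refl sum.swap)
  also have "\<dots> = (\<Sum>j\<in>J. \<Sum>i<n. \<Sum>k<n. c j * (\<phi> j (corner n i k) * indicator (cell n i k) p))"
    by (rule sum.swap)
  finally show ?thesis by (simp only: ustep_def sum_distrib_left)
qed

lemma \<phi>_hk: "bv_hardy_krause S T (\<phi> j)"
  using basis by (simp add: bv_complete_orthonormal_def)

text \<open>The left side will be the variance of a uniform sum, the limit the variance of a
  combination of independent standard normals.\<close>

lemma nrm_ustep_comb_tendsto:
  assumes J: "finite J"
  shows "(\<lambda>n. (nrm (ustep n (comb c J)))\<^sup>2) \<longlonglongrightarrow> (\<Sum>j\<in>J. (c j)\<^sup>2)"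
proof -
  have "(\<lambda>n. \<Sum>j\<in>J. \<bar>c j\<bar> * nrm (\<lambda>p. \<phi> j p - ustep n (\<phi> j) p)) \<longlonglongrightarrow> (\<Sum>j\<in>J. \<bar>c j\<bar> * 0)"
    by (intro tendsto_sum tendsto_mult tendsto_const ustep_tendsto \<phi>_hk)
  then have lim0: "(\<lambda>n. \<Sum>j\<in>J. \<bar>c j\<bar> * nrm (\<lambda>p. \<phi> j p - ustep n (\<phi> j) p)) \<longlonglongrightarrow> 0" by simp
  have "\<bar>nrm (ustep n (comb c J)) - nrm (comb c J)\<bar> \<le> (\<Sum>j\<in>J. \<bar>c j\<bar> * nrm (\<lambda>p. \<phi> j p - ustep n (\<phi> j) p))"
    if n: "0 < n" for n
  proof -
    have eq: "(\<lambda>p. comb c J p - ustep n (comb c J) p) = (\<lambda>p. \<Sum>j\<in>J. c j * (\<phi> j p - ustep n (\<phi> j) p))"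
      unfolding ustep_comb by (simp add: comb_def sum_subtractf right_diff_distrib)
    have "nrm (\<lambda>p. comb c J p - ustep n (comb c J) p) \<le> (\<Sum>j\<in>J. nrm (\<lambda>p. c j * (\<phi> j p - ustep n (\<phi> j) p)))"
      unfolding eq using J n by (intro nrm_sum_le L2_scale L2_diff) auto
    also have "\<dots> = (\<Sum>j\<in>J. \<bar>c j\<bar> * nrm (\<lambda>p. \<phi> j p - ustep n (\<phi> j) p))" by (simp only: nrm_scale)
    finally have le: "nrm (\<lambda>p. comb c J p - ustep n (comb c J) p) \<le> \<dots>" .
    have "nrm (comb c J) \<le> nrm (\<lambda>p. comb c J p - ustep n (comb c J) p) + nrm (ustep n (comb c J))"
      using nrm_triangle[OF L2_diff[OF comb_L2[of c J] ustep_L2[OF n, of "comb c J"]] ustep_L2[OF n, of "comb c J"]] by simp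
    moreover have "nrm (ustep n (comb c J)) \<le> nrm (\<lambda>p. comb c J p - ustep n (comb c J) p) + nrm (comb c J)"
      using nrm_triangle[OF L2_diff[OF ustep_L2[OF n, of "comb c J"] comb_L2[of c J]] comb_L2[of c J]] nrm_minus_commute[of "comb c J" "ustep n (comb c J)"] by simp
    ultimately show ?thesis using le by linarith
  qed
  then have "\<forall>\<^sub>F n in sequentially. norm (nrm (ustep n (comb c J)) - nrm (comb c J)) \<le> (\<Sum>j\<in>J. \<bar>c j\<bar> * nrm (\<lambda>p. \<phi> j p - ustep n (\<phi> j) p))"
    using eventually_mono[OF eventually_gt_at_top[of "0::nat"]] by simp
  from Lim_null_comparison[OF this lim0] have "(\<lambda>n. nrm (ustep n (comb c J))) \<longlonglongrightarrow> nrm (comb c J)"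
    by (simp add: LIM_zero_iff)
  then have "(\<lambda>n. (nrm (ustep n (comb c J)))\<^sup>2) \<longlonglongrightarrow> (nrm (comb c J))\<^sup>2" by (rule tendsto_power)
  then show ?thesis by (simp add: nrm_comb[OF J])
qed

end

section \<open>Independence from characteristic functions\<close>

context prob_space begin

text \<open>Change of measure: under the density (2 + Y) / c, where c normalises the mass,
  hypothesis \<open>h\<close> says that Z keeps its characteristic function, so by Levy's uniqueness
  theorem it keeps its law. Comparing the two laws on B gives the claim. The shift by 2 makes the
  density positive, as |Y| <= 1.\<close>

lemma char_factor_real:
  fixes Y Z :: "'a \<Rightarrow> real"
  assumes Z[measurable]: "Z \<in> borel_measurable M" and Y[measurable]: "Y \<in> borel_measurable M"
    and Y1: "\<And>x. \<bar>Y x\<bar> \<le> 1"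
    and h: "\<And>t. (LINT x|M. of_real (Y x) * iexp (t * Z x)) = of_real (LINT x|M. Y x) * (LINT x|M. iexp (t * Z x))"
    and B[measurable]: "B \<in> sets borel"
  shows "(LINT x|M. Y x * indicator B (Z x)) = (LINT x|M. Y x) * prob (Z -` B \<inter> space M)"
proof -
  have iY: "integrable M Y" by (rule integrable_const_bound[where B=1]) (use Y1 in auto)
  define c where "c = 2 + (LINT x|M. Y x)"
  have "(LINT x|M. Y x) \<ge> (LINT x|M. -1)"
  proof (intro integral_mono iY integrable_const)
    show "-1 \<le> Y x" for x using Y1[of x] by linarith
  qed
  then have c: "c \<ge> 1" by (simp add: c_def prob_space)
  define D where "D x = (2 + Y x) / c" for x
  have D0: "D x \<ge> 0" for x
    using Y1[of x] c by (simp add: D_def abs_le_iff)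
  have [measurable]: "D \<in> borel_measurable M" unfolding D_def[abs_def] by measurable
  have iD: "integrable M D" unfolding D_def[abs_def] using iY by (intro integrable_divide Bochner_Integration.integrable_add) auto
  have ED: "(LINT x|M. D x) = 1"
    unfolding D_def[abs_def] using iY c by (simp add: prob_space c_def)
  define N where "N = density M (\<lambda>x. ennreal (D x))"
  have sN[simp]: "space N = space M" "sets N = sets M" by (auto simp: N_def)
  have "emeasure N (space N) = (\<integral>\<^sup>+x. ennreal (D x) * indicator (space M) x \<partial>M)"
    unfolding N_def by (subst emeasure_density) auto
  also have "\<dots> = (\<integral>\<^sup>+x. ennreal (D x) \<partial>M)"
    by (intro nn_integral_cong) auto
  also have "\<dots> = 1" using iD D0 by (simp add: nn_integral_eq_integral ED)
  finally interpret N: prob_space N by (rule prob_spaceI)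
  have ZN: "Z \<in> borel_measurable N" using Z by (simp add: measurable_cong_sets[of N M borel borel])
  have ie: "integrable M (\<lambda>x. iexp (t * Z x))" for t
    by (rule integrable_const_bound[where B=1]) auto
  have iYe: "integrable M (\<lambda>x. of_real (Y x) * iexp (t * Z x))" for t
    by (rule integrable_const_bound[where B=1]) (use Y1 in \<open>auto simp: norm_mult\<close>)
  have "char (distr N borel Z) t = char (distr M borel Z) t" for t
  proof -
    have "char (distr N borel Z) t = (LINT x|N. iexp (t * Z x))"
      unfolding char_def using ZN by (subst integral_distr) auto
    also have "\<dots> = (LINT x|M. D x *\<^sub>R iexp (t * Z x))"
      unfolding N_def by (intro integral_density) (use D0 in auto)
    also have "\<dots> = (LINT x|M. (2 * iexp (t * Z x) + of_real (Y x) * iexp (t * Z x)) / of_real c)"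
      by (intro Bochner_Integration.integral_cong) (auto simp: D_def scaleR_conv_of_real distrib_right add_divide_distrib)
    also have "\<dots> = (2 * (LINT x|M. iexp (t * Z x)) + (LINT x|M. of_real (Y x) * iexp (t * Z x))) / of_real c"
      using ie[of t] iYe[of t] by simp
    also have "\<dots> = (2 * (LINT x|M. iexp (t * Z x)) + of_real (LINT x|M. Y x) * (LINT x|M. iexp (t * Z x))) / of_real c"
      by (simp only: h)
    also have "\<dots> = (of_real c * (LINT x|M. iexp (t * Z x))) / of_real c"
      by (simp only: c_def of_real_add of_real_numeral distrib_right)
    also have "\<dots> = (LINT x|M. iexp (t * Z x))" using c by simp
    also have "\<dots> = char (distr M borel Z) t"
      unfolding char_def by (subst integral_distr) auto
    finally show ?thesis .
  qed
  then have "char (distr N borel Z) = char (distr M borel Z)" by blast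
  moreover have "real_distribution (distr N borel Z)" by (rule N.real_distribution_distr[OF ZN])
  moreover have "real_distribution (distr M borel Z)" by (rule real_distribution_distr[OF Z])
  ultimately have eq: "distr N borel Z = distr M borel Z" by (intro Levy_uniqueness)
  have iYB: "integrable M (\<lambda>x. Y x * indicator B (Z x))"
    by (rule integrable_const_bound[where B=1]) (use Y1 in \<open>auto simp: indicator_def abs_mult\<close>)
  have iB: "integrable M (\<lambda>x. indicator B (Z x) :: real)"
    by (rule integrable_const_bound[where B=1]) (auto simp: indicator_def)
  have P: "(LINT x|M. indicator B (Z x)) = prob (Z -` B \<inter> space M)"
  proof -
    have "(LINT x|M. indicator B (Z x) :: real) = (LINT x|M. indicator (Z -` B \<inter> space M) x)"
      by (intro Bochner_Integration.integral_cong) (auto simp: indicator_def)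
    then show ?thesis by simp
  qed
  have "(LINT x|N. indicator B (Z x)) = (LINT z|distr N borel Z. indicator B z :: real)"
    using ZN by (subst integral_distr) auto
  also have "\<dots> = (LINT x|M. indicator B (Z x))"
    unfolding eq by (subst integral_distr) auto
  finally have "prob (Z -` B \<inter> space M) = (LINT x|N. indicator B (Z x))" by (simp only: P)
  also have "\<dots> = (LINT x|M. D x *\<^sub>R indicator B (Z x))"
    unfolding N_def by (intro integral_density) (use D0 in auto)
  also have "\<dots> = (LINT x|M. (2 * indicator B (Z x) + Y x * indicator B (Z x)) / c)"
    by (intro Bochner_Integration.integral_cong) (auto simp: D_def distrib_right add_divide_distrib)
  also have "\<dots> = (2 * prob (Z -` B \<inter> space M) + (LINT x|M. Y x * indicator B (Z x))) / c"
    using iB iYB by (simp add: P)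
  finally have "c * prob (Z -` B \<inter> space M) = 2 * prob (Z -` B \<inter> space M) + (LINT x|M. Y x * indicator B (Z x))"
    using c by (simp add: field_simps)
  then show ?thesis by (simp add: c_def distrib_right)
qed

text \<open>Real and imaginary part of Y inherit the hypothesis, because conjugating it at -t gives
  it for the conjugate of Y.\<close>

lemma char_factor:
  fixes Y :: "'a \<Rightarrow> complex" and Z :: "'a \<Rightarrow> real"
  assumes Z[measurable]: "Z \<in> borel_measurable M" and Y[measurable]: "Y \<in> borel_measurable M"
    and Y1: "\<And>x. norm (Y x) \<le> 1"
    and h: "\<And>t. (LINT x|M. Y x * iexp (t * Z x)) = (LINT x|M. Y x) * (LINT x|M. iexp (t * Z x))"
    and B[measurable]: "B \<in> sets borel"
  shows "(LINT x|M. Y x * indicator B (Z x)) = (LINT x|M. Y x) * of_real (prob (Z -` B \<inter> space M))"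
proof -
  let ?\<psi> = "\<lambda>t. LINT x|M. iexp (t * Z x)"
  have iY: "integrable M Y" by (rule integrable_const_bound[where B=1]) (use Y1 in auto)
  have iYe: "integrable M (\<lambda>x. Y x * iexp (t * Z x))" for t
    by (rule integrable_const_bound[where B=1]) (use Y1 in \<open>auto simp: norm_mult\<close>)
  have iYB: "integrable M (\<lambda>x. Y x * indicator B (Z x))"
    by (rule integrable_const_bound[where B=1]) (use Y1 in \<open>auto simp: indicator_def norm_mult\<close>)
  have conj\<psi>: "cnj (?\<psi> (- t)) = ?\<psi> t" for t
  proof -
    have "cnj (?\<psi> (- t)) = (LINT x|M. cnj (iexp (- t * Z x)))" by (rule Bochner_Integration.integral_cnj[symmetric])
    also have "\<dots> = ?\<psi> t" by (intro Bochner_Integration.integral_cong) (auto simp: exp_cnj)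
    finally show ?thesis .
  qed
  have hc: "(LINT x|M. cnj (Y x) * iexp (t * Z x)) = cnj (LINT x|M. Y x) * ?\<psi> t" for t
  proof -
    have "(LINT x|M. cnj (Y x) * iexp (t * Z x)) = (LINT x|M. cnj (Y x * iexp (- t * Z x)))"
      by (intro Bochner_Integration.integral_cong) (auto simp: exp_cnj)
    also have "\<dots> = cnj (LINT x|M. Y x * iexp (- t * Z x))" by (rule Bochner_Integration.integral_cnj)
    also have "\<dots> = cnj (LINT x|M. Y x) * ?\<psi> t" by (simp only: h complex_cnj_mult conj\<psi>)
    finally show ?thesis .
  qed
  have [measurable]: "(\<lambda>x. cnj (Y x)) \<in> borel_measurable M"
    by (intro borel_measurable_continuous_on[OF _ Y] continuous_intros)
  have iYc: "integrable M (\<lambda>x. cnj (Y x) * iexp (t * Z x))" for t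
    by (rule integrable_const_bound[where B=1]) (use Y1 in \<open>auto simp: norm_mult\<close>)
  have re: "(LINT x|M. of_real (Re (Y x)) * iexp (t * Z x)) = of_real (LINT x|M. Re (Y x)) * ?\<psi> t" for t
  proof -
    have "(LINT x|M. of_real (Re (Y x)) * iexp (t * Z x)) =
       (LINT x|M. (Y x * iexp (t * Z x) + cnj (Y x) * iexp (t * Z x)) / 2)"
      by (intro Bochner_Integration.integral_cong) (auto simp: complex_add_cnj distrib_right[symmetric])
    also have "\<dots> = ((LINT x|M. Y x * iexp (t * Z x)) + (LINT x|M. cnj (Y x) * iexp (t * Z x))) / 2"
      using iYe[of t] iYc[of t] by simp
    also have "\<dots> = ((LINT x|M. Y x) * ?\<psi> t + cnj (LINT x|M. Y x) * ?\<psi> t) / 2"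
      by (simp only: h hc)
    also have "\<dots> = of_real (Re (LINT x|M. Y x)) * ?\<psi> t"
      by (simp add: distrib_right[symmetric] complex_add_cnj)
    finally show ?thesis by (simp only: integral_Re[OF iY])
  qed
  have im_eq: "of_real (Im z) * w = (z * w - cnj z * w) / (2 * \<i>)" for z w
  proof -
    have "z * w - cnj z * w = (2 * \<i>) * (of_real (Im z) * w)"
      unfolding left_diff_distrib[symmetric] complex_diff_cnj by simp
    then show ?thesis by simp
  qed
  have im: "(LINT x|M. of_real (Im (Y x)) * iexp (t * Z x)) = of_real (LINT x|M. Im (Y x)) * ?\<psi> t" for t
  proof -
    have "(LINT x|M. of_real (Im (Y x)) * iexp (t * Z x)) =
       (LINT x|M. (Y x * iexp (t * Z x) - cnj (Y x) * iexp (t * Z x)) / (2 * \<i>))"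
    proof (intro Bochner_Integration.integral_cong refl)
      have "of_real (Im z) * w = (z * w - cnj z * w) / (2 * \<i>)" for z w
        by (rule im_eq)
      then show "of_real (Im (Y x)) * iexp (t * Z x) = (Y x * iexp (t * Z x) - cnj (Y x) * iexp (t * Z x)) / (2 * \<i>)" for x .
    qed
    also have "\<dots> = ((LINT x|M. Y x * iexp (t * Z x)) - (LINT x|M. cnj (Y x) * iexp (t * Z x))) / (2 * \<i>)"
      using iYe[of t] iYc[of t] by simp
    also have "\<dots> = ((LINT x|M. Y x) * ?\<psi> t - cnj (LINT x|M. Y x) * ?\<psi> t) / (2 * \<i>)"
      by (simp only: h hc)
    also have "\<dots> = of_real (Im (LINT x|M. Y x)) * ?\<psi> t"
      by (rule im_eq[symmetric])
    finally show ?thesis by (simp only: integral_Im[OF iY])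
  qed
  have R: "(LINT x|M. Re (Y x) * indicator B (Z x)) = (LINT x|M. Re (Y x)) * prob (Z -` B \<inter> space M)"
    by (rule char_factor_real[OF Z _ order_trans[OF abs_Re_le_cmod Y1] re B]) measurable
  have I: "(LINT x|M. Im (Y x) * indicator B (Z x)) = (LINT x|M. Im (Y x)) * prob (Z -` B \<inter> space M)"
    by (rule char_factor_real[OF Z _ order_trans[OF abs_Im_le_cmod Y1] im B]) measurable
  show ?thesis
  proof (rule complex_eqI)
    have "Re (LINT x|M. Y x * indicator B (Z x)) = (LINT x|M. Re (Y x) * indicator B (Z x))"
      unfolding integral_Re[OF iYB, symmetric] by (intro Bochner_Integration.integral_cong) (auto simp: indicator_def)
    then show "Re (LINT x|M. Y x * indicator B (Z x)) = Re ((LINT x|M. Y x) * of_real (prob (Z -` B \<inter> space M)))"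
      by (simp add: R integral_Re[OF iY])
    have "Im (LINT x|M. Y x * indicator B (Z x)) = (LINT x|M. Im (Y x) * indicator B (Z x))"
      unfolding integral_Im[OF iYB, symmetric] by (intro Bochner_Integration.integral_cong) (auto simp: indicator_def)
    then show "Im (LINT x|M. Y x * indicator B (Z x)) = Im ((LINT x|M. Y x) * of_real (prob (Z -` B \<inter> space M)))"
      by (simp add: I integral_Im[OF iY])
  qed
qed

text \<open>Induction on \<open>k\<close> trades the characters for indicators one coordinate at a time.\<close>

lemma joint_char_indicator:
  fixes X :: "nat \<Rightarrow> 'a \<Rightarrow> real"
  assumes X[measurable]: "\<And>j. X j \<in> borel_measurable M"
    and H: "\<And>n c. (LINT x|M. iexp (\<Sum>j<n. c j * X j x)) = (\<Prod>j<n. LINT x|M. iexp (c j * X j x))"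
    and B: "\<And>j. B j \<in> sets borel" and "k \<le> n"
  shows "(LINT x|M. (\<Prod>j<k. indicator (B j) (X j x)) * iexp (\<Sum>j\<in>{k..<n}. c j * X j x)) =
    (\<Prod>j<k. of_real (prob (X j -` B j \<inter> space M))) * (\<Prod>j\<in>{k..<n}. LINT x|M. iexp (c j * X j x))"
  using \<open>k \<le> n\<close>
proof (induction k arbitrary: c)
  case 0
  then show ?case by (simp only: lessThan_atLeast0[symmetric] lessThan_0 prod.empty mult_1 H)
next
  case (Suc k)
  then have IH: "(LINT x|M. (\<Prod>j<k. indicator (B j) (X j x)) * iexp (\<Sum>j\<in>{k..<n}. c j * X j x)) =
    (\<Prod>j<k. of_real (prob (X j -` B j \<inter> space M))) * (\<Prod>j\<in>{k..<n}. LINT x|M. iexp (c j * X j x))" for c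
    by simp
  have split: "{k..<n} = insert k {Suc k..<n}" using Suc.prems by auto
  have [measurable]: "B j \<in> sets borel" for j by (rule B)
  define Y where "Y x = (\<Prod>j<k. indicator (B j) (X j x)) * iexp (\<Sum>j\<in>{Suc k..<n}. c j * X j x)" for x
  have Ym: "Y \<in> borel_measurable M" unfolding Y_def[abs_def] by measurable
  have "norm (\<Prod>j<k. indicator (B j) (X j x) :: complex) \<le> 1" for x
    unfolding prod_norm[symmetric] by (intro prod_le_1) (auto simp: indicator_def)
  then have Y1: "norm (Y x) \<le> 1" for x by (simp add: Y_def norm_mult)
  let ?R = "(\<Prod>j<k. of_real (prob (X j -` B j \<inter> space M))) * (\<Prod>j\<in>{Suc k..<n}. LINT x|M. iexp (c j * X j x))"
  have Yt: "(LINT x|M. Y x * iexp (t * X k x)) = ?R * (LINT x|M. iexp (t * X k x))" for t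
  proof -
    have "Y x * iexp (t * X k x) = (\<Prod>j<k. indicator (B j) (X j x)) * iexp (\<Sum>j\<in>{k..<n}. (c(k := t)) j * X j x)" for x
    proof -
      have "(\<Sum>j\<in>{Suc k..<n}. (c(k := t)) j * X j x) = (\<Sum>j\<in>{Suc k..<n}. c j * X j x)"
        by (intro sum.cong) auto
      then have "iexp (\<Sum>j\<in>{k..<n}. (c(k := t)) j * X j x) = iexp (t * X k x) * iexp (\<Sum>j\<in>{Suc k..<n}. c j * X j x)"
        unfolding split by (simp add: exp_add[symmetric] distrib_left)
      then show ?thesis by (simp add: Y_def)
    qed
    then have "(LINT x|M. Y x * iexp (t * X k x)) =
        (\<Prod>j<k. of_real (prob (X j -` B j \<inter> space M))) * (\<Prod>j\<in>{k..<n}. LINT x|M. iexp ((c(k := t)) j * X j x))"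
      by (simp only: IH)
    also have "(\<Prod>j\<in>{k..<n}. LINT x|M. iexp ((c(k := t)) j * X j x)) =
        (LINT x|M. iexp (t * X k x)) * (\<Prod>j\<in>{Suc k..<n}. LINT x|M. iexp (c j * X j x))"
    proof -
      have "(\<Prod>j\<in>{Suc k..<n}. LINT x|M. iexp ((c(k := t)) j * X j x)) = (\<Prod>j\<in>{Suc k..<n}. LINT x|M. iexp (c j * X j x))"
        by (intro prod.cong) auto
      then show ?thesis
        unfolding split by (simp only: prod.insert finite_atLeastLessThan atLeastLessThan_iff Suc_n_not_le_n simp_thms fun_upd_same)
    qed
    finally show ?thesis by simp
  qed
  have Y0: "(LINT x|M. Y x) = ?R" using Yt[of 0] by (simp add: prob_space)
  have "(LINT x|M. Y x * indicator (B k) (X k x)) = (LINT x|M. Y x) * of_real (prob (X k -` B k \<inter> space M))"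
    by (rule char_factor[OF X Ym Y1 _ B]) (simp only: Yt Y0)
  moreover have "(LINT x|M. (\<Prod>j<Suc k. indicator (B j) (X j x)) * iexp (\<Sum>j\<in>{Suc k..<n}. c j * X j x)) =
      (LINT x|M. Y x * indicator (B k) (X k x))"
    by (intro Bochner_Integration.integral_cong) (auto simp: Y_def)
  ultimately show ?case by (simp add: Y0 mult_ac)
qed

lemma indep_vars_of_char:
  fixes X :: "nat \<Rightarrow> 'a \<Rightarrow> real"
  assumes X[measurable]: "\<And>j. X j \<in> borel_measurable M"
    and H: "\<And>n c. (LINT x|M. iexp (\<Sum>j<n. c j * X j x)) = (\<Prod>j<n. LINT x|M. iexp (c j * X j x))"
  shows "indep_vars (\<lambda>_. borel) X UNIV"
  unfolding indep_vars_def2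
proof (intro conjI ballI X indep_setsI)
  fix i show "{X i -` A \<inter> space M |A. A \<in> sets borel} \<subseteq> events" by (auto intro: measurable_sets[OF X])
next
  fix A and J :: "nat set" assume J: "J \<noteq> {}" "finite J" and A: "\<forall>j\<in>J. A j \<in> {X j -` A \<inter> space M |A. A \<in> sets borel}"
  from A have "\<forall>j\<in>J. \<exists>B\<in>sets borel. A j = X j -` B \<inter> space M" by blast
  then obtain B' where B': "\<And>j. j \<in> J \<Longrightarrow> B' j \<in> sets borel" "\<And>j. j \<in> J \<Longrightarrow> A j = X j -` B' j \<inter> space M" by metis
  \<comment> \<open>Coordinates below n outside J get the whole line, which contributes the factor
    1.\<close>
  define B where "B j = (if j \<in> J then B' j else UNIV)" for j
  have B: "B j \<in> sets borel" for j using B' by (simp add: B_def)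
  obtain n where n: "J \<subseteq> {..<n}" using J(2) finite_nat_bounded by blast
  let ?I = "\<Inter>j\<in>J. A j"
  have Im: "?I \<in> events" using J B' by (intro sets.finite_INT) (auto intro: measurable_sets[OF X])
  have "(\<Prod>j<n. indicator (B j) (X j x) :: complex) = indicator ?I x" if x: "x \<in> space M" for x
  proof (cases "x \<in> ?I")
    case True
    then have "\<forall>j\<in>J. X j x \<in> B' j" using B'(2) by blast
    then have "\<forall>j<n. indicator (B j) (X j x) = (1::complex)" by (simp add: B_def)
    then show ?thesis using True by simp
  next
    case False
    then obtain j where "j \<in> J" "x \<notin> A j" by auto
    then have "j < n" "indicator (B j) (X j x) = (0::complex)" using n x B' by (auto simp: B_def)
    then have "(\<Prod>j<n. indicator (B j) (X j x) :: complex) = 0" by (intro prod_zero) auto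
    then show ?thesis using False by simp
  qed
  then have "(LINT x|M. (\<Prod>j<n. indicator (B j) (X j x))) = (LINT x|M. complex_of_real (indicator ?I x))"
    by (intro Bochner_Integration.integral_cong) (auto simp: indicator_def)
  also have "\<dots> = of_real (prob ?I)" using Im by (simp add: Int_absorb2 sets.sets_into_space)
  \<comment> \<open>With k = n no character is left, and the preceding lemma becomes the product
    formula for events.\<close>
  finally have "of_real (prob ?I) = (\<Prod>j<n. complex_of_real (prob (X j -` B j \<inter> space M)))"
    using joint_char_indicator[where c="\<lambda>_. 0", OF X H B order_refl[of n]] by simp
  then have "prob ?I = (\<Prod>j<n. prob (X j -` B j \<inter> space M))"
    by (simp only: of_real_prod[symmetric] of_real_eq_iff)
  also have "\<dots> = (\<Prod>j\<in>J. prob (A j))"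
    using n B'(2) by (intro prod.mono_neutral_cong_right) (auto simp: B_def prob_space)
  finally show "prob ?I = (\<Prod>j\<in>J. prob (A j))" .
qed

end

section \<open>Kolmogorov's convergence theorem\<close>

context prob_space begin

lemma square_integrable_prod:
  fixes f g :: "'a \<Rightarrow> real"
  assumes [measurable]: "f \<in> borel_measurable M" "g \<in> borel_measurable M"
    and "integrable M (\<lambda>x. (f x)\<^sup>2)" "integrable M (\<lambda>x. (g x)\<^sup>2)"
  shows "integrable M (\<lambda>x. f x * g x)"
proof (rule Bochner_Integration.integrable_bound)
  show "integrable M (\<lambda>x. (f x)\<^sup>2 + (g x)\<^sup>2)" using assms by simp
  have "\<bar>a * b\<bar> \<le> \<bar>a\<^sup>2 + b\<^sup>2\<bar>" for a b :: real
    using sum_squares_bound[of "\<bar>a\<bar>" "\<bar>b\<bar>"] mult_nonneg_nonneg[of "\<bar>a\<bar>" "\<bar>b\<bar>"]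
    by (simp only: abs_mult power2_abs abs_ge_zero simp_thms)
  then show "AE x in M. norm (f x * g x) \<le> norm ((f x)\<^sup>2 + (g x)\<^sup>2)" by simp
qed simp

lemma square_integrable_add:
  fixes f g :: "'a \<Rightarrow> real"
  assumes [measurable]: "f \<in> borel_measurable M" "g \<in> borel_measurable M"
    and i: "integrable M (\<lambda>x. (f x)\<^sup>2)" "integrable M (\<lambda>x. (g x)\<^sup>2)"
  shows "integrable M (\<lambda>x. (f x + g x)\<^sup>2)"
proof -
  have "integrable M (\<lambda>x. (f x)\<^sup>2 + 2 * (f x * g x) + (g x)\<^sup>2)"
    using i square_integrable_prod[OF assms] by simp
  then show ?thesis by (simp add: power2_sum algebra_simps)
qed

lemma square_integrable_sum:
  fixes f :: "'i \<Rightarrow> 'a \<Rightarrow> real"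
  assumes "\<And>i. i \<in> I \<Longrightarrow> f i \<in> borel_measurable M" "\<And>i. i \<in> I \<Longrightarrow> integrable M (\<lambda>x. (f i x)\<^sup>2)"
  shows "integrable M (\<lambda>x. (\<Sum>i\<in>I. f i x)\<^sup>2)"
  using assms
proof (induction I rule: infinite_finite_induct)
  case (insert i I)
  then have "integrable M (\<lambda>x. (f i x + (\<Sum>i\<in>I. f i x))\<^sup>2)"
    by (intro square_integrable_add borel_measurable_sum) auto
  then show ?case using insert by simp
qed simp_all

context
  fixes X :: "nat \<Rightarrow> 'a \<Rightarrow> real"
  assumes ind: "indep_vars (\<lambda>_. borel) X UNIV"
    and sq: "\<And>j. integrable M (\<lambda>x. (X j x)\<^sup>2)" and mean: "\<And>j. expectation (X j) = 0"
begin

private lemma X_measurable[measurable]: "X j \<in> borel_measurable M"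
  using ind by (simp add: indep_vars_def)

private definition T :: "nat \<Rightarrow> nat \<Rightarrow> 'a \<Rightarrow> real" where "T m k x = (\<Sum>j\<in>{m..<k}. X j x)"

private lemma T_measurable[measurable]: "T m k \<in> borel_measurable M"
  unfolding T_def[abs_def] by measurable

private lemma T_square: "integrable M (\<lambda>x. (T m k x)\<^sup>2)"
  unfolding T_def by (intro square_integrable_sum sq X_measurable)

private lemma X_integrable: "integrable M (X j)"
  using square_integrable_prod[of "X j" "\<lambda>_. 1"] sq[of j] by simp

private lemma T_integrable: "integrable M (T m k)"
  unfolding T_def[abs_def] using X_integrable by (intro Bochner_Integration.integrable_sum)

text \<open>A function of the coordinates in A is independent of \<open>X l\<close>, which has mean
  0. This makes the mixed terms of all squares below vanish.\<close>

private lemma orthogonal: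
  assumes f: "f \<in> borel_measurable (PiM A (\<lambda>_. borel :: real measure))" and l: "l \<notin> A"
    and i: "integrable M (\<lambda>x. f (restrict (\<lambda>i. X i x) A))"
  shows "expectation (\<lambda>x. f (restrict (\<lambda>i. X i x) A) * X l x) = (0::real)"
proof -
  have "indep_var (PiM A (\<lambda>_. borel)) (\<lambda>\<omega>. restrict (\<lambda>i. X i \<omega>) A) (PiM {l} (\<lambda>_. borel)) (\<lambda>\<omega>. restrict (\<lambda>i. X i \<omega>) {l})"
    using l by (intro indep_var_restrict[OF ind]) auto
  then have "indep_var borel (f \<circ> (\<lambda>\<omega>. restrict (\<lambda>i. X i \<omega>) A)) borel ((\<lambda>z. z l) \<circ> (\<lambda>\<omega>. restrict (\<lambda>i. X i \<omega>) {l}))"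
    by (rule indep_var_compose) (use f in \<open>auto intro: measurable_component_singleton\<close>)
  then have "indep_var borel (\<lambda>x. f (restrict (\<lambda>i. X i x) A)) borel (X l)"
    by (simp add: comp_def)
  then show ?thesis
    using indep_var_lebesgue_integral[OF _ i X_integrable[of l]] mean[of l] by simp
qed

private lemma T_restrict: "m \<le> i \<Longrightarrow> i \<le> k \<Longrightarrow> T m i x = (\<Sum>j\<in>{m..<i}. restrict (\<lambda>i. X i x) {m..<k} j)"
  unfolding T_def by (intro sum.cong) auto

private lemma T_variance: "expectation (\<lambda>x. (T m k x)\<^sup>2) = (\<Sum>j\<in>{m..<k}. expectation (\<lambda>x. (X j x)\<^sup>2))"
proof (induction k)
  case (Suc k)
  show ?case
  proof (cases "m \<le> k")
    case True
    have T: "T m (Suc k) x = T m k x + X k x" for x using True by (simp add: T_def)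
    have "expectation (\<lambda>x. T m k x * X k x) = 0"
      using orthogonal[of "\<lambda>z. \<Sum>j\<in>{m..<k}. z j" "{m..<k}" k] T_integrable[of m k]
      unfolding T_def[abs_def] by simp
    moreover have "integrable M (\<lambda>x. T m k x * X k x)"
      by (intro square_integrable_prod T_square sq T_measurable X_measurable)
    ultimately have "expectation (\<lambda>x. (T m k x)\<^sup>2 + 2 * (T m k x * X k x) + (X k x)\<^sup>2) =
        expectation (\<lambda>x. (T m k x)\<^sup>2) + expectation (\<lambda>x. (X k x)\<^sup>2)"
      using T_square[of m k] sq[of k] by simp
    moreover have "(\<lambda>x. (T m (Suc k) x)\<^sup>2) = (\<lambda>x. (T m k x)\<^sup>2 + 2 * (T m k x * X k x) + (X k x)\<^sup>2)"
      by (simp add: T power2_sum algebra_simps)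
    ultimately show ?thesis using Suc True by simp
  qed (simp add: T_def)
qed (simp add: T_def)

private definition first_exit :: "real \<Rightarrow> nat \<Rightarrow> nat \<Rightarrow> 'a \<Rightarrow> real" where
  "first_exit e m k x = of_bool (\<bar>T m k x\<bar> > e \<and> (\<forall>i\<in>{m..<k}. \<bar>T m i x\<bar> \<le> e))"

private lemma first_exit_measurable[measurable]: "first_exit e m k \<in> borel_measurable M"
  unfolding first_exit_def[abs_def] of_bool_def by measurable

text \<open>The sum up to n is the sum up to k plus later terms. The event of a first exit at k and
  the sum up to k depend on coordinates below k only, so the mixed term has mean 0; the square of
  the later terms is dropped.\<close>

private lemma first_exit_le:
  assumes e: "e > 0" and k: "m \<le> k" "k \<le> n"
  shows "e\<^sup>2 * expectation (first_exit e m k) \<le> expectation (\<lambda>x. first_exit e m k x * (T m n x)\<^sup>2)"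
proof -
  let ?I = "first_exit e m k"
  have I01: "0 \<le> ?I x" "?I x \<le> 1" for x by (auto simp: first_exit_def)
  have iI: "integrable M ?I" by (rule integrable_const_bound[where B=1]) (use I01 in auto)
  have bounded: "integrable M (\<lambda>x. ?I x * f x)" if f: "integrable M f" for f
  proof (rule Bochner_Integration.integrable_bound[OF f])
    show "AE x in M. norm (?I x * f x) \<le> norm (f x)"
      using I01 by (auto simp: abs_mult mult_left_le_one_le)
  qed (use f in measurable)
  have zero: "expectation (\<lambda>x. ?I x * T m k x * X l x) = 0" if l: "l \<in> {k..<n}" for l
  proof -
    \<comment> \<open>Writes the product of the event and the sum as a function of the coordinates
      in \<open>{m..<k}\<close>, the form to which \<open>orthogonal\<close> applies.\<close>
    define f where "f z = of_bool (\<bar>\<Sum>j\<in>{m..<k}. z j\<bar> > e \<and> (\<forall>i\<in>{m..<k}. \<bar>\<Sum>j\<in>{m..<i}. z j\<bar> \<le> e)) * (\<Sum>j\<in>{m..<k}. z j)" for z :: "nat \<Rightarrow> real"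
    have comp: "(\<lambda>z. \<Sum>j\<in>{m..<i}. z j) \<in> borel_measurable (PiM {m..<k} (\<lambda>_. borel :: real measure))" if "i \<le> k" for i
      using that by (intro borel_measurable_sum measurable_component_singleton) auto
    let ?N = "PiM {m..<k} (\<lambda>_. borel :: real measure)"
    have [measurable]: "Measurable.pred ?N (\<lambda>z. \<forall>i\<in>{m..<k}. \<bar>\<Sum>j\<in>{m..<i}. z j\<bar> \<le> e)"
    proof (rule pred_intros_finite)
      fix i assume "i \<in> {m..<k}"
      then have [measurable]: "(\<lambda>z. \<Sum>j\<in>{m..<i}. z j) \<in> borel_measurable ?N" by (intro comp) auto
      show "Measurable.pred ?N (\<lambda>z. \<bar>\<Sum>j\<in>{m..<i}. z j\<bar> \<le> e)" by measurable
    qed simp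
    note [measurable] = comp[OF order_refl]
    have f: "f \<in> borel_measurable ?N"
      unfolding f_def[abs_def] of_bool_def by measurable
    have eq: "f (restrict (\<lambda>i. X i x) {m..<k}) = ?I x * T m k x" for x
      unfolding f_def first_exit_def
      using T_restrict[of m _ k x] k(1) by (simp add: T_def)
    show ?thesis
      using orthogonal[OF f, of l] bounded[OF T_integrable[of m k]] l by (simp add: eq)
  qed
  have iIT: "integrable M (\<lambda>x. ?I x * T m k x * X l x)" for l
    using bounded[OF square_integrable_prod[OF T_measurable X_measurable T_square[of m k] sq[of l]]] by (simp add: mult.assoc)
  have "e\<^sup>2 * expectation ?I = expectation (\<lambda>x. e\<^sup>2 * ?I x)" by simp
  also have "\<dots> \<le> expectation (\<lambda>x. ?I x * (T m k x)\<^sup>2)"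
  proof (intro integral_mono integrable_mult_right iI bounded T_square)
    fix x
    show "e\<^sup>2 * ?I x \<le> ?I x * (T m k x)\<^sup>2"
    proof (cases "\<bar>T m k x\<bar> > e")
      case True
      then have le: "e\<^sup>2 \<le> (T m k x)\<^sup>2" using e by (metis abs_ge_zero less_imp_le power2_abs power_mono)
      show ?thesis using mult_right_mono[OF le I01(1)[of x]] by (simp only: mult.commute[of "first_exit e m k x"])
    qed (simp add: first_exit_def)
  qed
  \<comment> \<open>Mixed terms of mean 0 are inserted, so that the integrand can be compared
    pointwise with the square of the sum up to n.\<close>
  also have "\<dots> = expectation (\<lambda>x. ?I x * (T m k x)\<^sup>2) + 2 * (\<Sum>l\<in>{k..<n}. expectation (\<lambda>x. ?I x * T m k x * X l x))"
    using zero by simp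
  also have "\<dots> = expectation (\<lambda>x. ?I x * (T m k x)\<^sup>2 + 2 * (\<Sum>l\<in>{k..<n}. ?I x * T m k x * X l x))"
    using iIT bounded[OF T_square[of m k]] by simp
  also have "\<dots> \<le> expectation (\<lambda>x. ?I x * (T m n x)\<^sup>2)"
  proof (intro integral_mono Bochner_Integration.integrable_add integrable_mult_right Bochner_Integration.integrable_sum iIT bounded T_square)
    fix x
    have "T m n x = T m k x + (\<Sum>l\<in>{k..<n}. X l x)"
      unfolding T_def using k by (simp add: sum.atLeastLessThan_concat)
    then have "(T m n x)\<^sup>2 = (T m k x)\<^sup>2 + 2 * (T m k x * (\<Sum>l\<in>{k..<n}. X l x)) + (\<Sum>l\<in>{k..<n}. X l x)\<^sup>2"
      by (simp add: power2_sum algebra_simps)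
    then have "(T m k x)\<^sup>2 + 2 * (T m k x * (\<Sum>l\<in>{k..<n}. X l x)) \<le> (T m n x)\<^sup>2" by simp
    then have "?I x * ((T m k x)\<^sup>2 + 2 * (T m k x * (\<Sum>l\<in>{k..<n}. X l x))) \<le> ?I x * (T m n x)\<^sup>2"
      using I01(1) by (intro mult_left_mono)
    then show "?I x * (T m k x)\<^sup>2 + 2 * (\<Sum>l\<in>{k..<n}. ?I x * T m k x * X l x) \<le> ?I x * (T m n x)\<^sup>2"
      by (simp add: distrib_left sum_distrib_left mult.assoc mult.left_commute)
  qed
  finally show ?thesis .
qed

private definition exit_set :: "real \<Rightarrow> nat \<Rightarrow> nat \<Rightarrow> 'a set" where
  "exit_set e m n = {x \<in> space M. \<exists>k\<in>{m..n}. \<bar>T m k x\<bar> > e}"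

private lemma exit_set_measurable[measurable]: "exit_set e m n \<in> events"
  unfolding exit_set_def by measurable

text \<open>At most one index is the first exit, and one exists on the exit set. Hence the estimates
  for single indices add up to at most the variance of the sum up to n.\<close>

private lemma kolmogorov_inequality:
  assumes e: "e > 0"
  shows "e\<^sup>2 * prob (exit_set e m n) \<le> (\<Sum>j\<in>{m..<n}. expectation (\<lambda>x. (X j x)\<^sup>2))"
proof -
  have I01: "0 \<le> first_exit e m k x" "first_exit e m k x \<le> 1" for k x by (auto simp: first_exit_def)
  have iI: "integrable M (first_exit e m k)" for k by (rule integrable_const_bound[where B=1]) (use I01 in auto)
  have iIT: "integrable M (\<lambda>x. first_exit e m k x * (T m n x)\<^sup>2)" for k
  proof (rule Bochner_Integration.integrable_bound[OF T_square[of m n]])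
    show "AE x in M. norm (first_exit e m k x * (T m n x)\<^sup>2) \<le> norm ((T m n x)\<^sup>2)"
      using I01 by (auto simp: abs_mult mult_left_le_one_le)
  qed measurable
  have ge: "indicator (exit_set e m n) x \<le> (\<Sum>k\<in>{m..n}. first_exit e m k x)" for x
  proof (cases "x \<in> exit_set e m n")
    case True
    then obtain k where k: "k \<in> {m..n} \<and> \<bar>T m k x\<bar> > e" by (auto simp: exit_set_def)
    define k0 where "k0 = (LEAST k. k \<in> {m..n} \<and> \<bar>T m k x\<bar> > e)"
    have k0: "k0 \<in> {m..n} \<and> \<bar>T m k0 x\<bar> > e" unfolding k0_def using k by (rule LeastI)
    have "\<bar>T m i x\<bar> \<le> e" if "i \<in> {m..<k0}" for i
      using not_less_Least[of i "\<lambda>k. k \<in> {m..n} \<and> \<bar>T m k x\<bar> > e"] that k0 unfolding k0_def[symmetric] by auto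
    then have "first_exit e m k0 x = 1" using k0 by (simp add: first_exit_def)
    then have "1 \<le> (\<Sum>k\<in>{m..n}. first_exit e m k x)"
      using member_le_sum[of k0 "{m..n}" "\<lambda>k. first_exit e m k x"] k0 I01 by auto
    then show ?thesis using True by simp
  qed (use I01 in \<open>auto intro: sum_nonneg\<close>)
  have le: "(\<Sum>k\<in>{m..n}. first_exit e m k x) \<le> 1" for x
    unfolding first_exit_def
  proof (rule sum_of_bool_le_1)
    fix i j assume *: "i \<in> {m..n}" "j \<in> {m..n}" "\<bar>T m i x\<bar> > e \<and> (\<forall>k\<in>{m..<i}. \<bar>T m k x\<bar> \<le> e)"
      "\<bar>T m j x\<bar> > e \<and> (\<forall>k\<in>{m..<j}. \<bar>T m k x\<bar> \<le> e)"
    show "i = j"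
    proof (rule ccontr)
      assume "i \<noteq> j"
      then consider "i \<in> {m..<j}" | "j \<in> {m..<i}" using *(1,2) by force
      then show False using *(3,4) by cases force+
    qed
  qed simp
  have "e\<^sup>2 * prob (exit_set e m n) = e\<^sup>2 * expectation (indicator (exit_set e m n))"
    by (simp add: Int_absorb2 sets.sets_into_space)
  also have "\<dots> \<le> e\<^sup>2 * expectation (\<lambda>x. \<Sum>k\<in>{m..n}. first_exit e m k x)"
    by (intro mult_left_mono integral_mono Bochner_Integration.integrable_sum iI ge) (auto simp: emeasure_eq_measure)
  also have "\<dots> = (\<Sum>k\<in>{m..n}. e\<^sup>2 * expectation (first_exit e m k))"
    using iI by (simp add: sum_distrib_left)
  also have "\<dots> \<le> (\<Sum>k\<in>{m..n}. expectation (\<lambda>x. first_exit e m k x * (T m n x)\<^sup>2))"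
    by (intro sum_mono first_exit_le e) auto
  also have "\<dots> = expectation (\<lambda>x. (\<Sum>k\<in>{m..n}. first_exit e m k x) * (T m n x)\<^sup>2)"
    using iIT by (simp add: sum_distrib_right)
  also have "\<dots> \<le> expectation (\<lambda>x. (T m n x)\<^sup>2)"
  proof (rule integral_mono)
    show "integrable M (\<lambda>x. (\<Sum>k\<in>{m..n}. first_exit e m k x) * (T m n x)\<^sup>2)"
      unfolding sum_distrib_right using iIT by (intro Bochner_Integration.integrable_sum)
    show "(\<Sum>k\<in>{m..n}. first_exit e m k x) * (T m n x)\<^sup>2 \<le> (T m n x)\<^sup>2" for x
      using mult_right_mono[OF le, of "(T m n x)\<^sup>2" x] by simp
  qed (rule T_square)
  finally show ?thesis by (simp only: T_variance)
qed

text \<open>By the maximal inequality the probability that the sums started at m ever exceed e is at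
  most a tail of the variances divided by e^2. As m grows, almost surely the sums from some index on
  stay within e; countably many e give the Cauchy property.\<close>

lemma kolmogorov_convergence:
  assumes summ: "summable (\<lambda>j. expectation (\<lambda>x. (X j x)\<^sup>2))"
  shows "AE x in M. convergent (\<lambda>n. \<Sum>j<n. X j x)"
proof -
  let ?v = "\<lambda>j. expectation (\<lambda>x. (X j x)\<^sup>2)"
  define r where "r m = (\<Sum>j. ?v j) - (\<Sum>j<m. ?v j)" for m
  have r: "(\<Sum>j\<in>{m..<n}. ?v j) \<le> r m" for m n
  proof (cases "m \<le> n")
    case True
    have "(\<Sum>j<m. ?v j) + (\<Sum>j\<in>{m..<n}. ?v j) = (\<Sum>j<n. ?v j)"
      using True by (simp add: lessThan_atLeast0 sum.atLeastLessThan_concat)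
    moreover have "(\<Sum>j<n. ?v j) \<le> (\<Sum>j. ?v j)" by (intro sum_le_suminf summ) auto
    ultimately show ?thesis by (simp add: r_def)
  next
    case False
    have "(\<Sum>j<m. ?v j) \<le> (\<Sum>j. ?v j)" by (intro sum_le_suminf summ) auto
    then show ?thesis using False by (simp add: r_def)
  qed
  have r0: "r \<longlonglongrightarrow> 0"
    unfolding r_def[abs_def] using tendsto_diff[OF tendsto_const summable_LIMSEQ[OF summ], of "\<Sum>j. ?v j"] by simp
  have ae: "AE x in M. \<exists>m. \<forall>k\<ge>m. \<bar>T m k x\<bar> \<le> e" if e: "e > 0" for e
  proof -
    have B: "prob (\<Union>n. exit_set e m n) \<le> r m / e\<^sup>2" for m
    proof (rule LIMSEQ_le_const2)
      show "(\<lambda>n. prob (exit_set e m n)) \<longlonglongrightarrow> prob (\<Union>n. exit_set e m n)"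
        by (intro finite_Lim_measure_incseq) (auto simp: incseq_def exit_set_def intro: exit_set_measurable)
      show "\<exists>N. \<forall>n\<ge>N. prob (exit_set e m n) \<le> r m / e\<^sup>2"
        using order_trans[OF kolmogorov_inequality[OF e] r] e by (simp add: pos_le_divide_eq mult.commute)
    qed
    \<comment> \<open>The event that e is exceeded from every starting index. It is contained in
      each of the tail events, so its probability is below bounds that tend to 0.\<close>
    define C where "C = (\<Inter>m. \<Union>n. exit_set e m n)"
    have C[measurable]: "C \<in> events" unfolding C_def by measurable
    have "prob C \<le> r m / e\<^sup>2" for m
      by (rule order_trans[OF finite_measure_mono B]) (auto simp: C_def)
    moreover have "(\<lambda>m. r m / e\<^sup>2) \<longlonglongrightarrow> 0" using tendsto_divide[OF r0 tendsto_const, of "e\<^sup>2"] e by simp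
    ultimately have "prob C \<le> 0" by (intro LIMSEQ_le_const[where a="prob C" and X="\<lambda>m. r m / e\<^sup>2"]) auto
    then have "prob C = 0" using measure_nonneg[of M C] by linarith
    then have "AE x in M. x \<notin> C" by (simp add: prob_eq_0[OF C])
    then show ?thesis
    proof (rule AE_mp, intro AE_I2 impI)
      fix x assume x: "x \<in> space M" "x \<notin> C"
      then obtain m where "x \<notin> (\<Union>n. exit_set e m n)" by (auto simp: C_def)
      then have "\<bar>T m k x\<bar> \<le> e" if "k \<ge> m" for k
        using that x(1) by (fastforce simp: exit_set_def not_less)
      then show "\<exists>m. \<forall>k\<ge>m. \<bar>T m k x\<bar> \<le> e" by blast
    qed
  qed
  have "AE x in M. \<forall>i::nat. \<exists>m. \<forall>k\<ge>m. \<bar>T m k x\<bar> \<le> 1 / real (Suc i)"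
    unfolding AE_all_countable by (intro allI ae) simp
  then show ?thesis
  proof eventually_elim
    case (elim x)
    have "Cauchy (\<lambda>n. \<Sum>j<n. X j x)"
    proof (rule CauchyI)
      fix e :: real assume "0 < e"
      then obtain i where i: "1 / real (Suc i) < e / 2" using nat_approx_posE[of "e/2"] by auto
      obtain m where m: "\<And>k. k \<ge> m \<Longrightarrow> \<bar>T m k x\<bar> \<le> 1 / real (Suc i)" using elim by blast
      have S: "(\<Sum>j<k. X j x) = (\<Sum>j<m. X j x) + T m k x" if "k \<ge> m" for k
        using that by (simp add: T_def lessThan_atLeast0 sum.atLeastLessThan_concat)
      have "norm ((\<Sum>j<k. X j x) - (\<Sum>j<l. X j x)) < e" if "k \<ge> m" "l \<ge> m" for k l
        using m[OF that(1)] m[OF that(2)] i unfolding S[OF that(1)] S[OF that(2)] real_norm_def by linarith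
      then show "\<exists>M. \<forall>k\<ge>M. \<forall>l\<ge>M. norm ((\<Sum>j<k. X j x) - (\<Sum>j<l. X j x)) < e" by blast
    qed
    then show ?case by (simp add: Cauchy_convergent_iff)
  qed
qed

end

end

section \<open>The Paley--Wiener--Zygmund integral\<close>

lemma (in prob_space) centered_normal_moments:
  assumes X[measurable]: "X \<in> borel_measurable M" and n: "centered_normal M X"
  shows "integrable M (\<lambda>x. (X x)\<^sup>2)"
    and "(LINT x|M. iexp (t * X x)) = of_real (exp (- (t\<^sup>2 * (LINT x|M. (X x)\<^sup>2)) / 2))"
proof -
  have "integrable M (\<lambda>x. (X x)\<^sup>2) \<and>
    (LINT x|M. iexp (t * X x)) = of_real (exp (- (t\<^sup>2 * (LINT x|M. (X x)\<^sup>2)) / 2))"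
    using n unfolding centered_normal_def
  proof
    assume 0: "AE x in M. X x = 0"
    then have 1: "AE x in M. (X x)\<^sup>2 = 0" by eventually_elim simp
    have "integrable M (\<lambda>x. (X x)\<^sup>2) = integrable M (\<lambda>x. 0::real)"
      using 1 by (intro integrable_cong_AE) auto
    moreover have "(LINT x|M. (X x)\<^sup>2) = (LINT x|M. 0)" using 1 by (intro integral_cong_AE) auto
    moreover have "(LINT x|M. iexp (t * X x)) = (LINT x|M. 1)"
      using 0 by (intro integral_cong_AE) (auto elim: eventually_mono)
    ultimately show ?thesis by (simp add: prob_space)
  next
    assume "\<exists>\<sigma>>0. distributed M lborel X (\<lambda>r. ennreal (normal_density 0 \<sigma> r))"
    then obtain \<sigma> where \<sigma>: "\<sigma> > 0" and d: "distributed M lborel X (\<lambda>r. ennreal (normal_density 0 \<sigma> r))" by blast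
    have i: "integrable M (\<lambda>x. (X x)\<^sup>2)"
      using distributed_integrable[OF d, of "\<lambda>x. x\<^sup>2"] integrable_normal_moment[OF \<sigma>, of 0 2] by simp
    have v: "(LINT x|M. (X x)\<^sup>2) = \<sigma>\<^sup>2"
      using normal_distributed_variance[OF \<sigma> d] normal_distributed_expectation[OF \<sigma> d] by simp
    \<comment> \<open>Scaling to the standard normal law, whose characteristic function is then
      evaluated at \<open>t * \<sigma>\<close>.\<close>
    have "distributed M lborel (\<lambda>x. X x / \<sigma>) std_normal_density"
      using d normal_standard_normal_convert[OF \<sigma>, of X 0] by simp
    then have "distr M lborel (\<lambda>x. X x / \<sigma>) = std_normal_distribution"
      by (simp add: distributed_distr_eq_density)
    then have "char std_normal_distribution (t * \<sigma>) = (LINT y|distr M lborel (\<lambda>x. X x / \<sigma>). iexp ((t * \<sigma>) * y))"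
      by (simp add: char_def)
    also have "\<dots> = (LINT x|M. iexp ((t * \<sigma>) * (X x / \<sigma>)))" by (rule integral_distr) auto
    also have "\<dots> = (LINT x|M. iexp (t * X x))" using \<sigma> by simp
    finally have "(LINT x|M. iexp (t * X x)) = of_real (exp (- ((t * \<sigma>)\<^sup>2) / 2))"
      by (simp add: char_std_normal_distribution)
    then show ?thesis using i v by (simp add: power_mult_distrib)
  qed
  then show "integrable M (\<lambda>x. (X x)\<^sup>2)"
    "(LINT x|M. iexp (t * X x)) = of_real (exp (- (t\<^sup>2 * (LINT x|M. (X x)\<^sup>2)) / 2))" by auto
qed

text \<open>\<open>W0\<close> is the measure before completion. Joint measurability and Fubini's
  theorem are used on it; the completion returns in null sets and inside
  \<open>partial_integral\<close>.\<close>

locale yeh_wiener = l2_basis S T \<phi> + W0: prob_space W0 for S T \<phi> and W0 :: "field2 measure" +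
  assumes space_W0: "space W0 = C0 S T" and sets_W0: "sets W0 = sets (cylinder_C0 S T)"
    and normal: "\<And>P c. finite P \<Longrightarrow> P \<subseteq> rect S T \<Longrightarrow> centered_normal W0 (\<lambda>x. \<Sum>p\<in>P. c p * x p)"
    and cov: "\<And>s t s' t'. s \<in> {0..S} \<Longrightarrow> t \<in> {0..T} \<Longrightarrow> s' \<in> {0..S} \<Longrightarrow> t' \<in> {0..T} \<Longrightarrow>
      (LINT x|W0. x (s, t) * x (s', t')) = min s s' * min t t'"
begin

section \<open>Finite combinations of point values and their covariances\<close>

lemma eval_measurable:
  assumes p: "p \<in> rect S T"
  shows "(\<lambda>x. x p) \<in> borel_measurable W0"
proof (rule measurableI)
  fix A :: "real set" assume A: "A \<in> sets borel"
  have "{x \<in> C0 S T. x p \<in> A} \<in> sets (cylinder_C0 S T)"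
    unfolding cylinder_C0_def using p A by (subst sets_measure_of) (auto intro!: sigma_sets.Basic simp del: split_paired_Ex)
  moreover have "(\<lambda>x. x p) -` A \<inter> space W0 = {x \<in> C0 S T. x p \<in> A}" by (auto simp: space_W0)
  ultimately show "(\<lambda>x. x p) -` A \<inter> space W0 \<in> sets W0" by (simp add: sets_W0)
qed simp

text \<open>These are the functionals on which normality is postulated. Being closed under sums and
  multiples, they include the Riemann-Stieltjes sums.\<close>

definition lin :: "(field2 \<Rightarrow> real) \<Rightarrow> bool" where
  "lin X \<longleftrightarrow> (\<exists>P c. finite P \<and> P \<subseteq> rect S T \<and> X = (\<lambda>x. \<Sum>p\<in>P. c p * x p))"

lemma lin_eval: "p \<in> rect S T \<Longrightarrow> lin (\<lambda>x. x p)"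
  unfolding lin_def by (intro exI[of _ "{p}"] exI[of _ "\<lambda>_. 1"]) simp

lemma lin_add: assumes "lin X" "lin Y" shows "lin (\<lambda>x. X x + Y x)"
proof -
  obtain P c where P: "finite P" "P \<subseteq> rect S T" "X = (\<lambda>x. \<Sum>p\<in>P. c p * x p)" using assms(1) unfolding lin_def by blast
  obtain P' c' where P': "finite P'" "P' \<subseteq> rect S T" "Y = (\<lambda>x. \<Sum>p\<in>P'. c' p * x p)" using assms(2) unfolding lin_def by blast
  define d where "d p = (if p \<in> P then c p else 0) + (if p \<in> P' then c' p else 0)" for p
  have "X x + Y x = (\<Sum>p\<in>P \<union> P'. d p * x p)" for x
  proof -
    have "X x = (\<Sum>p\<in>P \<union> P'. (if p \<in> P then c p else 0) * x p)"
      unfolding P(3) using P(1) P'(1) by (intro sum.mono_neutral_cong_left) auto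
    moreover have "Y x = (\<Sum>p\<in>P \<union> P'. (if p \<in> P' then c' p else 0) * x p)"
      unfolding P'(3) using P(1) P'(1) by (intro sum.mono_neutral_cong_left) auto
    ultimately show ?thesis by (simp only: d_def distrib_right sum.distrib)
  qed
  then show ?thesis unfolding lin_def using P P' by (intro exI[of _ "P \<union> P'"] exI[of _ d]) auto
qed

lemma lin_scale: assumes "lin X" shows "lin (\<lambda>x. a * X x)"
proof -
  obtain P c where P: "finite P" "P \<subseteq> rect S T" "X = (\<lambda>x. \<Sum>p\<in>P. c p * x p)" using assms(1) unfolding lin_def by blast
  then show ?thesis unfolding lin_def
    by (intro exI[of _ P] exI[of _ "\<lambda>p. a * c p"]) (simp add: sum_distrib_left mult.assoc)
qed

lemma lin_0: "lin (\<lambda>x. 0)"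
  unfolding lin_def by (intro exI[of _ "{}"]) simp

lemma lin_diff: "lin X \<Longrightarrow> lin Y \<Longrightarrow> lin (\<lambda>x. X x - Y x)"
  using lin_add[of X "\<lambda>x. (-1) * Y x"] lin_scale[of Y "-1"] by simp

lemma lin_sum: "(\<And>i. i \<in> I \<Longrightarrow> lin (X i)) \<Longrightarrow> lin (\<lambda>x. \<Sum>i\<in>I. X i x)"
  by (induction I rule: infinite_finite_induct) (simp_all add: lin_0 lin_add)

lemma lin_measurable: "lin X \<Longrightarrow> X \<in> borel_measurable W0"
  unfolding lin_def using eval_measurable
  by (auto intro!: borel_measurable_sum borel_measurable_times)

lemma lin_centered_normal: "lin X \<Longrightarrow> centered_normal W0 X"
  unfolding lin_def using normal by blast

lemma lin_square_integrable: "lin X \<Longrightarrow> integrable W0 (\<lambda>x. (X x)\<^sup>2)"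
  using W0.centered_normal_moments(1)[OF lin_measurable lin_centered_normal] .

lemma lin_char: "lin X \<Longrightarrow> (LINT x|W0. iexp (t * X x)) = of_real (exp (- (t\<^sup>2 * (LINT x|W0. (X x)\<^sup>2)) / 2))"
  using W0.centered_normal_moments(2)[OF lin_measurable lin_centered_normal] .

lemma lin_prod_integrable: "lin X \<Longrightarrow> lin Y \<Longrightarrow> integrable W0 (\<lambda>x. X x * Y x)"
  by (intro W0.square_integrable_prod lin_measurable lin_square_integrable)

lemma cov_diff_left: "lin X \<Longrightarrow> lin Y \<Longrightarrow> lin Z \<Longrightarrow>
   (LINT x|W0. (X x - Y x) * Z x) = (LINT x|W0. X x * Z x) - (LINT x|W0. Y x * Z x)"
  using lin_prod_integrable[of X Z] lin_prod_integrable[of Y Z] by (simp add: left_diff_distrib)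

lemma cov_diff_right: "lin X \<Longrightarrow> lin Y \<Longrightarrow> lin Z \<Longrightarrow>
   (LINT x|W0. Z x * (X x - Y x)) = (LINT x|W0. Z x * X x) - (LINT x|W0. Z x * Y x)"
  using lin_prod_integrable[of Z X] lin_prod_integrable[of Z Y] by (simp add: right_diff_distrib)

text \<open>A rectangle increment is a difference of two of these. Taking one variable at a time
  keeps each covariance a product of a factor in s and a factor in t.\<close>

definition strip :: "real \<Rightarrow> real \<Rightarrow> real \<Rightarrow> field2 \<Rightarrow> real" where
  "strip t s s' x = x (s', t) - x (s, t)"

lemma lin_strip: "s \<in> {0..S} \<Longrightarrow> s' \<in> {0..S} \<Longrightarrow> t \<in> {0..T} \<Longrightarrow> lin (strip t s s')"
  unfolding strip_def[abs_def] by (intro lin_diff lin_eval) (auto simp: rect_def)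

lemma cov_strip:
  assumes "s \<in> {0..S}" "s' \<in> {0..S}" "t \<in> {0..T}" "r \<in> {0..S}" "r' \<in> {0..S}" "u \<in> {0..T}"
  shows "(LINT x|W0. strip t s s' x * strip u r r' x) =
    ((min s' r' - min s' r) - (min s r' - min s r)) * min t u"
proof -
  have l: "lin (\<lambda>x. x (s, t))" "lin (\<lambda>x. x (s', t))" "lin (\<lambda>x. x (r, u))" "lin (\<lambda>x. x (r', u))"
    using assms by (auto intro!: lin_eval simp: rect_def)
  show ?thesis
    unfolding strip_def
    by (simp only: cov_diff_left[OF l(2) l(1) lin_diff[OF l(4) l(3)]] cov_diff_right[OF l(4) l(3) l(2)]
        cov_diff_right[OF l(4) l(3) l(1)] cov assms) (simp only: left_diff_distrib)
qed

definition inc :: "nat \<Rightarrow> nat \<Rightarrow> nat \<Rightarrow> field2 \<Rightarrow> real" where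
  "inc n i j x = rect_increment x (unode S n i) (unode S n (Suc i)) (unode T n j) (unode T n (Suc j))"

lemma inc_strip: "inc n i j x = strip (unode T n (Suc j)) (unode S n i) (unode S n (Suc i)) x
    - strip (unode T n j) (unode S n i) (unode S n (Suc i)) x"
  by (simp add: inc_def rect_increment_def strip_def)

lemma lin_inc: "i < n \<Longrightarrow> j < n \<Longrightarrow> lin (inc n i j)"
  unfolding inc_strip[abs_def]
  by (intro lin_diff lin_strip unode_range) (use S_pos T_pos in auto)

text \<open>min a b is the length of the overlap of [0, a] and [0, b], so the mixed difference is
  the length of the overlap of two grid intervals, which is everything or nothing.\<close>

lemma min_unode_increment:
  assumes "L > 0" "n > 0"
  shows "(min (unode L n (Suc i)) (unode L n (Suc k)) - min (unode L n (Suc i)) (unode L n k))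
    - (min (unode L n i) (unode L n (Suc k)) - min (unode L n i) (unode L n k)) = (if i = k then L / n else 0)"
proof -
  have le: "unode L n a \<le> unode L n b" if "a \<le> b" for a b
    using that assms by (simp add: unode_def divide_right_mono)
  consider "i = k" | "Suc i \<le> k" | "Suc k \<le> i" by linarith
  then show ?thesis
  proof cases
    case 1
    then show ?thesis using le[of i "Suc i"] unode_diff[OF assms(2), of L i] by (simp add: min_absorb1 min_absorb2)
  next
    case 2
    then show ?thesis using le[OF 2] le[of "Suc i" "Suc k"] le[of i "Suc k"] le[of i k] by (simp add: min_absorb1)
  next
    case 3
    then show ?thesis using le[OF 3] le[of "Suc k" "Suc i"] le[of k "Suc i"] le[of k i] by (simp add: min_absorb2)
  qed
qed

lemma cov_inc:
  assumes "i < n" "j < n" "i' < n" "j' < n"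
  shows "(LINT x|W0. inc n i j x * inc n i' j' x) = (if i = i' \<and> j = j' then S / n * (T / n) else 0)"
proof -
  have n: "n > 0" using assms by simp
  have r: "unode S n i \<in> {0..S}" "unode S n (Suc i) \<in> {0..S}" "unode S n i' \<in> {0..S}" "unode S n (Suc i') \<in> {0..S}"
    "unode T n j \<in> {0..T}" "unode T n (Suc j) \<in> {0..T}" "unode T n j' \<in> {0..T}" "unode T n (Suc j') \<in> {0..T}"
    using assms by (intro unode_range n S_pos T_pos; simp)+
  note l = lin_strip[OF r(1,2)] lin_strip[OF r(3,4)]
  have "(LINT x|W0. inc n i j x * inc n i' j' x) =
     ((min (unode S n (Suc i)) (unode S n (Suc i')) - min (unode S n (Suc i)) (unode S n i'))
      - (min (unode S n i) (unode S n (Suc i')) - min (unode S n i) (unode S n i'))) *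
     ((min (unode T n (Suc j)) (unode T n (Suc j')) - min (unode T n (Suc j)) (unode T n j'))
      - (min (unode T n j) (unode T n (Suc j')) - min (unode T n j) (unode T n j')))"
    unfolding inc_strip
    by (simp only: cov_diff_left[OF l(1)[OF r(6)] l(1)[OF r(5)] lin_diff[OF l(2)[OF r(8)] l(2)[OF r(7)]]]
        cov_diff_right[OF l(2)[OF r(8)] l(2)[OF r(7)] l(1)[OF r(6)]] cov_diff_right[OF l(2)[OF r(8)] l(2)[OF r(7)] l(1)[OF r(5)]]
        cov_strip r) (simp only: right_diff_distrib)
  then show ?thesis
    unfolding min_unode_increment[OF S_pos n] min_unode_increment[OF T_pos n] by simp
qed

lemma usum_inc: "usum S T n g x = (\<Sum>i<n. \<Sum>j<n. g (corner n i j) * inc n i j x)"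
  by (simp add: usum_def grid_sum_def corner_def inc_def)

lemma lin_usum: "lin (usum S T n g)"
  unfolding usum_inc[abs_def] by (intro lin_sum lin_scale lin_inc) auto

text \<open>Increments over different cells are uncorrelated, and the variance of each is the area
  of its cell. So the variance of the sum is the integral of the squared step function.\<close>

lemma usum_variance:
  assumes n: "n > 0"
  shows "(LINT x|W0. (usum S T n g x)\<^sup>2) = (nrm (ustep n g))\<^sup>2"
proof -
  let ?I = "{..<n} \<times> {..<n}"
  define G where "G = (\<lambda>(i,j). g (corner n i j))"
  define D where "D = (\<lambda>(i,j). inc n i j)"
  have lD: "lin (D a)" if "a \<in> ?I" for a using that lin_inc by (auto simp: D_def)
  have u: "usum S T n g x = (\<Sum>a\<in>?I. G a * D a x)" for x
    by (simp add: usum_inc sum.cartesian_product G_def D_def split_def)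
  have "(LINT x|W0. (usum S T n g x)\<^sup>2) = (LINT x|W0. (\<Sum>a\<in>?I. \<Sum>b\<in>?I. (G a * G b) * (D a x * D b x)))"
    unfolding u power2_eq_square sum_product by (intro Bochner_Integration.integral_cong refl sum.cong) (simp only: mult_ac)
  also have "\<dots> = (\<Sum>a\<in>?I. \<Sum>b\<in>?I. (G a * G b) * (LINT x|W0. D a x * D b x))"
  proof -
    have i: "integrable W0 (\<lambda>x. (G a * G b) * (D a x * D b x))" if "a \<in> ?I" "b \<in> ?I" for a b
      by (intro integrable_mult_right lin_prod_integrable lD that)
    have "(LINT x|W0. (\<Sum>a\<in>?I. \<Sum>b\<in>?I. (G a * G b) * (D a x * D b x))) =
        (\<Sum>a\<in>?I. (LINT x|W0. (\<Sum>b\<in>?I. (G a * G b) * (D a x * D b x))))"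
      by (rule Bochner_Integration.integral_sum) (intro Bochner_Integration.integrable_sum i)
    also have "\<dots> = (\<Sum>a\<in>?I. \<Sum>b\<in>?I. (LINT x|W0. (G a * G b) * (D a x * D b x)))"
      by (intro sum.cong refl Bochner_Integration.integral_sum i)
    finally show ?thesis by simp
  qed
  also have "\<dots> = (\<Sum>a\<in>?I. \<Sum>b\<in>?I. if b = a then (G a)\<^sup>2 * (S / n * (T / n)) else 0)"
  proof (intro sum.cong refl)
    fix a b assume "a \<in> ?I" "b \<in> ?I"
    then show "G a * G b * (LINT x|W0. D a x * D b x) = (if b = a then (G a)\<^sup>2 * (S / n * (T / n)) else 0)"
      using cov_inc[of "fst a" n "snd a" "fst b" "snd b"] by (auto simp: D_def split_def power2_eq_square prod_eq_iff)
  qed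
  also have "\<dots> = (\<Sum>a\<in>?I. (G a)\<^sup>2 * (S / n * (T / n)))" by simp
  also have "\<dots> = (nrm (ustep n g))\<^sup>2"
    by (simp only: nrm_ustep[OF n] sum.cartesian_product G_def split_def)
  finally show ?thesis .
qed

section \<open>The integrals of the basis functions\<close>

definition Z :: "nat \<Rightarrow> field2 \<Rightarrow> real" where "Z j x = rs_integral S T (\<phi> j) x"

lemma usum_Z: "x \<in> C0 S T \<Longrightarrow> (\<lambda>n. usum S T n (\<phi> j) x) \<longlonglongrightarrow> Z j x"
  unfolding Z_def by (intro has_rs_integral_usum has_rs_integral_rs_integral \<phi>_hk S_pos T_pos)

lemma Z_measurable[measurable]: "Z j \<in> borel_measurable W0"
proof (rule borel_measurable_LIMSEQ_real)
  show "(\<lambda>n. usum S T n (\<phi> j) x) \<longlonglongrightarrow> Z j x" if "x \<in> space W0" for x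
    using usum_Z that by (simp add: space_W0)
qed (intro lin_measurable lin_usum)

lemma usum_comb: "usum S T n (comb c J) x = (\<Sum>k\<in>J. c k * usum S T n (\<phi> k) x)"
proof -
  have "usum S T n (comb c J) x = (\<Sum>i<n. \<Sum>j<n. \<Sum>k\<in>J. c k * (\<phi> k (corner n i j) * inc n i j x))"
    by (simp only: usum_inc comb_def sum_distrib_right mult.assoc)
  also have "\<dots> = (\<Sum>i<n. \<Sum>k\<in>J. \<Sum>j<n. c k * (\<phi> k (corner n i j) * inc n i j x))"
    by (intro sum.cong refl sum.swap)
  also have "\<dots> = (\<Sum>k\<in>J. \<Sum>i<n. \<Sum>j<n. c k * (\<phi> k (corner n i j) * inc n i j x))"
    by (rule sum.swap)
  finally show ?thesis by (simp only: usum_inc sum_distrib_left)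
qed

text \<open>The uniform sums of a combination of basis functions are normal with variances tending
  to the sum of squares, and their characters converge boundedly. Valid for all combinations, the
  formula contains both the laws and the independence of the \<open>Z j\<close>.\<close>

lemma Z_char: "finite J \<Longrightarrow> (LINT x|W0. iexp (\<Sum>j\<in>J. c j * Z j x)) = of_real (exp (- (\<Sum>j\<in>J. (c j)\<^sup>2) / 2))"
proof (rule LIMSEQ_unique)
  assume J: "finite J"
  show "(\<lambda>n. LINT x|W0. iexp (usum S T n (comb c J) x)) \<longlonglongrightarrow> (LINT x|W0. iexp (\<Sum>j\<in>J. c j * Z j x))"
  proof (rule integral_dominated_convergence[where w="\<lambda>_. 1"])
    show "(\<lambda>x. iexp (usum S T n (comb c J) x)) \<in> borel_measurable W0" for n
      using lin_measurable[OF lin_usum[of n "comb c J"]] by measurable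
    show "AE x in W0. (\<lambda>n. iexp (usum S T n (comb c J) x)) \<longlonglongrightarrow> iexp (\<Sum>j\<in>J. c j * Z j x)"
      using usum_Z by (intro AE_I2) (auto simp: usum_comb space_W0 intro!: tendsto_intros)
  qed auto
  have "(\<lambda>n. complex_of_real (exp (- (nrm (ustep n (comb c J)))\<^sup>2 / 2))) \<longlonglongrightarrow> of_real (exp (- (\<Sum>j\<in>J. (c j)\<^sup>2) / 2))"
    by (intro tendsto_intros nrm_ustep_comb_tendsto J) simp
  moreover have "\<forall>\<^sub>F n in sequentially. complex_of_real (exp (- (nrm (ustep n (comb c J)))\<^sup>2 / 2)) = (LINT x|W0. iexp (usum S T n (comb c J) x))"
    using eventually_gt_at_top[of 0]
  proof eventually_elim
    case (elim n)
    show ?case using lin_char[OF lin_usum[of n "comb c J"], of 1] usum_variance[OF elim, of "comb c J"] by simp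
  qed
  ultimately show "(\<lambda>n. LINT x|W0. iexp (usum S T n (comb c J) x)) \<longlonglongrightarrow> of_real (exp (- (\<Sum>j\<in>J. (c j)\<^sup>2) / 2))"
    by (rule Lim_transform_eventually)
qed

lemma Z_char1: "(LINT x|W0. iexp (t * Z j x)) = of_real (exp (- (t\<^sup>2) / 2))"
  using Z_char[of "{j}" "\<lambda>_. t"] by simp

lemma Z_indep: "W0.indep_vars (\<lambda>_. borel) Z UNIV"
proof (rule W0.indep_vars_of_char)
  fix n and c :: "nat \<Rightarrow> real"
  show "(LINT x|W0. iexp (\<Sum>j<n. c j * Z j x)) = (\<Prod>j<n. LINT x|W0. iexp (c j * Z j x))"
    unfolding Z_char[OF finite_lessThan] Z_char1
    by (simp add: exp_sum[symmetric] sum_negf sum_divide_distrib flip: of_real_prod exp_sum)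
qed (rule Z_measurable)

text \<open>The law is identified by its characteristic function; it supplies the moments that
  Kolmogorov's theorem asks for.\<close>

lemma Z_distributed: "distributed W0 lborel (Z j) std_normal_density"
proof -
  have "char (distr W0 borel (Z j)) = char std_normal_distribution"
  proof
    fix t
    have "char (distr W0 borel (Z j)) t = (LINT x|W0. iexp (t * Z j x))"
      unfolding char_def by (rule integral_distr) measurable
    then show "char (distr W0 borel (Z j)) t = char std_normal_distribution t"
      by (simp only: Z_char1 char_std_normal_distribution)
  qed
  then have "distr W0 borel (Z j) = std_normal_distribution"
    by (intro Levy_uniqueness W0.real_distribution_distr real_dist_normal_dist Z_measurable)
  moreover have "distr W0 lborel (Z j) = distr W0 borel (Z j)" by (intro distr_cong) auto
  ultimately show ?thesis by (simp add: distributed_def)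
qed

lemma Z_moments: "integrable W0 (\<lambda>x. (Z j x)\<^sup>2)" "(LINT x|W0. Z j x) = 0" "(LINT x|W0. (Z j x)\<^sup>2) = 1"
proof -
  show "integrable W0 (\<lambda>x. (Z j x)\<^sup>2)"
    using distributed_integrable[OF Z_distributed, of "\<lambda>x. x\<^sup>2" j] integrable_std_normal_moment[of 2] by simp
  show 0: "(LINT x|W0. Z j x) = 0" by (rule W0.standard_normal_distributed_expectation[OF Z_distributed])
  show "(LINT x|W0. (Z j x)\<^sup>2) = 1"
    using W0.standard_normal_distributed_variance[OF Z_distributed[of j]] 0 by simp
qed

section \<open>Convergence and law of the integral\<close>

definition pwz_sum :: "field2 \<Rightarrow> nat \<Rightarrow> field2 \<Rightarrow> real" where
  "pwz_sum v n x = (\<Sum>j<n. coef v j * Z j x)"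

text \<open>Where the sums diverge, \<open>lim\<close> has an unspecified value, so linearity and
  scaling of the integral are claimed under this condition.\<close>

definition pwz_conv :: "field2 \<Rightarrow> field2 \<Rightarrow> bool" where
  "pwz_conv v x \<longleftrightarrow> convergent (\<lambda>n. pwz_sum v n x)"

abbreviation I :: "field2 \<Rightarrow> field2 \<Rightarrow> real" where "I \<equiv> pwz S T \<phi>"

lemma pwz_eq: "x \<in> C0 S T \<Longrightarrow> I v x = lim (\<lambda>n. pwz_sum v n x)"
  unfolding pwz_def pwz_sum_def Z_def coef_def
  by (subst rs_integral_sum[OF \<phi>_hk _ S_pos T_pos]) auto

lemma pwz_tendsto: "x \<in> C0 S T \<Longrightarrow> pwz_conv v x \<Longrightarrow> (\<lambda>n. pwz_sum v n x) \<longlonglongrightarrow> I v x"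
  by (simp add: pwz_eq pwz_conv_def convergent_LIMSEQ_iff)

text \<open>The terms are independent and centered with variances \<open>(coef v j)\<^sup>2\<close>,
  which are summable by Bessel's inequality.\<close>

lemma pwz_conv_AE:
  assumes v: "v \<in> L2 S T" shows "AE x in W0. pwz_conv v x"
  unfolding pwz_conv_def pwz_sum_def
proof (rule W0.kolmogorov_convergence)
  have "W0.indep_vars (\<lambda>_. borel) (\<lambda>i x. (\<lambda>z. coef v i * z) (Z i x)) UNIV"
    by (rule W0.indep_vars_compose2[OF Z_indep]) measurable
  then show "W0.indep_vars (\<lambda>_. borel) (\<lambda>j x. coef v j * Z j x) UNIV" .
  show "integrable W0 (\<lambda>x. (coef v j * Z j x)\<^sup>2)" for j
    using Z_moments(1)[of j] by (simp add: power_mult_distrib)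
  show "W0.expectation (\<lambda>x. coef v j * Z j x) = 0" for j
    using Z_moments(2)[of j] by simp
  show "summable (\<lambda>j. W0.expectation (\<lambda>x. (coef v j * Z j x)\<^sup>2))"
    using summable_coef[OF v] by (simp add: power_mult_distrib Z_moments(3))
qed

lemma pwz_sum_measurable[measurable]: "pwz_sum v n \<in> borel_measurable W0"
  unfolding pwz_sum_def[abs_def] by measurable

lemma pwz_measurable[measurable]: "I v \<in> borel_measurable W0"
proof -
  have "(\<lambda>x. lim (\<lambda>n. pwz_sum v n x)) \<in> borel_measurable W0"
    by (intro borel_measurable_lim_metric) measurable
  then show ?thesis by (subst measurable_cong[OF pwz_eq]) (simp_all add: space_W0)
qed

text \<open>The characters of the partial sums converge boundedly almost everywhere, and the
  exponents of their means converge by Parseval's identity.\<close>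

lemma pwz_char:
  assumes v: "v \<in> L2 S T"
  shows "(LINT x|W0. iexp (a * I v x)) = of_real (exp (- (a\<^sup>2 * (nrm v)\<^sup>2) / 2))"
proof (rule LIMSEQ_unique)
  show "(\<lambda>n. LINT x|W0. iexp (a * pwz_sum v n x)) \<longlonglongrightarrow> (LINT x|W0. iexp (a * I v x))"
  proof (rule integral_dominated_convergence[where w="\<lambda>_. 1"])
    show "AE x in W0. (\<lambda>n. iexp (a * pwz_sum v n x)) \<longlonglongrightarrow> iexp (a * I v x)"
      using pwz_conv_AE[OF v] AE_space
    proof eventually_elim
      case (elim x)
      then have "(\<lambda>n. pwz_sum v n x) \<longlonglongrightarrow> I v x" by (intro pwz_tendsto) (auto simp: space_W0)
      then show ?case by (intro tendsto_intros)
    qed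
  qed auto
  have "(LINT x|W0. iexp (a * pwz_sum v n x)) = of_real (exp (- (a\<^sup>2 * (\<Sum>j<n. (coef v j)\<^sup>2)) / 2))" for n
    using Z_char[of "{..<n}" "\<lambda>j. a * coef v j"]
    by (simp add: pwz_sum_def sum_distrib_left power_mult_distrib mult.assoc)
  moreover have "(\<lambda>n. complex_of_real (exp (- (a\<^sup>2 * (\<Sum>j<n. (coef v j)\<^sup>2)) / 2))) \<longlonglongrightarrow> of_real (exp (- (a\<^sup>2 * (nrm v)\<^sup>2) / 2))"
    by (intro tendsto_intros parseval[OF v, unfolded sums_def]) simp
  ultimately show "(\<lambda>n. LINT x|W0. iexp (a * pwz_sum v n x)) \<longlonglongrightarrow> of_real (exp (- (a\<^sup>2 * (nrm v)\<^sup>2) / 2))" by simp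
qed

end

section \<open>Gaussian averages and analytic continuation\<close>

text \<open>The character has modulus 1, so integrability of D makes the double integral absolutely
  convergent. Integrating over x first leaves the given characteristic function.\<close>

lemma (in prob_space) gaussian_fubini:
  fixes D :: "'b \<Rightarrow> complex"
  assumes N: "finite_measure N" and D: "integrable N D"
    and Y[measurable]: "(\<lambda>(x, z). Y z x) \<in> borel_measurable (M \<Otimes>\<^sub>M N)"
    and char: "\<And>z. z \<in> space N \<Longrightarrow> (LINT x|M. iexp (a * Y z x)) = of_real (exp (- (a\<^sup>2 * c z) / 2))"
  shows "integrable M (\<lambda>x. LINT z|N. D z * iexp (a * Y z x))"
    and "(LINT x|M. LINT z|N. D z * iexp (a * Y z x)) = (LINT z|N. D z * of_real (exp (- (a\<^sup>2 * c z) / 2)))"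
proof -
  interpret N: finite_measure N by fact
  interpret P: pair_sigma_finite M N ..
  have [measurable]: "D \<in> borel_measurable N" using D by auto
  have int: "integrable (M \<Otimes>\<^sub>M N) (\<lambda>(x, z). D z * iexp (a * Y z x))"
  proof (rule P.Fubini_integrable)
    show "(\<lambda>(x, z). D z * iexp (a * Y z x)) \<in> borel_measurable (M \<Otimes>\<^sub>M N)"
      using Y by (auto simp: split_def)
    have "(\<lambda>x. LINT z|N. norm (case (x, z) of (x, z) \<Rightarrow> D z * iexp (a * Y z x))) = (\<lambda>x. LINT z|N. norm (D z))"
      by (simp add: norm_mult)
    then show "integrable M (\<lambda>x. LINT z|N. norm (case (x, z) of (x, z) \<Rightarrow> D z * iexp (a * Y z x)))" by simp
    show "AE x in M. integrable N (\<lambda>z. case (x, z) of (x, z) \<Rightarrow> D z * iexp (a * Y z x))"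
    proof (rule AE_I2)
      fix x assume x: "x \<in> space M"
      have [measurable]: "(\<lambda>z. Y z x) \<in> borel_measurable N"
        using measurable_Pair2[OF Y x] by simp
      show "integrable N (\<lambda>z. case (x, z) of (x, z) \<Rightarrow> D z * iexp (a * Y z x))"
        by (rule Bochner_Integration.integrable_bound[OF integrable_norm[OF D]]) (auto simp: norm_mult)
    qed
  qed
  show "integrable M (\<lambda>x. LINT z|N. D z * iexp (a * Y z x))"
    using P.integrable_fst'[OF int] by simp
  have "(LINT x|M. LINT z|N. D z * iexp (a * Y z x)) = (LINT z|N. LINT x|M. D z * iexp (a * Y z x))"
    using P.Fubini_integral[OF int] by simp
  also have "\<dots> = (LINT z|N. D z * of_real (exp (- (a\<^sup>2 * c z) / 2)))"
    by (intro Bochner_Integration.integral_cong refl) (simp only: integral_mult_right_zero char)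
  finally show "(LINT x|M. LINT z|N. D z * iexp (a * Y z x)) = (LINT z|N. D z * of_real (exp (- (a\<^sup>2 * c z) / 2)))" .
qed

section \<open>Laplace transforms and their boundary values\<close>

context
  fixes N :: "'b measure" and D :: "'b \<Rightarrow> complex" and c :: "'b \<Rightarrow> real"
  assumes D: "integrable N D" and c[measurable]: "c \<in> borel_measurable N" and c0: "\<And>z. c z \<ge> 0"
begin

private lemma D_measurable[measurable]: "D \<in> borel_measurable N" using D by auto

text \<open>In the variable w = 1 / (2 \<lambda>) the Gaussian averages are exponentials of a linear
  function, so that this is a Laplace transform. The point \<lambda> = -iq corresponds to w = i / (2
  q) on the boundary of the half plane.\<close>

private definition \<Psi> :: "complex \<Rightarrow> complex" where
  "\<Psi> w = (LINT z|N. D z * exp (- (of_real (c z) * w)))"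

private lemma exp_bound: "Re w \<ge> 0 \<Longrightarrow> norm (exp (- (of_real (c z) * w))) \<le> 1"
  using c0 by simp

private lemma \<Psi>_integrable: "Re w \<ge> 0 \<Longrightarrow> integrable N (\<lambda>z. D z * exp (- (of_real (c z) * w)))"
  by (rule Bochner_Integration.integrable_bound[OF D])
     (use exp_bound in \<open>auto simp: norm_mult mult_left_le\<close>)

text \<open>Since c is nonnegative, the exponentials are bounded by 1 on the closed half plane.
  Dominated convergence therefore reaches the boundary, where the Feynman limit is taken.\<close>

private lemma \<Psi>_continuous:
  assumes "Re w \<ge> 0"
  shows "(\<Psi> \<longlongrightarrow> \<Psi> w) (at w within {w. Re w \<ge> 0})"
  unfolding tendsto_at_iff_sequentially comp_def
proof (intro allI impI)
  fix X assume X: "\<forall>i. X i \<in> {w. 0 \<le> Re w} - {w}" "X \<longlonglongrightarrow> w"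
  show "(\<lambda>i. \<Psi> (X i)) \<longlonglongrightarrow> \<Psi> w"
    unfolding \<Psi>_def
  proof (rule integral_dominated_convergence[where w="\<lambda>z. norm (D z)"])
    show "AE z in N. (\<lambda>i. D z * exp (- (of_real (c z) * X i))) \<longlonglongrightarrow> D z * exp (- (of_real (c z) * w))"
      by (intro AE_I2 tendsto_intros X(2))
    show "AE z in N. norm (D z * exp (- (of_real (c z) * X i))) \<le> norm (D z)" for i
      using exp_bound[of "X i"] X(1) by (auto simp: norm_mult mult_left_le)
  qed (use D in auto)
qed

text \<open>Differentiation under the integral. On the half plane Re > d the derivative of the
  exponential is bounded by 1 / d uniformly in z, because t exp(-t) <= 1 for t = c z * d, even if c
  is unbounded.\<close>

private lemma \<Psi>_derivative:
  assumes w: "Re w > 0"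
  shows "(\<Psi> has_field_derivative (LINT z|N. D z * (- of_real (c z) * exp (- (of_real (c z) * w))))) (at w)"
proof -
  \<comment> \<open>Half of the real part leaves an open convex neighbourhood of w on which the
    bound is uniform.\<close>
  define d where "d = Re w / 2"
  have d: "d > 0" using w by (simp add: d_def)
  define A where "A = {v. Re v > d}"
  have A: "open A" "convex A"
    unfolding A_def by (rule open_halfspace_Re_gt convex_halfspace_Re_gt)+
  have wA: "w \<in> A" using w by (simp add: A_def d_def)
  have bound: "norm (exp (- (of_real (c z) * u)) - exp (- (of_real (c z) * v))) \<le> 1 / d * norm (u - v)"
    if "u \<in> A" "v \<in> A" for u v z
  proof (rule field_differentiable_bound[OF A(2) _ _ that])
    fix x assume "x \<in> A"
    then have x: "Re x > d" by (simp add: A_def)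
    show "((\<lambda>x. exp (- (of_real (c z) * x))) has_field_derivative - of_real (c z) * exp (- (of_real (c z) * x))) (at x within A)"
      by (auto intro!: derivative_eq_intros)
    have "norm (- of_real (c z) * exp (- (of_real (c z) * x))) = c z * exp (- (c z * Re x))"
      using c0[of z] by (simp add: norm_mult)
    also have "\<dots> \<le> c z * exp (- (c z * d))"
      using x c0[of z] by (intro mult_left_mono) (auto intro: mult_left_mono)
    also have "\<dots> \<le> 1 / d"
    proof -
      have "c z * d \<le> exp (c z * d)" using exp_ge_add_one_self[of "c z * d"] by linarith
      then have "c z * d * exp (- (c z * d)) \<le> exp (c z * d) * exp (- (c z * d))"
        by (rule mult_right_mono) simp
      also have "\<dots> = 1" by (simp add: exp_minus)
      finally show ?thesis using d by (simp add: pos_le_divide_eq mult_ac)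
    qed
    finally show "norm (- of_real (c z) * exp (- (of_real (c z) * x))) \<le> 1 / d" .
  qed
  have "((\<lambda>v. (\<Psi> v - \<Psi> w) / (v - w)) \<longlongrightarrow> (LINT z|N. D z * (- of_real (c z) * exp (- (of_real (c z) * w))))) (at w within A)"
    unfolding tendsto_at_iff_sequentially comp_def
  proof (intro allI impI)
    fix X assume X: "\<forall>i. X i \<in> A - {w}" "X \<longlonglongrightarrow> w"
    have Re_pos: "Re (X i) \<ge> 0" for i using X(1) d unfolding A_def by (force intro: less_imp_le less_trans)
    have Xw: "filterlim X (at w) sequentially"
      using X by (auto simp: filterlim_at)
    have "(\<lambda>i. LINT z|N. D z * ((exp (- (of_real (c z) * X i)) - exp (- (of_real (c z) * w))) / (X i - w))) \<longlonglongrightarrow>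
        (LINT z|N. D z * (- of_real (c z) * exp (- (of_real (c z) * w))))"
    proof (rule integral_dominated_convergence[where w="\<lambda>z. 1 / d * norm (D z)"])
      show "AE z in N. (\<lambda>i. D z * ((exp (- (of_real (c z) * X i)) - exp (- (of_real (c z) * w))) / (X i - w)))
          \<longlonglongrightarrow> D z * (- of_real (c z) * exp (- (of_real (c z) * w)))"
      proof (intro AE_I2 tendsto_mult tendsto_const)
        fix z
        have "((\<lambda>x. exp (- (of_real (c z) * x))) has_field_derivative - of_real (c z) * exp (- (of_real (c z) * w))) (at w)"
          by (auto intro!: derivative_eq_intros)
        then have "((\<lambda>v. (exp (- (of_real (c z) * v)) - exp (- (of_real (c z) * w))) / (v - w)) \<longlongrightarrow>
            - of_real (c z) * exp (- (of_real (c z) * w))) (at w)"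
          by (simp add: has_field_derivative_iff)
        then show "(\<lambda>i. (exp (- (of_real (c z) * X i)) - exp (- (of_real (c z) * w))) / (X i - w)) \<longlonglongrightarrow>
            - of_real (c z) * exp (- (of_real (c z) * w))"
          by (rule filterlim_compose[OF _ Xw])
      qed
      show "AE z in N. norm (D z * ((exp (- (of_real (c z) * X i)) - exp (- (of_real (c z) * w))) / (X i - w)))
          \<le> 1 / d * norm (D z)" for i
      proof (intro AE_I2)
        fix z
        have "norm (X i - w) > 0" using X(1) by auto
        then have "norm (exp (- (of_real (c z) * X i)) - exp (- (of_real (c z) * w))) / norm (X i - w) \<le> 1 / d"
          using bound[of "X i" w z] X(1) wA by (simp add: divide_le_eq)
        then show "norm (D z * ((exp (- (of_real (c z) * X i)) - exp (- (of_real (c z) * w))) / (X i - w))) \<le> 1 / d * norm (D z)"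
          unfolding norm_mult norm_divide mult.commute[of "1 / d"] by (intro mult_left_mono) auto
      qed
    qed (use D in auto)
    moreover have "(\<Psi> (X i) - \<Psi> w) / (X i - w) =
        (LINT z|N. D z * ((exp (- (of_real (c z) * X i)) - exp (- (of_real (c z) * w))) / (X i - w)))" for i
    proof -
      have "(\<Psi> (X i) - \<Psi> w) / (X i - w) =
          (LINT z|N. (D z * exp (- (of_real (c z) * X i)) - D z * exp (- (of_real (c z) * w))) / (X i - w))"
        using \<Psi>_integrable[OF Re_pos[of i]] \<Psi>_integrable[of w] w by (simp add: \<Psi>_def)
      also have "\<dots> = (LINT z|N. D z * ((exp (- (of_real (c z) * X i)) - exp (- (of_real (c z) * w))) / (X i - w)))"
        by (intro Bochner_Integration.integral_cong refl) (simp add: right_diff_distrib)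
      finally show ?thesis .
    qed
    ultimately show "(\<lambda>i. (\<Psi> (X i) - \<Psi> w) / (X i - w)) \<longlonglongrightarrow>
        (LINT z|N. D z * (- of_real (c z) * exp (- (of_real (c z) * w))))" by (simp only:)
  qed
  then show ?thesis
    using A by (simp add: has_field_derivative_iff at_within_open[OF wA A(1)])
qed

lemma feynman_limit_eq:
  assumes q: "q \<noteq> 0" and J: "\<And>r. r > 0 \<Longrightarrow> J r = Some (LINT z|N. D z * of_real (exp (- (c z / (2 * r)))))"
  shows "feynman_limit q J = Some (LINT z|N. D z * exp (- (\<i> * of_real (c z / (2 * q)))))"
proof -
  define \<Phi> where "\<Phi> w = \<Psi> (1 / (2 * w))" for w
  have Re_inv: "Re (1 / (2 * w)) > 0" if "Re w > 0" for w
    using that by (auto simp: Re_divide intro!: divide_pos_pos add_pos_nonneg)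
  have \<Psi>_holo: "\<Psi> holomorphic_on right_half_plane"
    unfolding holomorphic_on_def field_differentiable_def right_half_plane_def
    using \<Psi>_derivative has_field_derivative_at_within by blast
  have op: "open right_half_plane" "connected right_half_plane"
    unfolding right_half_plane_def by (auto simp: open_halfspace_Re_gt convex_connected convex_halfspace_Re_gt)
  have "(\<Psi> \<circ> (\<lambda>w. 1 / (2 * w))) holomorphic_on right_half_plane"
  proof (rule holomorphic_on_compose_gen[OF _ \<Psi>_holo])
    show "(\<lambda>w. 1 / (2 * w)) holomorphic_on right_half_plane"
      by (intro holomorphic_intros) (auto simp: right_half_plane_def)
  qed (use Re_inv in \<open>auto simp: right_half_plane_def\<close>)
  then have \<Phi>_holo: "\<Phi> holomorphic_on right_half_plane" by (simp add: \<Phi>_def[abs_def] comp_def)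
  let ?p = "- \<i> * of_real q :: complex"
  let ?v = "LINT z|N. D z * exp (- (\<i> * of_real (c z / (2 * q))))"
  have p: "1 / (2 * ?p) = \<i> / of_real (2 * q)" using q by (simp add: field_simps)
  have v: "\<Psi> (1 / (2 * ?p)) = ?v"
    unfolding p \<Psi>_def by (intro Bochner_Integration.integral_cong refl) (simp add: mult.commute)
  have lim: "(\<Phi> \<longlongrightarrow> ?v) (at ?p within right_half_plane)"
  proof -
    have "((\<lambda>w. 1 / (2 * w)) \<longlongrightarrow> 1 / (2 * ?p)) (at ?p within right_half_plane)"
      using q by (intro tendsto_intros) auto
    \<comment> \<open>The images must stay in the closed half plane and avoid the limit point
      itself; the latter is injectivity of the inversion.\<close>
    moreover have "\<forall>\<^sub>F w in at ?p within right_half_plane. 1 / (2 * w) \<in> {w. Re w \<ge> 0} \<and> 1 / (2 * w) \<noteq> 1 / (2 * ?p)"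
      unfolding eventually_at_filter
    proof (intro always_eventually allI impI conjI)
      fix w assume "w \<noteq> ?p" "w \<in> right_half_plane"
      show "1 / (2 * w) \<noteq> 1 / (2 * ?p)"
      proof
        assume "1 / (2 * w) = 1 / (2 * ?p)"
        then have "inverse (2 * w) = inverse (2 * ?p)" by (simp only: inverse_eq_divide)
        then have "2 * w = 2 * ?p" by (rule inverse_eq_imp_eq)
        then show False using \<open>w \<noteq> ?p\<close> by simp
      qed
      show "1 / (2 * w) \<in> {w. Re w \<ge> 0}"
        using Re_inv[of w] \<open>w \<in> right_half_plane\<close> by (auto simp: right_half_plane_def)
    qed
    ultimately have f: "filterlim (\<lambda>w. 1 / (2 * w)) (at (1 / (2 * ?p)) within {w. Re w \<ge> 0}) (at ?p within right_half_plane)"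
      by (simp add: filterlim_at eventually_conj_iff)
    have "Re (1 / (2 * ?p)) \<ge> 0" unfolding p by simp
    from filterlim_compose[OF \<Psi>_continuous[OF this] f] show ?thesis unfolding v \<Phi>_def .
  qed
  have J\<Phi>: "J r = Some (\<Phi> (of_real r))" if "r > 0" for r
  proof -
    have "\<Phi> (of_real r) = (LINT z|N. D z * of_real (exp (- (c z / (2 * r)))))"
      unfolding \<Phi>_def \<Psi>_def by (intro Bochner_Integration.integral_cong refl) (simp add: exp_of_real[symmetric])
    then show ?thesis using J[OF that] by simp
  qed
  \<comment> \<open>The point -iq is outside the open half plane but is a limit point of it, so
    limits there are unique.\<close>
  have nontriv: "at ?p within right_half_plane \<noteq> bot"
  proof -
    have "?p islimpt right_half_plane"
      unfolding islimpt_approachable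
    proof (intro allI impI)
      fix e :: real assume "e > 0"
      then show "\<exists>x'\<in>right_half_plane. x' \<noteq> ?p \<and> dist x' ?p < e"
        by (intro bexI[of _ "of_real (e/2) + ?p"]) (auto simp: right_half_plane_def dist_norm)
    qed
    then show ?thesis by (simp add: trivial_limit_within)
  qed
  have has: "has_feynman_limit q J ?v"
    unfolding has_feynman_limit_def using \<Phi>_holo J\<Phi> lim by blast
  have uniq: "b = ?v" if b: "has_feynman_limit q J b" for b
  proof -
    obtain \<Phi>' where \<Phi>': "\<Phi>' holomorphic_on right_half_plane" "\<And>r. r > 0 \<Longrightarrow> J r = Some (\<Phi>' (of_real r))"
      "(\<Phi>' \<longlongrightarrow> b) (at ?p within right_half_plane)"
      using b unfolding has_feynman_limit_def by blast
    \<comment> \<open>Two continuations agree on the positive reals, which accumulate at the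
      interior point 1, and hence on the connected half plane.\<close>
    have "\<Phi>' w - \<Phi> w = 0" if w: "w \<in> right_half_plane" for w
    proof (rule analytic_continuation[of "\<lambda>w. \<Phi>' w - \<Phi> w" right_half_plane "of_real ` {0<..}" 1 w])
      show "(\<lambda>w. \<Phi>' w - \<Phi> w) holomorphic_on right_half_plane" by (intro holomorphic_intros \<Phi>' \<Phi>_holo)
      show "(1::complex) islimpt of_real ` {0<..}"
        unfolding islimpt_approachable
      proof (intro allI impI)
        fix e :: real assume "e > 0"
        then show "\<exists>x'\<in>complex_of_real ` {0<..}. x' \<noteq> 1 \<and> dist x' 1 < e"
          by (intro bexI[OF _ imageI[of "1 + e/2"]]) (auto simp: dist_norm)
      qed
      show "\<Phi>' x - \<Phi> x = 0" if "x \<in> of_real ` {0<..}" for x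
        using that \<Phi>'(2) J\<Phi> by auto
    qed (use op w in \<open>auto simp: right_half_plane_def\<close>)
    then have "\<forall>\<^sub>F w in at ?p within right_half_plane. \<Phi>' w = \<Phi> w"
      unfolding eventually_at_filter by (intro always_eventually) auto
    then have "(\<Phi> \<longlongrightarrow> b) (at ?p within right_half_plane)"
      using \<Phi>'(3) by (rule Lim_transform_eventually[rotated])
    then show ?thesis using tendsto_unique[OF nontriv _ lim] by blast
  qed
  have "(THE b. has_feynman_limit q J b) = ?v" using has uniq by (intro the_equality)
  then show ?thesis unfolding feynman_limit_def using has by auto
qed

end

text \<open>Vanishing moments give 0 on polynomials in e, then by uniform approximation on [0, 1] on
  bounded continuous functions of e, and finally by bounded limits on indicators of level
  sets.\<close>

lemma sigma_functional_weierstrass: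
  fixes e :: "'a \<Rightarrow> real"
  assumes \<Lambda>: "sigma_functional M \<Lambda>" and e[measurable]: "e \<in> borel_measurable M"
    and e01: "\<And>x. x \<in> space M \<Longrightarrow> 0 \<le> e x \<and> e x \<le> 1"
    and mom: "\<And>m::nat. \<Lambda> (\<lambda>x. of_real (e x ^ m)) = 0"
  shows "\<Lambda> (indicator {x \<in> space M. e x > c}) = 0"
proof -
  have bm: "bounded_measurable M (\<lambda>x. of_real (e x ^ m))" for m :: nat
  proof (rule bounded_measurableI[where B=1])
    fix x assume "x \<in> space M"
    then have "0 \<le> e x ^ m" "e x ^ m \<le> 1" using e01[of x] by (auto intro: power_le_one)
    then show "norm (complex_of_real (e x ^ m)) \<le> 1" unfolding norm_of_real by simp
  qed measurable
  have poly: "\<Lambda> (\<lambda>x. of_real (g (e x))) = 0" if g: "real_polynomial_function g" for g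
  proof -
    obtain a n where a: "g = (\<lambda>x. \<Sum>i\<le>n. a i * x ^ i)"
      using g unfolding real_polynomial_function_iff_sum by blast
    have "(\<lambda>x. complex_of_real (g (e x))) = (\<lambda>x. \<Sum>i\<le>n. of_real (a i) * of_real (e x ^ i))"
      by (simp add: a)
    then show ?thesis
      using sigma_functional_sum[OF \<Lambda>, of "{..n}" "\<lambda>i x. of_real (e x ^ i)" "\<lambda>i. of_real (a i)"] bm mom by simp
  qed
  have cont: "\<Lambda> (\<lambda>x. of_real (\<psi> (e x))) = 0" if \<psi>: "continuous_on UNIV \<psi>" "\<And>t. \<bar>\<psi> t\<bar> \<le> 1" for \<psi> :: "real \<Rightarrow> real"
  proof -
    have "\<exists>g. real_polynomial_function g \<and> (\<forall>x\<in>{0..1}. \<bar>\<psi> x - g x\<bar> < 1 / real (Suc n))" for n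
    proof -
      have c: "continuous_on {0..1} \<psi>" and p: "0 < 1 / real (Suc n)"
        using continuous_on_subset[OF \<psi>(1)] by auto
      show ?thesis
        by (rule Stone_Weierstrass_real_polynomial_function[OF compact_Icc c p]) blast
    qed
    then obtain g where g: "\<And>n. real_polynomial_function (g n)"
      "\<And>n x. x \<in> {0..1} \<Longrightarrow> \<bar>\<psi> x - g n x\<bar> < 1 / real (Suc n)"
      by metis
    have [measurable]: "\<psi> \<in> borel_measurable borel" by (intro borel_measurable_continuous_onI \<psi>)
    have [measurable]: "g n \<in> borel_measurable borel" for n
      using continuous_on_polymonial_function g(1)[of n]
      by (intro borel_measurable_continuous_onI) (simp add: real_polynomial_function_eq)
    have "(\<lambda>n. \<Lambda> (\<lambda>x. of_real (g n (e x)))) \<longlonglongrightarrow> \<Lambda> (\<lambda>x. of_real (\<psi> (e x)))"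
    proof (rule sigma_functional_lim[OF \<Lambda>, where B=2])
      fix x assume x: "x \<in> space M"
      then have ex: "e x \<in> {0..1}" using e01 by auto
      show "norm (complex_of_real (g n (e x))) \<le> 2" for n
      proof -
        have "1 / real (Suc n) \<le> 1" by simp
        then show ?thesis using g(2)[OF ex, of n] \<psi>(2)[of "e x"] unfolding norm_of_real by linarith
      qed
      have "(\<lambda>n. \<psi> (e x) - g n (e x)) \<longlonglongrightarrow> 0"
      proof (rule Lim_null_comparison[OF always_eventually])
        show "\<forall>n. norm (\<psi> (e x) - g n (e x)) \<le> inverse (real (Suc n))"
          using g(2)[OF ex] by (auto simp: inverse_eq_divide intro: less_imp_le)
      qed (rule LIMSEQ_inverse_real_of_nat)
      then have "(\<lambda>n. \<psi> (e x) - (\<psi> (e x) - g n (e x))) \<longlonglongrightarrow> \<psi> (e x) - 0" by (intro tendsto_intros)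
      then show "(\<lambda>n. complex_of_real (g n (e x))) \<longlonglongrightarrow> complex_of_real (\<psi> (e x))"
        by (intro tendsto_of_real) simp
    qed measurable
    then show ?thesis using poly[OF g(1)] by (simp add: LIMSEQ_const_iff)
  qed
  \<comment> \<open>Ramps that vanish up to c and, for k > 0, reach 1 at c + 1/k. They increase to
    the indicator of the points above c.\<close>
  define \<psi> where "\<psi> k t = min 1 (real k * max 0 (t - c))" for k :: nat and t
  have \<psi>: "continuous_on UNIV (\<psi> k)" "\<bar>\<psi> k t\<bar> \<le> 1" for k t
    unfolding \<psi>_def by (auto intro!: continuous_intros)
  have [measurable]: "\<psi> k \<in> borel_measurable borel" for k by (intro borel_measurable_continuous_onI \<psi>)
  have "(\<lambda>k. \<Lambda> (\<lambda>x. of_real (\<psi> k (e x)))) \<longlonglongrightarrow> \<Lambda> (indicator {x \<in> space M. e x > c})"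
  proof (rule sigma_functional_lim[OF \<Lambda>, where B=1])
    show "norm (complex_of_real (\<psi> n (e x))) \<le> 1" for n x using \<psi>(2)[of n "e x"] by simp
    fix x assume x: "x \<in> space M"
    show "(\<lambda>n. complex_of_real (\<psi> n (e x))) \<longlonglongrightarrow> indicator {x \<in> space M. e x > c} x"
    proof (cases "e x > c")
      case True
      have "\<forall>\<^sub>F n in sequentially. \<psi> n (e x) = 1"
      proof -
        obtain n0 :: nat where n0: "1 / (e x - c) < real n0" using reals_Archimedean2 by blast
        have "\<psi> n (e x) = 1" if "n \<ge> n0" for n
        proof -
          have "1 / (e x - c) \<le> real n" using n0 that by linarith
          then have "1 \<le> real n * (e x - c)" using True by (simp add: pos_divide_le_eq)
          then show ?thesis using True by (simp add: \<psi>_def)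
        qed
        then show ?thesis by (auto simp: eventually_sequentially)
      qed
      then have "\<forall>\<^sub>F n in sequentially. complex_of_real (\<psi> n (e x)) = indicator {x \<in> space M. e x > c} x"
        by eventually_elim (use True x in simp)
      then show ?thesis by (rule tendsto_eventually)
    next
      case False
      then show ?thesis by (simp add: \<psi>_def)
    qed
  qed measurable
  then show ?thesis using cont[OF \<psi>] by (simp add: LIMSEQ_const_iff)
qed

section \<open>The measure of a functional is unique\<close>

lemma sigma_functional_scale:
  "sigma_functional M \<Lambda> \<Longrightarrow> bounded_measurable M v \<Longrightarrow> \<Lambda> (\<lambda>x. a * v x) = a * \<Lambda> v"
  using sigma_functional_lin[of M \<Lambda> v v a 0] by simp

lemma sigma_functional_zero: "sigma_functional M \<Lambda> \<Longrightarrow> \<Lambda> (\<lambda>x. 0) = 0"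
  using sigma_functional_scale[OF _ bounded_measurable_const, of M \<Lambda> 0 0] by simp

context yeh_wiener begin

section \<open>Scaling, linearity and scale-invariant null sets\<close>

abbreviation W :: "field2 measure" where "W \<equiv> completion W0"

lemma C0_scale: "x \<in> C0 S T \<Longrightarrow> (\<lambda>p. \<rho> * x p) \<in> C0 S T"
  by (auto simp: C0_def intro!: continuous_intros)

lemma Z_scale: "x \<in> C0 S T \<Longrightarrow> Z j (\<lambda>p. \<rho> * x p) = \<rho> * Z j x"
  unfolding Z_def by (intro rs_integral_scale_path \<phi>_hk C0_scale S_pos T_pos)

lemma pwz_sum_scale: "x \<in> C0 S T \<Longrightarrow> pwz_sum v n (\<lambda>p. \<rho> * x p) = \<rho> * pwz_sum v n x"
  by (simp add: pwz_sum_def Z_scale sum_distrib_left mult.left_commute)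

lemma pwz_scale:
  assumes x: "x \<in> C0 S T" and c: "pwz_conv v x"
  shows "pwz_conv v (\<lambda>p. \<rho> * x p)" "I v (\<lambda>p. \<rho> * x p) = \<rho> * I v x"
proof -
  have *: "(\<lambda>n. pwz_sum v n (\<lambda>p. \<rho> * x p)) \<longlonglongrightarrow> \<rho> * I v x"
    unfolding pwz_sum_scale[OF x] by (intro tendsto_intros pwz_tendsto x c)
  then show "pwz_conv v (\<lambda>p. \<rho> * x p)" unfolding pwz_conv_def by (rule convergentI)
  show "I v (\<lambda>p. \<rho> * x p) = \<rho> * I v x"
    unfolding pwz_eq[OF C0_scale[OF x]] by (rule limI[OF *])
qed

lemma pwz_lincomb:
  assumes x: "x \<in> C0 S T" and c: "pwz_conv u x" "pwz_conv v x" and L: "u \<in> L2 S T" "v \<in> L2 S T"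
  shows "pwz_conv (\<lambda>p. a * u p + b * v p) x" "I (\<lambda>p. a * u p + b * v p) x = a * I u x + b * I v x"
proof -
  have "pwz_sum (\<lambda>p. a * u p + b * v p) n x = a * pwz_sum u n x + b * pwz_sum v n x" for n
    using L by (simp add: pwz_sum_def coef_add coef_scale L2_scale distrib_right sum.distrib sum_distrib_left mult.assoc)
  then have *: "(\<lambda>n. pwz_sum (\<lambda>p. a * u p + b * v p) n x) \<longlonglongrightarrow> a * I u x + b * I v x"
    using pwz_tendsto[OF x c(1)] pwz_tendsto[OF x c(2)] by (simp only:) (intro tendsto_intros)
  then show "pwz_conv (\<lambda>p. a * u p + b * v p) x" unfolding pwz_conv_def by (rule convergentI)
  show "I (\<lambda>p. a * u p + b * v p) x = a * I u x + b * I v x"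
    unfolding pwz_eq[OF x] by (rule limI[OF *[unfolded pwz_eq[OF x]]])
qed

text \<open>If \<rho> x lies in the exceptional set, then x lies in its image under multiplication
  by 1 / \<rho>, which is a null set as well.\<close>

lemma s_ae_AE:
  assumes P: "s_ae W P" and \<rho>: "\<rho> > 0"
  shows "AE x in W0. P (\<lambda>p. \<rho> * x p)"
proof -
  obtain N where N: "scale_invariant_null W N" "\<And>x. x \<in> space W - N \<Longrightarrow> P x"
    using P unfolding s_ae_def by blast
  have "(\<lambda>x p. (1 / \<rho>) * x p) ` N \<in> null_sets W"
    using N(1) \<rho> unfolding scale_invariant_null_def by (metis zero_less_divide_1_iff)
  then have "AE x in W. x \<notin> (\<lambda>x p. (1 / \<rho>) * x p) ` N" by (rule AE_not_in)
  then have "AE x in W. P (\<lambda>p. \<rho> * x p)"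
    using AE_space
  proof eventually_elim
    case (elim x)
    have "(\<lambda>p. \<rho> * x p) \<notin> N"
    proof
      assume "(\<lambda>p. \<rho> * x p) \<in> N"
      then have "(\<lambda>x p. (1 / \<rho>) * x p) (\<lambda>p. \<rho> * x p) \<in> (\<lambda>x p. (1 / \<rho>) * x p) ` N" by (rule imageI)
      moreover have "(\<lambda>x p. (1 / \<rho>) * x p) (\<lambda>p. \<rho> * x p) = x" using \<rho> by (simp add: fun_eq_iff)
      ultimately show False using elim(1) by simp
    qed
    then show ?case using C0_scale elim(2) by (intro N(2)) (simp add: space_W0)
  qed
  then show ?thesis by (simp add: AE_completion_iff)
qed

text \<open>If the property is stable under positive scaling, so is its failure, by scaling back
  with 1 / \<rho>. The exceptional set then contains its scaled copies, and its being null once is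
  enough.\<close>

lemma s_aeI:
  assumes ae: "AE x in W0. P x" and inv: "\<And>x \<rho>. \<rho> > 0 \<Longrightarrow> x \<in> C0 S T \<Longrightarrow> P x \<Longrightarrow> P (\<lambda>p. \<rho> * x p)"
  shows "s_ae W P"
proof -
  define N where "N = {x \<in> C0 S T. \<not> P x}"
  have "AE x in W. P x" using ae by (simp add: AE_completion_iff)
  then have null: "N \<in> null_sets W"
    unfolding N_def completion.AE_iff_null_sets by (simp add: space_W0)
  have "(\<lambda>x p. \<rho> * x p) ` N \<subseteq> N" if \<rho>: "\<rho> > 0" for \<rho>
  proof safe
    fix x assume x: "x \<in> N"
    have "\<not> P (\<lambda>p. \<rho> * x p)"
    proof
      assume "P (\<lambda>p. \<rho> * x p)"
      then have "P (\<lambda>p. (1 / \<rho>) * (\<rho> * x p))"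
        using x \<rho> C0_scale by (intro inv[of "1 / \<rho>" "\<lambda>p. \<rho> * x p"]) (auto simp: N_def)
      then show False using x \<rho> by (simp add: N_def)
    qed
    then show "(\<lambda>p. \<rho> * x p) \<in> N" using x C0_scale by (auto simp: N_def)
  qed
  then have "scale_invariant_null W N"
    unfolding scale_invariant_null_def using completion.complete2[OF _ null] by blast
  then show ?thesis
    unfolding s_ae_def by (intro exI[of _ N]) (auto simp: N_def space_W0)
qed

lemma s_ae_conj:
  assumes "s_ae W P" "s_ae W R"
  shows "s_ae W (\<lambda>x. P x \<and> R x)"
proof -
  obtain N where N: "scale_invariant_null W N" "\<And>x. x \<in> space W - N \<Longrightarrow> P x"
    using assms(1) unfolding s_ae_def by blast
  obtain N' where N': "scale_invariant_null W N'" "\<And>x. x \<in> space W - N' \<Longrightarrow> R x"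
    using assms(2) unfolding s_ae_def by blast
  have "scale_invariant_null W (N \<union> N')"
    using N(1) N'(1) unfolding scale_invariant_null_def by (simp add: image_Un null_sets.Un)
  then show ?thesis unfolding s_ae_def using N(2) N'(2) by (intro exI[of _ "N \<union> N'"]) auto
qed

lemma s_ae_mono:
  assumes P: "s_ae W P" and le: "\<And>x. x \<in> C0 S T \<Longrightarrow> P x \<Longrightarrow> R x"
  shows "s_ae W R"
proof -
  obtain N where N: "scale_invariant_null W N" "\<And>x. x \<in> space W - N \<Longrightarrow> P x"
    using P unfolding s_ae_def by blast
  then show ?thesis unfolding s_ae_def using le by (intro exI[of _ N]) (auto simp: space_W0)
qed

lemma s_ae_scale:
  assumes P: "s_ae W P" and \<sigma>: "\<sigma> > 0"
  shows "s_ae W (\<lambda>x. P (\<lambda>p. \<sigma> * x p))"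
proof -
  obtain N where N: "scale_invariant_null W N" "\<And>x. x \<in> space W - N \<Longrightarrow> P x"
    using P unfolding s_ae_def by blast
  define N' where "N' = (\<lambda>x p. (1 / \<sigma>) * x p) ` N"
  have "(\<lambda>x p. \<rho> * x p) ` N' = (\<lambda>x p. (\<rho> / \<sigma>) * x p) ` N" for \<rho>
    unfolding N'_def image_image by simp
  moreover have "(\<lambda>x p. (\<rho> / \<sigma>) * x p) ` N \<in> null_sets W" if "\<rho> > 0" for \<rho>
    using N(1) \<sigma> that unfolding scale_invariant_null_def by (metis divide_pos_pos)
  ultimately have "scale_invariant_null W N'"
    unfolding scale_invariant_null_def by (simp only:) blast
  moreover have "P (\<lambda>p. \<sigma> * x p)" if x: "x \<in> space W - N'" for x
  proof (rule N(2))
    have "(\<lambda>p. \<sigma> * x p) \<notin> N"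
    proof
      assume "(\<lambda>p. \<sigma> * x p) \<in> N"
      then have "(\<lambda>x p. (1 / \<sigma>) * x p) (\<lambda>p. \<sigma> * x p) \<in> N'" unfolding N'_def by (rule imageI)
      moreover have "(\<lambda>x p. (1 / \<sigma>) * x p) (\<lambda>p. \<sigma> * x p) = x" using \<sigma> by (simp add: fun_eq_iff)
      ultimately show False using x by simp
    qed
    then show "(\<lambda>p. \<sigma> * x p) \<in> space W - N" using x C0_scale by (simp add: space_W0)
  qed
  ultimately show ?thesis unfolding s_ae_def by blast
qed

section \<open>Joint measurability and common exceptional sets\<close>

lemma pwz_sum_pair_measurable:
  assumes [measurable]: "\<And>j. (\<lambda>z. coef (\<theta> z) j) \<in> borel_measurable N"
  shows "(\<lambda>xz. pwz_sum (\<theta> (snd xz)) n (fst xz)) \<in> borel_measurable (W0 \<Otimes>\<^sub>M N)"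
  unfolding pwz_sum_def by measurable

text \<open>Expressed through coefficients, the partial sums are finite sums of a function of z
  times a function of x, and the limit inherits their joint measurability.\<close>

lemma pwz_pair_measurable:
  assumes \<theta>: "\<And>j. (\<lambda>z. coef (\<theta> z) j) \<in> borel_measurable N"
  shows "(\<lambda>(x, z). I (\<theta> z) x) \<in> borel_measurable (W0 \<Otimes>\<^sub>M N)"
proof -
  note [measurable] = pwz_sum_pair_measurable[OF \<theta>]
  have "(\<lambda>xz. lim (\<lambda>n. pwz_sum (\<theta> (snd xz)) n (fst xz))) \<in> borel_measurable (W0 \<Otimes>\<^sub>M N)"
    by (intro borel_measurable_lim_metric) measurable
  moreover have "(case xz of (x, z) \<Rightarrow> I (\<theta> z) x) = lim (\<lambda>n. pwz_sum (\<theta> (snd xz)) n (fst xz))"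
    if "xz \<in> space (W0 \<Otimes>\<^sub>M N)" for xz
    using that by (auto simp: space_pair_measure space_W0 pwz_eq split_def)
  ultimately show ?thesis by (subst measurable_cong) auto
qed

lemma pwz_left_measurable:
  assumes [measurable]: "\<And>j. (\<lambda>z. coef (\<theta> z) j) \<in> borel_measurable N" and x: "x \<in> C0 S T"
  shows "(\<lambda>z. I (\<theta> z) x) \<in> borel_measurable N"
  unfolding pwz_eq[OF x] pwz_sum_def by (intro borel_measurable_lim_metric) measurable

text \<open>For each z the series converges for almost every x. Fubini's theorem exchanges the two,
  the set of convergence being measurable by the Cauchy criterion, and the outcome is stable under
  scaling of x.\<close>

lemma pwz_conv_s_ae:
  assumes N: "finite_measure N" and L: "\<And>z. z \<in> space N \<Longrightarrow> \<theta> z \<in> L2 S T"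
    and \<theta>: "\<And>j. (\<lambda>z. coef (\<theta> z) j) \<in> borel_measurable N"
  shows "s_ae W (\<lambda>x. AE z in N. pwz_conv (\<theta> z) x)"
proof (rule s_aeI)
  interpret N: finite_measure N by fact
  interpret P: pair_sigma_finite W0 N ..
  note [measurable] = pwz_sum_pair_measurable[OF \<theta>]
  have "{xz \<in> space (W0 \<Otimes>\<^sub>M N). pwz_conv (\<theta> (snd xz)) (fst xz)} \<in> sets (W0 \<Otimes>\<^sub>M N)"
    unfolding pwz_conv_def Cauchy_convergent_iff[symmetric] by (intro sets_Collect_Cauchy) measurable
  moreover have "AE z in N. AE x in W0. pwz_conv (\<theta> z) x"
  proof (rule AE_I2)
    show "AE x in W0. pwz_conv (\<theta> z) x" if "z \<in> space N" for z by (rule pwz_conv_AE[OF L[OF that]])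
  qed
  ultimately show "AE x in W0. AE z in N. pwz_conv (\<theta> z) x"
    by (subst P.AE_commute) auto
  show "AE z in N. pwz_conv (\<theta> z) (\<lambda>p. \<rho> * x p)" if "x \<in> C0 S T" "AE z in N. pwz_conv (\<theta> z) x" for x \<rho>
    using that(2) by eventually_elim (rule pwz_scale(1)[OF that(1)])
qed

lemma pwz_diff_char:
  assumes u: "u \<in> L2 S T" and v: "v \<in> L2 S T"
  shows "(LINT x|W0. iexp (a * (I u x - I v x))) = of_real (exp (- (a\<^sup>2 * (nrm (\<lambda>p. u p - v p))\<^sup>2) / 2))"
proof -
  have m: "(\<lambda>p. u p - v p) = (\<lambda>p. 1 * u p + (-1) * v p)" by simp
  have "(LINT x|W0. iexp (a * (I u x - I v x))) = (LINT x|W0. iexp (a * I (\<lambda>p. u p - v p) x))"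
  proof (rule integral_cong_AE)
    show "AE x in W0. iexp (a * (I u x - I v x)) = iexp (a * I (\<lambda>p. u p - v p) x)"
      using pwz_conv_AE[OF u] pwz_conv_AE[OF v] AE_space
    proof eventually_elim
      case (elim x)
      then show ?case using pwz_lincomb(2)[OF _ elim(1,2) u v, of 1 "-1"] by (simp add: space_W0)
    qed
  qed measurable
  then show ?thesis by (simp only: pwz_char[OF L2_diff[OF u v]])
qed

section \<open>Gaussian kernels on L_2(Q)\<close>

abbreviation BL :: "field2 measure" where "BL \<equiv> borel_L2 S T"

lemma iexp_pwz_bounded: "x \<in> C0 S T \<Longrightarrow> bounded_measurable BL (\<lambda>u. iexp (I u x))"
  using pwz_left_measurable[of "\<lambda>u. u" BL x, OF measurable_coef]
  by (intro bounded_measurableI[where B=1]) auto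

text \<open>For \<alpha> >= 0 this is the mean over x of exp(i sqrt(\<alpha>) (<u,x> -
  <w,x>)).\<close>

definition kern :: "real \<Rightarrow> field2 \<Rightarrow> field2 \<Rightarrow> real" where
  "kern \<alpha> w u = exp (- (\<alpha> * (nrm (\<lambda>p. u p - w p))\<^sup>2) / 2)"

lemma nrm_diff_measurable:
  assumes w: "w \<in> L2 S T" shows "(\<lambda>u. (nrm (\<lambda>p. u p - w p))\<^sup>2) \<in> borel_measurable BL"
proof (rule measurable_nrm)
  show "(\<lambda>u. coef (\<lambda>p. u p - w p) j) \<in> borel_measurable BL" for j
  proof (subst measurable_cong)
    show "coef (\<lambda>p. u p - w p) j = coef u j - coef w j" if "u \<in> space BL" for u
      using that w by (simp add: coef_diff)
  qed measurable
qed (use w in \<open>auto intro: L2_diff\<close>)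

lemma kern_measurable: "w \<in> L2 S T \<Longrightarrow> kern \<alpha> w \<in> borel_measurable BL"
  unfolding kern_def[abs_def] using nrm_diff_measurable[of w] by measurable

lemma kern_bounds: "0 \<le> \<alpha> \<Longrightarrow> 0 \<le> kern \<alpha> w u \<and> kern \<alpha> w u \<le> 1"
  by (simp add: kern_def)

lemma kern_bounded: "0 \<le> \<alpha> \<Longrightarrow> w \<in> L2 S T \<Longrightarrow> bounded_measurable BL (\<lambda>u. of_real (kern \<alpha> w u))"
  using kern_measurable[of w \<alpha>] kern_bounds[of \<alpha> w] by (intro bounded_measurableI[where B=1]) auto

text \<open>Completing the square: the product of two Gaussians is a Gaussian about the weighted
  mean of the centers, times a constant that depends on the distance of the centers.\<close>

lemma kern_mult:
  assumes \<alpha>: "\<alpha> > 0" "\<beta> \<ge> 0" and L: "w \<in> L2 S T" "v \<in> L2 S T"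
  obtains c z where "z \<in> L2 S T" "\<And>u. u \<in> L2 S T \<Longrightarrow> kern \<alpha> w u * kern \<beta> v u = c * kern (\<alpha> + \<beta>) z u"
proof
  define \<gamma> where "\<gamma> = \<alpha> + \<beta>"
  have \<gamma>: "\<gamma> > 0" using \<alpha> by (simp add: \<gamma>_def)
  define z where "z = (\<lambda>p. (\<alpha> / \<gamma>) * w p + (\<beta> / \<gamma>) * v p)"
  define c where "c = exp (- (\<alpha> * \<beta> / \<gamma> * (nrm (\<lambda>p. w p - v p))\<^sup>2) / 2)"
  show z: "z \<in> L2 S T" unfolding z_def by (intro L2_add L2_scale L)
  show "kern \<alpha> w u * kern \<beta> v u = c * kern (\<alpha> + \<beta>) z u" if u: "u \<in> L2 S T" for u
  proof -
    have uz: "\<gamma> * ip u z = \<alpha> * ip u w + \<beta> * ip u v"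
    proof -
      have "ip u z = (\<alpha> / \<gamma>) * ip u w + (\<beta> / \<gamma>) * ip u v"
        unfolding z_def using ip_add_right[OF L2_scale[OF L(1), of "\<alpha> / \<gamma>"] L2_scale[OF L(2), of "\<beta> / \<gamma>"] u]
        by (simp only: ip_scale ip_commute[of u "\<lambda>p. (\<alpha> / \<gamma>) * w p"] ip_commute[of u "\<lambda>p. (\<beta> / \<gamma>) * v p"]
            ip_commute[of w u] ip_commute[of v u])
      then show ?thesis using \<gamma> by (simp add: field_simps)
    qed
    have zz: "\<gamma>\<^sup>2 * (nrm z)\<^sup>2 = \<alpha>\<^sup>2 * (nrm w)\<^sup>2 + 2 * \<alpha> * \<beta> * ip w v + \<beta>\<^sup>2 * (nrm v)\<^sup>2"
    proof -
      have *: "(nrm (\<lambda>p. c * x p))\<^sup>2 = c\<^sup>2 * (nrm x)\<^sup>2" for c x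
        by (simp add: nrm_scale power_mult_distrib)
      have "ip (\<lambda>p. (\<alpha> / \<gamma>) * w p) (\<lambda>p. (\<beta> / \<gamma>) * v p) = (\<alpha> / \<gamma>) * ((\<beta> / \<gamma>) * ip w v)"
        by (simp only: ip_scale ip_commute[of w "\<lambda>p. (\<beta> / \<gamma>) * v p"] ip_commute[of v w])
      then have "(nrm z)\<^sup>2 = (\<alpha> / \<gamma>)\<^sup>2 * (nrm w)\<^sup>2 + 2 * ((\<alpha> / \<gamma>) * ((\<beta> / \<gamma>) * ip w v)) + (\<beta> / \<gamma>)\<^sup>2 * (nrm v)\<^sup>2"
        unfolding z_def using ip_sum_sum[OF L2_scale[OF L(1), of "\<alpha> / \<gamma>"] L2_scale[OF L(2), of "\<beta> / \<gamma>"]] by (simp only: *)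
      then show ?thesis using \<gamma> by (simp add: field_simps power2_eq_square)
    qed
    \<comment> \<open>Multiplied by \<gamma>, the identity is polynomial in norms and inner
      products.\<close>
    have "\<gamma> * (\<alpha> * (nrm (\<lambda>p. u p - w p))\<^sup>2 + \<beta> * (nrm (\<lambda>p. u p - v p))\<^sup>2) =
        \<gamma> * (\<gamma> * (nrm (\<lambda>p. u p - z p))\<^sup>2) + \<alpha> * \<beta> * (nrm (\<lambda>p. w p - v p))\<^sup>2"
    proof -
      have "\<gamma> * (\<gamma> * (nrm (\<lambda>p. u p - z p))\<^sup>2) = \<gamma>\<^sup>2 * (nrm u)\<^sup>2 - 2 * \<gamma> * (\<gamma> * ip u z) + \<gamma>\<^sup>2 * (nrm z)\<^sup>2"
        unfolding ip_diff_diff[OF u z] by (simp add: algebra_simps power2_eq_square)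
      then show ?thesis
        unfolding uz zz ip_diff_diff[OF u L(1)] ip_diff_diff[OF u L(2)] ip_diff_diff[OF L]
        by (simp add: \<gamma>_def algebra_simps power2_eq_square)
    qed
    then have "\<alpha> * (nrm (\<lambda>p. u p - w p))\<^sup>2 + \<beta> * (nrm (\<lambda>p. u p - v p))\<^sup>2 =
        \<gamma> * (nrm (\<lambda>p. u p - z p))\<^sup>2 + \<alpha> * \<beta> / \<gamma> * (nrm (\<lambda>p. w p - v p))\<^sup>2"
      using \<gamma> by (simp add: field_simps)
    moreover have "- a / 2 + - b / 2 = - d / 2 + - c / 2" if "a + b = c + d" for a b c d :: real
      using that by linarith
    ultimately show ?thesis
      unfolding kern_def c_def \<gamma>_def[symmetric] mult_exp_exp by (intro arg_cong[where f=exp]) blast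
  qed
qed

lemma kern_power: "kern 1 w u ^ m = kern (real m) w u"
  by (simp add: kern_def exp_of_nat_mult[symmetric])

text \<open>A complex measure in the form to which Fubini's theorem applies: a density on a finite
  positive measure space, carried to L_2(Q) by \<theta>.\<close>

definition density_rep :: "(field2 set \<Rightarrow> complex) \<Rightarrow> 'b measure \<Rightarrow> ('b \<Rightarrow> field2) \<Rightarrow> ('b \<Rightarrow> complex) \<Rightarrow> bool" where
  "density_rep f N \<theta> g \<longleftrightarrow> finite_measure N \<and> integrable N g \<and> \<theta> \<in> measurable N BL \<and>
     (\<forall>w. bounded_measurable BL w \<longrightarrow> complex_integral BL f w = (LINT z|N. g z * w (\<theta> z)))"

lemma density_rep_ex:
  assumes "complex_measure_on BL f"
  obtains \<mu> :: "field2 measure" and g where "density_rep f \<mu> (\<lambda>u. u) g"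
proof -
  obtain \<mu> g where "finite_measure \<mu>" "sets \<mu> = sets BL" "integrable \<mu> g"
    "\<And>w. bounded_measurable BL w \<Longrightarrow> complex_integral BL f w = (LINT x|\<mu>. g x * w x)"
    by (rule complex_measure_density[OF assms]) blast
  then have "density_rep f \<mu> (\<lambda>u. u) g" by (auto simp: density_rep_def measurable_ident_sets)
  then show ?thesis using that by blast
qed

lemma density_repD:
  assumes "density_rep f N \<theta> g"
  shows "finite_measure N" "integrable N g" "\<theta> \<in> measurable N BL"
    "\<And>w. bounded_measurable BL w \<Longrightarrow> complex_integral BL f w = (LINT z|N. g z * w (\<theta> z))"
    "\<And>z. z \<in> space N \<Longrightarrow> \<theta> z \<in> L2 S T" "\<And>j. (\<lambda>z. coef (\<theta> z) j) \<in> borel_measurable N"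
proof -
  show *: "finite_measure N" "integrable N g" "\<theta> \<in> measurable N BL"
    "\<And>w. bounded_measurable BL w \<Longrightarrow> complex_integral BL f w = (LINT z|N. g z * w (\<theta> z))"
    using assms by (auto simp: density_rep_def)
  show "\<theta> z \<in> L2 S T" if "z \<in> space N" for z using measurable_space[OF *(3) that] by simp
  show "(\<lambda>z. coef (\<theta> z) j) \<in> borel_measurable N" for j using *(3) by measurable
qed

text \<open>An equality that holds s-almost everywhere may be read along \<rho> x for each \<rho> >
  0. The factor \<rho> can be taken out of <u,x> where the series converges, which for almost every
  x is the case for almost every z.\<close>

lemma has_measure_AE:
  assumes F: "has_measure S T \<phi> W F f" and rep: "density_rep f N \<theta> g" and \<rho>: "\<rho> > 0"
  shows "AE x in W0. F (\<lambda>p. \<rho> * x p) = Some (LINT z|N. g z * iexp (\<rho> * I (\<theta> z) x))"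
proof -
  note r = density_repD[OF rep]
  have [measurable]: "g \<in> borel_measurable N" using r(2) by auto
  have "s_ae W (\<lambda>x. F x = Some (complex_integral BL f (\<lambda>u. iexp (I u x))))"
    using F by (simp add: has_measure_def)
  from s_ae_AE[OF this \<rho>] have 1: "AE x in W0. F (\<lambda>p. \<rho> * x p) = Some (complex_integral BL f (\<lambda>u. iexp (I u (\<lambda>p. \<rho> * x p))))" .
  have 2: "AE x in W0. AE z in N. pwz_conv (\<theta> z) x"
    using s_ae_AE[OF pwz_conv_s_ae[OF r(1,5,6)], of 1] by simp
  show ?thesis using 1 2 AE_space
  proof eventually_elim
    case (elim x)
    then have x: "x \<in> C0 S T" by (simp add: space_W0)
    have [measurable]: "(\<lambda>z. I (\<theta> z) y) \<in> borel_measurable N" if "y \<in> C0 S T" for y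
      by (rule pwz_left_measurable[OF r(6) that])
    have "complex_integral BL f (\<lambda>u. iexp (I u (\<lambda>p. \<rho> * x p))) = (LINT z|N. g z * iexp (I (\<theta> z) (\<lambda>p. \<rho> * x p)))"
      by (rule r(4)[OF iexp_pwz_bounded[OF C0_scale[OF x]]])
    also have "\<dots> = (LINT z|N. g z * iexp (\<rho> * I (\<theta> z) x))"
    proof (rule integral_cong_AE)
      show "(\<lambda>z. g z * iexp (I (\<theta> z) (\<lambda>p. \<rho> * x p))) \<in> borel_measurable N"
        using pwz_left_measurable[OF r(6) C0_scale[OF x]] by measurable
      show "(\<lambda>z. g z * iexp (\<rho> * I (\<theta> z) x)) \<in> borel_measurable N"
        using pwz_left_measurable[OF r(6) x] by measurable
      show "AE z in N. g z * iexp (I (\<theta> z) (\<lambda>p. \<rho> * x p)) = g z * iexp (\<rho> * I (\<theta> z) x)"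
        using elim(2) by eventually_elim (simp only: pwz_scale(2)[OF x])
    qed
    finally show ?case using elim(1) by simp
  qed
qed

lemma kern_integral:
  assumes rep: "density_rep f N \<theta> g" and w: "w \<in> L2 S T" and \<alpha>: "\<alpha> > 0"
  shows "integrable W0 (\<lambda>x. LINT z|N. g z * iexp (sqrt \<alpha> * (I (\<theta> z) x - I w x)))"
    and "(LINT x|W0. LINT z|N. g z * iexp (sqrt \<alpha> * (I (\<theta> z) x - I w x))) = complex_integral BL f (\<lambda>u. of_real (kern \<alpha> w u))"
proof -
  note r = density_repD[OF rep]
  have Y: "(\<lambda>(x, z). I (\<theta> z) x - I w x) \<in> borel_measurable (W0 \<Otimes>\<^sub>M N)"
    using pwz_pair_measurable[OF r(6)] by (auto simp: split_def intro!: borel_measurable_diff measurable_compose[OF measurable_fst pwz_measurable])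
  note G = W0.gaussian_fubini[OF r(1,2) Y pwz_diff_char[OF r(5) w], of "sqrt \<alpha>"]
  show "integrable W0 (\<lambda>x. LINT z|N. g z * iexp (sqrt \<alpha> * (I (\<theta> z) x - I w x)))" by (rule G(1)) simp
  have "complex_integral BL f (\<lambda>u. of_real (kern \<alpha> w u)) = (LINT z|N. g z * of_real (kern \<alpha> w (\<theta> z)))"
    using \<alpha> by (intro r(4) kern_bounded w) simp
  then show "(LINT x|W0. LINT z|N. g z * iexp (sqrt \<alpha> * (I (\<theta> z) x - I w x))) = complex_integral BL f (\<lambda>u. of_real (kern \<alpha> w u))"
    using G(2) \<alpha> by (simp add: kern_def)
qed

text \<open>The factor exp(-i sqrt(\<alpha>) <w,x>) is constant in the integration over the measure.
  What remains is F at sqrt(\<alpha>) x, and this is represented by both measures.\<close>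

lemma kern_integral_unique:
  assumes F: "has_measure S T \<phi> W F f" "has_measure S T \<phi> W F f'" and w: "w \<in> L2 S T" and \<alpha>: "\<alpha> > 0"
  shows "complex_integral BL f (\<lambda>u. of_real (kern \<alpha> w u)) = complex_integral BL f' (\<lambda>u. of_real (kern \<alpha> w u))"
proof -
  obtain \<mu> :: "field2 measure" and g where rep: "density_rep f \<mu> (\<lambda>u. u) g"
    using F(1) density_rep_ex[of f] by (auto simp: has_measure_def)
  obtain \<mu>' :: "field2 measure" and g' where rep': "density_rep f' \<mu>' (\<lambda>u. u) g'"
    using F(2) density_rep_ex[of f'] by (auto simp: has_measure_def)
  have s: "sqrt \<alpha> > 0" using \<alpha> by simp
  have split: "(LINT z|N. g z * iexp (sqrt \<alpha> * (I z x - I w x))) =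
      iexp (- (sqrt \<alpha> * I w x)) * (LINT z|N. g z * iexp (sqrt \<alpha> * I z x))" for N x and g :: "field2 \<Rightarrow> complex"
  proof -
    have "(LINT z|N. g z * iexp (sqrt \<alpha> * (I z x - I w x))) = (LINT z|N. iexp (- (sqrt \<alpha> * I w x)) * (g z * iexp (sqrt \<alpha> * I z x)))"
      by (intro Bochner_Integration.integral_cong refl) (simp add: exp_diff exp_minus right_diff_distrib field_simps)
    then show ?thesis by simp
  qed
  have "(LINT x|W0. LINT z|\<mu>. g z * iexp (sqrt \<alpha> * (I z x - I w x))) =
      (LINT x|W0. LINT z|\<mu>'. g' z * iexp (sqrt \<alpha> * (I z x - I w x)))"
  proof (rule integral_cong_AE)
    show "AE x in W0. (LINT z|\<mu>. g z * iexp (sqrt \<alpha> * (I z x - I w x))) = (LINT z|\<mu>'. g' z * iexp (sqrt \<alpha> * (I z x - I w x)))"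
      using has_measure_AE[OF F(1) rep s] has_measure_AE[OF F(2) rep' s]
    proof eventually_elim
      case (elim x)
      then have "(LINT z|\<mu>. g z * iexp (sqrt \<alpha> * I z x)) = (LINT z|\<mu>'. g' z * iexp (sqrt \<alpha> * I z x))"
        by (metis option.inject)
      then show ?case unfolding split by (rule arg_cong)
    qed
  qed (use kern_integral(1)[OF rep w \<alpha>] kern_integral(1)[OF rep' w \<alpha>] in auto)
  then show ?thesis unfolding kern_integral(2)[OF rep w \<alpha>] kern_integral(2)[OF rep' w \<alpha>] .
qed

text \<open>Lists permit induction on the number of balls, and concatenation of lists corresponds to
  intersection of the sets.\<close>

definition balls :: "(field2 \<times> real) list \<Rightarrow> field2 set" where
  "balls L = {u \<in> L2 S T. \<forall>(w, r)\<in>set L. u \<in> ball2 w r}"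

lemma balls_Cons: "indicator (balls ((w, r) # L)) u = (indicator (balls L) u * indicator (ball2 w r) u :: complex)"
  by (auto simp: balls_def indicator_def ball2_def)

lemma balls_sets: "(\<And>w r. (w, r) \<in> set L \<Longrightarrow> w \<in> L2 S T) \<Longrightarrow> balls L \<in> sets BL"
proof (induction L)
  case Nil
  then show ?case using sets.top[of BL] by (simp add: balls_def)
next
  case (Cons a L)
  obtain w r where a: "a = (w, r)" by fastforce
  have "balls (a # L) = balls L \<inter> ball2 w r" by (auto simp: balls_def a)
  then show ?case using Cons a ball2_sets[of w r] by auto
qed

text \<open>A product of kernels is a multiple of a kernel. So the functional vanishes on polynomials in kernels,
  by the Weierstrass theorem on indicators of finite intersections of balls, and these generate the
  Borel sets.\<close>

lemma kern_determines:
  assumes \<Lambda>: "sigma_functional BL \<Lambda>"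
    and 0: "\<And>\<alpha> w. \<alpha> > 0 \<Longrightarrow> w \<in> L2 S T \<Longrightarrow> \<Lambda> (\<lambda>u. of_real (kern \<alpha> w u)) = 0"
    and A: "A \<in> sets BL"
  shows "\<Lambda> (indicator A) = 0"
proof -
  \<comment> \<open>The induction is on the list with arbitrary \<alpha> and v, because
    multiplication by powers of another kernel changes width and center.\<close>
  have step: "\<Lambda> (\<lambda>u. indicator (balls L) u * of_real (kern \<alpha> v u)) = 0"
    if "\<And>w r. (w, r) \<in> set L \<Longrightarrow> w \<in> L2 S T" "\<alpha> > 0" "v \<in> L2 S T" for L \<alpha> v
    using that
  proof (induction L arbitrary: \<alpha> v)
    case Nil
    have "\<Lambda> (\<lambda>u. of_real (kern \<alpha> v u)) = \<Lambda> (\<lambda>u. indicator (balls []) u * of_real (kern \<alpha> v u))"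
      using Nil by (intro sigma_functional_cong[OF \<Lambda> kern_bounded]) (auto simp: balls_def)
    then show ?case using 0[OF Nil(2,3)] by simp
  next
    case (Cons a L)
    obtain w r where a: "a = (w, r)" by fastforce
    have w: "w \<in> L2 S T" and L: "\<And>w r. (w, r) \<in> set L \<Longrightarrow> w \<in> L2 S T" using Cons.prems(1) a by auto
    have bmL: "bounded_measurable BL (indicator (balls L))"
      by (intro bounded_measurable_indicator balls_sets L)
    have bm: "bounded_measurable BL (\<lambda>u. indicator (balls L) u * of_real (kern \<alpha> v u))"
      using Cons.prems by (intro bounded_measurable_mult bmL kern_bounded) auto
    have "\<Lambda> (\<lambda>u. indicator (balls L) u * of_real (kern \<alpha> v u) * indicator (ball2 w r) u) = 0"
    proof (cases "r > 0")
      case True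
      have mom: "\<Lambda> (\<lambda>u. indicator (balls L) u * of_real (kern \<alpha> v u) * of_real (kern 1 w u ^ m)) = 0" for m
      proof -
        obtain c z where z: "z \<in> L2 S T" "\<And>u. u \<in> L2 S T \<Longrightarrow> kern \<alpha> v u * kern (real m) w u = c * kern (\<alpha> + real m) z u"
          by (rule kern_mult[of \<alpha> "real m" v w]) (use Cons.prems w in auto)
        have bmz: "bounded_measurable BL (\<lambda>u. indicator (balls L) u * of_real (kern (\<alpha> + real m) z u))"
          using Cons.prems by (intro bounded_measurable_mult bmL kern_bounded z(1)) auto
        have "\<Lambda> (\<lambda>u. of_real c * (indicator (balls L) u * of_real (kern (\<alpha> + real m) z u))) =
            \<Lambda> (\<lambda>u. indicator (balls L) u * of_real (kern \<alpha> v u) * of_real (kern 1 w u ^ m))"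
        proof (rule sigma_functional_cong[OF \<Lambda>])
          show "bounded_measurable BL (\<lambda>u. of_real c * (indicator (balls L) u * of_real (kern (\<alpha> + real m) z u)))"
            by (intro bounded_measurable_mult[OF bounded_measurable_const bmz])
          fix u assume "u \<in> space BL"
          then have "kern \<alpha> v u * kern 1 w u ^ m = c * kern (\<alpha> + real m) z u" using z(2) by (simp add: kern_power)
          then have "of_real (kern \<alpha> v u) * of_real (kern 1 w u ^ m) = of_real c * complex_of_real (kern (\<alpha> + real m) z u)"
            by (simp only: of_real_mult[symmetric])
          then show "of_real c * (indicator (balls L) u * of_real (kern (\<alpha> + real m) z u)) =
              indicator (balls L) u * of_real (kern \<alpha> v u) * complex_of_real (kern 1 w u ^ m)"
            by (simp only: mult.assoc mult.left_commute)
        qed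
        moreover have "\<Lambda> (\<lambda>u. of_real c * (indicator (balls L) u * of_real (kern (\<alpha> + real m) z u))) = 0"
          using sigma_functional_scale[OF \<Lambda> bmz, of "of_real c"] Cons.IH[OF L add_pos_nonneg[OF Cons.prems(2) of_nat_0_le_iff] z(1)] by simp
        ultimately show ?thesis by simp
      qed
      have "\<Lambda> (\<lambda>u. indicator (balls L) u * of_real (kern \<alpha> v u) * indicator {x \<in> space BL. exp (- r\<^sup>2 / 2) < kern 1 w x} u) = 0"
      proof (rule sigma_functional_weierstrass[OF sigma_functional_times[OF \<Lambda> bm] kern_measurable[OF w]])
        show "\<Lambda> (\<lambda>u. indicator (balls L) u * of_real (kern \<alpha> v u) * complex_of_real (kern 1 w u ^ m)) = 0" for m
          by (rule mom)
      qed (use kern_bounds[of 1 w] in auto)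
      \<comment> \<open>The kernel decreases with the distance from w, and exp(-r^2/2) is its value
        at distance r.\<close>
      moreover have "{x \<in> space BL. exp (- r\<^sup>2 / 2) < kern 1 w x} = ball2 w r"
        using True power2_less_imp_less[of _ r] power_strict_mono[of _ r 2] by (auto simp: ball2_def kern_def)
      ultimately show ?thesis by simp
    next
      case False
      then have "ball2 w r = {}" using le_less_trans[OF nrm_nonneg] by (auto simp: ball2_def)
      then show ?thesis using sigma_functional_zero[OF \<Lambda>] by simp
    qed
    then show ?case by (simp add: a balls_Cons mult_ac)
  qed
  have balls0: "\<Lambda> (indicator (balls L)) = 0" if L: "\<And>w r. (w, r) \<in> set L \<Longrightarrow> w \<in> L2 S T" for L
  proof -
    \<comment> \<open>Kernels of ever larger width tend to 1, so the remaining kernel factor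
      disappears in the limit.\<close>
    have "(\<lambda>n. \<Lambda> (\<lambda>u. indicator (balls L) u * of_real (kern (1 / real (Suc n)) (\<lambda>_. 0) u))) \<longlonglongrightarrow> \<Lambda> (indicator (balls L))"
    proof (rule sigma_functional_lim[OF \<Lambda>, where B=1])
      show "(\<lambda>u. indicator (balls L) u * complex_of_real (kern (1 / real (Suc n)) (\<lambda>_. 0) u)) \<in> borel_measurable BL" for n
        using bounded_measurable_indicator[OF balls_sets[OF L]] kern_bounded[OF _ L2_const[of 0], of "1 / real (Suc n)"]
        by (intro borel_measurable_times) (auto simp: bounded_measurable_def)
      show "indicator (balls L) \<in> borel_measurable BL"
        using balls_sets[OF L] by (intro borel_measurable_indicator) auto
      show "norm (indicator (balls L) u * complex_of_real (kern (1 / real (Suc n)) (\<lambda>_. 0) u)) \<le> 1" for n u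
        using kern_bounds[of "1 / real (Suc n)" "\<lambda>_. 0" u] by (auto simp: norm_mult indicator_def)
      fix u
      have "(\<lambda>n. kern (1 / real (Suc n)) (\<lambda>_. 0) u) \<longlonglongrightarrow> exp (- (0 * (nrm (\<lambda>p. u p - 0))\<^sup>2) / 2)"
        unfolding kern_def inverse_eq_divide[symmetric] by (intro tendsto_intros LIMSEQ_inverse_real_of_nat) simp
      then have "(\<lambda>n. indicator (balls L) u * complex_of_real (kern (1 / real (Suc n)) (\<lambda>_. 0) u)) \<longlonglongrightarrow> indicator (balls L) u * of_real 1"
        by (intro tendsto_intros) simp
      then show "(\<lambda>n. indicator (balls L) u * complex_of_real (kern (1 / real (Suc n)) (\<lambda>_. 0) u)) \<longlonglongrightarrow> indicator (balls L) u" by simp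
    qed
    moreover have "\<Lambda> (\<lambda>u. indicator (balls L) u * of_real (kern (1 / real (Suc n)) (\<lambda>_. 0) u)) = 0" for n
      by (intro step L L2_const) auto
    ultimately show ?thesis by (simp add: LIMSEQ_const_iff)
  qed
  define E where "E = {balls L | L. \<forall>w r. (w, r) \<in> set L \<longrightarrow> w \<in> L2 S T}"
  have E: "Int_stable E" "E \<subseteq> Pow (L2 S T)"
  proof -
    have "balls L \<inter> balls L' \<in> E" if "\<forall>w r. (w, r) \<in> set L \<longrightarrow> w \<in> L2 S T"
      "\<forall>w r. (w, r) \<in> set L' \<longrightarrow> w \<in> L2 S T" for L L'
    proof -
      have "balls L \<inter> balls L' = balls (L @ L')" by (auto simp: balls_def)
      moreover have "\<forall>w r. (w, r) \<in> set (L @ L') \<longrightarrow> w \<in> L2 S T" using that by auto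
      ultimately show ?thesis unfolding E_def by blast
    qed
    then show "Int_stable E" by (intro Int_stableI) (auto simp: E_def)
  qed (auto simp: E_def balls_def)
  have "sets BL \<subseteq> sigma_sets (L2 S T) E"
    unfolding sets_borel_L2
  proof (rule sigma_sets_mono, safe)
    fix U assume "open_L2 S T U"
    then obtain C where C: "countable C" "C \<subseteq> dense_combs \<times> UNIV" "U = (\<Union>(w,r)\<in>C. ball2 w r)"
      using open_L2_countable_balls by blast
    have "(\<Union>(w,r)\<in>C. ball2 w r) \<in> sets (sigma (L2 S T) E)"
    proof (rule sets.countable_UN''[OF C(1)], safe)
      fix w r assume "(w, r) \<in> C"
      then have w: "w \<in> L2 S T" using C(2) dense_combs_L2 by auto
      have "ball2 w r = balls [(w, r)]" by (auto simp: balls_def ball2_def)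
      then have "ball2 w r \<in> E" unfolding E_def using w by (intro CollectI exI[of _ "[(w, r)]"]) simp
      then show "ball2 w r \<in> sets (sigma (L2 S T) E)" using E(2) by auto
    qed
    then show "U \<in> sigma_sets (L2 S T) E" using E(2) C(3) by simp
  qed
  then have A': "A \<in> sigma_sets (L2 S T) E" using A by blast
  have sub: "sigma_sets (L2 S T) E \<subseteq> sets BL"
  proof -
    have "E \<subseteq> sets BL"
    proof
      fix A assume "A \<in> E"
      then obtain L where "A = balls L" "\<And>w r. (w, r) \<in> set L \<Longrightarrow> w \<in> L2 S T" unfolding E_def by blast
      then show "A \<in> sets BL" using balls_sets by simp
    qed
    from sets.sigma_sets_subset[OF this] show ?thesis by simp
  qed
  show ?thesis
    using E(1) E(2) A'
  proof (induction rule: sigma_sets_induct_disjoint)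
    case (basic A)
    then show ?case using balls0 by (auto simp: E_def)
  next
    case empty
    then show ?case using sigma_functional_zero[OF \<Lambda>] by (simp add: indicator_def[abs_def])
  next
    case (compl A)
    then have A: "A \<in> sets BL" "A \<subseteq> L2 S T" using sub sets.sets_into_space[of A BL] by auto
    have L2: "balls [] = L2 S T" by (simp add: balls_def)
    have "indicator (L2 S T - A) = (\<lambda>u. 1 * indicator (L2 S T) u + (-1) * indicator A u :: complex)"
      using A(2) by (auto simp: fun_eq_iff indicator_def)
    moreover have "\<Lambda> (\<lambda>u. 1 * indicator (L2 S T) u + (-1) * indicator A u) = 1 * \<Lambda> (indicator (L2 S T)) + (-1) * \<Lambda> (indicator A)"
      using sets.top[of BL] by (intro sigma_functional_lin[OF \<Lambda>] bounded_measurable_indicator A(1)) simp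
    ultimately show ?case using compl(2) balls0[of "[]"] L2 by simp
  next
    case (union A)
    have "(\<lambda>i. \<Lambda> (indicator (A i))) sums \<Lambda> (indicator (\<Union>i. A i))"
      using complex_measure_on_functional[OF \<Lambda>] union(1,2) sub unfolding complex_measure_on_def by blast
    then show ?case using union(3) by (simp add: sums_unique2[OF _ sums_zero])
  qed
qed

lemma measure_unique:
  assumes F: "has_measure S T \<phi> W F f" "has_measure S T \<phi> W F f'" and w: "bounded_measurable BL w"
  shows "complex_integral BL f w = complex_integral BL f' w"
proof -
  have f: "complex_measure_on BL f" "complex_measure_on BL f'" using F by (auto simp: has_measure_def)
  note \<Lambda> = sigma_functional_combine[OF sigma_functional_complex_integral[OF f(1)] sigma_functional_complex_integral[OF f(2)], of 1 "-1"]
  have "f A = f' A" if A: "A \<in> sets BL" for A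
    using kern_determines[OF \<Lambda> _ A] kern_integral_unique[OF F]
    by (simp add: complex_integral_indicator[OF f(1) A] complex_integral_indicator[OF f(2) A])
  then show ?thesis by (rule complex_integral_cong_measure[OF f _ w])
qed

end

section \<open>Transforms and convolution products\<close>

lemma integral_pair_times:
  fixes a :: "'a \<Rightarrow> complex" and b :: "'b \<Rightarrow> complex"
  assumes N: "finite_measure N" "finite_measure N'" and a: "integrable N a" and b: "integrable N' b"
  shows "integrable (N \<Otimes>\<^sub>M N') (\<lambda>z. a (fst z) * b (snd z))"
    and "(LINT z|(N \<Otimes>\<^sub>M N'). a (fst z) * b (snd z)) = (LINT z|N. a z) * (LINT z|N'. b z)"
proof -
  interpret N: finite_measure N by fact
  interpret N': finite_measure N' by fact
  interpret P: pair_sigma_finite N N' ..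
  have [measurable]: "a \<in> borel_measurable N" "b \<in> borel_measurable N'" using a b by auto
  have int: "integrable (N \<Otimes>\<^sub>M N') (\<lambda>(x, y). a x * b y)"
  proof (rule P.Fubini_integrable)
    have "(\<lambda>x. LINT y|N'. norm (case (x, y) of (x, y) \<Rightarrow> a x * b y)) = (\<lambda>x. norm (a x) * (LINT y|N'. norm (b y)))"
      by (simp add: norm_mult)
    then show "integrable N (\<lambda>x. LINT y|N'. norm (case (x, y) of (x, y) \<Rightarrow> a x * b y))"
      using a by simp
    show "AE x in N. integrable N' (\<lambda>y. case (x, y) of (x, y) \<Rightarrow> a x * b y)" using b by simp
  qed measurable
  then show "integrable (N \<Otimes>\<^sub>M N') (\<lambda>z. a (fst z) * b (snd z))" by (simp add: split_def)
  have "(LINT z|(N \<Otimes>\<^sub>M N'). a (fst z) * b (snd z)) = (LINT x|N. LINT y|N'. a x * b y)"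
    using P.integral_fst'[OF int] by (simp add: split_def)
  then show "(LINT z|(N \<Otimes>\<^sub>M N'). a (fst z) * b (snd z)) = (LINT z|N. a z) * (LINT z|N'. b z)" by simp
qed

lemma integrable_times_iexp:
  assumes D: "integrable N D" and t[measurable]: "t \<in> borel_measurable N"
  shows "integrable N (\<lambda>z. D z * iexp (t z))"
proof (rule Bochner_Integration.integrable_bound[OF D])
  have [measurable]: "D \<in> borel_measurable N" using D by auto
  show "(\<lambda>z. D z * iexp (t z)) \<in> borel_measurable N" by measurable
qed (simp add: norm_mult)

context yeh_wiener begin

section \<open>Multiplication operators and Fourier representations\<close>

definition multiplier :: "field2 \<Rightarrow> bool" where
  "multiplier k \<longleftrightarrow> (\<forall>u\<in>L2 S T. (\<lambda>p. u p * k p) \<in> L2 S T)"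

lemma multiplier_L2: "multiplier k \<Longrightarrow> u \<in> L2 S T \<Longrightarrow> (\<lambda>p. u p * k p) \<in> L2 S T"
  by (simp add: multiplier_def)

lemma multiplier_hk: "bv_hardy_krause S T k \<Longrightarrow> multiplier k"
  by (simp add: multiplier_def hk_L2_mult)

lemma multiplier_divide: "multiplier k \<Longrightarrow> multiplier (\<lambda>p. k p / c)"
  unfolding multiplier_def using L2_scale[of "\<lambda>p. u p * k p" "1 / c" for u] by simp

text \<open>Multiplication by k is symmetric, so the j-th coefficient of u k is the inner product of
  u with the product of \<open>\<phi> j\<close> and k, a measurable function of u.\<close>

lemma multiplier_measurable:
  assumes k: "multiplier k" and \<theta>: "\<theta> \<in> measurable N BL"
  shows "(\<lambda>z p. \<theta> z p * k p) \<in> measurable N BL"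
proof (rule measurable_compose[OF \<theta>], rule borel_L2_measurableI)
  show "(\<lambda>p. u p * k p) \<in> L2 S T" if "u \<in> space BL" for u using that k by (simp add: multiplier_L2)
  fix j
  have "coef (\<lambda>p. u p * k p) j = ip u (\<lambda>p. \<phi> j p * k p)" for u
    unfolding coef_def inner2_def by (intro Bochner_Integration.integral_cong refl) simp
  then show "(\<lambda>u. coef (\<lambda>p. u p * k p) j) \<in> borel_measurable BL"
    using measurable_ip[OF multiplier_L2[OF k hk_L2[OF \<phi>_hk]]] by simp
qed

lemma measurable_BL_coef: "\<theta> \<in> measurable N BL \<Longrightarrow> (\<lambda>z. coef (\<theta> z) j) \<in> borel_measurable N"
  by measurable

lemma measurable_BL_space: "\<theta> \<in> measurable N BL \<Longrightarrow> z \<in> space N \<Longrightarrow> \<theta> z \<in> L2 S T"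
  using measurable_space[of \<theta> N BL z] by simp

lemma measurable_BL_nrm: "\<theta> \<in> measurable N BL \<Longrightarrow> (\<lambda>z. (nrm (\<theta> z))\<^sup>2) \<in> borel_measurable N"
  by (intro measurable_nrm measurable_BL_space measurable_BL_coef)

lemma measurable_BL_pwz: "\<theta> \<in> measurable N BL \<Longrightarrow> x \<in> C0 S T \<Longrightarrow> (\<lambda>z. I (\<theta> z) x) \<in> borel_measurable N"
  by (intro pwz_left_measurable measurable_BL_coef)

lemma measurable_BL_lincomb:
  assumes "\<theta> \<in> measurable N BL" "\<theta>' \<in> measurable N BL"
  shows "(\<lambda>z p. a * \<theta> z p + b * \<theta>' z p) \<in> measurable N BL"
proof (rule borel_L2_measurableI)
  show "(\<lambda>p. a * \<theta> z p + b * \<theta>' z p) \<in> L2 S T" if "z \<in> space N" for z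
    by (intro L2_add L2_scale measurable_BL_space[OF assms(1) that] measurable_BL_space[OF assms(2) that])
  fix j
  have "coef (\<lambda>p. a * \<theta> z p + b * \<theta>' z p) j = a * coef (\<theta> z) j + b * coef (\<theta>' z) j" if "z \<in> space N" for z
    using measurable_BL_space[OF assms(1) that] measurable_BL_space[OF assms(2) that]
    by (simp add: coef_add coef_scale L2_scale)
  moreover have "(\<lambda>z. a * coef (\<theta> z) j + b * coef (\<theta>' z) j) \<in> borel_measurable N"
    using measurable_BL_coef[OF assms(1)] measurable_BL_coef[OF assms(2)] by measurable
  ultimately show "(\<lambda>z. coef (\<lambda>p. a * \<theta> z p + b * \<theta>' z p) j) \<in> borel_measurable N"
    by (subst measurable_cong)
qed

text \<open>The parameter space and the map \<theta> are kept general: transforms change only the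
  density g, while a product of functionals moves to a product space.\<close>

definition fourier_rep :: "functional \<Rightarrow> 'b measure \<Rightarrow> ('b \<Rightarrow> field2) \<Rightarrow> ('b \<Rightarrow> complex) \<Rightarrow> bool" where
  "fourier_rep F N \<theta> g \<longleftrightarrow> finite_measure N \<and> integrable N g \<and> \<theta> \<in> measurable N BL \<and>
     s_ae W (\<lambda>x. F x = Some (LINT z|N. g z * iexp (I (\<theta> z) x)))"

lemma fourier_repD:
  assumes "fourier_rep F N \<theta> g"
  shows "finite_measure N" "integrable N g" "\<theta> \<in> measurable N BL"
    "s_ae W (\<lambda>x. F x = Some (LINT z|N. g z * iexp (I (\<theta> z) x)))"
  using assms by (auto simp: fourier_rep_def)

lemma fourier_rep_ex:
  assumes F: "has_measure S T \<phi> W F f"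
  obtains \<mu> :: "field2 measure" and g where "fourier_rep F \<mu> (\<lambda>u. u) g"
proof -
  obtain \<mu> :: "field2 measure" and g where rep: "density_rep f \<mu> (\<lambda>u. u) g"
    using F density_rep_ex[of f] by (auto simp: has_measure_def)
  note r = density_repD[OF rep]
  have "s_ae W (\<lambda>x. F x = Some (complex_integral BL f (\<lambda>u. iexp (I u x))))"
    using F by (simp add: has_measure_def)
  then have "s_ae W (\<lambda>x. F x = Some (LINT u|\<mu>. g u * iexp (I u x)))"
    by (rule s_ae_mono) (simp only: r(4)[OF iexp_pwz_bounded])
  then have "fourier_rep F \<mu> (\<lambda>u. u) g" using r(1,2,3) by (simp add: fourier_rep_def)
  then show ?thesis by (rule that)
qed

lemma fourier_rep_has_measure:
  assumes "fourier_rep F N \<theta> g"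
  shows "has_measure S T \<phi> W F (\<lambda>A. LINT z|N. g z * indicator A (\<theta> z))"
proof -
  note r = fourier_repD[OF assms]
  note \<Lambda> = sigma_functional_integral[OF r(2,3)]
  have "s_ae W (\<lambda>x. F x = Some (complex_integral BL (\<lambda>A. LINT z|N. g z * indicator A (\<theta> z)) (\<lambda>u. iexp (I u x))))"
    using r(4) by (rule s_ae_mono) (simp only: complex_integral_functional[OF \<Lambda> iexp_pwz_bounded])
  then show ?thesis using complex_measure_on_functional[OF \<Lambda>] by (simp add: has_measure_def)
qed

text \<open>\<open>eval_gaussian\<close> refers to some choice of a measure for F. By uniqueness the
  choice may be replaced by the image of the density under \<theta>.\<close>

lemma fourier_rep_integral:
  assumes rep: "fourier_rep F N \<theta> g" and w: "bounded_measurable BL w"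
  shows "complex_integral BL (SOME f. has_measure S T \<phi> W F f) w = (LINT z|N. g z * w (\<theta> z))"
proof -
  note m = fourier_rep_has_measure[OF rep]
  have "complex_integral BL (SOME f. has_measure S T \<phi> W F f) w =
      complex_integral BL (\<lambda>A. LINT z|N. g z * indicator A (\<theta> z)) w"
    by (rule measure_unique[OF someI[of "has_measure S T \<phi> W F", OF m] m w])
  also have "\<dots> = (LINT z|N. g z * w (\<theta> z))"
    by (rule complex_integral_functional[OF sigma_functional_integral[OF fourier_repD(2,3)[OF rep]] w])
  finally show ?thesis .
qed

lemma fourier_rep_eval:
  assumes rep: "fourier_rep F N \<theta> g" and k: "multiplier k" and y: "y \<in> C0 S T" and x: "x \<in> C0 S T"
  shows "eval_gaussian S T \<phi> W F b y c k x =
    Some (LINT z|N. g z * iexp (b * I (\<theta> z) y) * iexp (c * I (\<lambda>p. \<theta> z p * k p) x))"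
proof -
  let ?w = "\<lambda>u. exp (\<i> * of_real b * of_real (I u y) + \<i> * of_real c * of_real (I (\<lambda>p. u p * k p) x))"
  have w: "?w u = iexp (b * I u y) * iexp (c * I (\<lambda>p. u p * k p) x)" for u
    by (simp add: exp_add mult.assoc)
  have id: "(\<lambda>u. u) \<in> measurable BL BL" by simp
  have "bounded_measurable BL ?w"
    unfolding w
  proof (rule bounded_measurableI[where B=1])
    show "(\<lambda>u. iexp (b * I u y) * iexp (c * I (\<lambda>p. u p * k p) x)) \<in> borel_measurable BL"
      using measurable_BL_pwz[OF id y] measurable_BL_pwz[OF multiplier_measurable[OF k id] x] by measurable
  qed (simp add: norm_mult)
  from fourier_rep_integral[OF rep this]
  have "complex_integral BL (SOME f. has_measure S T \<phi> W F f) ?w =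
      (LINT z|N. g z * iexp (b * I (\<theta> z) y) * iexp (c * I (\<lambda>p. \<theta> z p * k p) x))"
    unfolding w mult.assoc[of "g z" "iexp s" "iexp t" for s t z] .
  moreover have "F \<in> S_class S T \<phi> W"
    using fourier_rep_has_measure[OF rep] by (auto simp: S_class_def)
  ultimately show ?thesis by (simp only: eval_gaussian_def if_True)
qed

section \<open>Values of the transform and the convolution product\<close>

lemma partial_integral_completion:
  assumes w: "\<And>x. x \<in> C0 S T \<Longrightarrow> w x = Some (v x)" and v: "integrable W0 v"
  shows "partial_integral W w = Some (LINT x|W0. v x)"
proof -
  have vm: "v \<in> borel_measurable W0" using v by auto
  have 1: "AE x in W. w x \<noteq> None" using w by (intro AE_I2) (simp add: space_W0)
  have "integrable W (\<lambda>x. the (w x)) = integrable W v"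
    by (intro Bochner_Integration.integrable_cong refl) (simp add: w space_W0)
  then have 2: "integrable W (\<lambda>x. the (w x))" using v by (simp add: integrable_completion[OF vm])
  have "(LINT x|W. the (w x)) = (LINT x|W. v x)"
    by (intro Bochner_Integration.integral_cong refl) (simp add: w space_W0)
  then have 3: "(LINT x|W. the (w x)) = (LINT x|W0. v x)" by (simp add: integral_completion[OF vm])
  show ?thesis unfolding partial_integral_def 3 using 1 2 by simp
qed

text \<open>The factor exp(i <\<theta> z, y>) joins the density, and the other factor is averaged
  over x. As Gaussian paths are evaluated through the measure, the formula holds at every y in
  C_0(Q) and not just outside a null set.\<close>

lemma gfft_value:
  assumes rep: "fourier_rep F N \<theta> g" and k: "multiplier k" and y: "y \<in> C0 S T" and q: "q \<noteq> 0"
  shows "gfft S T \<phi> W q k F y =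
    Some (LINT z|N. g z * iexp (I (\<theta> z) y) * iexp (- ((nrm (\<lambda>p. \<theta> z p * k p))\<^sup>2 / (2 * q))))"
proof -
  note r = fourier_repD[OF rep]
  note \<theta>k = multiplier_measurable[OF k r(3)]
  have D: "integrable N (\<lambda>z. g z * iexp (I (\<theta> z) y))"
    by (intro integrable_times_iexp r(2) measurable_BL_pwz[OF r(3) y])
  have Y: "(\<lambda>(x, z). I (\<lambda>p. \<theta> z p * k p) x) \<in> borel_measurable (W0 \<Otimes>\<^sub>M N)"
    by (rule pwz_pair_measurable[OF measurable_BL_coef[OF \<theta>k]])
  note G = W0.gaussian_fubini[OF r(1) D Y pwz_char[OF measurable_BL_space[OF \<theta>k]]]
  have J: "partial_integral W (\<lambda>x. eval_gaussian S T \<phi> W F 1 y (1 / sqrt s) k x) =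
      Some (LINT z|N. g z * iexp (I (\<theta> z) y) * of_real (exp (- ((nrm (\<lambda>p. \<theta> z p * k p))\<^sup>2 / (2 * s)))))"
    if s: "s > 0" for s
  proof -
    have "partial_integral W (\<lambda>x. eval_gaussian S T \<phi> W F 1 y (1 / sqrt s) k x) =
        Some (LINT x|W0. LINT z|N. g z * iexp (I (\<theta> z) y) * iexp (1 / sqrt s * I (\<lambda>p. \<theta> z p * k p) x))"
      using G(1)[of "1 / sqrt s"]
      by (intro partial_integral_completion) (simp_all only: fourier_rep_eval[OF rep k y] mult_1)
    also have "(LINT x|W0. LINT z|N. g z * iexp (I (\<theta> z) y) * iexp (1 / sqrt s * I (\<lambda>p. \<theta> z p * k p) x)) =
        (LINT z|N. g z * iexp (I (\<theta> z) y) * of_real (exp (- ((1 / sqrt s)\<^sup>2 * (nrm (\<lambda>p. \<theta> z p * k p))\<^sup>2) / 2)))"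
      by (rule G(2))
    also have "(1 / sqrt s)\<^sup>2 = 1 / s" using s by (simp add: power_divide)
    finally show ?thesis by (simp add: mult.commute)
  qed
  have "gfft S T \<phi> W q k F y =
      Some (LINT z|N. g z * iexp (I (\<theta> z) y) * exp (- (\<i> * of_real ((nrm (\<lambda>p. \<theta> z p * k p))\<^sup>2 / (2 * q)))))"
    unfolding gfft_def by (rule feynman_limit_eq[OF D measurable_BL_nrm[OF \<theta>k] _ q J]) simp
  then show ?thesis by (simp only: of_real_minus mult_minus_right)
qed

lemma fourier_rep_gfft:
  assumes rep: "fourier_rep F N \<theta> g" and k: "multiplier k" and q: "q \<noteq> 0"
  shows "fourier_rep (gfft S T \<phi> W q k F) N \<theta> (\<lambda>z. g z * iexp (- ((nrm (\<lambda>p. \<theta> z p * k p))\<^sup>2 / (2 * q))))"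
proof -
  note r = fourier_repD[OF rep]
  have [measurable]: "(\<lambda>z. (nrm (\<lambda>p. \<theta> z p * k p))\<^sup>2) \<in> borel_measurable N"
    by (rule measurable_BL_nrm[OF multiplier_measurable[OF k r(3)]])
  have "integrable N (\<lambda>z. g z * iexp (- ((nrm (\<lambda>p. \<theta> z p * k p))\<^sup>2 / (2 * q))))"
    by (intro integrable_times_iexp r(2)) measurable
  moreover have "s_ae W (\<lambda>x. gfft S T \<phi> W q k F x =
      Some (LINT z|N. g z * iexp (- ((nrm (\<lambda>p. \<theta> z p * k p))\<^sup>2 / (2 * q))) * iexp (I (\<theta> z) x)))"
    using r(4)
    by (rule s_ae_mono) (simp only: gfft_value[OF rep k _ q] mult.assoc mult.commute[of "iexp (I u x)" for u x])
  ultimately show ?thesis unfolding fourier_rep_def using r(1,3) by blast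
qed

lemma nrm_half: "(nrm (\<lambda>p. u p * (k p / sqrt 2)))\<^sup>2 = (nrm (\<lambda>p. u p * k p))\<^sup>2 / 2"
  using nrm_scale[of "1 / sqrt 2" "\<lambda>p. u p * k p"] by (simp add: power_divide)

text \<open>Division by sqrt 2 halves the squared norm, so the phases of successive transforms add
  up in \<open>a\<close> over the common denominator \<open>4 * q\<close>.\<close>

lemma fourier_rep_gfft_half:
  assumes rep: "fourier_rep F N \<theta> (\<lambda>z. g z * iexp (- (a z / (4 * q))))" and k: "multiplier k" and q: "q \<noteq> 0"
  shows "fourier_rep (gfft S T \<phi> W q (\<lambda>p. k p / sqrt 2) F) N \<theta>
    (\<lambda>z. g z * iexp (- ((a z + (nrm (\<lambda>p. \<theta> z p * k p))\<^sup>2) / (4 * q))))"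
proof -
  have "iexp (- (s / (4 * q))) * iexp (- (t / 2 / (2 * q))) = iexp (- ((s + t) / (4 * q)))" for s t :: real
    by (simp add: exp_add[symmetric] add_divide_distrib algebra_simps)
  then show ?thesis
    using fourier_rep_gfft[OF rep multiplier_divide[OF k] q, of "sqrt 2"] by (simp only: nrm_half mult.assoc)
qed

lemma fourier_rep_iterated_gfft:
  assumes "fourier_rep F N \<theta> (\<lambda>z. g z * iexp (- (a z / (4 * q))))" and "\<And>k. k \<in> set ks \<Longrightarrow> multiplier k" and q: "q \<noteq> 0"
  shows "fourier_rep (iterated_gfft S T \<phi> W q ks F) N \<theta>
    (\<lambda>z. g z * iexp (- ((a z + (\<Sum>k\<leftarrow>ks. (nrm (\<lambda>p. \<theta> z p * k p))\<^sup>2)) / (4 * q))))"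
  using assms(1,2)
proof (induction ks arbitrary: F a)
  case Nil
  then show ?case by (simp add: iterated_gfft_def)
next
  case (Cons k ks)
  have k: "multiplier k" using Cons.prems(2) by simp
  have "fourier_rep (iterated_gfft S T \<phi> W q ks (gfft S T \<phi> W q (\<lambda>p. k p / sqrt 2) F)) N \<theta>
    (\<lambda>z. g z * iexp (- ((a z + (nrm (\<lambda>p. \<theta> z p * k p))\<^sup>2 + (\<Sum>k\<leftarrow>ks. (nrm (\<lambda>p. \<theta> z p * k p))\<^sup>2)) / (4 * q))))"
    by (rule Cons.IH[OF fourier_rep_gfft_half[OF Cons.prems(1) k q]]) (simp add: Cons.prems(2))
  then show ?case by (simp only: iterated_gfft_def fold_Cons comp_apply list.map sum_list.Cons add.assoc)
qed

text \<open>Both Gaussian paths are driven by the same x. The product of the two integrals is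
  therefore an integral over pairs (u, v) whose random exponent is a difference of two PWZ
  integrals, normal with variance the squared distance of u k1 and v k2.\<close>

lemma fourier_rep_conv_product:
  assumes F: "fourier_rep F N \<theta> d" and G: "fourier_rep G N' \<theta>' e" and k: "multiplier k1" "multiplier k2"
    and y: "y \<in> C0 S T" and q: "q \<noteq> 0"
  shows "conv_product S T \<phi> W q k1 k2 F G y = Some (LINT z|(N \<Otimes>\<^sub>M N').
    d (fst z) * iexp (1 / sqrt 2 * I (\<theta> (fst z)) y) * (e (snd z) * iexp (1 / sqrt 2 * I (\<theta>' (snd z)) y)) *
    iexp (- ((nrm (\<lambda>p. \<theta> (fst z) p * k1 p - \<theta>' (snd z) p * k2 p))\<^sup>2 / (4 * q))))"
proof -
  note f = fourier_repD[OF F] and g = fourier_repD[OF G]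
  interpret N: finite_measure N by (rule f(1))
  interpret N': finite_measure N' by (rule g(1))
  interpret P: finite_measure "N \<Otimes>\<^sub>M N'" by (rule finite_measure_pair_measure) unfold_locales
  note \<theta> = multiplier_measurable[OF k(1) measurable_compose[OF measurable_fst f(3)]]
    and \<theta>' = multiplier_measurable[OF k(2) measurable_compose[OF measurable_snd g(3)]]
  define a where "a u = d u * iexp (1 / sqrt 2 * I (\<theta> u) y)" for u
  define b where "b v = e v * iexp (1 / sqrt 2 * I (\<theta>' v) y)" for v
  have a: "integrable N a"
    unfolding a_def[abs_def] by (intro integrable_times_iexp f(2) borel_measurable_times borel_measurable_const measurable_BL_pwz[OF f(3) y])
  have b: "integrable N' b"
    unfolding b_def[abs_def] by (intro integrable_times_iexp g(2) borel_measurable_times borel_measurable_const measurable_BL_pwz[OF g(3) y])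
  note D = integral_pair_times(1)[OF f(1) g(1) a b]
  define Y where "Y z x = I (\<lambda>p. \<theta> (fst z) p * k1 p) x - I (\<lambda>p. \<theta>' (snd z) p * k2 p) x" for z x
  define c where "c z = (nrm (\<lambda>p. \<theta> (fst z) p * k1 p - \<theta>' (snd z) p * k2 p))\<^sup>2" for z
  have Y: "(\<lambda>(x, z). Y z x) \<in> borel_measurable (W0 \<Otimes>\<^sub>M (N \<Otimes>\<^sub>M N'))"
    using pwz_pair_measurable[OF measurable_BL_coef[OF \<theta>]] pwz_pair_measurable[OF measurable_BL_coef[OF \<theta>']]
    unfolding Y_def split_def by (rule borel_measurable_diff)
  have "(\<lambda>z. (nrm (\<lambda>p. 1 * (\<theta> (fst z) p * k1 p) + (-1) * (\<theta>' (snd z) p * k2 p)))\<^sup>2) \<in> borel_measurable (N \<Otimes>\<^sub>M N')"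
    by (rule measurable_BL_nrm[OF measurable_BL_lincomb[OF \<theta> \<theta>']])
  then have cm: "(\<lambda>z. c z / 2) \<in> borel_measurable (N \<Otimes>\<^sub>M N')" unfolding c_def by simp
  have char: "(LINT x|W0. iexp (t * Y z x)) = of_real (exp (- (t\<^sup>2 * c z) / 2))" if "z \<in> space (N \<Otimes>\<^sub>M N')" for z t
    unfolding Y_def c_def by (rule pwz_diff_char[OF measurable_BL_space[OF \<theta> that] measurable_BL_space[OF \<theta>' that]])
  note fub = W0.gaussian_fubini[OF P.finite_measure_axioms D Y char]
  have J: "partial_integral W (\<lambda>x.
       Option.bind (eval_gaussian S T \<phi> W F (1 / sqrt 2) y (1 / sqrt r / sqrt 2) k1 x) (\<lambda>a.
       Option.bind (eval_gaussian S T \<phi> W G (1 / sqrt 2) y (- (1 / sqrt r) / sqrt 2) k2 x) (\<lambda>b. Some (a * b)))) =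
      Some (LINT z|(N \<Otimes>\<^sub>M N'). a (fst z) * b (snd z) * of_real (exp (- (c z / 2 / (2 * r)))))"
    if r: "r > 0" for r
  proof -
    define t where "t = 1 / sqrt r / sqrt 2"
    \<comment> \<open>The division of the argument by sqrt 2 adds a factor 1/2 to the variance 1 /
      r, so \<open>c z / 2\<close> takes the role of the variance in
      \<open>feynman_limit_eq\<close>.\<close>
    have t2: "t\<^sup>2 = 1 / (2 * r)" using r by (simp add: t_def power_divide power_mult_distrib)
    have "Option.bind (eval_gaussian S T \<phi> W F (1 / sqrt 2) y (1 / sqrt r / sqrt 2) k1 x) (\<lambda>a.
       Option.bind (eval_gaussian S T \<phi> W G (1 / sqrt 2) y (- (1 / sqrt r) / sqrt 2) k2 x) (\<lambda>b. Some (a * b))) =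
      Some (LINT z|(N \<Otimes>\<^sub>M N'). a (fst z) * b (snd z) * iexp (t * Y z x))" if x: "x \<in> C0 S T" for x
    proof -
      have i1: "integrable N (\<lambda>u. a u * iexp (t * I (\<lambda>p. \<theta> u p * k1 p) x))"
        by (intro integrable_times_iexp a borel_measurable_times borel_measurable_const
            measurable_BL_pwz[OF multiplier_measurable[OF k(1) f(3)] x])
      have i2: "integrable N' (\<lambda>v. b v * iexp (- t * I (\<lambda>p. \<theta>' v p * k2 p) x))"
        by (intro integrable_times_iexp b borel_measurable_times borel_measurable_const
            measurable_BL_pwz[OF multiplier_measurable[OF k(2) g(3)] x])
      have tt: "- (1 / sqrt r) / sqrt 2 = - t" by (simp add: t_def)
      have "(LINT u|N. a u * iexp (t * I (\<lambda>p. \<theta> u p * k1 p) x)) * (LINT v|N'. b v * iexp (- t * I (\<lambda>p. \<theta>' v p * k2 p) x)) =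
          (LINT z|(N \<Otimes>\<^sub>M N'). (a (fst z) * iexp (t * I (\<lambda>p. \<theta> (fst z) p * k1 p) x)) *
             (b (snd z) * iexp (- t * I (\<lambda>p. \<theta>' (snd z) p * k2 p) x)))"
        by (rule integral_pair_times(2)[OF f(1) g(1) i1 i2, symmetric])
      also have "\<dots> = (LINT z|(N \<Otimes>\<^sub>M N'). a (fst z) * b (snd z) * iexp (t * Y z x))"
      proof (intro Bochner_Integration.integral_cong refl)
        have "iexp (t * s) * iexp (- t * s') = iexp (t * (s - s'))" for s s'
          by (simp add: exp_add[symmetric] algebra_simps)
        then have "(x * iexp (t * s)) * (x' * iexp (- t * s')) = x * x' * iexp (t * (s - s'))" for x x' s s'
          by (simp only: mult.assoc mult.left_commute[of "iexp (t * s)" x'])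
        then show "(a (fst z) * iexp (t * I (\<lambda>p. \<theta> (fst z) p * k1 p) x)) * (b (snd z) * iexp (- t * I (\<lambda>p. \<theta>' (snd z) p * k2 p) x)) =
            a (fst z) * b (snd z) * iexp (t * Y z x)" for z
          unfolding Y_def .
      qed
      finally show ?thesis
        unfolding tt unfolding t_def[symmetric] fourier_rep_eval[OF F k(1) y x] fourier_rep_eval[OF G k(2) y x] a_def b_def by simp
    qed
    then have "partial_integral W (\<lambda>x.
       Option.bind (eval_gaussian S T \<phi> W F (1 / sqrt 2) y (1 / sqrt r / sqrt 2) k1 x) (\<lambda>a.
       Option.bind (eval_gaussian S T \<phi> W G (1 / sqrt 2) y (- (1 / sqrt r) / sqrt 2) k2 x) (\<lambda>b. Some (a * b)))) =
      Some (LINT x|W0. LINT z|(N \<Otimes>\<^sub>M N'). a (fst z) * b (snd z) * iexp (t * Y z x))"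
      by (rule partial_integral_completion[OF _ fub(1)])
    also have "(LINT x|W0. LINT z|(N \<Otimes>\<^sub>M N'). a (fst z) * b (snd z) * iexp (t * Y z x)) =
        (LINT z|(N \<Otimes>\<^sub>M N'). a (fst z) * b (snd z) * of_real (exp (- (t\<^sup>2 * c z) / 2)))"
      by (rule fub(2))
    finally show ?thesis by (simp add: t2 field_simps)
  qed
  have "conv_product S T \<phi> W q k1 k2 F G y = Some (LINT z|(N \<Otimes>\<^sub>M N').
    a (fst z) * b (snd z) * exp (- (\<i> * of_real (c z / 2 / (2 * q)))))"
    unfolding conv_product_def by (rule feynman_limit_eq[OF D cm _ q J]) (simp add: c_def)
  moreover have "- (\<i> * of_real (c z / 2 / (2 * q))) = \<i> * of_real (- (c z / (4 * q)))" for z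
    by simp
  ultimately show ?thesis unfolding a_def b_def c_def by (simp only:)
qed

text \<open>The product of the two integrals is an integral over pairs. Adding the exponents uses
  linearity of <v,x> in v, available at those x for which both series converge for almost every
  pair.\<close>

lemma fourier_rep_mult:
  assumes F: "fourier_rep F N \<theta> d" and G: "fourier_rep G N' \<theta>' e" and c: "c > 0"
  shows "fourier_rep (mult_functional (scale_functional c F) (scale_functional c G)) (N \<Otimes>\<^sub>M N')
    (\<lambda>z p. c * \<theta> (fst z) p + c * \<theta>' (snd z) p) (\<lambda>z. d (fst z) * e (snd z))"
proof -
  note f = fourier_repD[OF F] and g = fourier_repD[OF G]
  interpret N: finite_measure N by (rule f(1))
  interpret N': finite_measure N' by (rule g(1))
  interpret P: finite_measure "N \<Otimes>\<^sub>M N'" by (rule finite_measure_pair_measure) unfold_locales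
  note \<theta> = measurable_compose[OF measurable_fst f(3), of N'] and \<theta>' = measurable_compose[OF measurable_snd g(3), of N]
  note \<Theta> = measurable_BL_lincomb[OF \<theta> \<theta>', of c c]
  note D = integral_pair_times(1)[OF f(1) g(1) f(2) g(2)]
  have [measurable]: "(\<lambda>z. d (fst z) * e (snd z)) \<in> borel_measurable (N \<Otimes>\<^sub>M N')" using D by auto
  have c1: "s_ae W (\<lambda>x. AE z in N \<Otimes>\<^sub>M N'. pwz_conv (\<theta> (fst z)) x)"
    by (intro pwz_conv_s_ae P.finite_measure_axioms measurable_BL_space[OF \<theta>] measurable_BL_coef[OF \<theta>])
  have c2: "s_ae W (\<lambda>x. AE z in N \<Otimes>\<^sub>M N'. pwz_conv (\<theta>' (snd z)) x)"
    by (intro pwz_conv_s_ae P.finite_measure_axioms measurable_BL_space[OF \<theta>'] measurable_BL_coef[OF \<theta>'])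
  have "s_ae W (\<lambda>x. mult_functional (scale_functional c F) (scale_functional c G) x =
      Some (LINT z|(N \<Otimes>\<^sub>M N'). d (fst z) * e (snd z) * iexp (I (\<lambda>p. c * \<theta> (fst z) p + c * \<theta>' (snd z) p) x)))"
    using s_ae_conj[OF s_ae_conj[OF c1 c2] s_ae_conj[OF s_ae_scale[OF f(4) c] s_ae_scale[OF g(4) c]]]
  proof (rule s_ae_mono, elim conjE)
    fix x
    assume x: "x \<in> C0 S T" and c12: "AE z in N \<Otimes>\<^sub>M N'. pwz_conv (\<theta> (fst z)) x" "AE z in N \<Otimes>\<^sub>M N'. pwz_conv (\<theta>' (snd z)) x"
      and v: "F (\<lambda>p. c * x p) = Some (LINT z|N. d z * iexp (I (\<theta> z) (\<lambda>p. c * x p)))"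
        "G (\<lambda>p. c * x p) = Some (LINT z|N'. e z * iexp (I (\<theta>' z) (\<lambda>p. c * x p)))"
    note cx = C0_scale[OF x, of c]
    have i: "integrable N (\<lambda>z. d z * iexp (I (\<theta> z) (\<lambda>p. c * x p)))" "integrable N' (\<lambda>z. e z * iexp (I (\<theta>' z) (\<lambda>p. c * x p)))"
      by (intro integrable_times_iexp f(2) g(2) measurable_BL_pwz[OF f(3) cx] measurable_BL_pwz[OF g(3) cx])+
    have "(LINT z|N. d z * iexp (I (\<theta> z) (\<lambda>p. c * x p))) * (LINT z|N'. e z * iexp (I (\<theta>' z) (\<lambda>p. c * x p))) =
        (LINT z|(N \<Otimes>\<^sub>M N'). (d (fst z) * iexp (I (\<theta> (fst z)) (\<lambda>p. c * x p))) * (e (snd z) * iexp (I (\<theta>' (snd z)) (\<lambda>p. c * x p))))"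
      by (rule integral_pair_times(2)[OF f(1) g(1) i, symmetric])
    also have "\<dots> = (LINT z|(N \<Otimes>\<^sub>M N'). d (fst z) * e (snd z) * iexp (I (\<lambda>p. c * \<theta> (fst z) p + c * \<theta>' (snd z) p) x))"
    proof (rule integral_cong_AE)
      show "(\<lambda>z. (d (fst z) * iexp (I (\<theta> (fst z)) (\<lambda>p. c * x p))) * (e (snd z) * iexp (I (\<theta>' (snd z)) (\<lambda>p. c * x p)))) \<in> borel_measurable (N \<Otimes>\<^sub>M N')"
        using integral_pair_times(1)[OF f(1) g(1) i] by auto
      show "(\<lambda>z. d (fst z) * e (snd z) * iexp (I (\<lambda>p. c * \<theta> (fst z) p + c * \<theta>' (snd z) p) x)) \<in> borel_measurable (N \<Otimes>\<^sub>M N')"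
        using measurable_BL_pwz[OF \<Theta> x] by measurable
      show "AE z in N \<Otimes>\<^sub>M N'. (d (fst z) * iexp (I (\<theta> (fst z)) (\<lambda>p. c * x p))) * (e (snd z) * iexp (I (\<theta>' (snd z)) (\<lambda>p. c * x p))) =
          d (fst z) * e (snd z) * iexp (I (\<lambda>p. c * \<theta> (fst z) p + c * \<theta>' (snd z) p) x)"
        using c12 AE_space
      proof eventually_elim
        case (elim z)
        have "I (\<lambda>p. c * \<theta> (fst z) p + c * \<theta>' (snd z) p) x = c * I (\<theta> (fst z)) x + c * I (\<theta>' (snd z)) x"
          by (rule pwz_lincomb(2)[OF x elim(1,2) measurable_BL_space[OF \<theta> elim(3)] measurable_BL_space[OF \<theta>' elim(3)]])
        then show ?case
          unfolding pwz_scale(2)[OF x elim(1)] pwz_scale(2)[OF x elim(2)] by (simp add: distrib_left exp_add)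
      qed
    qed
    finally show "mult_functional (scale_functional c F) (scale_functional c G) x =
        Some (LINT z|(N \<Otimes>\<^sub>M N'). d (fst z) * e (snd z) * iexp (I (\<lambda>p. c * \<theta> (fst z) p + c * \<theta>' (snd z) p) x))"
      by (simp add: mult_functional_def scale_functional_def v)
  qed
  then show ?thesis unfolding fourier_rep_def using P.finite_measure_axioms D \<Theta> by blast
qed

end

section \<open>Comparison of the phases and the theorem\<close>

context yeh_wiener begin

lemma nrm_multiplier_sum_list:
  assumes s: "multiplier s" and ks: "\<And>k. k \<in> set ks \<Longrightarrow> multiplier k" and u: "u \<in> L2 S T"
    and eq: "AE p in Q. (s p)\<^sup>2 = (\<Sum>k\<leftarrow>ks. (k p)\<^sup>2)"
  shows "(nrm (\<lambda>p. u p * s p))\<^sup>2 = (\<Sum>k\<leftarrow>ks. (nrm (\<lambda>p. u p * k p))\<^sup>2)"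
proof -
  have int: "integrable Q (\<lambda>p. (u p * k p)\<^sup>2)" if "multiplier k" for k
    using multiplier_L2[OF that u] by (simp add: L2_def)
  have n: "(nrm (\<lambda>p. u p * k p))\<^sup>2 = (LINT p|Q. (u p * k p)\<^sup>2)" for k
    by (subst nrm_power2) (simp add: inner2_def power2_eq_square)
  have sum: "integrable Q (\<lambda>p. \<Sum>k\<leftarrow>ks. (u p * k p)\<^sup>2) \<and>
      (LINT p|Q. (\<Sum>k\<leftarrow>ks. (u p * k p)\<^sup>2)) = (\<Sum>k\<leftarrow>ks. (LINT p|Q. (u p * k p)\<^sup>2))"
    using ks
  proof (induction ks)
    case (Cons k ks)
    then show ?case using int[of k] by simp
  qed simp
  have "(LINT p|Q. (u p * s p)\<^sup>2) = (LINT p|Q. (\<Sum>k\<leftarrow>ks. (u p * k p)\<^sup>2))"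
  proof (rule integral_cong_AE)
    show "AE p in Q. (u p * s p)\<^sup>2 = (\<Sum>k\<leftarrow>ks. (u p * k p)\<^sup>2)"
      using eq by eventually_elim (simp only: power_mult_distrib sum_list_const_mult)
  qed (use int[OF s] sum in auto)
  then show ?thesis using sum by (simp only: n)
qed

lemma ip_multiplier_cong:
  assumes m: "multiplier h" "multiplier s1" "multiplier s2" and u: "u \<in> L2 S T" and v: "v \<in> L2 S T"
    and eq: "AE p in Q. (h p)\<^sup>2 = s1 p * s2 p"
  shows "ip (\<lambda>p. u p * s1 p) (\<lambda>p. v p * s2 p) = ip (\<lambda>p. u p * h p) (\<lambda>p. v p * h p)"
  unfolding inner2_def
proof (rule integral_cong_AE)
  have L: "w \<in> borel_measurable Q" if "w \<in> L2 S T" for w using that by (simp add: L2_def)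
  show "(\<lambda>p. u p * s1 p * (v p * s2 p)) \<in> borel_measurable Q" "(\<lambda>p. u p * h p * (v p * h p)) \<in> borel_measurable Q"
    by (intro borel_measurable_times[OF L L] multiplier_L2 m u v)+
  show "AE p in Q. u p * s1 p * (v p * s2 p) = u p * h p * (v p * h p)"
    using eq
  proof eventually_elim
    case (elim p)
    have "u p * s1 p * (v p * s2 p) = u p * v p * (s1 p * s2 p)" by simp
    also have "\<dots> = u p * h p * (v p * h p)" unfolding elim[symmetric] by (simp add: power2_eq_square)
    finally show ?case .
  qed
qed

text \<open>F' and G' enter through their phases a and b. In the three convolution products of the
  theorem these are different expressions with the same values, so one computation serves all
  three.\<close>

lemma conv_product_eq_gfft_mult:
  assumes F: "fourier_rep F N (\<lambda>u. u) d" and G: "fourier_rep G N' (\<lambda>v. v) e"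
    and F': "fourier_rep F' N (\<lambda>u. u) (\<lambda>u. d u * iexp (- (a u / (4 * q))))"
    and G': "fourier_rep G' N' (\<lambda>v. v) (\<lambda>v. e v * iexp (- (b v / (4 * q))))"
    and m: "multiplier h" "multiplier s1" "multiplier s2" and q: "q \<noteq> 0"
    and hs: "AE p in Q. (h p)\<^sup>2 = s1 p * s2 p"
    and a: "\<And>u. u \<in> L2 S T \<Longrightarrow> a u = (nrm (\<lambda>p. u p * h p))\<^sup>2 + (nrm (\<lambda>p. u p * s1 p))\<^sup>2"
    and b: "\<And>v. v \<in> L2 S T \<Longrightarrow> b v = (nrm (\<lambda>p. v p * h p))\<^sup>2 + (nrm (\<lambda>p. v p * s2 p))\<^sup>2"
    and y: "y \<in> C0 S T"
    and conv: "AE z in N \<Otimes>\<^sub>M N'. pwz_conv (fst z) y" "AE z in N \<Otimes>\<^sub>M N'. pwz_conv (snd z) y"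
  shows "conv_product S T \<phi> W (- q) s1 s2 F' G' y =
    gfft S T \<phi> W q h (mult_functional (scale_functional (1 / sqrt 2) F) (scale_functional (1 / sqrt 2) G)) y"
proof -
  let ?c = "1 / sqrt 2 :: real"
  note f = fourier_repD[OF F] and g = fourier_repD[OF G] and f' = fourier_repD[OF F'] and g' = fourier_repD[OF G']
  note rm = fourier_rep_mult[OF F G, of ?c]
  note \<theta> = measurable_compose[OF measurable_fst f(3), of N'] and \<theta>' = measurable_compose[OF measurable_snd g(3), of N]
  have q': "- q \<noteq> 0" using q by simp
  have [measurable]: "d \<in> borel_measurable N" "e \<in> borel_measurable N'" using f(2) g(2) by auto
  have [measurable]: "(\<lambda>u. d u * iexp (- (a u / (4 * q)))) \<in> borel_measurable N"
    "(\<lambda>v. e v * iexp (- (b v / (4 * q)))) \<in> borel_measurable N'" using f'(2) g'(2) by auto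
  note \<theta>s = multiplier_measurable[OF m(2) \<theta>] multiplier_measurable[OF m(3) \<theta>']
  have [measurable]: "(\<lambda>z. (nrm (\<lambda>p. fst z p * s1 p - snd z p * s2 p))\<^sup>2) \<in> borel_measurable (N \<Otimes>\<^sub>M N')"
    using measurable_BL_nrm[OF measurable_BL_lincomb[OF \<theta>s, of 1 "-1"]] by simp
  note \<Theta> = measurable_BL_lincomb[OF \<theta> \<theta>', of ?c ?c]
  have [measurable]: "(\<lambda>z. I (fst z) y) \<in> borel_measurable (N \<Otimes>\<^sub>M N')" "(\<lambda>z. I (snd z) y) \<in> borel_measurable (N \<Otimes>\<^sub>M N')"
    "(\<lambda>z. I (\<lambda>p. ?c * fst z p + ?c * snd z p) y) \<in> borel_measurable (N \<Otimes>\<^sub>M N')"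
    by (intro measurable_BL_pwz[OF _ y] \<theta> \<theta>' \<Theta>)+
  have [measurable]: "(\<lambda>z. (nrm (\<lambda>p. (?c * fst z p + ?c * snd z p) * h p))\<^sup>2) \<in> borel_measurable (N \<Otimes>\<^sub>M N')"
    by (rule measurable_BL_nrm[OF multiplier_measurable[OF m(1) \<Theta>]])
  \<comment> \<open>The squared norms of u s1 and v s2 cancel against those in a and b, and the
    inner product of u s1 and v s2 becomes that of u h and v h. The factor 2 on the right makes up
    for \<open>?c\<close> being squared.\<close>
  have phase: "a u + b v - (nrm (\<lambda>p. u p * s1 p - v p * s2 p))\<^sup>2 = 2 * (nrm (\<lambda>p. (?c * u p + ?c * v p) * h p))\<^sup>2"
    if u: "u \<in> L2 S T" and v: "v \<in> L2 S T" for u v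
  proof -
    have "(\<lambda>p. (?c * u p + ?c * v p) * h p) = (\<lambda>p. ?c * (u p * h p + v p * h p))"
      by (simp add: fun_eq_iff distrib_right distrib_left)
    then have "2 * (nrm (\<lambda>p. (?c * u p + ?c * v p) * h p))\<^sup>2 = (nrm (\<lambda>p. u p * h p + v p * h p))\<^sup>2"
      by (simp only: nrm_scale power_mult_distrib) (simp add: power_divide)
    then show ?thesis
      by (simp add: ip_sum_sum[OF multiplier_L2[OF m(1) u] multiplier_L2[OF m(1) v]]
          ip_diff_diff[OF multiplier_L2[OF m(2) u] multiplier_L2[OF m(3) v]] ip_multiplier_cong[OF m u v hs] a[OF u] b[OF v])
  qed
  have c: "?c > 0" by simp
  have "(LINT z|(N \<Otimes>\<^sub>M N'). d (fst z) * iexp (- (a (fst z) / (4 * q))) * iexp (?c * I (fst z) y) *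
        (e (snd z) * iexp (- (b (snd z) / (4 * q))) * iexp (?c * I (snd z) y)) *
        iexp (- ((nrm (\<lambda>p. fst z p * s1 p - snd z p * s2 p))\<^sup>2 / (4 * - q)))) =
      (LINT z|(N \<Otimes>\<^sub>M N'). d (fst z) * e (snd z) * iexp (I (\<lambda>p. ?c * fst z p + ?c * snd z p) y) *
        iexp (- ((nrm (\<lambda>p. (?c * fst z p + ?c * snd z p) * h p))\<^sup>2 / (2 * q))))"
  proof (rule integral_cong_AE)
    show "AE z in N \<Otimes>\<^sub>M N'. d (fst z) * iexp (- (a (fst z) / (4 * q))) * iexp (?c * I (fst z) y) *
        (e (snd z) * iexp (- (b (snd z) / (4 * q))) * iexp (?c * I (snd z) y)) *
        iexp (- ((nrm (\<lambda>p. fst z p * s1 p - snd z p * s2 p))\<^sup>2 / (4 * - q))) =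
        d (fst z) * e (snd z) * iexp (I (\<lambda>p. ?c * fst z p + ?c * snd z p) y) *
        iexp (- ((nrm (\<lambda>p. (?c * fst z p + ?c * snd z p) * h p))\<^sup>2 / (2 * q)))"
      using conv AE_space
    proof eventually_elim
      case (elim z)
      note u = measurable_BL_space[OF \<theta> elim(3)] and v = measurable_BL_space[OF \<theta>' elim(3)]
      have Iuv: "I (\<lambda>p. ?c * fst z p + ?c * snd z p) y = ?c * I (fst z) y + ?c * I (snd z) y"
        by (rule pwz_lincomb(2)[OF y elim(1,2) u v])
      \<comment> \<open>The parameter -q reverses the sign of the phase C of the convolution, so
        that C is subtracted from A + B.\<close>
      have "- (A / (4 * q)) + s + (- (B / (4 * q)) + t) + - (C / (4 * - q)) = s + t + - (D / (2 * q))"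
        if "A + B - C = 2 * D" for A B C D s t :: real
      proof -
        have A: "A = 2 * D - B + C" using that by simp
        show ?thesis unfolding A by (simp add: add_divide_distrib diff_divide_distrib)
      qed
      note ex = this[OF phase[OF u v]]
      have "x * iexp A * iexp s * (x' * iexp B * iexp t) * iexp C = x * x' * iexp (s + t) * iexp D"
        if "A + s + (B + t) + C = s + t + D" for x x' and A B C D s t :: real
      proof -
        have "x * iexp A * iexp s * (x' * iexp B * iexp t) * iexp C = x * x' * iexp (A + s + (B + t) + C)"
          by (simp only: of_real_add distrib_left exp_add mult_ac)
        also have "\<dots> = x * x' * iexp (s + t + D)" by (simp only: that)
        finally show ?thesis by (simp only: of_real_add distrib_left exp_add mult_ac)
      qed
      then show ?case unfolding Iuv using ex by blast
    qed
  qed measurable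
  then show ?thesis
    unfolding fourier_rep_conv_product[OF F' G' m(2,3) y q'] gfft_value[OF rm[OF c] m(1) y q] by (simp only:)
qed

end

theorem theorem6p13:
  fixes S T q :: real
    and \<phi> :: "nat \<Rightarrow> field2"
    and W :: "field2 measure"
    and F G :: functional
    and f g :: "field2 set \<Rightarrow> complex"
    and h s1 s2 sh1 sh2 :: field2
    and K1 K2 :: "field2 list"
  assumes "S > 0" and "T > 0"
    and "yeh_wiener_measure S T W"
    and "bv_complete_orthonormal S T \<phi>"
    and "has_measure S T \<phi> W F f"
    and "has_measure S T \<phi> W G g"
    and "h \<in> Supp_BV S T"
    and "K1 \<noteq> []" and "set K1 \<subseteq> Supp_BV S T"
    and "K2 \<noteq> []" and "set K2 \<subseteq> Supp_BV S T"
    and "s1 \<in> Supp_BV S T"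
    and "AE p in lebesgue_on (rect S T). (s1 p)\<^sup>2 = (\<Sum>k\<leftarrow>K1. (k p)\<^sup>2)"
    and "s2 \<in> Supp_BV S T"
    and "AE p in lebesgue_on (rect S T). (s2 p)\<^sup>2 = (\<Sum>k\<leftarrow>K2. (k p)\<^sup>2)"
    and "AE p in lebesgue_on (rect S T). (h p)\<^sup>2 = s1 p * s2 p"
    and "sh1 \<in> Supp_BV S T"
    and "AE p in lebesgue_on (rect S T). (sh1 p)\<^sup>2 = (h p)\<^sup>2 + (s1 p)\<^sup>2"
    and "sh2 \<in> Supp_BV S T"
    and "AE p in lebesgue_on (rect S T). (sh2 p)\<^sup>2 = (h p)\<^sup>2 + (s2 p)\<^sup>2"
    and "q \<noteq> 0"
  shows "s_ae W (\<lambda>y.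
    let Th = gfft S T \<phi> W q (\<lambda>p. h p / sqrt 2);
        A = conv_product S T \<phi> W (- q) s1 s2
              (Th (iterated_gfft S T \<phi> W q K1 F))
              (Th (iterated_gfft S T \<phi> W q K2 G));
        B = conv_product S T \<phi> W (- q) s1 s2
              (Th (gfft S T \<phi> W q (\<lambda>p. s1 p / sqrt 2) F))
              (Th (gfft S T \<phi> W q (\<lambda>p. s2 p / sqrt 2) G));
        C = conv_product S T \<phi> W (- q) s1 s2
              (gfft S T \<phi> W q (\<lambda>p. sh1 p / sqrt 2) F)
              (gfft S T \<phi> W q (\<lambda>p. sh2 p / sqrt 2) G);
        D = gfft S T \<phi> W q h
              (mult_functional (scale_functional (1 / sqrt 2) F)
                               (scale_functional (1 / sqrt 2) G))
    in A y \<noteq> None \<and> A y = B y \<and> B y = C y \<and> C y = D y)"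
proof -
  obtain W0 where W: "W = completion W0" and W0: "prob_space W0" "space W0 = C0 S T" "sets W0 = sets (cylinder_C0 S T)"
      and normal: "\<forall>P c. finite P \<longrightarrow> P \<subseteq> rect S T \<longrightarrow> centered_normal W0 (\<lambda>x. \<Sum>p\<in>P. c p * x p)"
      and cov: "\<forall>s\<in>{0..S}. \<forall>t\<in>{0..T}. \<forall>s'\<in>{0..S}. \<forall>t'\<in>{0..T}.
        (LINT x|W0. x (s, t) * x (s', t')) = min s s' * min t t'"
    using assms(3) unfolding yeh_wiener_measure_def by (elim exE conjE) (rule that)
  interpret W0: prob_space W0 by (rule W0(1))
  interpret yeh_wiener S T \<phi> W0
  proof
    show "centered_normal W0 (\<lambda>x. \<Sum>p\<in>P. c p * x p)" if "finite P" "P \<subseteq> rect S T" for P c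
      using normal[rule_format, OF that] .
    show "(LINT x|W0. x (s, t) * x (s', t')) = min s s' * min t t'"
      if "s \<in> {0..S}" "t \<in> {0..T}" "s' \<in> {0..S}" "t' \<in> {0..T}" for s t s' t'
      using cov[rule_format, OF that] .
  qed (fact assms(1,2,4) W0(2,3))+
  have mult: "multiplier k" if "k \<in> Supp_BV S T" for k
    using that by (intro multiplier_hk) (simp add: Supp_BV_def)
  note m = mult[OF assms(7)] mult[OF assms(12)] mult[OF assms(14)] mult[OF assms(17)] mult[OF assms(19)]
  have mK1: "\<And>k. k \<in> set K1 \<Longrightarrow> multiplier k" and mK2: "\<And>k. k \<in> set K2 \<Longrightarrow> multiplier k"
    using assms(9,11) mult by blast+
  obtain N :: "field2 measure" and d where F: "fourier_rep F N (\<lambda>u. u) d"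
    by (rule fourier_rep_ex[OF assms(5)[unfolded W]])
  obtain N' :: "field2 measure" and e where G: "fourier_rep G N' (\<lambda>v. v) e"
    by (rule fourier_rep_ex[OF assms(6)[unfolded W]])
  \<comment> \<open>A zero phase brings F into the form on which the transforms with factor 1 / sqrt
    2 act.\<close>
  have F0: "fourier_rep F N (\<lambda>u. u) (\<lambda>u. d u * iexp (- (0 / (4 * q))))" using F by simp
  have G0: "fourier_rep G N' (\<lambda>v. v) (\<lambda>v. e v * iexp (- (0 / (4 * q))))" using G by simp
  note f = fourier_repD[OF F] and g = fourier_repD[OF G]
  interpret N: finite_measure N by (rule f(1))
  interpret N': finite_measure N' by (rule g(1))
  interpret P: finite_measure "N \<Otimes>\<^sub>M N'" by (rule finite_measure_pair_measure) unfold_locales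
  note \<theta> = measurable_compose[OF measurable_fst f(3), of N'] and \<theta>' = measurable_compose[OF measurable_snd g(3), of N]
  \<comment> \<open>Together with \<open>c2\<close> this is the exceptional set of the theorem:
    outside it <u,y> and <v,y> converge for almost every pair, which allows the exponents to be
    added.\<close>
  have c1: "s_ae W (\<lambda>y. AE z in N \<Otimes>\<^sub>M N'. pwz_conv (fst z) y)"
    unfolding W by (intro pwz_conv_s_ae P.finite_measure_axioms measurable_BL_space[OF \<theta>] measurable_BL_coef[OF \<theta>])
  have c2: "s_ae W (\<lambda>y. AE z in N \<Otimes>\<^sub>M N'. pwz_conv (snd z) y)"
    unfolding W by (intro pwz_conv_s_ae P.finite_measure_axioms measurable_BL_space[OF \<theta>'] measurable_BL_coef[OF \<theta>'])
  note q = assms(21) and hs = assms(16)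
  have sh: "(nrm (\<lambda>p. u p * sh p))\<^sup>2 = (nrm (\<lambda>p. u p * h p))\<^sup>2 + (nrm (\<lambda>p. u p * s p))\<^sup>2"
    if "multiplier sh" "multiplier s" "AE p in Q. (sh p)\<^sup>2 = (h p)\<^sup>2 + (s p)\<^sup>2" "u \<in> L2 S T" for sh s u
  proof -
    have mult: "multiplier k" if "k \<in> set [h, s]" for k using that \<open>multiplier s\<close> m(1) by auto
    have "AE p in Q. (sh p)\<^sup>2 = (\<Sum>k\<leftarrow>[h, s]. (k p)\<^sup>2)" using that(3) by simp
    from nrm_multiplier_sum_list[OF that(1) mult that(4) this] show ?thesis by simp
  qed
  note eq = conv_product_eq_gfft_mult[OF F G _ _ m(1,2,3) q hs]
  show ?thesis
    using s_ae_conj[OF c1[unfolded W] c2[unfolded W]] unfolding W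
  proof (rule s_ae_mono, elim conjE)
    fix y assume y: "y \<in> C0 S T"
      and conv: "AE z in N \<Otimes>\<^sub>M N'. pwz_conv (fst z) y" "AE z in N \<Otimes>\<^sub>M N'. pwz_conv (snd z) y"
    let ?Th = "gfft S T \<phi> (completion W0) q (\<lambda>p. h p / sqrt 2)"
    let ?D = "gfft S T \<phi> (completion W0) q h (mult_functional (scale_functional (1 / sqrt 2) F) (scale_functional (1 / sqrt 2) G)) y"
    have A: "conv_product S T \<phi> (completion W0) (- q) s1 s2 (?Th (iterated_gfft S T \<phi> (completion W0) q K1 F))
        (?Th (iterated_gfft S T \<phi> (completion W0) q K2 G)) y = ?D"
    proof (rule eq[OF _ _ _ _ y conv])
      show "fourier_rep (?Th (iterated_gfft S T \<phi> (completion W0) q K1 F)) N (\<lambda>u. u)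
          (\<lambda>u. d u * iexp (- ((0 + (\<Sum>k\<leftarrow>K1. (nrm (\<lambda>p. u p * k p))\<^sup>2) + (nrm (\<lambda>p. u p * h p))\<^sup>2) / (4 * q))))"
        by (rule fourier_rep_gfft_half[OF fourier_rep_iterated_gfft[OF F0 mK1 q] m(1) q])
      show "fourier_rep (?Th (iterated_gfft S T \<phi> (completion W0) q K2 G)) N' (\<lambda>u. u)
          (\<lambda>u. e u * iexp (- ((0 + (\<Sum>k\<leftarrow>K2. (nrm (\<lambda>p. u p * k p))\<^sup>2) + (nrm (\<lambda>p. u p * h p))\<^sup>2) / (4 * q))))"
        by (rule fourier_rep_gfft_half[OF fourier_rep_iterated_gfft[OF G0 mK2 q] m(1) q])
    qed (simp_all add: nrm_multiplier_sum_list[OF m(2) mK1 _ assms(13)] nrm_multiplier_sum_list[OF m(3) mK2 _ assms(15)])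
    have B: "conv_product S T \<phi> (completion W0) (- q) s1 s2 (?Th (gfft S T \<phi> (completion W0) q (\<lambda>p. s1 p / sqrt 2) F))
        (?Th (gfft S T \<phi> (completion W0) q (\<lambda>p. s2 p / sqrt 2) G)) y = ?D"
      by (rule eq[OF fourier_rep_gfft_half[OF fourier_rep_gfft_half[OF F0 m(2) q] m(1) q] fourier_rep_gfft_half[OF fourier_rep_gfft_half[OF G0 m(3) q] m(1) q] _ _ y conv])
        simp_all
    have C: "conv_product S T \<phi> (completion W0) (- q) s1 s2 (gfft S T \<phi> (completion W0) q (\<lambda>p. sh1 p / sqrt 2) F)
        (gfft S T \<phi> (completion W0) q (\<lambda>p. sh2 p / sqrt 2) G) y = ?D"
      by (rule eq[OF fourier_rep_gfft_half[OF F0 m(4) q] fourier_rep_gfft_half[OF G0 m(5) q] _ _ y conv])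
        (simp_all add: sh[OF m(4,2) assms(18)] sh[OF m(5,3) assms(20)])
    \<comment> \<open>The last functional is defined at y, and the equations carry this back to the
      first.\<close>
    have "?D \<noteq> None"
      using gfft_value[OF fourier_rep_mult[OF F G, of "1 / sqrt 2"] m(1) y q] by simp
    then show "let Th = gfft S T \<phi> (completion W0) q (\<lambda>p. h p / sqrt 2);
        A = conv_product S T \<phi> (completion W0) (- q) s1 s2
              (Th (iterated_gfft S T \<phi> (completion W0) q K1 F)) (Th (iterated_gfft S T \<phi> (completion W0) q K2 G));
        B = conv_product S T \<phi> (completion W0) (- q) s1 s2
              (Th (gfft S T \<phi> (completion W0) q (\<lambda>p. s1 p / sqrt 2) F)) (Th (gfft S T \<phi> (completion W0) q (\<lambda>p. s2 p / sqrt 2) G));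
        C = conv_product S T \<phi> (completion W0) (- q) s1 s2
              (gfft S T \<phi> (completion W0) q (\<lambda>p. sh1 p / sqrt 2) F) (gfft S T \<phi> (completion W0) q (\<lambda>p. sh2 p / sqrt 2) G);
        D = gfft S T \<phi> (completion W0) q h
              (mult_functional (scale_functional (1 / sqrt 2) F) (scale_functional (1 / sqrt 2) G))
      in A y \<noteq> None \<and> A y = B y \<and> B y = C y \<and> C y = D y"
      unfolding Let_def A B C by blast
  qed
qed

end
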